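(* Fix $k$, and let $\mathcal L$ be a $k$-local Lindblad generator on $n$ qubits with bounded weighted interaction strength $\alpha$. Suppose there are constants $C>0$ and $p>k+1$ such that, for every nonempty $S\subseteq[n]$ and every $\mathbf P_S,\mathbf Q_S\in\mathcal P_S$, the nonincreasing rearrangement $(a_j)_{j\ge1}$ of the diagonal-extension magnitudes $\bigl\{|\chi_{\mathbf P_S\otimes\mathbf A_{\overline S},\mathbf Q_S\otimes\mathbf A_{\overline S}}|:\mathbf A_{\overline S}\in\mathcal P_{\overline S},\ \mathbf A_{\overline S}\ne I_{\overline S}\bigr\}$ satisfies $a_j\le Cj^{-p}$. Let $\overline C_p:=C\bigl(2+\frac1{p-1}\bigr)$ and, for a target accuracy $\varepsilon_\chi>0$, choose $$b_\chi:=\left\lceil\max\left\{1,\Bigl(\frac{4C}{\varepsilon_\chi}\Bigr)^{1/p},\Bigl(\frac{2(k+1)\overline C_p}{\varepsilon_\chi}\Bigr)^{\frac1{p-k-1}}\right\}\right\rceil$$ and a threshold $\tau_{b_\chi}$ with $C(b_\chi+1)^{-p}<\tau_{b_\chi}\le2C(b_\chi+1)^{-p}$, and suppose the threshold support $\Omega_{\tau_{b_\chi}}:=\{(\mathbf P,\mathbf Q)\in\mathcal I_k^\circ:|\chi_{\mathbf P,\mathbf Q}|>\tau_{b_\chi}\}$ is supplied. Then the supplied-support algorithm, run with $\Omega=\Omega_{\tau_{b_\chi}}$, learns all entries of $G$ and $h$ to entrywise error $\mathcal O(\varepsilon_\chi)$ (with probability at least $1-\delta$) using $$\widetilde{\mathcal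 O}_k\Bigl(\Bigl(\sum_{\ell=0}^kb_\chi^\ell\Bigr)^2\varepsilon_\chi^{-2}\log\frac{|\Omega_{\tau_{b_\chi}}|}\delta\Bigr)=\widetilde{\mathcal O}_{k,p,C}\Bigl(\varepsilon_\chi^{-2-\frac{2k}{p-k-1}}\log\frac{|\Omega_{\tau_{b_\chi}}|}\delta\Bigr)$$ samples and $\mathcal O_k(|\Omega_{\tau_{b_\chi}}|)$ classical postprocessing time.
   Context: Pauli notation. $\mathcal P_n=\{I,X,Y,Z\}^{\otimes n}$; $\operatorname{supp}(\mathbf P)$ is the set of qubits of nontrivial action, $\operatorname{wt}$ its size. For $S\subseteq[n]$, $\overline S=[n]\setminus S$, $\mathcal P_S$ is the set of Pauli strings on $S$, $\mathbf P_S$ the restriction of $\mathbf P$ to $S$ (also viewed as an $n$-qubit string by tensoring with identity). $X\bullet Y$ denotes $M\mapsto XMY$. $\mathcal I_k=\{(\mathbf P,\mathbf Q)\in\mathcal P_n^2:|\operatorname{supp}(\mathbf P)\cup\operatorname{supp}(\mathbf Q)|\le k\}$, $\mathcal I_k^\circ=\mathcal I_k\setminus\{(I,I)\}$. Generator. A $k$-local Lindblad generator is $\mathcal L=\sum_{e\subseteq[n],|e|\le k}\mathcal L_e=-i[H,\bullet]+\sum_{e}\sum_{a}\bigl(L_{e,a}\bullet L_{e,a}^\dagger-\tfrac12\{L_{e,a}^\dagger L_{e,a},\bullet\}\bigr)$, with $H=\sum_{\operatorname{wt}(\mathbf P)\le k}h_{\mathbf P}\mathbf P$ Hermitian traceless,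 $L_{e,a}$ traceless supported on $e$, $\mathcal L_e$ the full contribution supported on $e$. It is uniquely $\mathcal L=-i[H,\bullet]+\sum_{\mathbf P,\mathbf Q\ne I}G_{\mathbf P,\mathbf Q}(\mathbf P\bullet\mathbf Q-\tfrac12\{\mathbf Q\mathbf P,\bullet\})=\sum_{\mathbf P,\mathbf Q}\chi_{\mathbf P,\mathbf Q}\mathbf P\bullet\mathbf Q$, with $G_{\mathbf P,\mathbf Q}=\chi_{\mathbf P,\mathbf Q}$ for $\mathbf P,\mathbf Q\neq I$ and $h_{\mathbf P}=\frac i2(\chi_{\mathbf P,I}-\chi_{I,\mathbf P})$. $\alpha=\max_u\sum_{e\ni u}\|\mathcal L_e^\dagger\|_{2\to2}$ (norm induced by the Hilbert--Schmidt norm). PTM entries: $L_{\mathbf P,\mathbf Q}=2^{-n}\operatorname{Tr}(\mathbf P\mathcal L(\mathbf Q))$. Supplied-support algorithm for a set $\Omega\subseteq\mathcal I_k^\circ$. (i) One sample prepares a random product of single-qubit Pauli eigenstates, evolves it by $e^{t\mathcal L}$ with $t\in[0,(4\alpha k)^{-1}]$, and measures each qubit in a random Pauli basis; samples are independent. Overlaps $2^{-n}\operatorname{Tr}(\mathbf Pe^{t\mathcal L}(\mathbf Q))$ are estimated in parallel by median-of-means at $\mathcal O(d\log d)$ times, a degree-$d$ polynomial in $t$ ($d$ logarithmic in the inverse precision) is fitted by robust polynomial regression, and $\widehat L_{\mathbf P,\mathbf Q}$ is its derivative at $0$. (ii) For $u=(\mathbf P,\mathbf Q)\in\Omega$ with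 support union $S_u$, compute $\widehat\chi^{(S_u)}_u=2^{-3|S_u|}\sum_{\mathbf A,\mathbf B\in\mathcal P_{S_u}}\widehat L_{\mathbf A\otimes I,\mathbf B\otimes I}\operatorname{Tr}(\mathbf A\mathbf Q_{S_u}\mathbf B\mathbf P_{S_u})$; with registers $R_u=0$ initially, process $u\in\Omega$ in decreasing order of $|S_u|$: set $\widehat\chi_u=\widehat\chi_u^{(S_u)}-R_u$ and add $\widehat\chi_u$ to $R_w$ for every $w=(\mathbf P_T,\mathbf Q_T)\in\Omega$ with support union $T\subsetneq S_u$ and $\mathbf P_{S_u\setminus T}=\mathbf Q_{S_u\setminus T}$. (iii) Set $\widehat\chi=0$ outside $\Omega$ and $\widehat G_{\mathbf P,\mathbf Q}=\widehat\chi_{\mathbf P,\mathbf Q}$, $\widehat h_{\mathbf P}=\frac i2(\widehat\chi_{\mathbf P,I}-\widehat\chi_{I,\mathbf P})$. $\widetilde{\mathcal O}$ hides constants depending on the indices and on $\alpha$, and polylogarithmic factors in $b_\chi$, $1/\varepsilon_\chi$ and $|\Omega_{\tau_{b_\chi}}|$. *)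

theory Defs
  imports
    "HOL-Probability.Product_PMF"
    "HOL-Computational_Algebra.Polynomial"
    "Jordan_Normal_Form.Schur_Decomposition"
begin

section \<open>Pauli strings and operators on n qubits\<close>

datatype pauli = PI | PX | PY | PZ

definition pauli_mat :: "pauli \<Rightarrow> complex mat" where
  "pauli_mat \<sigma> = mat_of_rows_list 2 (case \<sigma> of
       PI \<Rightarrow> [[1, 0], [0, 1]]
     | PX \<Rightarrow> [[0, 1], [1, 0]]
     | PY \<Rightarrow> [[0, - \<i>], [\<i>, 0]]
     | PZ \<Rightarrow> [[1, 0], [0, - 1]])"

text \<open>Qubits are numbered \<open>0, \<dots>, n - 1\<close>. A Pauli string on a set \<open>S\<close> of qubits is represented by its
  extension with the identity to all of \<open>nat\<close>, so that strings on \<open>S\<close> and their tensor products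
  with the identity are the same object.\<close>

type_synonym pstring = "nat \<Rightarrow> pauli"

definition id_string :: pstring where "id_string = (\<lambda>_. PI)"

definition supp :: "pstring \<Rightarrow> nat set" where "supp P = {q. P q \<noteq> PI}"

definition paulis_on :: "nat set \<Rightarrow> pstring set" where "paulis_on S = {P. supp P \<subseteq> S}"

abbreviation paulis :: "nat \<Rightarrow> pstring set" where "paulis n \<equiv> paulis_on {..<n}"

definition restrict_string :: "nat set \<Rightarrow> pstring \<Rightarrow> pstring" where
  "restrict_string S P = (\<lambda>q. if q \<in> S then P q else PI)"

text \<open>\<open>P\<close> on the qubits in \<open>S\<close>, tensored with \<open>A\<close> on the remaining ones.\<close>

definition tensor_string :: "nat set \<Rightarrow> pstring \<Rightarrow> pstring \<Rightarrow> pstring" where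
  "tensor_string S P A = (\<lambda>q. if q \<in> S then P q else A q)"

definition pair_supp :: "pstring \<times> pstring \<Rightarrow> nat set" where
  "pair_supp u = supp (fst u) \<union> supp (snd u)"

definition local_pairs :: "nat \<Rightarrow> nat \<Rightarrow> (pstring \<times> pstring) set" where
  "local_pairs n k = {u \<in> paulis n \<times> paulis n. card (pair_supp u) \<le> k}"

definition local_pairs_nontriv :: "nat \<Rightarrow> nat \<Rightarrow> (pstring \<times> pstring) set" where
  "local_pairs_nontriv n k = local_pairs n k - {(id_string, id_string)}"

text \<open>Tensor product over the qubits; qubit \<open>q\<close> is the \<open>q\<close>-th binary digit of a basis index.\<close>

definition tensor_op :: "nat \<Rightarrow> (nat \<Rightarrow> complex mat) \<Rightarrow> complex mat" where
  "tensor_op n F = mat (2 ^ n) (2 ^ n)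
     (\<lambda>(a, b). \<Prod>q<n. F q $$ (a div 2 ^ q mod 2, b div 2 ^ q mod 2))"

definition pauli_op :: "nat \<Rightarrow> pstring \<Rightarrow> complex mat" where
  "pauli_op n P = tensor_op n (\<lambda>q. pauli_mat (P q))"

definition mtrace :: "complex mat \<Rightarrow> complex" where
  "mtrace M = (\<Sum>i<dim_row M. M $$ (i, i))"

text \<open>The type of matrices has no zero element of unspecified dimension, so that \<^const>\<open>sum\<close> is not
  available for it; finite sums of operators are taken entrywise.\<close>

definition op_sum :: "nat \<Rightarrow> ('a \<Rightarrow> complex mat) \<Rightarrow> 'a set \<Rightarrow> complex mat" where
  "op_sum n f A = mat (2 ^ n) (2 ^ n) (\<lambda>ij. \<Sum>x\<in>A. f x $$ ij)"

abbreviation operators :: "nat \<Rightarrow> complex mat set" where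
  "operators n \<equiv> carrier_mat (2 ^ n) (2 ^ n)"

definition commutator :: "complex mat \<Rightarrow> complex mat \<Rightarrow> complex mat" where
  "commutator A B = A * B - B * A"

definition anticommutator :: "complex mat \<Rightarrow> complex mat \<Rightarrow> complex mat" where
  "anticommutator A B = A * B + B * A"


section \<open>Superoperators\<close>

type_synonym superop = "complex mat \<Rightarrow> complex mat"

definition hs_norm :: "complex mat \<Rightarrow> real" where
  "hs_norm M = sqrt (Re (mtrace (mat_adjoint M * M)))"

definition superop_norm :: "nat \<Rightarrow> superop \<Rightarrow> real" where
  "superop_norm n \<Phi> = (SUP M \<in> {M \<in> operators n. hs_norm M \<le> 1}. hs_norm (\<Phi> M))"

definition matrix_unit :: "nat \<Rightarrow> nat \<Rightarrow> nat \<Rightarrow> complex mat" where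
  "matrix_unit n i j = mat (2 ^ n) (2 ^ n) (\<lambda>ab. if ab = (i, j) then 1 else 0)"

text \<open>Adjoint for the inner product \<open>Tr(X\<^sup>* Y)\<close>: the \<open>(i, j)\<close> entry of the image of \<open>X\<close> is its inner
  product with the matrix unit \<open>E\<^sub>i\<^sub>j\<close>, i.e. the inner product of \<open>X\<close> with \<open>\<Phi> E\<^sub>i\<^sub>j\<close>.\<close>

definition superop_adjoint :: "nat \<Rightarrow> superop \<Rightarrow> superop" where
  "superop_adjoint n \<Phi> X = mat (2 ^ n) (2 ^ n)
     (\<lambda>(i, j). mtrace (mat_adjoint (\<Phi> (matrix_unit n i j)) * X))"

text \<open>\<open>e\<^sup>t\<^sup>\<L>\<close>, by the entrywise exponential series.\<close>

definition lindblad_flow :: "nat \<Rightarrow> superop \<Rightarrow> real \<Rightarrow> superop" where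
  "lindblad_flow n \<L> t M = mat (2 ^ n) (2 ^ n)
     (\<lambda>ij. \<Sum>m. of_real (t ^ m / fact m) * (((\<L> ^^ m) M) $$ ij))"


section \<open>Local Lindblad generators\<close>

text \<open>\<open>ham_coeff\<close> is the family of coefficients of the Hamiltonian and \<open>jumps e\<close> lists the jump
  operators attached to the set of qubits \<open>e\<close>.\<close>

record lindblad_data =
  ham_coeff :: "pstring \<Rightarrow> complex"
  jumps :: "nat set \<Rightarrow> complex mat list"

definition edges :: "nat \<Rightarrow> nat \<Rightarrow> nat set set" where
  "edges n k = {e. e \<subseteq> {..<n} \<and> card e \<le> k}"

definition supported_on :: "nat \<Rightarrow> nat set \<Rightarrow> complex mat \<Rightarrow> bool" where
  "supported_on n e M \<longleftrightarrow>
     (\<exists>c. M = op_sum n (\<lambda>P. c P \<cdot>\<^sub>m pauli_op n P) (paulis_on e))"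

definition dissipator :: "complex mat \<Rightarrow> superop" where
  "dissipator L M = L * M * mat_adjoint L
     - (1 / 2) \<cdot>\<^sub>m anticommutator (mat_adjoint L * L) M"

definition hamiltonian :: "nat \<Rightarrow> (pstring \<Rightarrow> complex) \<Rightarrow> pstring set \<Rightarrow> complex mat" where
  "hamiltonian n h A = op_sum n (\<lambda>P. h P \<cdot>\<^sub>m pauli_op n P) A"

text \<open>The full contribution of \<open>e\<close>: the Hamiltonian terms with support exactly \<open>e\<close> and the jump
  operators attached to \<open>e\<close>.\<close>

definition local_term :: "nat \<Rightarrow> lindblad_data \<Rightarrow> nat set \<Rightarrow> superop" where
  "local_term n g e M =
     (- \<i>) \<cdot>\<^sub>m commutator (hamiltonian n (ham_coeff g) {P. supp P = e}) M
     + op_sum n (\<lambda>a. dissipator (jumps g e ! a) M) {..<length (jumps g e)}"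

definition lindbladian :: "nat \<Rightarrow> nat \<Rightarrow> lindblad_data \<Rightarrow> superop" where
  "lindbladian n k g M = op_sum n (\<lambda>e. local_term n g e M) (edges n k)"

definition k_local_lindblad :: "nat \<Rightarrow> nat \<Rightarrow> lindblad_data \<Rightarrow> bool" where
  "k_local_lindblad n k g \<longleftrightarrow>
     (\<forall>P. ham_coeff g P \<noteq> 0 \<longrightarrow> P \<in> paulis n \<and> card (supp P) \<le> k) \<and>
     (let H = hamiltonian n (ham_coeff g) (paulis n) in mat_adjoint H = H \<and> mtrace H = 0) \<and>
     (\<forall>e \<in> edges n k. \<forall>L \<in> set (jumps g e).
        L \<in> operators n \<and> mtrace L = 0 \<and> supported_on n e L)"

text \<open>The maximum over the qubits; \<open>0\<close> is inserted (all the sums are nonnegative) to cover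
  \<open>n = 0\<close>.\<close>

definition interaction_strength :: "nat \<Rightarrow> nat \<Rightarrow> lindblad_data \<Rightarrow> real" where
  "interaction_strength n k g = Max (insert 0 ((\<lambda>u.
     \<Sum>e \<in> {e \<in> edges n k. u \<in> e}. superop_norm n (superop_adjoint n (local_term n g e))) ` {..<n}))"

text \<open>The coefficients \<open>chi\<close> and \<open>G\<close> are unique on Pauli strings on \<open>n\<close> qubits (nontrivial ones for \<open>G\<close>);
  their values elsewhere are irrelevant.\<close>

definition chi_expansion :: "nat \<Rightarrow> superop \<Rightarrow> (pstring \<times> pstring \<Rightarrow> complex) \<Rightarrow> bool" where
  "chi_expansion n \<L> chi \<longleftrightarrow> (\<forall>M \<in> operators n.
     \<L> M = op_sum n (\<lambda>(P, Q). chi (P, Q) \<cdot>\<^sub>m (pauli_op n P * M * pauli_op n Q))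
             (paulis n \<times> paulis n))"

definition gks_expansion ::
  "nat \<Rightarrow> superop \<Rightarrow> (pstring \<Rightarrow> complex) \<Rightarrow> (pstring \<times> pstring \<Rightarrow> complex) \<Rightarrow> bool" where
  "gks_expansion n \<L> h G \<longleftrightarrow> (\<forall>M \<in> operators n.
     \<L> M = (- \<i>) \<cdot>\<^sub>m commutator (hamiltonian n h (paulis n)) M
       + op_sum n (\<lambda>(P, Q). G (P, Q) \<cdot>\<^sub>m (pauli_op n P * M * pauli_op n Q
            - (1 / 2) \<cdot>\<^sub>m anticommutator (pauli_op n Q * pauli_op n P) M))
          ((paulis n - {id_string}) \<times> (paulis n - {id_string})))"

definition decreasing_rearrangement :: "('a \<Rightarrow> real) \<Rightarrow> 'a set \<Rightarrow> real list" where
  "decreasing_rearrangement f A = rev (sorted_list_of_multiset (image_mset f (mset_set A)))"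

text \<open>The list is indexed from \<open>0\<close>, so that its entry \<open>j\<close> is \<open>a\<^bsub>j+1\<^esub>\<close>.\<close>

definition diagonal_extension_decay ::
  "nat \<Rightarrow> (pstring \<times> pstring \<Rightarrow> complex) \<Rightarrow> real \<Rightarrow> real \<Rightarrow> bool" where
  "diagonal_extension_decay n chi C p \<longleftrightarrow>
     (\<forall>S P Q. S \<subseteq> {..<n} \<and> S \<noteq> {} \<and> P \<in> paulis_on S \<and> Q \<in> paulis_on S \<longrightarrow>
        (let a = decreasing_rearrangement
                   (\<lambda>A. cmod (chi (tensor_string S P A, tensor_string S Q A)))
                   (paulis_on ({..<n} - S) - {id_string})
         in \<forall>j<length a. a ! j \<le> C * real (j + 1) powr (- p)))"


section \<open>One sample\<close>

definition sign_of :: "bool \<Rightarrow> real" where "sign_of s = (if s then - 1 else 1)"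

definition eigenprojector :: "pauli \<Rightarrow> bool \<Rightarrow> complex mat" where
  "eigenprojector \<sigma> s = (1 / 2) \<cdot>\<^sub>m (pauli_mat PI + of_real (sign_of s) \<cdot>\<^sub>m pauli_mat \<sigma>)"

definition product_projector :: "nat \<Rightarrow> (nat \<Rightarrow> pauli) \<Rightarrow> (nat \<Rightarrow> bool) \<Rightarrow> complex mat" where
  "product_projector n \<beta> s = tensor_op n (\<lambda>q. eigenprojector (\<beta> q) (s q))"

definition random_bases :: "nat \<Rightarrow> (nat \<Rightarrow> pauli) pmf" where
  "random_bases n = Pi_pmf {..<n} PI (\<lambda>_. pmf_of_set {PX, PY, PZ})"

definition random_signs :: "nat \<Rightarrow> (nat \<Rightarrow> bool) pmf" where
  "random_signs n = Pi_pmf {..<n} False (\<lambda>_. pmf_of_set UNIV)"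

text \<open>The Born rule for measuring every qubit \<open>q\<close> of the state \<open>\<rho>\<close> in the eigenbasis of \<open>\<gamma> q\<close>.\<close>

definition measure_outcome :: "nat \<Rightarrow> (nat \<Rightarrow> pauli) \<Rightarrow> complex mat \<Rightarrow> (nat \<Rightarrow> bool) pmf" where
  "measure_outcome n \<gamma> \<rho> = embed_pmf (\<lambda>r.
     if \<forall>q\<ge>n. \<not> r q then Re (mtrace (product_projector n \<gamma> r * \<rho>)) else 0)"

text \<open>A sample records preparation bases, preparation signs, measurement bases and outcomes.\<close>

type_synonym sample = "(nat \<Rightarrow> pauli) \<times> (nat \<Rightarrow> bool) \<times> (nat \<Rightarrow> pauli) \<times> (nat \<Rightarrow> bool)"

definition sample_pmf :: "nat \<Rightarrow> superop \<Rightarrow> real \<Rightarrow> sample pmf" where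
  "sample_pmf n \<L> t = do {
     \<beta> \<leftarrow> random_bases n;
     s \<leftarrow> random_signs n;
     \<gamma> \<leftarrow> random_bases n;
     r \<leftarrow> measure_outcome n \<gamma> (lindblad_flow n \<L> t (product_projector n \<beta> s));
     return_pmf (\<beta>, s, \<gamma>, r)
   }"

text \<open>Unbiased single-sample estimator of \<open>2\<^sup>-\<^sup>n Tr(P e\<^sup>t\<^sup>\<L>(Q))\<close>: each qubit in the support of \<open>Q\<close> (of \<open>P\<close>) is
  prepared (measured) in the matching basis with probability \<open>1/3\<close>, whence the factors \<open>3\<close>.\<close>

definition overlap_estimator :: "pstring \<Rightarrow> pstring \<Rightarrow> sample \<Rightarrow> real" where
  "overlap_estimator P Q = (\<lambda>(\<beta>, s, \<gamma>, r).
     (\<Prod>q\<in>supp Q. if \<beta> q = Q q then 3 * sign_of (s q) else 0) *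
     (\<Prod>q\<in>supp P. if \<gamma> q = P q then 3 * sign_of (r q) else 0))"


section \<open>Estimation of the Pauli transfer matrix\<close>

text \<open>Every time is used for \<open>batches\<close> many batches of \<open>batch_size\<close> many samples each.\<close>

record plan =
  fit_degree :: nat
  fit_cells :: nat
  fit_rounds :: nat
  fit_times :: "real list"
  batches :: nat
  batch_size :: nat

definition sample_count :: "plan \<Rightarrow> nat" where
  "sample_count \<pi> = length (fit_times \<pi>) * batches \<pi> * batch_size \<pi>"

definition median :: "real list \<Rightarrow> real" where
  "median xs = sort xs ! (length xs div 2)"

definition mean :: "real list \<Rightarrow> real" where
  "mean xs = sum_list xs / real (length xs)"

type_synonym data = "nat \<times> nat \<times> nat \<Rightarrow> sample"

text \<open>Independent samples, indexed by time, batch and position in the batch.\<close>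

definition data_pmf :: "nat \<Rightarrow> superop \<Rightarrow> plan \<Rightarrow> data pmf" where
  "data_pmf n \<L> \<pi> =
     Pi_pmf ({..<length (fit_times \<pi>)} \<times> {..<batches \<pi>} \<times> {..<batch_size \<pi>}) undefined
       (\<lambda>(i, c, j). sample_pmf n \<L> (fit_times \<pi> ! i))"

definition median_of_means :: "plan \<Rightarrow> data \<Rightarrow> pstring \<Rightarrow> pstring \<Rightarrow> nat \<Rightarrow> real" where
  "median_of_means \<pi> D P Q i =
     median (map (\<lambda>c. mean (map (\<lambda>j. overlap_estimator P Q (D (i, c, j))) [0..<batch_size \<pi>]))
       [0..<batches \<pi>])"

text \<open>Robust polynomial regression on \<open>[0, T]\<close> (Kane, Karmalkar and Price): the interval is cut into
  \<open>m\<close> cells at the points corresponding to \<open>cos (\<pi> j / m)\<close>; an \<open>L\<^sup>1\<close> fit weighted by the widths of the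
  cells is followed by rounds in which a Chebyshev fit to the cellwise medians of the residuals
  is added.\<close>

definition chebyshev_point :: "real \<Rightarrow> nat \<Rightarrow> nat \<Rightarrow> real" where
  "chebyshev_point T m j = T * (1 + cos (pi * real j / real m)) / 2"

definition cell_indices :: "real \<Rightarrow> nat \<Rightarrow> real list \<Rightarrow> nat \<Rightarrow> nat list" where
  "cell_indices T m ts j =
     filter (\<lambda>i. ts ! i \<in> {chebyshev_point T m (Suc j)..chebyshev_point T m j}) [0..<length ts]"

definition l1_loss :: "real \<Rightarrow> nat \<Rightarrow> real list \<Rightarrow> (nat \<Rightarrow> real) \<Rightarrow> real poly \<Rightarrow> real" where
  "l1_loss T m ts y f =
     (\<Sum>j<m. (chebyshev_point T m j - chebyshev_point T m (Suc j)) *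
        mean (map (\<lambda>i. \<bar>y i - poly f (ts ! i)\<bar>) (cell_indices T m ts j)))"

definition residual_loss ::
  "real \<Rightarrow> nat \<Rightarrow> real list \<Rightarrow> (nat \<Rightarrow> real) \<Rightarrow> real poly \<Rightarrow> real poly \<Rightarrow> real" where
  "residual_loss T m ts y f g = Max (insert 0
     ((\<lambda>j. let I = cell_indices T m ts j in
            \<bar>poly g (ts ! hd I) - median (map (\<lambda>i. y i - poly f (ts ! i)) I)\<bar>)
      ` {j. j < m \<and> cell_indices T m ts j \<noteq> []}))"

definition refine_fit ::
  "nat \<Rightarrow> real \<Rightarrow> nat \<Rightarrow> real list \<Rightarrow> (nat \<Rightarrow> real) \<Rightarrow> real poly \<Rightarrow> real poly" where
  "refine_fit d T m ts y f = f + arg_min (residual_loss T m ts y f) (\<lambda>g. degree g \<le> d)"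

definition robust_fit ::
  "nat \<Rightarrow> real \<Rightarrow> nat \<Rightarrow> nat \<Rightarrow> real list \<Rightarrow> (nat \<Rightarrow> real) \<Rightarrow> real poly" where
  "robust_fit d T m r ts y =
     (refine_fit d T m ts y ^^ r) (arg_min (l1_loss T m ts y) (\<lambda>f. degree f \<le> d))"

definition ptm_estimate :: "real \<Rightarrow> plan \<Rightarrow> data \<Rightarrow> pstring \<Rightarrow> pstring \<Rightarrow> real" where
  "ptm_estimate T \<pi> D P Q =
     poly (pderiv (robust_fit (fit_degree \<pi>) T (fit_cells \<pi>) (fit_rounds \<pi>) (fit_times \<pi>)
                     (median_of_means \<pi> D P Q))) 0"


section \<open>Postprocessing on the supplied support\<close>

text \<open>\<open>steps\<close> counts elementary steps: arithmetic operations, accesses to a register or to the table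
  of estimated transfer matrix entries, tests for membership in \<open>\<Omega>\<close>, comparisons of single-qubit
  Paulis or of a string with the identity, and traces of products of four single-qubit Paulis. The
  count starts once the table is available; forming it requires reading all the samples.\<close>

record registers =
  chi_reg :: "pstring \<times> pstring \<Rightarrow> complex"
  R_reg :: "pstring \<times> pstring \<Rightarrow> complex"
  G_reg :: "pstring \<times> pstring \<Rightarrow> complex"
  h_reg :: "pstring \<Rightarrow> complex"
  steps :: nat

definition initial_registers :: registers where
  "initial_registers =
     \<lparr>chi_reg = (\<lambda>_. 0), R_reg = (\<lambda>_. 0), G_reg = (\<lambda>_. 0), h_reg = (\<lambda>_. 0), steps = 0\<rparr>"

definition charge :: "nat \<Rightarrow> registers \<Rightarrow> registers" where
  "charge c r = r\<lparr>steps := steps r + c\<rparr>"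

text \<open>\<open>Tr(A Q B P)\<close> on the qubits in \<open>S\<close>, evaluated qubit by qubit.\<close>

definition local_trace ::
  "nat set \<Rightarrow> pstring \<Rightarrow> pstring \<Rightarrow> pstring \<Rightarrow> pstring \<Rightarrow> complex" where
  "local_trace S A Q B P =
     (\<Prod>q\<in>S. mtrace (pauli_mat (A q) * pauli_mat (Q q) * pauli_mat (B q) * pauli_mat (P q)))"

definition local_inversion ::
  "(pstring \<Rightarrow> pstring \<Rightarrow> real) \<Rightarrow> pstring \<times> pstring \<Rightarrow> complex" where
  "local_inversion Lhat u = (let S = pair_supp u in
     (1 / 2 ^ (3 * card S)) *
     (\<Sum>A\<in>paulis_on S. \<Sum>B\<in>paulis_on S.
        of_real (Lhat A B) * local_trace S A (snd u) B (fst u)))"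

text \<open>There are \<open>16\<^sup>s\<close> summands, each with one table access, \<open>s\<close> single-qubit traces and \<open>s\<close>
  multiplications, one further multiplication and one addition.\<close>

definition local_inversion_cost :: "nat \<Rightarrow> nat" where
  "local_inversion_cost s = 16 ^ s * (2 * s + 3) + 1"

definition push ::
  "(pstring \<times> pstring) set \<Rightarrow> pstring \<times> pstring \<Rightarrow> complex \<Rightarrow> nat set \<Rightarrow> registers \<Rightarrow> registers" where
  "push \<Omega> u x T r =
     (let S = pair_supp u; w = (restrict_string T (fst u), restrict_string T (snd u)) in
      charge (2 * card S + 4)
        (if w \<in> \<Omega> \<and> pair_supp w = T \<and> T \<subset> S \<and> (\<forall>q\<in>S - T. fst u q = snd u q)
         then r\<lparr>R_reg := (R_reg r)(w := R_reg r w + x)\<rparr> else r))"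

definition visit ::
  "(pstring \<times> pstring) set \<Rightarrow> (pstring \<Rightarrow> pstring \<Rightarrow> real) \<Rightarrow> pstring \<times> pstring \<Rightarrow> registers \<Rightarrow> registers"
  where
  "visit \<Omega> Lhat u r =
     (let S = pair_supp u; x = local_inversion Lhat u - R_reg r u in
      fold (push \<Omega> u x) (map set (subseqs (sorted_list_of_set S)))
        (charge (local_inversion_cost (card S) + 3) (r\<lparr>chi_reg := (chi_reg r)(u := x)\<rparr>)))"

definition visit_level ::
  "(pstring \<times> pstring) list \<Rightarrow> (pstring \<Rightarrow> pstring \<Rightarrow> real) \<Rightarrow> nat \<Rightarrow> registers \<Rightarrow> registers" where
  "visit_level \<omega> Lhat s =
     fold (\<lambda>u r. charge 1 (if card (pair_supp u) = s then visit (set \<omega>) Lhat u r else r)) \<omega>"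

text \<open>The registers of \<open>chi\<close> outside \<open>\<Omega>\<close> keep their initial value \<open>0\<close>.\<close>

definition emit :: "pstring \<times> pstring \<Rightarrow> registers \<Rightarrow> registers" where
  "emit u r = charge 7
     (if fst u \<noteq> id_string \<and> snd u \<noteq> id_string
      then r\<lparr>G_reg := (G_reg r)(u := chi_reg r u)\<rparr>
      else let P = (if snd u = id_string then fst u else snd u) in
           r\<lparr>h_reg := (h_reg r)(P :=
               \<i> / 2 * (chi_reg r (P, id_string) - chi_reg r (id_string, P)))\<rparr>)"

definition postprocess ::
  "nat \<Rightarrow> (pstring \<times> pstring) list \<Rightarrow> (pstring \<Rightarrow> pstring \<Rightarrow> real) \<Rightarrow> registers" where
  "postprocess k \<omega> Lhat =
     fold emit \<omega> (fold (visit_level \<omega> Lhat) (rev [1..<k + 1]) initial_registers)"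

definition supplied_support_algorithm ::
  "nat \<Rightarrow> nat \<Rightarrow> superop \<Rightarrow> real \<Rightarrow> plan \<Rightarrow> (pstring \<times> pstring) list \<Rightarrow> registers pmf" where
  "supplied_support_algorithm n k \<L> T \<pi> \<omega> =
     map_pmf (\<lambda>D. postprocess k \<omega> (ptm_estimate T \<pi> D)) (data_pmf n \<L> \<pi>)"


section \<open>Parameters\<close>

definition C_bar :: "real \<Rightarrow> real \<Rightarrow> real" where
  "C_bar C p = C * (2 + 1 / (p - 1))"

definition branching :: "nat \<Rightarrow> real \<Rightarrow> real \<Rightarrow> real \<Rightarrow> nat" where
  "branching k C p \<epsilon> = nat \<lceil>Max {1, (4 * C / \<epsilon>) powr (1 / p),
     (2 * (real k + 1) * C_bar C p / \<epsilon>) powr (1 / (p - real k - 1))}\<rceil>"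

definition threshold_support ::
  "nat \<Rightarrow> nat \<Rightarrow> (pstring \<times> pstring \<Rightarrow> complex) \<Rightarrow> real \<Rightarrow> (pstring \<times> pstring) set" where
  "threshold_support n k chi \<tau> = {u \<in> local_pairs_nontriv n k. cmod (chi u) > \<tau>}"

definition geometric_factor :: "nat \<Rightarrow> nat \<Rightarrow> real" where
  "geometric_factor k b = (\<Sum>l\<le>k. real b ^ l)"

text \<open>As usual in asymptotic bounds, \<open>1/\<epsilon>\<close> and the logarithm are understood to be at least \<open>1\<close>;
  this makes the bounds meaningful without a smallness condition on \<open>\<epsilon>\<close> and \<open>\<delta>\<close>.\<close>

definition inv_accuracy :: "real \<Rightarrow> real" where
  "inv_accuracy \<epsilon> = max 1 (1 / \<epsilon>)"

definition log_factor :: "nat \<Rightarrow> real \<Rightarrow> real" where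
  "log_factor N \<delta> = max 1 (ln (real N / \<delta>))"

definition polylog :: "nat \<Rightarrow> nat \<Rightarrow> real \<Rightarrow> nat \<Rightarrow> real" where
  "polylog c b \<epsilon> N =
     (ln (exp 1 + real b) * ln (exp 1 + 1 / \<epsilon>) * ln (exp 1 + real N)) ^ c"

end

theory Submission
  imports Defs "HOL-Probability.Hoeffding" "HOL-Real_Asymp.Real_Asymp"
begin

text \<open>
  The Pauli transfer matrix of the generator on a set \<open>S\<close> of qubits determines the sums of the
  coefficients \<open>chi\<close> over all diagonal extensions of a pair of strings on \<open>S\<close>. These sums are
  unravelled from large supports to small ones. By the decay hypothesis at most \<open>b\<close> extensions of
  a pair exceed the threshold, and the others contribute at most \<open>C_bar C p * b powr (1 - p)\<close>; hence
  errors are amplified at most by \<open>1 + b + \<dots> + b\<^sup>k\<close>.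

  The entries of the transfer matrix are the derivatives at \<open>0\<close> of the overlaps. In the Heisenberg
  picture every application of the generator enlarges the support by at most \<open>k\<close> and only the terms
  meeting the support act, so that the \<open>m\<close>-th derivative of an overlap at \<open>0\<close> is at most
  \<open>(\<alpha> k)\<^sup>m m!\<close>. On \<open>[0, 1 / (4 \<alpha> k)]\<close> the overlaps are therefore \<open>(1/4)\<^sup>d\<close>-close to polynomials of
  degree \<open>d\<close>, and interpolation at \<open>d + 1\<close> Chebyshev nodes loses only a factor of order \<open>d\<^sup>3\<close> in the
  derivative. Hoeffding's inequality and a union bound control the statistical error. For the
  outcomes of a sample to be distributed by the Born rule, the flow has to preserve positivity and
  the trace; positivity is inherited from an Euler scheme all of whose steps are completely positive.
\<close>

section \<open>Polynomial fits at Chebyshev nodes\<close>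

text \<open>The number of samples must not depend on \<open>n\<close>. Hence the union bound runs
  only over the transfer matrix entries that the inversions on the supports of \<Omega> read, at
  most \<open>16 ^ k\<close> for each supplied pair. The threshold is squeezed from both sides:
  lying above the decay bound for the entry of index \<open>b\<close>, it leaves at most
  \<open>b\<close> extensions to subtract; lying below twice that bound, it keeps the coefficients
  set to 0 small and the sum of the discarded extensions of order \<open>b powr (1 - p)\<close>. The
  decay concerns all diagonal extensions, whereas \<Omega> contains only pairs on at most
  \<open>k\<close> qubits; the gap closes because the coefficients of a \<open>k\<close>-local
  generator vanish on larger supports. Since errors grow by \<open>geometric_factor k b\<close>,
  transfer matrix entries are needed to accuracy \<epsilon> divided by this factor, and the inverse
  square of that accuracy is the main term of the sample count. A plain Euler step
  \<open>M + c \<L>(M)\<close> need not preserve positivity; a correction of second order in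
  \<open>c\<close> restores it and disappears in the limit.\<close>

definition cheb_angle :: "nat \<Rightarrow> nat \<Rightarrow> real" where
  "cheb_angle d i = pi * (2 * real i + 1) / (2 * (real d + 1))"

text \<open>The zeros of \<open>shifted_cheb T (d + 1)\<close>. On them the Chebyshev polynomials of
  degree at most \<open>d\<close> are orthogonal for the counting measure.\<close>

definition cheb_nodes :: "real \<Rightarrow> nat \<Rightarrow> real list" where
  "cheb_nodes T d = map (\<lambda>i. T * (1 - cos (cheb_angle d i)) / 2) [0..<Suc d]"

text \<open>The Chebyshev polynomials in the variable \<open>1 - 2 x / T\<close>, which maps \<open>[0, T]\<close> to \<open>[-1, 1]\<close>.\<close>

fun shifted_cheb :: "real \<Rightarrow> nat \<Rightarrow> real poly" where
  "shifted_cheb T 0 = 1"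
| "shifted_cheb T (Suc 0) = [:1, - 2 / T:]"
| "shifted_cheb T (Suc (Suc j)) =
     Polynomial.smult 2 ([:1, - 2 / T:] * shifted_cheb T (Suc j)) - shifted_cheb T j"

text \<open>The recurrence is the identity for
  \<open>cos (a + \<theta>) + cos (a - \<theta>)\<close>, with \<open>cos \<theta>\<close> in the
  place of \<open>1 - 2 x / T\<close>.\<close>

lemma poly_shifted_cheb:
  assumes "T \<noteq> 0"
  shows "poly (shifted_cheb T j) (T * (1 - cos \<theta>) / 2) = cos (real j * \<theta>)"
  using assms
proof (induction T j rule: shifted_cheb.induct)
  case (3 T j)
  have "cos (real (Suc j) * \<theta> + \<theta>) + cos (real (Suc j) * \<theta> - \<theta>) = 2 * cos \<theta> * cos (real (Suc j) * \<theta>)"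
    by (simp add: cos_add cos_diff del: of_nat_Suc)
  then have "cos (real (Suc (Suc j)) * \<theta>) = 2 * cos \<theta> * cos (real (Suc j) * \<theta>) - cos (real j * \<theta>)"
    by (simp add: algebra_simps)
  then show ?case using 3 by (simp add: field_simps)
qed auto

lemma degree_shifted_cheb:
  assumes "T \<noteq> 0"
  shows "degree (shifted_cheb T j) \<le> j \<and> coeff (shifted_cheb T j) j \<noteq> 0"
  using assms
proof (induction T j rule: shifted_cheb.induct)
  case (3 T j)
  have "degree ([:1, - 2 / T:] * shifted_cheb T (Suc j)) \<le> degree [:1, - 2 / T:] + degree (shifted_cheb T (Suc j))"
    by (rule degree_mult_le)
  also have "\<dots> \<le> 1 + Suc j" using 3 by (intro add_mono) auto
  finally have "degree ([:1, - 2 / T:] * shifted_cheb T (Suc j)) \<le> Suc (Suc j)" by simp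
  then have "degree (shifted_cheb T (Suc (Suc j))) \<le> Suc (Suc j)"
    using 3 by (simp only: shifted_cheb.simps) (intro degree_diff_le, auto intro: order_trans[OF degree_smult_le])
  moreover have "coeff (shifted_cheb T j) (Suc (Suc j)) = 0"
    using 3 by (intro coeff_eq_0) auto
  moreover have "coeff (shifted_cheb T (Suc j)) (Suc (Suc j)) = 0"
    using 3 by (intro coeff_eq_0) auto
  ultimately show ?case using 3 by simp
qed auto

text \<open>The point 0 corresponds to the end point 1 of the Chebyshev interval, where the
  \<open>j\<close>-th polynomial has value 1 and slope \<open>j\<^sup>2\<close>; the factor
  \<open>- 2 / T\<close> is the chain rule. Value and slope are proved together because the product
  rule mixes them.\<close>

lemma pderiv_shifted_cheb_0:
  assumes "T \<noteq> 0"
  shows "poly (shifted_cheb T j) 0 = 1 \<and> poly (pderiv (shifted_cheb T j)) 0 = - 2 * (real j)\<^sup>2 / T"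
  using assms
proof (induction T j rule: shifted_cheb.induct)
  case (3 T j)
  then show ?case
    by (simp add: pderiv_diff pderiv_smult pderiv_mult pderiv_pCons del: mult_pCons_left)
       (simp add: field_simps power2_eq_square)
qed (auto simp: pderiv_pCons)

lemma shifted_cheb_basis:
  assumes T: "T \<noteq> 0" and r: "degree r \<le> d"
  shows "\<exists>c. r = (\<Sum>j\<le>d. Polynomial.smult (c j) (shifted_cheb T j))"
  using r
proof (induction d arbitrary: r)
  case 0
  then show ?case by (auto intro!: exI[of _ "\<lambda>_. coeff r 0"] elim: degree_eq_zeroE)
next
  case (Suc d)
  define a where "a = coeff r (Suc d) / coeff (shifted_cheb T (Suc d)) (Suc d)"
  define s where "s = r - Polynomial.smult a (shifted_cheb T (Suc d))"
  have d: "degree s \<le> Suc d"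
    unfolding s_def using Suc.prems degree_shifted_cheb[OF T, of "Suc d"]
    by (intro degree_diff_le) (auto intro: order_trans[OF degree_smult_le])
  have "coeff s (Suc d) = 0"
    using degree_shifted_cheb[OF T, of "Suc d"] by (simp add: s_def a_def)
  with d have "degree s \<le> d"
    by (cases "degree s = Suc d") (use leading_coeff_0_iff[of s] in auto)
  then obtain c where c: "s = (\<Sum>j\<le>d. Polynomial.smult (c j) (shifted_cheb T j))" using Suc.IH by blast
  have "r = s + Polynomial.smult a (shifted_cheb T (Suc d))" by (simp add: s_def)
  also have "\<dots> = (\<Sum>j\<le>Suc d. Polynomial.smult ((c(Suc d := a)) j) (shifted_cheb T j))"
    by (simp add: c)
  finally show ?case by blast
qed

text \<open>Multiplying by twice the sine of half the step makes the sum telescope.\<close>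

lemma sum_cos_cheb_angle:
  assumes "0 < j" "j < 2 * (d + 1)"
  shows "(\<Sum>i<Suc d. cos (real j * cheb_angle d i)) = 0"
proof -
  define x where "x = pi * real j / (2 * (real d + 1))"
  have x: "0 < x" "x < pi" 
  proof -
    have "real j < real (2 * (d + 1))" using assms(2) by (simp only: of_nat_less_iff)
    then have "real j < 2 * (real d + 1)" by simp
    then have "pi * real j < pi * (2 * (real d + 1))" by (intro mult_strict_left_mono) auto
    then show "0 < x" "x < pi" using assms(1) by (auto simp: x_def divide_less_eq)
  qed
  have ang: "real j * cheb_angle d i = 2 * real i * x + x" for i
    by (simp add: cheb_angle_def x_def algebra_simps add_divide_distrib)
  have "2 * sin x * (\<Sum>i<m. cos (real j * cheb_angle d i)) = sin (2 * real m * x)" for m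
  proof (induction m)
    case (Suc m)
    have "sin ((2 * real m * x + x) + x) - sin ((2 * real m * x + x) - x) = 2 * sin x * cos (2 * real m * x + x)"
      unfolding sin_add sin_diff by simp
    then have "sin (2 * real (Suc m) * x) = 2 * sin x * cos (2 * real m * x + x) + sin (2 * real m * x)"
      by (simp add: algebra_simps)
    then show ?case using Suc by (simp add: ang algebra_simps)
  qed simp
  from this[of "Suc d"] have "2 * sin x * (\<Sum>i<Suc d. cos (real j * cheb_angle d i)) = sin (2 * real (Suc d) * x)" .
  also have "2 * real (Suc d) * x = pi * real j"
    by (simp add: x_def field_simps)
  also have "sin \<dots> = 0" by (simp add: mult.commute)
  finally show ?thesis using sin_gt_zero[OF x] by (simp del: sum.lessThan_Suc)
qed

text \<open>Product-to-sum leaves cosine sums of index \<open>\<bar>j - m\<bar>\<close> and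
  \<open>j + m\<close>. Both indices are below \<open>2 * (d + 1)\<close>, so the sums vanish except
  at index 0. For \<open>j = m = 0\<close> both indices would be 0 and the norm would double, hence
  \<open>1 \<le> m\<close>.\<close>

lemma cheb_orthogonality:
  assumes "j \<le> d" "1 \<le> m" "m \<le> d"
  shows "(\<Sum>i<Suc d. cos (real j * cheb_angle d i) * cos (real m * cheb_angle d i)) =
    (if j = m then (real d + 1) / 2 else 0)"
proof -
  define a where "a = (if j \<le> m then m - j else j - m)"
  have prod: "cos (real j * t) * cos (real m * t) = (cos (real a * t) + cos (real (j + m) * t)) / 2" for t
  proof -
    have "cos (real a * t) = cos (real j * t - real m * t)"
    proof (cases "j \<le> m")
      case True
      then have "real a * t = - (real j * t - real m * t)"
        by (simp add: a_def of_nat_diff algebra_simps)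
      then show ?thesis by (simp only: cos_minus)
    next
      case False
      then show ?thesis by (simp add: a_def of_nat_diff algebra_simps)
    qed
    then show ?thesis by (simp add: cos_diff cos_add distrib_right)
  qed
  have "(\<Sum>i<Suc d. cos (real j * cheb_angle d i) * cos (real m * cheb_angle d i)) =
     ((\<Sum>i<Suc d. cos (real a * cheb_angle d i)) + (\<Sum>i<Suc d. cos (real (j + m) * cheb_angle d i))) / 2"
    by (simp only: prod sum.distrib[symmetric] sum_divide_distrib)
  also have "(\<Sum>i<Suc d. cos (real (j + m) * cheb_angle d i)) = 0"
    by (rule sum_cos_cheb_angle) (use assms in auto)
  also have "(\<Sum>i<Suc d. cos (real a * cheb_angle d i)) = (if j = m then real d + 1 else 0)"
  proof (cases "j = m")
    case True
    then show ?thesis by (simp add: a_def)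
  next
    case False
    then show ?thesis using assms by (simp only: if_False, intro sum_cos_cheb_angle) (auto simp: a_def)
  qed
  finally show ?thesis by (cases "j = m") (simp_all del: sum.lessThan_Suc)
qed

lemma cheb_nodes_nth: "i \<le> d \<Longrightarrow> cheb_nodes T d ! i = T * (1 - cos (cheb_angle d i)) / 2"
  by (simp add: cheb_nodes_def del: upt_Suc)

lemma length_cheb_nodes [simp]: "length (cheb_nodes T d) = Suc d"
  by (simp add: cheb_nodes_def)

lemma cheb_nodes_bounds:
  assumes "T \<ge> 0"
  shows "set (cheb_nodes T d) \<subseteq> {0..T}"
proof
  fix t assume "t \<in> set (cheb_nodes T d)"
  then obtain i where "t = T * (1 - cos (cheb_angle d i)) / 2"
    unfolding cheb_nodes_def set_map by blast
  then have t: "t = T * ((1 - cos (cheb_angle d i)) / 2)" by simp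
  have "0 \<le> (1 - cos (cheb_angle d i)) / 2" "(1 - cos (cheb_angle d i)) / 2 \<le> 1"
    using cos_le_one[of "cheb_angle d i"] cos_ge_minus_one[of "cheb_angle d i"] by auto
  then show "t \<in> {0..T}" using assms mult_left_le[of "(1 - cos (cheb_angle d i)) / 2" T] unfolding t
    by (simp del: times_divide_eq_right)
qed

lemma cheb_angle_bounds: "i \<le> d \<Longrightarrow> cheb_angle d i \<in> {0..pi}"
proof -
  assume "i \<le> d"
  then have "2 * real i + 1 \<le> 2 * (real d + 1)" by simp
  then have "pi * (2 * real i + 1) \<le> pi * (2 * (real d + 1))" by (intro mult_left_mono) auto
  then show ?thesis by (simp add: cheb_angle_def divide_le_eq)
qed

lemma cheb_nodes_inj:
  assumes "T > 0"
  shows "inj_on (\<lambda>i. cheb_nodes T d ! i) {..d}"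
proof (rule inj_onI)
  fix i j assume ij: "i \<in> {..d}" "j \<in> {..d}" "cheb_nodes T d ! i = cheb_nodes T d ! j"
  then have "cos (cheb_angle d i) = cos (cheb_angle d j)" using assms by (simp add: cheb_nodes_nth)
  then have "cheb_angle d i = cheb_angle d j"
    using ij(1,2) cheb_angle_bounds[of i d] cheb_angle_bounds[of j d] cos_inj_pi by simp
  then have "2 * real i + 1 = 2 * real j + 1"
    by (simp only: cheb_angle_def divide_cancel_right mult_cancel_left) simp
  then show "i = j" by simp
qed

text \<open>A Markov-type inequality from nodal values alone. Orthogonality bounds each Chebyshev
  coefficient of positive index by \<open>2 * \<eta>\<close>, and each slope at 0 is at most
  \<open>2 * d\<^sup>2 / T\<close>; there are \<open>d\<close> such terms.\<close>

lemma pderiv_bound_of_cheb_nodes: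
  assumes T: "T > 0" and deg: "degree r \<le> d"
    and r: "\<And>i. i \<le> d \<Longrightarrow> \<bar>poly r (cheb_nodes T d ! i)\<bar> \<le> \<eta>"
  shows "\<bar>poly (pderiv r) 0\<bar> \<le> 4 / T * real d ^ 3 * \<eta>"
proof -
  obtain c where c: "r = (\<Sum>j\<le>d. Polynomial.smult (c j) (shifted_cheb T j))"
    using shifted_cheb_basis[OF _ deg, of T] T by auto
  have eta: "\<eta> \<ge> 0" using r[of 0] by linarith
  have val: "poly r (cheb_nodes T d ! i) = (\<Sum>j\<le>d. c j * cos (real j * cheb_angle d i))" if "i \<le> d" for i
    using that T by (simp add: c poly_sum cheb_nodes_nth poly_shifted_cheb)
  have cb: "\<bar>c m\<bar> \<le> 2 * \<eta>" if m: "1 \<le> m" "m \<le> d" for m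
  proof -
    have "(\<Sum>i<Suc d. poly r (cheb_nodes T d ! i) * cos (real m * cheb_angle d i)) =
      (\<Sum>i<Suc d. \<Sum>j\<le>d. c j * (cos (real j * cheb_angle d i) * cos (real m * cheb_angle d i)))"
      by (intro sum.cong refl) (simp add: val sum_distrib_right mult.assoc)
    also have "\<dots> = (\<Sum>j\<le>d. c j * (\<Sum>i<Suc d. cos (real j * cheb_angle d i) * cos (real m * cheb_angle d i)))"
      by (subst sum.swap) (simp only: sum_distrib_left)
    also have "\<dots> = (\<Sum>j\<le>d. if j = m then c j * ((real d + 1) / 2) else 0)"
      by (intro sum.cong refl) (use m in \<open>simp add: cheb_orthogonality del: sum.lessThan_Suc\<close>)
    also have "\<dots> = c m * ((real d + 1) / 2)" using m by simp
    finally have e: "c m * ((real d + 1) / 2) =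
      (\<Sum>i<Suc d. poly r (cheb_nodes T d ! i) * cos (real m * cheb_angle d i))" by (rule sym)
    have "\<bar>\<Sum>i<Suc d. poly r (cheb_nodes T d ! i) * cos (real m * cheb_angle d i)\<bar> \<le> (\<Sum>i<Suc d. \<eta>)"
    proof (rule order_trans[OF sum_abs], rule sum_mono)
      fix i assume "i \<in> {..<Suc d}"
      then have "\<bar>poly r (cheb_nodes T d ! i)\<bar> \<le> \<eta>" using r[of i] by simp
      then have "\<bar>poly r (cheb_nodes T d ! i)\<bar> * \<bar>cos (real m * cheb_angle d i)\<bar> \<le> \<eta> * 1"
        by (rule mult_mono[OF _ abs_cos_le_one eta abs_ge_zero])
      then show "\<bar>poly r (cheb_nodes T d ! i) * cos (real m * cheb_angle d i)\<bar> \<le> \<eta>"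
        by (simp add: abs_mult)
    qed
    moreover have "(\<Sum>i<Suc d. \<eta>) = (real d + 1) * \<eta>" by (simp add: distrib_right)
    ultimately have "\<bar>c m * ((real d + 1) / 2)\<bar> \<le> (real d + 1) * \<eta>"
      by (simp only: e)
    then have "\<bar>c m\<bar> * ((real d + 1) / 2) \<le> (real d + 1) * \<eta>"
      by (simp only: abs_mult) simp
    then have "\<bar>c m\<bar> * (real d + 1) \<le> (2 * \<eta>) * (real d + 1)" by (simp add: field_simps)
    then show ?thesis by (rule mult_right_le_imp_le) simp
  qed
  have "poly (pderiv r) 0 = (\<Sum>j\<le>d. c j * (- 2 * (real j)\<^sup>2 / T))"
    using T pderiv_shifted_cheb_0[of T] by (simp add: c pderiv_sum pderiv_smult poly_sum)
  \<comment> \<open>The index 0 is split off: \<open>cb\<close> says nothing about it, but its slope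
    is 0. This leaves \<open>d\<close> terms instead of \<open>d + 1\<close>.\<close>
  also have "\<bar>\<dots>\<bar> \<le> (\<Sum>j\<le>d. if j = 0 then 0 else 2 * \<eta> * (2 * (real d)\<^sup>2 / T))"
  proof (rule order_trans[OF sum_abs], rule sum_mono)
    fix j assume j: "j \<in> {..d}"
    show "\<bar>c j * (- 2 * (real j)\<^sup>2 / T)\<bar> \<le> (if j = 0 then 0 else 2 * \<eta> * (2 * (real d)\<^sup>2 / T))"
    proof (cases "j = 0")
      case False
      have "\<bar>c j\<bar> * (2 * (real j)\<^sup>2 / T) \<le> 2 * \<eta> * (2 * (real d)\<^sup>2 / T)"
        using False j T cb[of j] eta by (intro mult_mono divide_right_mono mult_left_mono power_mono) simp_all
      then show ?thesis using False T by (simp add: abs_mult)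
    qed simp
  qed
  also have "\<dots> = (\<Sum>j\<in>{..d} - {0}. 2 * \<eta> * (2 * (real d)\<^sup>2 / T))"
    by (intro sum.mono_neutral_cong_right) auto
  also have "\<dots> = 4 / T * real d ^ 3 * \<eta>"
    by (simp add: field_simps power2_eq_square power3_eq_cube)
  finally show ?thesis .
qed

section \<open>Interpolation by the robust fit\<close>

lemma interpolation_exists:
  fixes x y :: "nat \<Rightarrow> real"
  assumes "inj_on x {..d}"
  shows "\<exists>p. degree p \<le> d \<and> (\<forall>i\<le>d. poly p (x i) = y i)"
  using assms
proof (induction d)
  case 0
  then show ?case by (intro exI[of _ "[:y 0:]"]) auto
next
  case (Suc d)
  have "inj_on x {..d}" using Suc.prems by (rule inj_on_subset) auto
  then obtain p where p: "degree p \<le> d" "\<forall>i\<le>d. poly p (x i) = y i" using Suc.IH by blast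
  define q where "q = (\<Prod>i\<le>d. [:- x i, 1:])"
  have q0: "poly q (x i) = 0" if "i \<le> d" for i
    using that by (auto simp: q_def poly_prod)
  have q1: "poly q (x (Suc d)) \<noteq> 0"
  proof
    assume "poly q (x (Suc d)) = 0"
    then obtain i where i: "i \<le> d" "x (Suc d) = x i" by (auto simp: q_def poly_prod)
    then show False using Suc.prems by (auto dest!: inj_onD)
  qed
  have "degree q \<le> (\<Sum>i\<le>d. degree [:- x i, 1:])"
    unfolding q_def by (intro order_trans[OF degree_prod_sum_le]) (auto simp: comp_def)
  then have dq: "degree q \<le> Suc d" by simp
  define a where "a = (y (Suc d) - poly p (x (Suc d))) / poly q (x (Suc d))"
  show ?case
  proof (intro exI[of _ "p + Polynomial.smult a q"] conjI allI impI)
    show "degree (p + Polynomial.smult a q) \<le> Suc d"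
      using p(1) dq by (intro degree_add_le) (auto intro: order_trans[OF degree_smult_le])
    fix i assume "i \<le> Suc d"
    then show "poly (p + Polynomial.smult a q) (x i) = y i"
      using p(2) q0 q1 by (cases "i = Suc d") (auto simp: a_def)
  qed
qed

text \<open>With a single cell, no refinement round and as many nodes as coefficients, the minimal \<open>L\<^sup>1\<close> loss
  is \<open>0\<close>, so that the fit interpolates the data.\<close>

lemma robust_fit_interpolates:
  fixes d :: nat and y :: "nat \<Rightarrow> real"
  assumes T: "T > 0"
  defines "f \<equiv> robust_fit d T 1 0 (cheb_nodes T d) y"
  shows "degree f \<le> d" and "\<And>i. i \<le> d \<Longrightarrow> poly f (cheb_nodes T d ! i) = y i"
proof -
  let ?ts = "cheb_nodes T d"
  let ?loss = "l1_loss T 1 ?ts y"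
  have "?ts ! i \<in> {0..T}" if "i < Suc d" for i
    
  proof -
    have "?ts ! i \<in> set ?ts" using that by (intro nth_mem) simp
    then show ?thesis using cheb_nodes_bounds[of T d] T by auto
  qed
  \<comment> \<open>With one cell the two cell boundaries are \<open>T\<close> and 0, so the cell
    contains every node.\<close>
  then have cells: "cell_indices T 1 ?ts 0 = [0..<Suc d]"
    unfolding cell_indices_def chebyshev_point_def length_cheb_nodes
    by (intro filter_True) (simp del: upt_Suc)
  have loss: "?loss g = T * ((\<Sum>i<Suc d. \<bar>y i - poly g (?ts ! i)\<bar>) / real (Suc d))" for g
  proof -
    have "sum_list (map (\<lambda>i. \<bar>y i - poly g (?ts ! i)\<bar>) [0..<Suc d]) = (\<Sum>i<Suc d. \<bar>y i - poly g (?ts ! i)\<bar>)"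
      by (simp only: interv_sum_list_conv_sum_set_nat set_upt atLeast0LessThan)
    moreover have "{..<1::nat} = {0}" by auto
    ultimately show ?thesis
      unfolding l1_loss_def mean_def
      by (simp add: cells chebyshev_point_def del: upt_Suc sum.lessThan_Suc One_nat_def)
  qed
  obtain p where p: "degree p \<le> d" "\<forall>i\<le>d. poly p (?ts ! i) = y i"
    using interpolation_exists[OF cheb_nodes_inj[OF T]] by blast
  have p0: "?loss p = 0" using p(2) by (simp add: loss del: sum.lessThan_Suc One_nat_def)
  have nonneg: "?loss g \<ge> 0" for g using T by (simp add: loss sum_nonneg del: sum.lessThan_Suc One_nat_def)
  \<comment> \<open>\<open>arg_min\<close> is a choice operator, so its minimality is available only
    after some minimiser has been exhibited; the interpolating \<open>p\<close> is one.\<close>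
  have "is_arg_min ?loss (\<lambda>g. degree g \<le> d) p"
    using p(1) p0 nonneg by (auto simp: is_arg_min_def not_less)
  then have "is_arg_min ?loss (\<lambda>g. degree g \<le> d) (arg_min ?loss (\<lambda>g. degree g \<le> d))"
    unfolding arg_min_def by (rule someI)
  then have f: "is_arg_min ?loss (\<lambda>g. degree g \<le> d) f"
    by (simp add: f_def robust_fit_def)
  then show "degree f \<le> d" by (simp add: is_arg_min_def)
  have "\<not> ?loss p < ?loss f" using f p(1) by (auto simp: is_arg_min_def)
  then have "?loss f = 0" using p0 nonneg[of f] by simp
  then have "(\<Sum>i<Suc d. \<bar>y i - poly f (?ts ! i)\<bar>) = 0" using T by (simp add: loss del: sum.lessThan_Suc One_nat_def)
  then have "\<forall>i\<in>{..<Suc d}. \<bar>y i - poly f (?ts ! i)\<bar> = 0"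
    by (subst (asm) sum_nonneg_eq_0_iff) auto
  then show "\<And>i. i \<le> d \<Longrightarrow> poly f (?ts ! i) = y i" by force
qed

text \<open>The fit passes through the data, so its difference from \<open>q\<close> is a polynomial
  of degree at most \<open>d\<close> with nodal values at most \<eta>.\<close>

lemma fit_derivative_error:
  assumes T: "T > 0" and q: "degree q \<le> d"
    and y: "\<And>i. i \<le> d \<Longrightarrow> \<bar>y i - poly q (cheb_nodes T d ! i)\<bar> \<le> \<eta>"
  shows "\<bar>poly (pderiv (robust_fit d T 1 0 (cheb_nodes T d) y)) 0 - poly (pderiv q) 0\<bar>
    \<le> 4 / T * real d ^ 3 * \<eta>"
proof -
  let ?f = "robust_fit d T 1 0 (cheb_nodes T d) y"
  have "\<bar>poly (pderiv (?f - q)) 0\<bar> \<le> 4 / T * real d ^ 3 * \<eta>"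
    using T q y robust_fit_interpolates[OF T, where d = d and y = y]
    by (intro pderiv_bound_of_cheb_nodes) (auto intro: degree_diff_le)
  then show ?thesis by (simp add: pderiv_diff)
qed

section \<open>The registers after postprocessing\<close>

text \<open>The proper diagonal extensions \<open>v\<close> of \<open>w\<close>, i.e. the pairs
  whose estimates end up in the register \<open>R\<close> of \<open>w\<close>.\<close>

definition extends :: "pstring \<times> pstring \<Rightarrow> pstring \<times> pstring \<Rightarrow> bool" where
  "extends w v \<longleftrightarrow> pair_supp w \<subset> pair_supp v \<and>
     w = (restrict_string (pair_supp w) (fst v), restrict_string (pair_supp w) (snd v)) \<and>
     (\<forall>q\<in>pair_supp v - pair_supp w. fst v q = snd v q)"

definition push_cost :: "nat \<Rightarrow> nat" where
  "push_cost s = 2 * s + 4"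

text \<open>Only the turn \<open>T = pair_supp w\<close> can touch the register of \<open>w\<close>;
  distinctness of the list makes \<open>x\<close> arrive there at most once.\<close>

lemma fold_push:
  assumes "distinct Ts"
  shows "R_reg (fold (push \<Omega> u x) Ts r) w =
      R_reg r w + (if pair_supp w \<in> set Ts \<and> w \<in> \<Omega> \<and> extends w u then x else 0)"
    and "chi_reg (fold (push \<Omega> u x) Ts r) = chi_reg r"
    and "G_reg (fold (push \<Omega> u x) Ts r) = G_reg r"
    and "h_reg (fold (push \<Omega> u x) Ts r) = h_reg r"
    and "steps (fold (push \<Omega> u x) Ts r) = steps r + length Ts * push_cost (card (pair_supp u))"
proof -
  have R: "R_reg (push \<Omega> u x T r) w =
      R_reg r w + (if pair_supp w = T \<and> w \<in> \<Omega> \<and> extends w u then x else 0)" for T r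
    by (auto simp: push_def charge_def Let_def extends_def)
  have rest: "chi_reg (push \<Omega> u x T r) = chi_reg r" "G_reg (push \<Omega> u x T r) = G_reg r"
    "h_reg (push \<Omega> u x T r) = h_reg r"
    "steps (push \<Omega> u x T r) = steps r + push_cost (card (pair_supp u))" for T r
    by (auto simp: push_def charge_def Let_def push_cost_def)
  show "R_reg (fold (push \<Omega> u x) Ts r) w =
      R_reg r w + (if pair_supp w \<in> set Ts \<and> w \<in> \<Omega> \<and> extends w u then x else 0)"
    using assms by (induction Ts arbitrary: r) (auto simp: R)
  show "chi_reg (fold (push \<Omega> u x) Ts r) = chi_reg r"
    by (induction Ts arbitrary: r) (auto simp: rest)
  show "G_reg (fold (push \<Omega> u x) Ts r) = G_reg r"
    by (induction Ts arbitrary: r) (auto simp: rest)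
  show "h_reg (fold (push \<Omega> u x) Ts r) = h_reg r"
    by (induction Ts arbitrary: r) (auto simp: rest)
  show "steps (fold (push \<Omega> u x) Ts r) = steps r + length Ts * push_cost (card (pair_supp u))"
    by (induction Ts arbitrary: r) (auto simp: rest)
qed

lemma subsets_list:
  assumes "finite S"
  defines "Ts \<equiv> map set (subseqs (sorted_list_of_set S))"
  shows "distinct Ts" and "set Ts = Pow S" and "length Ts = 2 ^ card S"
proof -
  show "set Ts = Pow S" using assms by (simp add: Ts_def subseqs_powset)
  show len: "length Ts = 2 ^ card S" using assms by (simp add: Ts_def length_subseqs)
  show "distinct Ts" using assms by (simp add: Ts_def distinct_set_subseqs)
qed

definition visit_cost :: "nat \<Rightarrow> nat" where
  "visit_cost s = local_inversion_cost s + 3 + 2 ^ s * push_cost s"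

lemma visit_registers:
  fixes Lhat u
  assumes "finite (pair_supp u)"
  defines "x \<equiv> \<lambda>r. local_inversion Lhat u - R_reg r u"
  shows "R_reg (visit \<Omega> Lhat u r) w = R_reg r w + (if w \<in> \<Omega> \<and> extends w u then x r else 0)"
    and "chi_reg (visit \<Omega> Lhat u r) = (chi_reg r)(u := x r)"
    and "G_reg (visit \<Omega> Lhat u r) = G_reg r"
    and "h_reg (visit \<Omega> Lhat u r) = h_reg r"
    and "steps (visit \<Omega> Lhat u r) = steps r + visit_cost (card (pair_supp u))"
proof -
  have "pair_supp w \<in> Pow (pair_supp u)" if "extends w u" using that by (auto simp: extends_def)
  then show "R_reg (visit \<Omega> Lhat u r) w = R_reg r w + (if w \<in> \<Omega> \<and> extends w u then x r else 0)"
    using assms subsets_list[OF assms(1)]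
    by (auto simp: visit_def Let_def fold_push charge_def)
qed (use subsets_list[OF assms(1)] in
      \<open>simp_all add: visit_def Let_def fold_push charge_def x_def visit_cost_def\<close>)

text \<open>Loop invariant, \<open>D\<close> being the set of pairs visited so far. Closure of
  \<open>D\<close> under extensions inside \<Omega> is part of it: it guarantees that the sum in the
  recursion for a visited pair is complete and never changes later.\<close>

definition processed ::
  "(pstring \<times> pstring) set \<Rightarrow> (pstring \<Rightarrow> pstring \<Rightarrow> real) \<Rightarrow> (pstring \<times> pstring) set \<Rightarrow> registers \<Rightarrow> bool" where
  "processed \<Omega> Lhat D r \<longleftrightarrow> D \<subseteq> \<Omega> \<and>
     (\<forall>u. u \<notin> D \<longrightarrow> chi_reg r u = 0) \<and>
     (\<forall>w\<in>\<Omega>. R_reg r w = (\<Sum>v\<in>{v \<in> D. extends w v}. chi_reg r v)) \<and>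
     (\<forall>u\<in>D. {v \<in> \<Omega>. extends u v} \<subseteq> D \<and>
        chi_reg r u = local_inversion Lhat u - (\<Sum>v\<in>{v \<in> \<Omega>. extends u v}. chi_reg r v)) \<and>
     (\<forall>u. G_reg r u = 0) \<and> (\<forall>P. h_reg r P = 0)"

lemma extends_irrefl: "\<not> extends u u"
  by (simp add: extends_def)

text \<open>As all extensions of \<open>u\<close> lie in \<open>D\<close>, the register
  \<open>R\<close> of \<open>u\<close> already holds their full sum. Writing \<open>u\<close> cannot
  disturb the equation of an earlier \<open>w\<close>: the extensions of \<open>w\<close> lie in
  \<open>D\<close>, and \<open>u\<close> does not.\<close>

lemma processed_visit:
  assumes fin: "finite \<Omega>" "finite (pair_supp u)"
    and P: "processed \<Omega> Lhat D r" and u: "u \<in> \<Omega>" "u \<notin> D" and ext: "{v \<in> \<Omega>. extends u v} \<subseteq> D"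
  shows "processed \<Omega> Lhat (insert u D) (visit \<Omega> Lhat u r)"
proof -
  note v = visit_registers[OF fin(2), where Lhat = Lhat]
  have D: "D \<subseteq> \<Omega>" "finite D" using P fin by (auto simp: processed_def intro: finite_subset)
  have eq: "{v \<in> D. extends u v} = {v \<in> \<Omega>. extends u v}" using ext D by auto
  have chi: "(\<Sum>v\<in>X. chi_reg (visit \<Omega> Lhat u r) v) = (\<Sum>v\<in>X. chi_reg r v)" if "u \<notin> X" for X
    using that by (intro sum.cong) (auto simp: v)
  show ?thesis
    unfolding processed_def
  proof (intro conjI ballI allI impI)
    fix w assume w: "w \<in> \<Omega>"
    have R: "R_reg r w = (\<Sum>v\<in>{v \<in> D. extends w v}. chi_reg r v)" using P w by (simp add: processed_def)
    show "R_reg (visit \<Omega> Lhat u r) w = (\<Sum>v\<in>{v \<in> insert u D. extends w v}. chi_reg (visit \<Omega> Lhat u r) v)"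
    proof (cases "extends w u")
      case True
      then have "{v \<in> insert u D. extends w v} = insert u {v \<in> D. extends w v}" by auto
      then show ?thesis using u D True w R by (simp add: chi) (simp add: v)
    next
      case False
      then have "{v \<in> insert u D. extends w v} = {v \<in> D. extends w v}" by auto
      then show ?thesis using u D False w R by (simp add: chi) (simp add: v)
    qed
  next
    fix w assume w: "w \<in> insert u D"
    then show "{v \<in> \<Omega>. extends w v} \<subseteq> insert u D" using P ext by (auto simp: processed_def)
    show "chi_reg (visit \<Omega> Lhat u r) w =
      local_inversion Lhat w - (\<Sum>v\<in>{v \<in> \<Omega>. extends w v}. chi_reg (visit \<Omega> Lhat u r) v)"
    proof (cases "w = u")
      case True
      have "R_reg r u = (\<Sum>v\<in>{v \<in> \<Omega>. extends u v}. chi_reg r v)"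
        using P u eq by (simp add: processed_def)
      then show ?thesis using True by (simp add: chi extends_irrefl) (simp add: v)
    next
      case False
      then have w: "w \<in> D" using w by simp
      then have "u \<notin> {v \<in> \<Omega>. extends w v}" using P u by (auto simp: processed_def)
      moreover have "chi_reg r w = local_inversion Lhat w - (\<Sum>v\<in>{v \<in> \<Omega>. extends w v}. chi_reg r v)"
        using P w unfolding processed_def by blast
      ultimately show ?thesis using False by (simp add: chi) (simp add: v)
    qed
  qed (use P u in \<open>auto simp: processed_def v\<close>)
qed

lemma processed_charge [simp]: "processed \<Omega> Lhat D (charge c r) = processed \<Omega> Lhat D r"
  by (simp add: processed_def charge_def)

lemma extends_card:
  "extends u v \<Longrightarrow> finite (pair_supp v) \<Longrightarrow> card (pair_supp u) < card (pair_supp v)"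
  by (auto simp: extends_def intro: psubset_card_mono)

text \<open>A pair never extends one with the same number of qubits, so the order within a level is
  arbitrary. The induction runs over an arbitrary part \<open>us\<close> of the list and an
  arbitrary \<open>D\<close> that contains all larger supports.\<close>

lemma processed_visit_level:
  assumes fin: "\<And>u. u \<in> \<Omega> \<Longrightarrow> finite (pair_supp u)" and \<omega>: "distinct \<omega>" "set \<omega> = \<Omega>"
    and P: "processed \<Omega> Lhat {u \<in> \<Omega>. s < card (pair_supp u)} r"
  shows "processed \<Omega> Lhat {u \<in> \<Omega>. s \<le> card (pair_supp u)} (visit_level \<omega> Lhat s r)"
proof -
  let ?f = "\<lambda>u r. charge 1 (if card (pair_supp u) = s then visit \<Omega> Lhat u r else r)"
  have "processed \<Omega> Lhat (D \<union> {u \<in> set us. card (pair_supp u) = s}) (fold ?f us r)"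
    if "processed \<Omega> Lhat D r" "distinct us" "set us \<subseteq> \<Omega>" "\<And>u. u \<in> set us \<Longrightarrow> card (pair_supp u) = s \<Longrightarrow> u \<notin> D"
      "{u \<in> \<Omega>. s < card (pair_supp u)} \<subseteq> D" for us D r
    using that
  proof (induction us arbitrary: D r)
    case (Cons u us)
    show ?case
    proof (cases "card (pair_supp u) = s")
      case True
      have "{v \<in> \<Omega>. extends u v} \<subseteq> D"
        using Cons.prems(5) True fin extends_card by fastforce
      then have "processed \<Omega> Lhat (insert u D) (visit \<Omega> Lhat u r)"
        using Cons.prems \<omega> fin True by (intro processed_visit) auto
      then have "processed \<Omega> Lhat (insert u D \<union> {u \<in> set us. card (pair_supp u) = s})
        (fold ?f us (charge 1 (visit \<Omega> Lhat u r)))"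
        using Cons.prems by (intro Cons.IH) auto
      moreover have "insert u D \<union> {u \<in> set us. card (pair_supp u) = s} =
        D \<union> {x \<in> set (u # us). card (pair_supp x) = s}" using True by auto
      ultimately show ?thesis using True by simp
    next
      case False
      have "processed \<Omega> Lhat (D \<union> {u \<in> set us. card (pair_supp u) = s}) (fold ?f us (charge 1 r))"
        using Cons.prems by (intro Cons.IH) auto
      moreover have "{x \<in> set (u # us). card (pair_supp x) = s} = {u \<in> set us. card (pair_supp u) = s}"
        using False by auto
      ultimately show ?thesis using False by simp
    qed
  qed simp
  from this[OF P, of \<omega>] have "processed \<Omega> Lhat
     ({u \<in> \<Omega>. s < card (pair_supp u)} \<union> {u \<in> \<Omega>. card (pair_supp u) = s}) (visit_level \<omega> Lhat s r)"
    using \<omega>(1) unfolding visit_level_def \<omega>(2)[symmetric] by simp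
  moreover have "{u \<in> \<Omega>. s < card (pair_supp u)} \<union> {u \<in> \<Omega>. card (pair_supp u) = s} =
    {u \<in> \<Omega>. s \<le> card (pair_supp u)}" by auto
  ultimately show ?thesis by simp
qed

text \<open>The sizes from \<open>m + j - 1\<close> down to \<open>m\<close> are visited. The
  hypothesis, which says that the sizes from \<open>m + j\<close> on are done, has the form that
  becomes the premise of \<open>processed_visit_level\<close> for the topmost size.\<close>

lemma processed_levels:
  assumes fin: "\<And>u. u \<in> \<Omega> \<Longrightarrow> finite (pair_supp u)" and \<omega>: "distinct \<omega>" "set \<omega> = \<Omega>"
    and "processed \<Omega> Lhat {u \<in> \<Omega>. m + j < Suc (card (pair_supp u))} r"
  shows "processed \<Omega> Lhat {u \<in> \<Omega>. m \<le> card (pair_supp u)} (fold (visit_level \<omega> Lhat) (rev [m..<m + j]) r)"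
  using assms(4)
proof (induction j arbitrary: r)
  case 0
  then show ?case by (simp add: less_Suc_eq_le)
next
  case (Suc j)
  have "processed \<Omega> Lhat {u \<in> \<Omega>. m + j \<le> card (pair_supp u)} (visit_level \<omega> Lhat (m + j) r)"
    using Suc.prems by (intro processed_visit_level fin \<omega>) (auto simp: less_Suc_eq_le Suc_le_eq)
  then show ?case using Suc.IH[of "visit_level \<omega> Lhat (m + j) r"] by (simp add: less_Suc_eq_le)
qed

text \<open>The register \<open>h\<close> of \<open>P\<close> may be written twice, through
  \<open>(P, id_string)\<close> and through \<open>(id_string, P)\<close>; as \<open>chi_reg\<close>
  no longer changes, both writes give the same value.\<close>

lemma fold_emit:
  fixes us r
  assumes id: "(id_string, id_string) \<notin> set us"
  defines "r' \<equiv> fold emit us r"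
  shows "chi_reg r' = chi_reg r"
    and "G_reg r' (P, Q) = (if (P, Q) \<in> set us \<and> P \<noteq> id_string \<and> Q \<noteq> id_string
      then chi_reg r (P, Q) else G_reg r (P, Q))"
    and "h_reg r' P = (if (P, id_string) \<in> set us \<or> (id_string, P) \<in> set us
      then \<i> / 2 * (chi_reg r (P, id_string) - chi_reg r (id_string, P)) else h_reg r P)"
    and "steps r' = steps r + 7 * length us"
proof -
  show chi: "chi_reg r' = chi_reg r"
    unfolding r'_def by (induction us arbitrary: r) (auto simp: emit_def charge_def Let_def)
  have c: "chi_reg (emit u r) = chi_reg r" for u r by (auto simp: emit_def charge_def Let_def)
  show "G_reg r' (P, Q) = (if (P, Q) \<in> set us \<and> P \<noteq> id_string \<and> Q \<noteq> id_string
      then chi_reg r (P, Q) else G_reg r (P, Q))"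
    unfolding r'_def
  proof (induction us arbitrary: r)
    case (Cons u us)
    have "G_reg (emit u r) (P, Q) = (if (P, Q) = u \<and> P \<noteq> id_string \<and> Q \<noteq> id_string
      then chi_reg r (P, Q) else G_reg r (P, Q))"
      by (cases u) (auto simp: emit_def charge_def Let_def)
    then show ?case unfolding fold.simps comp_apply Cons.IH c by auto
  qed simp
  show "h_reg r' P = (if (P, id_string) \<in> set us \<or> (id_string, P) \<in> set us
      then \<i> / 2 * (chi_reg r (P, id_string) - chi_reg r (id_string, P)) else h_reg r P)"
    unfolding r'_def using id
  proof (induction us arbitrary: r)
    case (Cons u us)
    have "h_reg (emit u r) P = (if (P, id_string) = u \<or> (id_string, P) = u
      then \<i> / 2 * (chi_reg r (P, id_string) - chi_reg r (id_string, P)) else h_reg r P)"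
      using Cons.prems by (cases u) (auto simp: emit_def charge_def Let_def)
    then show ?case using Cons.prems by (simp add: Cons.IH c)
  qed simp
  show "steps r' = steps r + 7 * length us"
    unfolding r'_def by (induction us arbitrary: r) (auto simp: emit_def charge_def Let_def)
qed

text \<open>Outside \<Omega> the registers of \<open>chi\<close>, \<open>G\<close> and
  \<open>h\<close> keep the value 0, so the formulas for \<open>G\<close> and \<open>h\<close> hold
  there as well, and all later error bounds reduce to \<open>chi_reg\<close>.\<close>

lemma postprocess_registers:
  fixes Lhat k \<omega>
  assumes fin: "\<And>u. u \<in> \<Omega> \<Longrightarrow> finite (pair_supp u)"
    and card: "\<And>u. u \<in> \<Omega> \<Longrightarrow> 1 \<le> card (pair_supp u) \<and> card (pair_supp u) \<le> k"
    and \<omega>: "distinct \<omega>" "set \<omega> = \<Omega>"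
  defines "r \<equiv> postprocess k \<omega> Lhat"
  shows "\<And>u. u \<notin> \<Omega> \<Longrightarrow> chi_reg r u = 0"
    and "\<And>u. u \<in> \<Omega> \<Longrightarrow>
      chi_reg r u = local_inversion Lhat u - (\<Sum>v\<in>{v \<in> \<Omega>. extends u v}. chi_reg r v)"
    and "\<And>P Q. P \<noteq> id_string \<Longrightarrow> Q \<noteq> id_string \<Longrightarrow> G_reg r (P, Q) = chi_reg r (P, Q)"
    and "\<And>P. h_reg r P = \<i> / 2 * (chi_reg r (P, id_string) - chi_reg r (id_string, P))"
proof -
  define r1 where "r1 = fold (visit_level \<omega> Lhat) (rev [1..<k + 1]) initial_registers"
  have r: "r = fold emit \<omega> r1" by (simp add: r_def r1_def postprocess_def)
  have "{u \<in> \<Omega>. 1 + k < Suc (card (pair_supp u))} = {}" using card by force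
  moreover have "processed \<Omega> Lhat {} initial_registers"
    by (auto simp: processed_def initial_registers_def)
  ultimately have "processed \<Omega> Lhat {u \<in> \<Omega>. 1 + k < Suc (card (pair_supp u))} initial_registers"
    by (simp only:)
  then have "processed \<Omega> Lhat {u \<in> \<Omega>. 1 \<le> card (pair_supp u)}
    (fold (visit_level \<omega> Lhat) (rev [1..<1 + k]) initial_registers)"
    by (rule processed_levels[rotated -1]) (use fin \<omega> in auto)
  moreover have "{u \<in> \<Omega>. 1 \<le> card (pair_supp u)} = \<Omega>" using card by auto
  ultimately have P: "processed \<Omega> Lhat \<Omega> r1" by (simp add: r1_def add.commute)
  have "pair_supp (id_string, id_string) = {}" by (simp add: pair_supp_def supp_def id_string_def)
  then have id: "(id_string, id_string) \<notin> set \<omega>" using card \<omega> by force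
  note e = fold_emit[OF id, of r1, folded r]
  show "chi_reg r u = 0" if "u \<notin> \<Omega>" for u
    using P that unfolding e(1) processed_def by blast
  show "chi_reg r u = local_inversion Lhat u - (\<Sum>v\<in>{v \<in> \<Omega>. extends u v}. chi_reg r v)" if "u \<in> \<Omega>" for u
    using P that unfolding e(1) processed_def by blast
  show "G_reg r (P, Q) = chi_reg r (P, Q)" if "P \<noteq> id_string" "Q \<noteq> id_string" for P Q
  proof (cases "(P, Q) \<in> \<Omega>")
    case True
    then show ?thesis using that \<omega> by (simp add: e)
  next
    case False
    then have "chi_reg r1 (P, Q) = 0" "G_reg r1 (P, Q) = 0"
      using P unfolding processed_def by blast+
    then show ?thesis by (simp add: e)
  qed
  show "h_reg r P' = \<i> / 2 * (chi_reg r (P', id_string) - chi_reg r (id_string, P'))" for P'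
  proof (cases "(P', id_string) \<in> \<Omega> \<or> (id_string, P') \<in> \<Omega>")
    case True
    then show ?thesis using \<omega> by (simp only: e if_True)
  next
    case False
    then have "chi_reg r1 (P', id_string) = 0" "chi_reg r1 (id_string, P') = 0" "h_reg r1 P' = 0"
      using P unfolding processed_def by blast+
    then show ?thesis by (simp add: e)
  qed
qed

text \<open>Each of the \<open>k\<close> levels scans the whole list. Charging a full visit of the
  largest size to every entry at every level costs only a factor depending on \<open>k\<close>; the
  7 is the charge of \<open>emit\<close>.\<close>

lemma steps_postprocess:
  assumes fin: "\<And>u. u \<in> set \<omega> \<Longrightarrow> finite (pair_supp u)"
  shows "steps (postprocess k \<omega> Lhat) \<le> (k * (1 + visit_cost k) + 7) * length \<omega>"
proof -
  have "steps (visit_level \<omega> Lhat s r) \<le> steps r + length \<omega> * (1 + visit_cost k)" if "s \<le> k" for s r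
  proof -
    let ?f = "\<lambda>\<Omega> u r. charge 1 (if card (pair_supp u) = s then visit \<Omega> Lhat u r else r)"
    have mono: "visit_cost s \<le> visit_cost k"
      unfolding visit_cost_def local_inversion_cost_def push_cost_def using that
      by (intro add_mono mult_mono power_increasing) auto
    have "steps (fold (?f \<Omega>) us r) \<le> steps r + length us * (1 + visit_cost k)" if "set us \<subseteq> set \<omega>" for us \<Omega> r
      using that
    proof (induction us arbitrary: r)
      case (Cons u us)
      have "steps (?f \<Omega> u r) \<le> steps r + (1 + visit_cost k)"
        using mono Cons.prems fin by (auto simp: charge_def visit_registers)
      then show ?case using Cons.IH[of "?f \<Omega> u r"] Cons.prems by simp
    qed simp
    then show ?thesis unfolding visit_level_def by simp
  qed
  then have "steps (fold (visit_level \<omega> Lhat) ss r) \<le> steps r + length ss * (length \<omega> * (1 + visit_cost k))"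
    if "\<forall>s\<in>set ss. s \<le> k" for ss r
    using that
  proof (induction ss arbitrary: r)
    case (Cons s ss)
    have "steps (visit_level \<omega> Lhat s r) \<le> steps r + length \<omega> * (1 + visit_cost k)"
      using Cons.prems by simp
    then show ?case
      using order_trans[OF Cons.IH[of "visit_level \<omega> Lhat s r"]] Cons.prems by simp
  qed simp
  from this[of "rev [1..<k + 1]" initial_registers]
  have "steps (fold (visit_level \<omega> Lhat) (rev [1..<k + 1]) initial_registers) \<le> k * (length \<omega> * (1 + visit_cost k))"
    by (simp add: initial_registers_def del: upt_Suc)
  moreover have "steps (fold emit us r) = steps r + 7 * length us" for us r
    by (induction us arbitrary: r) (auto simp: emit_def charge_def Let_def)
  ultimately show ?thesis by (simp add: postprocess_def algebra_simps del: upt_Suc)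
qed

text \<open>Induction on the distance of the rank from \<open>k\<close>: with
  \<open>m = k - rank u - 1\<close>, each of at most \<open>b\<close> successors contributes
  \<open>a * (1 + \<dots> + b ^ m)\<close>, and \<open>1 + b * (1 + \<dots> + b ^ m)\<close> is the
  next geometric sum.\<close>

lemma error_propagation:
  fixes err :: "'a \<Rightarrow> real" and rank :: "'a \<Rightarrow> nat"
  assumes step: "\<And>u. u \<in> \<Omega> \<Longrightarrow> err u \<le> a + (\<Sum>v\<in>E u. err v)"
    and E: "\<And>u. u \<in> \<Omega> \<Longrightarrow> E u \<subseteq> \<Omega> \<and> card (E u) \<le> b"
    and rank: "\<And>u v. u \<in> \<Omega> \<Longrightarrow> v \<in> E u \<Longrightarrow> rank u < rank v" "\<And>u. u \<in> \<Omega> \<Longrightarrow> rank u \<le> k"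
    and a: "a \<ge> 0" and u: "u \<in> \<Omega>"
  shows "err u \<le> a * (\<Sum>l\<le>k - rank u. real b ^ l)"
  using u
proof (induction "k - rank u" arbitrary: u rule: less_induct)
  case less
  have nonneg: "0 \<le> a * (\<Sum>l\<le>m. real b ^ l)" for m using a by (intro mult_nonneg_nonneg sum_nonneg) auto
  show ?case
  proof (cases "E u = {}")
    case True
    have "(\<Sum>l\<in>{0::nat}. real b ^ l) \<le> (\<Sum>l\<le>k - rank u. real b ^ l)" by (intro sum_mono2) auto
    then have "a * 1 \<le> a * (\<Sum>l\<le>k - rank u. real b ^ l)" using a by (intro mult_left_mono) auto
    then show ?thesis using step[OF less.prems] True by simp
  next
    case False
    then obtain v0 where "v0 \<in> E u" by auto
    then have lt: "rank u < k" using rank E less.prems by (meson less_le_trans subsetD)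
    define m where "m = k - rank u - 1"
    have m: "k - rank u = Suc m" using lt by (simp add: m_def)
    have "err v \<le> a * (\<Sum>l\<le>m. real b ^ l)" if v: "v \<in> E u" for v
    proof -
      have "v \<in> \<Omega>" "rank u < rank v" using v less.prems E rank by auto
      then have "err v \<le> a * (\<Sum>l\<le>k - rank v. real b ^ l)" using lt by (intro less.hyps) auto
      also have "\<dots> \<le> a * (\<Sum>l\<le>m. real b ^ l)"
        using a \<open>rank u < rank v\<close> by (intro mult_left_mono sum_mono2) (auto simp: m_def)
      finally show ?thesis .
    qed
    then have "(\<Sum>v\<in>E u. err v) \<le> real (card (E u)) * (a * (\<Sum>l\<le>m. real b ^ l))"
      by (rule sum_bounded_above)
    also have "\<dots> \<le> real b * (a * (\<Sum>l\<le>m. real b ^ l))"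
      using E[OF less.prems] nonneg by (intro mult_right_mono) auto
    finally have "err u \<le> a * (1 + (\<Sum>l\<le>m. real b ^ Suc l))"
      using step[OF less.prems] by (simp add: algebra_simps sum_distrib_left)
    also have "1 + (\<Sum>l\<le>m. real b ^ Suc l) = (\<Sum>l\<le>Suc m. real b ^ l)"
      by (subst sum.atMost_Suc_shift) simp
    finally show ?thesis by (simp only: m)
  qed
qed

section \<open>Tensor products and Pauli strings\<close>

lemma mat_adjoint_carrier [simp]: "A \<in> carrier_mat m n \<Longrightarrow> mat_adjoint A \<in> carrier_mat n m"
  for A :: "complex mat"
  by (auto simp: mat_adjoint_def)

lemma mat_adjoint_dim [simp]:
  "dim_row (mat_adjoint A) = dim_col A" "dim_col (mat_adjoint A) = dim_row A" for A :: "complex mat"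
  by (auto simp: mat_adjoint_def)

lemma mat_adjoint_index [simp]:
  "i < dim_col A \<Longrightarrow> j < dim_row A \<Longrightarrow> mat_adjoint A $$ (i, j) = cnj (A $$ (j, i))" for A :: "complex mat"
  by (simp add: mat_adjoint_def mat_of_rows_index)

lemma mult_mat_index:
  assumes "A \<in> carrier_mat d d" "B \<in> carrier_mat d d" "i < d" "j < d"
  shows "(A * B) $$ (i, j) = (\<Sum>l<d. A $$ (i, l) * B $$ (l, j))"
  using assms by (simp add: scalar_prod_def lessThan_atLeast0)

lemma mtrace_mult:
  assumes "A \<in> carrier_mat d d" "B \<in> carrier_mat d d"
  shows "mtrace (A * B) = (\<Sum>i<d. \<Sum>j<d. A $$ (i, j) * B $$ (j, i))"
proof -
  have "dim_row (A * B) = d" using assms by simp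
  then show ?thesis using assms unfolding mtrace_def by (intro sum.cong) (auto simp: mult_mat_index[OF assms] simp del: index_mult_mat)
qed

lemma mtrace_comm:
  assumes "A \<in> carrier_mat d d" "B \<in> carrier_mat d d"
  shows "mtrace (A * B) = mtrace (B * A)"
  unfolding mtrace_mult[OF assms] mtrace_mult[OF assms(2,1)]
  by (subst sum.swap) (simp add: mult.commute)

text \<open>The hypothesis \<open>complete\<close> says that the tensor squares of the matrices
  \<open>E x\<close> add up to \<kappa> times the swap; the two conclusions are the two ways of
  contracting the swap with \<open>U\<close> and \<open>V\<close>. The lemma serves both the
  single-qubit Paulis (\<kappa> = 2) and the Pauli strings
  (\<open>\<kappa> = 2 ^ n\<close>).\<close>

lemma completeness_trace:
  assumes E: "\<And>x. x \<in> S \<Longrightarrow> E x \<in> carrier_mat d d" "finite S"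
    and complete: "\<And>a b e f. a < d \<Longrightarrow> b < d \<Longrightarrow> e < d \<Longrightarrow> f < d \<Longrightarrow>
      (\<Sum>x\<in>S. E x $$ (a, b) * E x $$ (e, f)) = (if a = f \<and> b = e then \<kappa> else 0 :: complex)"
    and UV: "U \<in> carrier_mat d d" "V \<in> carrier_mat d d"
  shows "(\<Sum>x\<in>S. mtrace (E x * U) * mtrace (E x * V)) = \<kappa> * mtrace (U * V)"
    and "(\<Sum>x\<in>S. mtrace (E x * U * E x * V)) = \<kappa> * mtrace U * mtrace V"
proof -
  have "(\<Sum>x\<in>S. mtrace (E x * U) * mtrace (E x * V)) =
     (\<Sum>x\<in>S. \<Sum>a<d. \<Sum>b<d. \<Sum>e<d. \<Sum>f<d. E x $$ (a, b) * E x $$ (e, f) * (U $$ (b, a) * V $$ (f, e)))"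
  proof (rule sum.cong[OF refl])
    fix x assume x: "x \<in> S"
    have "mtrace (E x * U) * mtrace (E x * V) =
      (\<Sum>a<d. \<Sum>e<d. (\<Sum>b<d. E x $$ (a, b) * U $$ (b, a)) * (\<Sum>f<d. E x $$ (e, f) * V $$ (f, e)))"
      by (simp only: mtrace_mult[OF E(1)[OF x] UV(1)] mtrace_mult[OF E(1)[OF x] UV(2)] sum_product)
    also have "\<dots> = (\<Sum>a<d. \<Sum>e<d. \<Sum>b<d. \<Sum>f<d. E x $$ (a, b) * E x $$ (e, f) * (U $$ (b, a) * V $$ (f, e)))"
      by (simp add: sum_product mult_ac)
    also have "\<dots> = (\<Sum>a<d. \<Sum>b<d. \<Sum>e<d. \<Sum>f<d. E x $$ (a, b) * E x $$ (e, f) * (U $$ (b, a) * V $$ (f, e)))"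
      by (rule sum.cong[OF refl], rule sum.swap)
    finally show "mtrace (E x * U) * mtrace (E x * V) =
      (\<Sum>a<d. \<Sum>b<d. \<Sum>e<d. \<Sum>f<d. E x $$ (a, b) * E x $$ (e, f) * (U $$ (b, a) * V $$ (f, e)))" .
  qed
  also have "\<dots> = (\<Sum>a<d. \<Sum>b<d. \<Sum>e<d. \<Sum>f<d. \<Sum>x\<in>S. E x $$ (a, b) * E x $$ (e, f) * (U $$ (b, a) * V $$ (f, e)))"
    by ((subst sum.swap, intro sum.cong refl)+)
  also have "\<dots> = (\<Sum>a<d. \<Sum>b<d. \<Sum>e<d. \<Sum>f<d. if f = a then (if e = b then \<kappa> * (U $$ (b, a) * V $$ (a, b)) else 0) else 0)"
    by (intro sum.cong refl) (auto simp: complete simp flip: sum_distrib_right)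
  also have "\<dots> = (\<Sum>a<d. \<Sum>b<d. \<kappa> * (V $$ (a, b) * U $$ (b, a)))"
    by (simp add: mult_ac)
  also have "\<dots> = \<kappa> * mtrace (V * U)"
    unfolding mtrace_mult[OF UV(2,1)] by (simp add: sum_distrib_left)
  finally show "(\<Sum>x\<in>S. mtrace (E x * U) * mtrace (E x * V)) = \<kappa> * mtrace (U * V)"
    using mtrace_comm[OF UV] by simp
  have "mtrace (E x * U * E x * V) =
      (\<Sum>a<d. \<Sum>b<d. \<Sum>e<d. \<Sum>f<d. E x $$ (a, b) * E x $$ (e, f) * (U $$ (b, e) * V $$ (f, a)))"
    if x: "x \<in> S" for x
  proof -
    have c: "E x * U \<in> carrier_mat d d" "E x * V \<in> carrier_mat d d" "E x \<in> carrier_mat d d"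
      using E(1)[OF x] UV by auto
    have "mtrace (E x * U * E x * V) = mtrace ((E x * U) * (E x * V))"
      using c UV by (simp add: assoc_mult_mat[of _ d d _ d _ d])
    also have "\<dots> = (\<Sum>a<d. \<Sum>e<d. (\<Sum>b<d. E x $$ (a, b) * U $$ (b, e)) * (\<Sum>f<d. E x $$ (e, f) * V $$ (f, a)))"
      unfolding mtrace_mult[OF c(1,2)] using UV c
      by (intro sum.cong refl) (simp only: mult_mat_index lessThan_iff)
    also have "\<dots> = (\<Sum>a<d. \<Sum>e<d. \<Sum>b<d. \<Sum>f<d. E x $$ (a, b) * E x $$ (e, f) * (U $$ (b, e) * V $$ (f, a)))"
      by (simp add: sum_product mult_ac)
    also have "\<dots> = (\<Sum>a<d. \<Sum>b<d. \<Sum>e<d. \<Sum>f<d. E x $$ (a, b) * E x $$ (e, f) * (U $$ (b, e) * V $$ (f, a)))"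
      by (rule sum.cong[OF refl], rule sum.swap)
    finally show ?thesis .
  qed
  then have "(\<Sum>x\<in>S. mtrace (E x * U * E x * V)) =
     (\<Sum>x\<in>S. \<Sum>a<d. \<Sum>b<d. \<Sum>e<d. \<Sum>f<d. E x $$ (a, b) * E x $$ (e, f) * (U $$ (b, e) * V $$ (f, a)))"
    by simp
  also have "\<dots> = (\<Sum>a<d. \<Sum>b<d. \<Sum>e<d. \<Sum>f<d. \<Sum>x\<in>S. E x $$ (a, b) * E x $$ (e, f) * (U $$ (b, e) * V $$ (f, a)))"
    by ((subst sum.swap, intro sum.cong refl)+)
  also have "\<dots> = (\<Sum>a<d. \<Sum>b<d. \<Sum>e<d. \<Sum>f<d. if f = a then (if e = b then \<kappa> * (U $$ (b, b) * V $$ (a, a)) else 0) else 0)"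
    by (intro sum.cong refl) (auto simp: complete simp flip: sum_distrib_right)
  also have "\<dots> = \<kappa> * mtrace U * mtrace V"
    using UV by (simp add: mtrace_def sum_distrib_left sum_distrib_right mult_ac) (rule sum.swap)
  finally show "(\<Sum>x\<in>S. mtrace (E x * U * E x * V)) = \<kappa> * mtrace U * mtrace V" .
qed

section \<open>Pauli matrices on one qubit\<close>

lemma UNIV_pauli: "UNIV = {PI, PX, PY, PZ}"
  using pauli.exhaust by auto

lemma finite_UNIV_pauli [simp]: "finite (UNIV :: pauli set)" "finite (A :: pauli set)"
  by (auto simp: UNIV_pauli intro: finite_subset[OF subset_UNIV])

lemma pauli_mat_carrier [simp]: "pauli_mat \<sigma> \<in> carrier_mat 2 2"
  by (cases \<sigma>) (auto simp: pauli_mat_def mat_of_rows_list_def)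

lemma pauli_mat_entries:
  "pauli_mat \<sigma> $$ (0, 0) = (if \<sigma> = PI \<or> \<sigma> = PZ then 1 else 0)"
  "pauli_mat \<sigma> $$ (0, Suc 0) = (if \<sigma> = PX then 1 else if \<sigma> = PY then - \<i> else 0)"
  "pauli_mat \<sigma> $$ (Suc 0, 0) = (if \<sigma> = PX then 1 else if \<sigma> = PY then \<i> else 0)"
  "pauli_mat \<sigma> $$ (Suc 0, Suc 0) = (if \<sigma> = PI then 1 else if \<sigma> = PZ then - 1 else 0)"
  by (cases \<sigma>; simp add: pauli_mat_def mat_of_rows_list_def)+

lemma less_2_iff: "(i::nat) < 2 \<longleftrightarrow> i = 0 \<or> i = Suc 0"
  by auto

lemma pauli_mat_complete:
  assumes "a < 2" "b < 2" "e < 2" "f < 2"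
  shows "(\<Sum>\<sigma>\<in>UNIV. pauli_mat \<sigma> $$ (a, b) * pauli_mat \<sigma> $$ (e, f)) =
    (if a = f \<and> b = e then 2 else 0)"
  using assms unfolding less_2_iff by (elim disjE) (simp_all add: UNIV_pauli pauli_mat_entries)

lemma pauli_mat_hermitian: "mat_adjoint (pauli_mat \<sigma>) = pauli_mat \<sigma>"
  by (rule eq_matI) (auto simp: less_2_iff pauli_mat_entries carrier_matD[OF pauli_mat_carrier])

lemma mtrace_2: "M \<in> carrier_mat 2 2 \<Longrightarrow> mtrace M = M $$ (0, 0) + M $$ (Suc 0, Suc 0)"
  by (simp add: mtrace_def numeral_2_eq_2)

lemma mult_2_entry:
  assumes "A \<in> carrier_mat 2 2" "B \<in> carrier_mat 2 2" "i < 2" "j < 2"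
  shows "(A * B) $$ (i, j) = A $$ (i, 0) * B $$ (0, j) + A $$ (i, Suc 0) * B $$ (Suc 0, j)"
  using mult_mat_index[OF assms] by (simp add: numeral_2_eq_2)

lemma mtrace_pauli_mult: "mtrace (pauli_mat \<sigma> * pauli_mat \<tau>) = (if \<sigma> = \<tau> then 2 else 0)"
proof -
  have "pauli_mat \<sigma> * pauli_mat \<tau> \<in> carrier_mat 2 2"
    by (rule mult_carrier_mat[of _ 2 2]) simp_all
  then show ?thesis
    by (cases \<sigma>; cases \<tau>; simp add: mtrace_2 mult_2_entry pauli_mat_entries del: index_mult_mat)
qed

lemma mtrace_pauli: "mtrace (pauli_mat \<sigma>) = (if \<sigma> = PI then 2 else 0)"
  by (cases \<sigma>; simp add: mtrace_2 pauli_mat_entries)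

text \<open>Completeness is used twice: the sum over \<sigma> merges the two traces into one, the
  sum over \<tau> separates that one into \<open>Tr(q q')\<close> and \<open>Tr(p' p)\<close>. Each
  use gives a factor 2, each remaining trace is 2 or 0, whence 16.\<close>

lemma local_pauli_inversion:
  "(\<Sum>\<sigma>\<in>UNIV. \<Sum>\<tau>\<in>UNIV.
      mtrace (pauli_mat \<sigma> * pauli_mat p * pauli_mat \<tau> * pauli_mat q) *
      mtrace (pauli_mat \<sigma> * pauli_mat q' * pauli_mat \<tau> * pauli_mat p')) =
   (if p = p' \<and> q = q' then 16 else 0)"
proof -
  let ?M = pauli_mat
  note complete = completeness_trace[of UNIV ?M 2 2, OF pauli_mat_carrier finite_UNIV_pauli(1) pauli_mat_complete]
  have c: "A * B \<in> carrier_mat 2 2" if "A \<in> carrier_mat 2 2" "B \<in> carrier_mat 2 2" for A B :: "complex mat"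
    using that by simp
  have as: "A * B * C = A * (B * C)" if "A \<in> carrier_mat 2 2" "B \<in> carrier_mat 2 2" "C \<in> carrier_mat 2 2"
    for A B C :: "complex mat"
    using that by (rule assoc_mult_mat)
  have "(\<Sum>\<sigma>\<in>UNIV. \<Sum>\<tau>\<in>UNIV. mtrace (?M \<sigma> * ?M p * ?M \<tau> * ?M q) * mtrace (?M \<sigma> * ?M q' * ?M \<tau> * ?M p')) =
    (\<Sum>\<tau>\<in>UNIV. \<Sum>\<sigma>\<in>UNIV. mtrace (?M \<sigma> * (?M p * ?M \<tau> * ?M q)) * mtrace (?M \<sigma> * (?M q' * ?M \<tau> * ?M p')))"
    by (subst sum.swap) (simp add: as c del: assoc_mult_mat)
  also have "\<dots> = (\<Sum>\<tau>\<in>UNIV. 2 * mtrace ((?M p * ?M \<tau> * ?M q) * (?M q' * ?M \<tau> * ?M p')))"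
    by (intro sum.cong refl complete(1) c) simp_all
  also have "\<dots> = (\<Sum>\<tau>\<in>UNIV. 2 * mtrace (?M \<tau> * (?M q * ?M q') * ?M \<tau> * (?M p' * ?M p)))"
  proof (intro sum.cong refl)
    fix \<tau>
    have "mtrace (?M p * (?M \<tau> * ?M q * (?M q' * ?M \<tau> * ?M p'))) = mtrace ((?M \<tau> * ?M q * (?M q' * ?M \<tau> * ?M p')) * ?M p)"
      by (rule mtrace_comm[of _ 2]) (simp_all add: c)
    then show "2 * mtrace ((?M p * ?M \<tau> * ?M q) * (?M q' * ?M \<tau> * ?M p')) =
        2 * mtrace (?M \<tau> * (?M q * ?M q') * ?M \<tau> * (?M p' * ?M p))"
      by (simp add: as c del: assoc_mult_mat)
  qed
  also have "\<dots> = 2 * (2 * mtrace (?M q * ?M q') * mtrace (?M p' * ?M p))"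
    unfolding sum_distrib_left[symmetric] by (subst complete(2)) (simp_all add: c)
  finally show ?thesis by (auto simp: mtrace_pauli_mult)
qed

section \<open>Binary digits and tensor products\<close>

lemma bit_expansion_inj:
  assumes "a < 2 ^ n" "b < 2 ^ n" and "\<And>q. q < n \<Longrightarrow> a div 2 ^ q mod 2 = (b::nat) div 2 ^ q mod 2"
  shows "a = b"
proof (rule bit_eqI)
  fix q
  show "bit a q = bit b q"
  proof (cases "q < n")
    case True
    then show ?thesis using assms(3)[of q] by (simp add: bit_iff_odd odd_iff_mod_2_eq_one)
  next
    case False
    have "a = take_bit n a" "b = take_bit n b" using assms(1,2) by (simp_all add: take_bit_nat_eq_self)
    then show ?thesis using False by (metis bit_take_bit_iff)
  qed
qed

lemma sum_lessThan_double: "(\<Sum>c<2 * (m::nat). g c) = (\<Sum>c<m. g c) + (\<Sum>c<m. g (c + m))"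
  for g :: "nat \<Rightarrow> complex"
proof -
  have "(\<Sum>c<m + m. g c) = (\<Sum>c\<in>{0..<m}. g c) + (\<Sum>c\<in>{m..<m + m}. g c)"
    by (simp add: sum.atLeastLessThan_concat lessThan_atLeast0)
  also have "(\<Sum>c\<in>{m..<m + m}. g c) = (\<Sum>c\<in>{0..<m}. g (c + m))"
    using sum.shift_bounds_nat_ivl[of g 0 m m] by simp
  finally show ?thesis by (simp add: lessThan_atLeast0 mult_2)
qed

lemma bit_shift:
  assumes "q < n"
  shows "(c + 2 ^ n) div 2 ^ q mod 2 = (c::nat) div 2 ^ q mod 2"
proof -
  obtain m where n: "n = q + Suc m" using assms by (metis less_imp_Suc_add add_Suc_right)
  have "(2::nat) ^ n = 2 ^ q * (2 * 2 ^ m)" by (simp add: n power_add)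
  then have "(c + 2 ^ n) div 2 ^ q = c div 2 ^ q + 2 * 2 ^ m" by simp
  then show ?thesis by simp
qed

text \<open>Induction on the top digit: the upper half of the range is the lower half shifted by
  \<open>2 ^ n\<close>, which changes no lower digit. This is what makes products and traces of
  tensor products factor over the qubits.\<close>

lemma sum_bits_prod:
  fixes f :: "nat \<Rightarrow> nat \<Rightarrow> complex"
  shows "(\<Sum>c<2 ^ n. \<Prod>q<n. f q (c div 2 ^ q mod 2)) = (\<Prod>q<n. f q 0 + f q (Suc 0))"
proof (induction n)
  case (Suc n)
  let ?g = "\<lambda>c. \<Prod>q<n. f q (c div 2 ^ q mod 2)"
  have "(\<Sum>c<2 ^ Suc n. \<Prod>q<Suc n. f q (c div 2 ^ q mod 2)) =
    (\<Sum>c<2 ^ n. \<Prod>q<Suc n. f q (c div 2 ^ q mod 2)) + (\<Sum>c<2 ^ n. \<Prod>q<Suc n. f q ((c + 2 ^ n) div 2 ^ q mod 2))"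
    unfolding power_Suc by (rule sum_lessThan_double)
  also have "(\<Sum>c<2 ^ n. \<Prod>q<Suc n. f q (c div 2 ^ q mod 2)) = (\<Sum>c<2 ^ n. ?g c * f n 0)"
    by (intro sum.cong refl) simp
  also have "(\<Sum>c<2 ^ n. \<Prod>q<Suc n. f q ((c + 2 ^ n) div 2 ^ q mod 2)) = (\<Sum>c<2 ^ n. ?g c * f n (Suc 0))"
  proof (intro sum.cong refl)
    fix c :: nat assume c: "c \<in> {..<2 ^ n}"
    have "(c + 2 ^ n) div 2 ^ n = 1" using c by simp
    then show "(\<Prod>q<Suc n. f q ((c + 2 ^ n) div 2 ^ q mod 2)) = ?g c * f n (Suc 0)"
      unfolding prod.lessThan_Suc by (simp add: bit_shift)
  qed
  finally show ?case by (simp add: Suc.IH[symmetric] sum_distrib_right distrib_left)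
qed simp

lemma tensor_op_carrier [simp]: "tensor_op n F \<in> operators n"
  by (simp add: tensor_op_def)

lemma tensor_op_dim [simp]: "dim_row (tensor_op n F) = 2 ^ n" "dim_col (tensor_op n F) = 2 ^ n"
  by (simp_all add: tensor_op_def)

lemma tensor_op_index:
  "a < 2 ^ n \<Longrightarrow> b < 2 ^ n \<Longrightarrow>
    tensor_op n F $$ (a, b) = (\<Prod>q<n. F q $$ (a div 2 ^ q mod 2, b div 2 ^ q mod 2))"
  by (simp add: tensor_op_def)

lemma tensor_op_mult:
  assumes "\<And>q. q < n \<Longrightarrow> F q \<in> carrier_mat 2 2" "\<And>q. q < n \<Longrightarrow> G q \<in> carrier_mat 2 2"
  shows "tensor_op n F * tensor_op n G = tensor_op n (\<lambda>q. F q * G q)"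
proof (rule eq_matI)
  fix a b assume "a < dim_row (tensor_op n (\<lambda>q. F q * G q))" "b < dim_col (tensor_op n (\<lambda>q. F q * G q))"
  then have ab: "a < 2 ^ n" "b < 2 ^ n" by simp_all
  let ?B = "\<lambda>c q. c div 2 ^ q mod (2::nat)"
  have "(tensor_op n F * tensor_op n G) $$ (a, b) =
    (\<Sum>c<2 ^ n. \<Prod>q<n. F q $$ (?B a q, ?B c q) * G q $$ (?B c q, ?B b q))"
    using ab unfolding mult_mat_index[OF tensor_op_carrier tensor_op_carrier ab]
    by (intro sum.cong refl) (simp add: tensor_op_index prod.distrib)
  also have "\<dots> = (\<Prod>q<n. F q $$ (?B a q, 0) * G q $$ (0, ?B b q) + F q $$ (?B a q, Suc 0) * G q $$ (Suc 0, ?B b q))"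
    by (rule sum_bits_prod[of "\<lambda>q c. F q $$ (?B a q, c) * G q $$ (c, ?B b q)"])
  also have "\<dots> = tensor_op n (\<lambda>q. F q * G q) $$ (a, b)"
    unfolding tensor_op_index[OF ab] using assms
    by (intro prod.cong refl) (subst mult_2_entry, auto)
  finally show "(tensor_op n F * tensor_op n G) $$ (a, b) = tensor_op n (\<lambda>q. F q * G q) $$ (a, b)" .
qed simp_all

lemma mtrace_tensor_op:
  assumes "\<And>q. q < n \<Longrightarrow> F q \<in> carrier_mat 2 2"
  shows "mtrace (tensor_op n F) = (\<Prod>q<n. mtrace (F q))"
proof -
  have "mtrace (tensor_op n F) = (\<Sum>c<2 ^ n. \<Prod>q<n. F q $$ (c div 2 ^ q mod 2, c div 2 ^ q mod 2))"
    unfolding mtrace_def by (intro sum.cong) (simp_all add: tensor_op_index)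
  also have "\<dots> = (\<Prod>q<n. F q $$ (0, 0) + F q $$ (Suc 0, Suc 0))"
    by (rule sum_bits_prod[of "\<lambda>q c. F q $$ (c, c)"])
  also have "\<dots> = (\<Prod>q<n. mtrace (F q))"
    using assms by (intro prod.cong refl) (simp add: mtrace_2)
  finally show ?thesis .
qed

lemma tensor_op_cong: "(\<And>q. q < n \<Longrightarrow> F q = G q) \<Longrightarrow> tensor_op n F = tensor_op n G"
  by (rule eq_matI) (auto simp: tensor_op_index)

lemma mat_adjoint_tensor_op:
  assumes "\<And>q. q < n \<Longrightarrow> F q \<in> carrier_mat 2 2"
  shows "mat_adjoint (tensor_op n F) = tensor_op n (\<lambda>q. mat_adjoint (F q))"
proof (rule eq_matI)
  fix i j assume "i < dim_row (tensor_op n (\<lambda>q. mat_adjoint (F q)))" "j < dim_col (tensor_op n (\<lambda>q. mat_adjoint (F q)))"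
  then have ij: "i < 2 ^ n" "j < 2 ^ n" by simp_all
  have "mat_adjoint (tensor_op n F) $$ (i, j) = (\<Prod>q<n. cnj (F q $$ (j div 2 ^ q mod 2, i div 2 ^ q mod 2)))"
    using ij by (simp add: tensor_op_index)
  also have "\<dots> = (\<Prod>q<n. mat_adjoint (F q) $$ (i div 2 ^ q mod 2, j div 2 ^ q mod 2))"
  proof (intro prod.cong refl)
    fix q assume "q \<in> {..<n}"
    then have "dim_row (F q) = 2" "dim_col (F q) = 2" using assms[of q] by auto
    then show "cnj (F q $$ (j div 2 ^ q mod 2, i div 2 ^ q mod 2)) =
      mat_adjoint (F q) $$ (i div 2 ^ q mod 2, j div 2 ^ q mod 2)" by simp
  qed
  finally show "mat_adjoint (tensor_op n F) $$ (i, j) = tensor_op n (\<lambda>q. mat_adjoint (F q)) $$ (i, j)"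
    by (simp add: tensor_op_index ij)
qed simp_all

section \<open>Pauli operators on n qubits\<close>

lemma pauli_op_carrier [simp]: "pauli_op n P \<in> operators n"
  by (simp add: pauli_op_def)

lemma pauli_op_dim [simp]: "dim_row (pauli_op n P) = 2 ^ n" "dim_col (pauli_op n P) = 2 ^ n"
  by (simp_all add: pauli_op_def)

lemma pauli_op_hermitian [simp]: "mat_adjoint (pauli_op n P) = pauli_op n P"
  by (simp add: pauli_op_def mat_adjoint_tensor_op pauli_mat_hermitian)

lemma pauli_op_id: "pauli_op n id_string = 1\<^sub>m (2 ^ n)"
proof (rule eq_matI)
  fix a b assume "a < dim_row (1\<^sub>m (2 ^ n) :: complex mat)" "b < dim_col (1\<^sub>m (2 ^ n) :: complex mat)"
  then have ab: "a < 2 ^ n" "b < 2 ^ n" by simp_all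
  have PI: "pauli_mat PI $$ (i, j) = (if i = j then 1 else 0)" if "i < 2" "j < 2" for i j
    using that unfolding less_2_iff by (elim disjE) (simp_all add: pauli_mat_entries)
  have "pauli_op n id_string $$ (a, b) = (\<Prod>q<n. if a div 2 ^ q mod 2 = b div 2 ^ q mod 2 then 1 else 0)"
    unfolding pauli_op_def tensor_op_index[OF ab] by (intro prod.cong refl) (simp add: id_string_def PI)
  also have "\<dots> = (if a = b then 1 else 0)"
  proof (cases "a = b")
    case False
    then obtain q where "q < n" "a div 2 ^ q mod 2 \<noteq> b div 2 ^ q mod 2"
      using bit_expansion_inj[OF ab] by blast
    then show ?thesis using False by (auto intro!: prod_zero)
  qed simp
  finally show "pauli_op n id_string $$ (a, b) = 1\<^sub>m (2 ^ n) $$ (a, b)" using ab by simp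
qed simp_all

lemma paulis_on_insert:
  assumes "x \<notin> S"
  shows "paulis_on (insert x S) = (\<lambda>(\<sigma>, P). P(x := \<sigma>)) ` (UNIV \<times> paulis_on S)"
    and "inj_on (\<lambda>(\<sigma>, P). P(x := \<sigma>)) (UNIV \<times> paulis_on S)"
proof -
  show "paulis_on (insert x S) = (\<lambda>(\<sigma>, P). P(x := \<sigma>)) ` (UNIV \<times> paulis_on S)"
  proof (intro equalityI subsetI)
    fix P assume "P \<in> paulis_on (insert x S)"
    then have "P(x := PI) \<in> paulis_on S" by (auto simp: paulis_on_def supp_def)
    moreover have "P = (\<lambda>(\<sigma>, P). P(x := \<sigma>)) (P x, P(x := PI))" by auto
    ultimately show "P \<in> (\<lambda>(\<sigma>, P). P(x := \<sigma>)) ` (UNIV \<times> paulis_on S)"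
      by (metis (no_types, lifting) SigmaI UNIV_I image_eqI)
  qed (auto simp: paulis_on_def supp_def split: if_splits)
  show "inj_on (\<lambda>(\<sigma>, P). P(x := \<sigma>)) (UNIV \<times> paulis_on S)"
  proof (rule inj_onI, clarify)
    fix \<sigma> P \<tau> Q assume P: "P \<in> paulis_on S" "Q \<in> paulis_on S" "P(x := \<sigma>) = Q(x := \<tau>)"
    have "P x = PI" "Q x = PI" using P(1,2) assms by (auto simp: paulis_on_def supp_def)
    then have "P = Q" using P(3) by (metis fun_upd_triv fun_upd_upd)
    then show "\<sigma> = \<tau> \<and> P = Q" using P(3) by (metis fun_upd_same)
  qed
qed

lemma paulis_on_empty: "paulis_on {} = {id_string}"
  by (auto simp: paulis_on_def supp_def id_string_def)

lemma finite_paulis_on [simp]: "finite S \<Longrightarrow> finite (paulis_on S)"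
  by (induction rule: finite_induct) (simp_all add: paulis_on_empty paulis_on_insert)

lemma card_paulis_on: "finite S \<Longrightarrow> card (paulis_on S) = 4 ^ card S"
proof (induction rule: finite_induct)
  case (insert x S)
  have "card (UNIV :: pauli set) = 4" by (simp add: UNIV_pauli)
  then show ?case using insert by (simp add: paulis_on_insert card_image card_cartesian_product)
qed (simp add: paulis_on_empty)

lemma sum_paulis_prod:
  fixes f :: "nat \<Rightarrow> pauli \<Rightarrow> complex"
  assumes "finite S"
  shows "(\<Sum>P\<in>paulis_on S. \<Prod>q\<in>S. f q (P q)) = (\<Prod>q\<in>S. \<Sum>\<sigma>\<in>UNIV. f q \<sigma>)"
  using assms
proof (induction rule: finite_induct)
  case (insert x S)
  have "(\<Sum>P\<in>paulis_on (insert x S). \<Prod>q\<in>insert x S. f q (P q)) =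
    (\<Sum>(\<sigma>, P)\<in>UNIV \<times> paulis_on S. \<Prod>q\<in>insert x S. f q ((P(x := \<sigma>)) q))"
    unfolding paulis_on_insert(1)[OF insert.hyps(2)]
    by (subst sum.reindex[OF paulis_on_insert(2)[OF insert.hyps(2)]]) (simp add: case_prod_unfold)
  also have "\<dots> = (\<Sum>(\<sigma>, P)\<in>UNIV \<times> paulis_on S. f x \<sigma> * (\<Prod>q\<in>S. f q (P q)))"
  proof (intro sum.cong refl, clarify)
    fix \<sigma> P
    have "(\<Prod>q\<in>S. f q ((P(x := \<sigma>)) q)) = (\<Prod>q\<in>S. f q (P q))"
      using insert.hyps by (intro prod.cong) auto
    then show "(\<Prod>q\<in>insert x S. f q ((P(x := \<sigma>)) q)) = f x \<sigma> * (\<Prod>q\<in>S. f q (P q))"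
      using insert.hyps by simp
  qed
  also have "\<dots> = (\<Sum>\<sigma>\<in>UNIV. f x \<sigma>) * (\<Sum>P\<in>paulis_on S. \<Prod>q\<in>S. f q (P q))"
    by (simp add: sum.cartesian_product[symmetric] sum_product)
  finally show ?case using insert by simp
qed (simp add: paulis_on_empty)

lemma prod_delta: "finite S \<Longrightarrow> (\<Prod>q\<in>S. if R q then c else 0) = (if \<forall>q\<in>S. R q then c ^ card S else (0::complex))"
  by (induction rule: finite_induct) auto

lemma pauli_op_complete:
  assumes "a < 2 ^ n" "b < 2 ^ n" "e < 2 ^ n" "f < 2 ^ n"
  shows "(\<Sum>P\<in>paulis n. pauli_op n P $$ (a, b) * pauli_op n P $$ (e, f)) =
    (if a = f \<and> b = e then 2 ^ n else 0)"
proof -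
  let ?B = "\<lambda>c q. c div 2 ^ q mod (2::nat)"
  have "(\<Sum>P\<in>paulis n. pauli_op n P $$ (a, b) * pauli_op n P $$ (e, f)) =
    (\<Sum>P\<in>paulis n. \<Prod>q<n. pauli_mat (P q) $$ (?B a q, ?B b q) * pauli_mat (P q) $$ (?B e q, ?B f q))"
    using assms by (simp add: pauli_op_def tensor_op_index prod.distrib)
  also have "\<dots> = (\<Prod>q<n. \<Sum>\<sigma>\<in>UNIV. pauli_mat \<sigma> $$ (?B a q, ?B b q) * pauli_mat \<sigma> $$ (?B e q, ?B f q))"
    by (rule sum_paulis_prod[of _ "\<lambda>q \<sigma>. pauli_mat \<sigma> $$ (?B a q, ?B b q) * pauli_mat \<sigma> $$ (?B e q, ?B f q)"]) simp
  also have "\<dots> = (\<Prod>q<n. if ?B a q = ?B f q \<and> ?B b q = ?B e q then 2 else 0)"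
    by (intro prod.cong refl pauli_mat_complete) simp_all
  also have "\<dots> = (if \<forall>q<n. ?B a q = ?B f q \<and> ?B b q = ?B e q then 2 ^ n else 0)"
    by (subst prod_delta) auto
  also have "(\<forall>q<n. ?B a q = ?B f q \<and> ?B b q = ?B e q) \<longleftrightarrow> a = f \<and> b = e"
    using bit_expansion_inj[of a n f] bit_expansion_inj[of b n e] assms by blast
  finally show ?thesis .
qed

lemmas completeness_pauli_op =
  completeness_trace[of "paulis n" "pauli_op n" "2 ^ n" "2 ^ n" for n,
    OF pauli_op_carrier finite_paulis_on[OF finite_lessThan] pauli_op_complete]

lemma supp_outside: "P \<in> paulis_on S \<Longrightarrow> q \<notin> S \<Longrightarrow> P q = PI"
  by (auto simp: paulis_on_def supp_def)

lemma paulis_on_eqI: "P \<in> paulis_on S \<Longrightarrow> Q \<in> paulis_on S \<Longrightarrow> (\<And>q. q \<in> S \<Longrightarrow> P q = Q q) \<Longrightarrow> P = Q"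
  by (metis ext supp_outside)

lemma mtrace_pauli_op_mult:
  assumes "P \<in> paulis n" "Q \<in> paulis n"
  shows "mtrace (pauli_op n P * pauli_op n Q) = (if P = Q then 2 ^ n else 0)"
proof -
  have "pauli_mat \<sigma> * pauli_mat \<tau> \<in> carrier_mat 2 2" for \<sigma> \<tau>
    by (rule mult_carrier_mat[of _ 2 2]) simp_all
  then have "mtrace (pauli_op n P * pauli_op n Q) = (\<Prod>q<n. if P q = Q q then 2 else 0)"
    by (simp add: pauli_op_def tensor_op_mult mtrace_tensor_op mtrace_pauli_mult)
  also have "\<dots> = (if \<forall>q\<in>{..<n}. P q = Q q then 2 ^ n else 0)"
    by (subst prod_delta) auto
  also have "(\<forall>q\<in>{..<n}. P q = Q q) \<longleftrightarrow> P = Q" using paulis_on_eqI[OF assms] by blast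
  finally show ?thesis .
qed

lemma id_string_paulis [simp]: "id_string \<in> paulis_on S"
  by (auto simp: paulis_on_def supp_def id_string_def)

lemma mtrace_pauli_op:
  assumes "P \<in> paulis n"
  shows "mtrace (pauli_op n P) = (if P = id_string then 2 ^ n else 0)"
  using mtrace_pauli_op_mult[OF assms id_string_paulis] by (simp add: pauli_op_id)

lemma mtrace_pauli_op_4:
  "mtrace (pauli_op n A * pauli_op n B * pauli_op n C * pauli_op n D) =
    (\<Prod>q<n. mtrace (pauli_mat (A q) * pauli_mat (B q) * pauli_mat (C q) * pauli_mat (D q)))"
proof -
  have c: "pauli_mat \<sigma> * pauli_mat \<tau> \<in> carrier_mat 2 2" for \<sigma> \<tau>
    by (rule mult_carrier_mat[of _ 2 2]) simp_all
  then have c3: "pauli_mat \<sigma> * pauli_mat \<tau> * pauli_mat \<rho> \<in> carrier_mat 2 2" for \<sigma> \<tau> \<rho>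
    by (rule mult_carrier_mat) simp
  then have c4: "pauli_mat \<sigma> * pauli_mat \<tau> * pauli_mat \<rho> * pauli_mat \<mu> \<in> carrier_mat 2 2" for \<sigma> \<tau> \<rho> \<mu>
    by (rule mult_carrier_mat) simp
  show ?thesis
    by (simp add: pauli_op_def tensor_op_mult mtrace_tensor_op c c3 c4 del: assoc_mult_mat)
qed

section \<open>Operators and their Pauli coefficients\<close>

lemma ops_mult [simp]: "A \<in> operators n \<Longrightarrow> B \<in> operators n \<Longrightarrow> A * B \<in> operators n"
  by (rule mult_carrier_mat)

lemma ops_assoc: "A \<in> operators n \<Longrightarrow> B \<in> operators n \<Longrightarrow> C \<in> operators n \<Longrightarrow> A * B * C = A * (B * C)"
  by (rule assoc_mult_mat)

lemma ops_index_add [simp]: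
  "A \<in> operators n \<Longrightarrow> B \<in> operators n \<Longrightarrow> A + B \<in> operators n"
  "A \<in> operators n \<Longrightarrow> B \<in> operators n \<Longrightarrow> A - B \<in> operators n" for A B :: "complex mat"
  by auto

lemma op_sum_carrier [simp]: "op_sum n f A \<in> operators n"
  by (simp add: op_sum_def)

lemma op_sum_dim [simp]: "dim_row (op_sum n f A) = 2 ^ n" "dim_col (op_sum n f A) = 2 ^ n"
  by (simp_all add: op_sum_def)

lemma op_sum_index: "i < 2 ^ n \<Longrightarrow> j < 2 ^ n \<Longrightarrow> op_sum n f A $$ (i, j) = (\<Sum>x\<in>A. f x $$ (i, j))"
  by (simp add: op_sum_def)

lemma op_sum_cong: "(\<And>x. x \<in> A \<Longrightarrow> f x = g x) \<Longrightarrow> op_sum n f A = op_sum n g A"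
  by (simp add: op_sum_def)

lemma ops_eqI:
  assumes "A \<in> operators n" "B \<in> operators n"
    and "\<And>i j. i < 2 ^ n \<Longrightarrow> j < 2 ^ n \<Longrightarrow> A $$ (i, j) = B $$ (i, j)"
  shows "A = B"
  using assms by (intro eq_matI) auto

lemma mult_op_sum:
  assumes "X \<in> operators n" "\<And>x. x \<in> A \<Longrightarrow> f x \<in> operators n"
  shows "X * op_sum n f A = op_sum n (\<lambda>x. X * f x) A"
proof (rule ops_eqI[of _ n])
  fix i j :: nat assume ij: "i < 2 ^ n" "j < 2 ^ n"
  have "(X * op_sum n f A) $$ (i, j) = (\<Sum>l<2 ^ n. \<Sum>x\<in>A. X $$ (i, l) * f x $$ (l, j))"
    unfolding mult_mat_index[OF assms(1) op_sum_carrier ij]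
    by (intro sum.cong refl) (simp add: op_sum_index ij sum_distrib_left)
  also have "\<dots> = (\<Sum>x\<in>A. (X * f x) $$ (i, j))"
    by (subst sum.swap, intro sum.cong refl) (simp only: mult_mat_index[OF assms(1) assms(2) ij])
  finally show "(X * op_sum n f A) $$ (i, j) = op_sum n (\<lambda>x. X * f x) A $$ (i, j)"
    by (simp add: op_sum_index ij)
qed (use assms in simp_all)

lemma op_sum_mult:
  assumes "X \<in> operators n" "\<And>x. x \<in> A \<Longrightarrow> f x \<in> operators n"
  shows "op_sum n f A * X = op_sum n (\<lambda>x. f x * X) A"
proof (rule ops_eqI[of _ n])
  fix i j :: nat assume ij: "i < 2 ^ n" "j < 2 ^ n"
  have "(op_sum n f A * X) $$ (i, j) = (\<Sum>l<2 ^ n. \<Sum>x\<in>A. f x $$ (i, l) * X $$ (l, j))"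
    unfolding mult_mat_index[OF op_sum_carrier assms(1) ij]
    by (intro sum.cong refl) (simp add: op_sum_index ij sum_distrib_right)
  also have "\<dots> = (\<Sum>x\<in>A. (f x * X) $$ (i, j))"
    by (subst sum.swap, intro sum.cong refl) (simp only: mult_mat_index[OF assms(2) assms(1) ij])
  finally show "(op_sum n f A * X) $$ (i, j) = op_sum n (\<lambda>x. f x * X) A $$ (i, j)"
    by (simp add: op_sum_index ij)
qed (use assms in simp_all)

lemma mtrace_op_sum:
  assumes "\<And>x. x \<in> A \<Longrightarrow> f x \<in> operators n"
  shows "mtrace (op_sum n f A) = (\<Sum>x\<in>A. mtrace (f x))"
proof -
  have "mtrace (op_sum n f A) = (\<Sum>i<2 ^ n. \<Sum>x\<in>A. f x $$ (i, i))"
    by (simp add: mtrace_def op_sum_index)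
  also have "\<dots> = (\<Sum>x\<in>A. mtrace (f x))"
  proof (subst sum.swap, intro sum.cong refl)
    fix x assume "x \<in> A"
    then have "dim_row (f x) = 2 ^ n" using assms by auto
    then show "(\<Sum>i<2 ^ n. f x $$ (i, i)) = mtrace (f x)" by (simp add: mtrace_def)
  qed
  finally show ?thesis .
qed

lemma mtrace_linear:
  shows "A \<in> operators n \<Longrightarrow> B \<in> operators n \<Longrightarrow> mtrace (A + B) = mtrace A + mtrace B"
    and "A \<in> operators n \<Longrightarrow> B \<in> operators n \<Longrightarrow> mtrace (A - B) = mtrace A - mtrace B"
    and "A \<in> operators n \<Longrightarrow> mtrace (c \<cdot>\<^sub>m A) = c * mtrace A"
  by (auto simp: mtrace_def sum.distrib sum_subtractf sum_distrib_left)

lemma ops_distrib: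
  fixes A B C :: "complex mat"
  shows "A \<in> operators n \<Longrightarrow> B \<in> operators n \<Longrightarrow> C \<in> operators n \<Longrightarrow> A * (B + C) = A * B + A * C"
    and "A \<in> operators n \<Longrightarrow> B \<in> operators n \<Longrightarrow> C \<in> operators n \<Longrightarrow> (B + C) * A = B * A + C * A"
    and "A \<in> operators n \<Longrightarrow> B \<in> operators n \<Longrightarrow> C \<in> operators n \<Longrightarrow> A * (B - C) = A * B - A * C"
    and "A \<in> operators n \<Longrightarrow> B \<in> operators n \<Longrightarrow> C \<in> operators n \<Longrightarrow> (B - C) * A = B * A - C * A"
    and "A \<in> operators n \<Longrightarrow> B \<in> operators n \<Longrightarrow> A * (c \<cdot>\<^sub>m B) = c \<cdot>\<^sub>m (A * B)"
    and "A \<in> operators n \<Longrightarrow> B \<in> operators n \<Longrightarrow> (c \<cdot>\<^sub>m B) * A = c \<cdot>\<^sub>m (B * A)"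
  by (simp_all add: mult_add_distrib_mat[of _ _ "2 ^ n"] add_mult_distrib_mat[of _ _ "2 ^ n"]
      mult_minus_distrib_mat[of _ _ "2 ^ n"] minus_mult_distrib_mat[of _ _ "2 ^ n"]
      mult_smult_distrib[of _ _ "2 ^ n"] mult_smult_assoc_mat[of _ _ "2 ^ n"])

lemma mat_adjoint_mult:
  assumes "A \<in> operators n" "B \<in> operators n"
  shows "mat_adjoint (A * B) = mat_adjoint B * mat_adjoint A"
proof (rule ops_eqI[of _ n])
  fix i j :: nat assume ij: "i < 2 ^ n" "j < 2 ^ n"
  have dim: "dim_row A = 2 ^ n" "dim_col A = 2 ^ n" "dim_row B = 2 ^ n" "dim_col B = 2 ^ n"
    using assms by auto
  have "mat_adjoint (A * B) $$ (i, j) = cnj ((A * B) $$ (j, i))" using ij dim by simp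
  also have "\<dots> = (\<Sum>l<2 ^ n. mat_adjoint B $$ (i, l) * mat_adjoint A $$ (l, j))"
    unfolding mult_mat_index[OF assms ij(2,1)] using ij dim by (simp add: mult.commute)
  also have "\<dots> = (mat_adjoint B * mat_adjoint A) $$ (i, j)"
    by (rule mult_mat_index[symmetric]) (use assms ij in auto)
  finally show "mat_adjoint (A * B) $$ (i, j) = (mat_adjoint B * mat_adjoint A) $$ (i, j)" .
qed (use assms in simp_all)

lemma mat_adjoint_linear:
  shows "A \<in> operators n \<Longrightarrow> B \<in> operators n \<Longrightarrow> mat_adjoint (A + B) = mat_adjoint A + mat_adjoint B"
    and "A \<in> operators n \<Longrightarrow> B \<in> operators n \<Longrightarrow> mat_adjoint (A - B) = mat_adjoint A - mat_adjoint B"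
    and "A \<in> operators n \<Longrightarrow> mat_adjoint (c \<cdot>\<^sub>m A) = cnj c \<cdot>\<^sub>m mat_adjoint A"
    and "A \<in> operators n \<Longrightarrow> mat_adjoint (mat_adjoint A) = A"
  by (auto intro!: ops_eqI[of _ n])

lemma mat_adjoint_op_sum:
  assumes "\<And>x. x \<in> A \<Longrightarrow> f x \<in> operators n"
  shows "mat_adjoint (op_sum n f A) = op_sum n (\<lambda>x. mat_adjoint (f x)) A"
proof (rule ops_eqI[of _ n])
  fix i j :: nat assume ij: "i < 2 ^ n" "j < 2 ^ n"
  have "dim_row (f x) = 2 ^ n" "dim_col (f x) = 2 ^ n" if "x \<in> A" for x using assms[OF that] by auto
  then show "mat_adjoint (op_sum n f A) $$ (i, j) = op_sum n (\<lambda>x. mat_adjoint (f x)) A $$ (i, j)"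
    using ij by (simp add: op_sum_index)
qed simp_all

lemma mat_adjoint_one [simp]: "mat_adjoint (1\<^sub>m d :: complex mat) = 1\<^sub>m d"
  by (rule eq_matI) auto

lemma mtrace_adjoint: "A \<in> operators n \<Longrightarrow> mtrace (mat_adjoint A) = cnj (mtrace A)"
  by (auto simp: mtrace_def intro!: sum.cong)

section \<open>Pauli coefficients and locality\<close>

lemma pauli_reconstruction:
  assumes "X \<in> operators n"
  shows "X = op_sum n (\<lambda>P. (mtrace (pauli_op n P * X) / 2 ^ n) \<cdot>\<^sub>m pauli_op n P) (paulis n)"
proof (rule ops_eqI[of _ n])
  fix i j :: nat assume ij: "i < 2 ^ n" "j < 2 ^ n"
  have "(\<Sum>P\<in>paulis n. mtrace (pauli_op n P * X) * pauli_op n P $$ (i, j)) =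
    (\<Sum>P\<in>paulis n. \<Sum>a<2 ^ n. \<Sum>b<2 ^ n. (pauli_op n P $$ (a, b) * pauli_op n P $$ (i, j)) * X $$ (b, a))"
    by (simp add: mtrace_mult[OF pauli_op_carrier assms] sum_distrib_left sum_distrib_right mult_ac)
  also have "\<dots> = (\<Sum>a<2 ^ n. \<Sum>b<2 ^ n. \<Sum>P\<in>paulis n. (pauli_op n P $$ (a, b) * pauli_op n P $$ (i, j)) * X $$ (b, a))"
    by ((subst sum.swap, intro sum.cong refl)+)
  also have "\<dots> = (\<Sum>a<2 ^ n. \<Sum>b<2 ^ n. if b = i then if a = j then 2 ^ n * X $$ (i, j) else 0 else 0)"
    using ij by (intro sum.cong refl) (auto simp: pauli_op_complete simp flip: sum_distrib_right)
  also have "\<dots> = 2 ^ n * X $$ (i, j)" using ij by simp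
  finally show "X $$ (i, j) =
     op_sum n (\<lambda>P. (mtrace (pauli_op n P * X) / 2 ^ n) \<cdot>\<^sub>m pauli_op n P) (paulis n) $$ (i, j)"
    using ij by (simp add: op_sum_index sum_divide_distrib[symmetric])
qed (use assms in simp_all)

text \<open>For sets of qubits this agrees with \<open>supported_on\<close>, but it is a family of
  linear equations instead of an existential statement, so that closure under sums and adjoints
  needs no choice of coefficients.\<close>

definition local_op :: "nat \<Rightarrow> nat set \<Rightarrow> complex mat \<Rightarrow> bool" where
  "local_op n e X \<longleftrightarrow> X \<in> operators n \<and>
     (\<forall>R\<in>paulis n. \<not> supp R \<subseteq> e \<longrightarrow> mtrace (pauli_op n R * X) = 0)"

lemma local_op_carrier: "local_op n e X \<Longrightarrow> X \<in> operators n"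
  by (simp add: local_op_def)

lemma mtrace_mult_op_sum:
  assumes "Y \<in> operators n" "\<And>x. x \<in> A \<Longrightarrow> f x \<in> operators n"
  shows "mtrace (Y * op_sum n (\<lambda>x. c x \<cdot>\<^sub>m f x) A) = (\<Sum>x\<in>A. c x * mtrace (Y * f x))"
  using assms by (simp add: mult_op_sum mtrace_op_sum[where n = n] ops_distrib[where n = n] mtrace_linear[where n = n])

lemma mtrace_pauli_op_sum:
  assumes "P \<in> paulis n" "A \<subseteq> paulis n"
  shows "mtrace (pauli_op n P * op_sum n (\<lambda>P. c P \<cdot>\<^sub>m pauli_op n P) A) = (if P \<in> A then 2 ^ n * c P else 0)"
proof -
  have fin: "finite A" using assms(2) by (rule finite_subset) simp
  have "mtrace (pauli_op n P * op_sum n (\<lambda>P. c P \<cdot>\<^sub>m pauli_op n P) A) =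
    (\<Sum>Q\<in>A. if Q = P then 2 ^ n * c P else 0)"
    unfolding mtrace_mult_op_sum[OF pauli_op_carrier pauli_op_carrier] using assms
    by (intro sum.cong refl) (auto simp: mtrace_pauli_op_mult subset_iff)
  then show ?thesis using fin by simp
qed

lemma paulis_on_mono: "S \<subseteq> T \<Longrightarrow> paulis_on S \<subseteq> paulis_on T"
  by (auto simp: paulis_on_def)

lemma local_op_pauli_sum:
  assumes "A \<subseteq> paulis n" "A \<subseteq> paulis_on e"
  shows "local_op n e (op_sum n (\<lambda>P. c P \<cdot>\<^sub>m pauli_op n P) A)"
  unfolding local_op_def using assms
  by (auto simp: mtrace_pauli_op_sum paulis_on_def)

lemma local_op_expansion:
  assumes X: "local_op n e X" and e: "e \<subseteq> {..<n}"
  shows "X = op_sum n (\<lambda>P. (mtrace (pauli_op n P * X) / 2 ^ n) \<cdot>\<^sub>m pauli_op n P) (paulis_on e)"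
proof -
  have "X = op_sum n (\<lambda>P. (mtrace (pauli_op n P * X) / 2 ^ n) \<cdot>\<^sub>m pauli_op n P) (paulis n)"
    using X by (intro pauli_reconstruction) (simp add: local_op_def)
  also have "\<dots> = op_sum n (\<lambda>P. (mtrace (pauli_op n P * X) / 2 ^ n) \<cdot>\<^sub>m pauli_op n P) (paulis_on e)"
  proof (rule ops_eqI[of _ n])
    fix i j :: nat assume ij: "i < 2 ^ n" "j < 2 ^ n"
    show "op_sum n (\<lambda>P. (mtrace (pauli_op n P * X) / 2 ^ n) \<cdot>\<^sub>m pauli_op n P) (paulis n) $$ (i, j) =
       op_sum n (\<lambda>P. (mtrace (pauli_op n P * X) / 2 ^ n) \<cdot>\<^sub>m pauli_op n P) (paulis_on e) $$ (i, j)"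
      unfolding op_sum_index[OF ij] using X ij paulis_on_mono[OF e]
      by (intro sum.mono_neutral_right) (simp_all add: local_op_def, auto simp: paulis_on_def)
  qed simp_all
  finally show ?thesis .
qed

lemma supported_on_iff_local_op:
  assumes "e \<subseteq> {..<n}"
  shows "supported_on n e X \<longleftrightarrow> local_op n e X"
proof
  assume "supported_on n e X"
  then obtain c where X: "X = op_sum n (\<lambda>P. c P \<cdot>\<^sub>m pauli_op n P) (paulis_on e)"
    by (auto simp: supported_on_def)
  show "local_op n e X" unfolding X by (rule local_op_pauli_sum[OF paulis_on_mono[OF assms] order_refl])
next
  assume "local_op n e X"
  from local_op_expansion[OF this assms] show "supported_on n e X"
    unfolding supported_on_def by (rule exI[of _ "\<lambda>P. mtrace (pauli_op n P * X) / 2 ^ n"])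
qed

lemma mtrace_pauli_op_3:
  "mtrace (pauli_op n A * pauli_op n B * pauli_op n C) =
    (\<Prod>q<n. mtrace (pauli_mat (A q) * pauli_mat (B q) * pauli_mat (C q)))"
proof -
  have c: "pauli_mat \<sigma> * pauli_mat \<tau> \<in> carrier_mat 2 2" for \<sigma> \<tau>
    by (rule mult_carrier_mat[of _ 2 2]) simp_all
  then have c3: "pauli_mat \<sigma> * pauli_mat \<tau> * pauli_mat \<rho> \<in> carrier_mat 2 2" for \<sigma> \<tau> \<rho>
    by (rule mult_carrier_mat) simp
  show ?thesis
    by (simp add: pauli_op_def tensor_op_mult mtrace_tensor_op c c3 del: assoc_mult_mat)
qed

lemma pauli_mat_PI: "pauli_mat PI = 1\<^sub>m 2"
  by (rule eq_matI) (auto simp: less_2_iff pauli_mat_entries carrier_matD[OF pauli_mat_carrier])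

lemma pauli_mat_mult_PI [simp]: "pauli_mat \<sigma> * pauli_mat PI = pauli_mat \<sigma>" "pauli_mat PI * pauli_mat \<sigma> = pauli_mat \<sigma>"
  unfolding pauli_mat_PI
  by (rule right_mult_one_mat[OF pauli_mat_carrier], rule left_mult_one_mat[OF pauli_mat_carrier])

text \<open>At a qubit \<open>q\<close> of \<open>R\<close> outside \<open>e\<close> both factors
  act as the identity, so the trace of the product has the factor
  \<open>Tr(R q) = 0\<close>.\<close>

lemma local_op_mult:
  assumes X: "local_op n e X" and Y: "local_op n e Y" and e: "e \<subseteq> {..<n}"
  shows "local_op n e (X * Y)"
  unfolding local_op_def
proof (intro conjI ballI impI)
  show "X * Y \<in> operators n" using X Y by (simp add: local_op_def)
  fix R assume R: "R \<in> paulis n" "\<not> supp R \<subseteq> e"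
  then obtain q where q: "q < n" "q \<notin> e" "R q \<noteq> PI" by (auto simp: paulis_on_def supp_def)
  define x y where "x = (\<lambda>P. mtrace (pauli_op n P * X) / 2 ^ n)" and "y = (\<lambda>P. mtrace (pauli_op n P * Y) / 2 ^ n)"
  have xy: "X = op_sum n (\<lambda>P. x P \<cdot>\<^sub>m pauli_op n P) (paulis_on e)"
      "Y = op_sum n (\<lambda>P. y P \<cdot>\<^sub>m pauli_op n P) (paulis_on e)"
    using local_op_expansion[OF X e] local_op_expansion[OF Y e] by (simp_all only: x_def y_def)
  have c: "X \<in> operators n" "Y \<in> operators n" using X Y by (auto simp: local_op_def)
  have 0: "mtrace (pauli_op n R * pauli_op n P * pauli_op n Q) = 0"
    if "P \<in> paulis_on e" "Q \<in> paulis_on e" for P Q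
    unfolding mtrace_pauli_op_3
    using q that by (intro prod_zero bexI[of _ q]) (auto simp: supp_outside mtrace_pauli)
  have "mtrace (pauli_op n R * pauli_op n P * Y) = 0" if "P \<in> paulis_on e" for P
    unfolding xy(2) by (subst mtrace_mult_op_sum) (use that 0 in simp_all)
  moreover have "mtrace (pauli_op n R * X * Y) = mtrace (Y * pauli_op n R * X)"
    using c mtrace_comm[of "pauli_op n R * X" "2 ^ n" Y] by (simp add: ops_assoc[where n = n])
  moreover have "mtrace (Y * pauli_op n R * X) = (\<Sum>P\<in>paulis_on e. x P * mtrace (Y * pauli_op n R * pauli_op n P))"
    unfolding xy(1) by (rule mtrace_mult_op_sum) (use c in simp_all)
  moreover have "mtrace (Y * pauli_op n R * pauli_op n P) = mtrace (pauli_op n R * pauli_op n P * Y)" for P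
    using c mtrace_comm[of Y "2 ^ n" "pauli_op n R * pauli_op n P"] by (simp add: ops_assoc[where n = n])
  ultimately have "mtrace (pauli_op n R * X * Y) = 0" by simp
  then show "mtrace (pauli_op n R * (X * Y)) = 0"
    using c by (simp add: ops_assoc[where n = n])
qed

lemma local_op_adjoint:
  assumes "local_op n e X"
  shows "local_op n e (mat_adjoint X)"
  unfolding local_op_def
proof (intro conjI ballI impI)
  have X: "X \<in> operators n" using assms by (simp add: local_op_def)
  then show "mat_adjoint X \<in> operators n" by simp
  fix R assume R: "R \<in> paulis n" "\<not> supp R \<subseteq> e"
  have "mtrace (pauli_op n R * mat_adjoint X) = mtrace (mat_adjoint (X * pauli_op n R))"
    using X by (simp add: mat_adjoint_mult)
  also have "\<dots> = cnj (mtrace (pauli_op n R * X))"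
    using X mtrace_comm[of X "2 ^ n" "pauli_op n R"] by (subst mtrace_adjoint[where n = n]) simp_all
  finally show "mtrace (pauli_op n R * mat_adjoint X) = 0" using assms R by (simp add: local_op_def)
qed

lemma local_op_linear:
  shows "local_op n e X \<Longrightarrow> local_op n e Y \<Longrightarrow> local_op n e (X + Y)"
    and "local_op n e X \<Longrightarrow> local_op n e Y \<Longrightarrow> local_op n e (X - Y)"
    and "local_op n e X \<Longrightarrow> local_op n e (c \<cdot>\<^sub>m X)"
  by (simp_all add: local_op_def ops_distrib[where n = n] mtrace_linear[where n = n])

lemma local_op_op_sum:
  assumes "\<And>x. x \<in> A \<Longrightarrow> local_op n e (f x)"
  shows "local_op n e (op_sum n f A)"
  using assms unfolding local_op_def
  by (auto simp: mult_op_sum mtrace_op_sum[where n = n])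

lemma local_op_mono: "local_op n e X \<Longrightarrow> e \<subseteq> S \<Longrightarrow> local_op n S X"
  by (auto simp: local_op_def)

lemma local_op_pauli: "P \<in> paulis n \<Longrightarrow> supp P \<subseteq> e \<Longrightarrow> local_op n e (pauli_op n P)"
  by (auto simp: local_op_def mtrace_pauli_op_mult)

lemma local_op_one: "local_op n e (1\<^sub>m (2 ^ n))"
  using local_op_pauli[OF id_string_paulis, of e n]
  by (simp add: pauli_op_id) (simp add: supp_def id_string_def)

text \<open>At every qubit at least one of two strings with disjoint supports is the identity, so
  the Pauli operators commute; the rest is bilinearity.\<close>

lemma local_op_commute:
  assumes X: "local_op n e X" "e \<subseteq> {..<n}" and Y: "local_op n S Y" "S \<subseteq> {..<n}" and "e \<inter> S = {}"
  shows "X * Y = Y * X"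
proof -
  have PQ: "pauli_op n P * pauli_op n Q = pauli_op n Q * pauli_op n P"
    if "P \<in> paulis_on e" "Q \<in> paulis_on S" for P Q
  proof -
    have "pauli_mat (P q) * pauli_mat (Q q) = pauli_mat (Q q) * pauli_mat (P q)" for q
    proof (cases "q \<in> e")
      case True
      then have "Q q = PI" using that assms(5) supp_outside by blast
      then show ?thesis by simp
    next
      case False
      then have "P q = PI" using that supp_outside by blast
      then show ?thesis by simp
    qed
    then show ?thesis by (simp add: pauli_op_def tensor_op_mult)
  qed
  define x y where "x = (\<lambda>P. mtrace (pauli_op n P * X) / 2 ^ n)" and "y = (\<lambda>P. mtrace (pauli_op n P * Y) / 2 ^ n)"
  have xy: "X = op_sum n (\<lambda>P. x P \<cdot>\<^sub>m pauli_op n P) (paulis_on e)"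
      "Y = op_sum n (\<lambda>P. y P \<cdot>\<^sub>m pauli_op n P) (paulis_on S)"
    using local_op_expansion[OF X] local_op_expansion[OF Y] by (simp_all only: x_def y_def)
  have PY: "pauli_op n P * Y = Y * pauli_op n P" if "P \<in> paulis_on e" for P
    unfolding xy(2) using that PQ
    by (simp add: mult_op_sum op_sum_mult ops_distrib[where n = n]) (rule op_sum_cong, simp add: ops_distrib[where n = n])
  have "Y \<in> operators n" using Y by (simp add: local_op_def)
  then show ?thesis
    unfolding xy(1) using PY
    by (simp add: mult_op_sum op_sum_mult) (rule op_sum_cong, simp add: ops_distrib[where n = n])
qed

section \<open>Coefficients of superoperators\<close>

text \<open>The inversion formula of the algorithm for the set of all qubits; there are no diagonal extensions
  left, so that it recovers single coefficients.\<close>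

definition chi_of :: "nat \<Rightarrow> superop \<Rightarrow> pstring \<Rightarrow> pstring \<Rightarrow> complex" where
  "chi_of n \<Phi> P Q = (\<Sum>A\<in>paulis n. \<Sum>B\<in>paulis n. mtrace (pauli_op n A * \<Phi> (pauli_op n B)) *
     mtrace (pauli_op n A * pauli_op n Q * pauli_op n B * pauli_op n P)) / 16 ^ n"

lemma chi_of_cong: "(\<And>M. M \<in> operators n \<Longrightarrow> \<Phi> M = \<Psi> M) \<Longrightarrow> chi_of n \<Phi> P Q = chi_of n \<Psi> P Q"
  by (simp add: chi_of_def)

lemma chi_of_linear:
  assumes "\<And>M. M \<in> operators n \<Longrightarrow> \<Phi> M \<in> operators n" "\<And>M. M \<in> operators n \<Longrightarrow> \<Psi> M \<in> operators n"
  shows "chi_of n (\<lambda>M. \<Phi> M + \<Psi> M) P Q = chi_of n \<Phi> P Q + chi_of n \<Psi> P Q"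
    and "chi_of n (\<lambda>M. \<Phi> M - \<Psi> M) P Q = chi_of n \<Phi> P Q - chi_of n \<Psi> P Q"
    and "chi_of n (\<lambda>M. c \<cdot>\<^sub>m \<Phi> M) P Q = c * chi_of n \<Phi> P Q"
  using assms
  by (simp_all add: chi_of_def ops_distrib[where n = n] mtrace_linear[where n = n] distrib_right left_diff_distrib
      sum.distrib sum_subtractf add_divide_distrib diff_divide_distrib sum_distrib_left mult.assoc)

lemma chi_of_op_sum:
  assumes "\<And>x M. x \<in> A \<Longrightarrow> M \<in> operators n \<Longrightarrow> \<Phi> x M \<in> operators n"
  shows "chi_of n (\<lambda>M. op_sum n (\<lambda>x. \<Phi> x M) A) P Q = (\<Sum>x\<in>A. chi_of n (\<Phi> x) P Q)"
proof -
  have "chi_of n (\<lambda>M. op_sum n (\<lambda>x. \<Phi> x M) A) P Q =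
    (\<Sum>B\<in>paulis n. \<Sum>C\<in>paulis n. \<Sum>x\<in>A. mtrace (pauli_op n B * \<Phi> x (pauli_op n C)) *
     mtrace (pauli_op n B * pauli_op n Q * pauli_op n C * pauli_op n P)) / 16 ^ n"
    using assms by (simp add: chi_of_def mult_op_sum mtrace_op_sum[where n = n] sum_distrib_right)
  also have "\<dots> = (\<Sum>x\<in>A. chi_of n (\<Phi> x) P Q)"
  proof -
    have "(\<Sum>B\<in>S. \<Sum>C\<in>T. \<Sum>x\<in>A. f B C x) = (\<Sum>x\<in>A. \<Sum>B\<in>S. \<Sum>C\<in>T. f B C x)"
      for S T and f :: "pstring \<Rightarrow> pstring \<Rightarrow> _ \<Rightarrow> complex"
      by (subst (2) sum.swap) (subst sum.swap, rule refl)
    then show ?thesis unfolding chi_of_def sum_divide_distrib[symmetric] by (rule arg_cong)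
  qed
  finally show ?thesis .
qed

text \<open>The two contractions of \<open>local_pauli_inversion\<close>, now on all qubits at once.
  Each gives \<open>2 ^ n\<close>; against \<open>16 ^ n\<close> this leaves the normalisation of
  two Pauli coefficients.\<close>

lemma chi_of_sandwich:
  assumes X: "X \<in> operators n" and Y: "Y \<in> operators n"
  shows "chi_of n (\<lambda>M. X * M * Y) P Q = mtrace (pauli_op n P * X) * mtrace (pauli_op n Q * Y) / 4 ^ n"
proof -
  let ?p = "pauli_op n"
  have "(\<Sum>A\<in>paulis n. \<Sum>B\<in>paulis n. mtrace (?p A * (X * ?p B * Y)) * mtrace (?p A * ?p Q * ?p B * ?p P)) =
    (\<Sum>B\<in>paulis n. \<Sum>A\<in>paulis n. mtrace (?p A * (X * ?p B * Y)) * mtrace (?p A * (?p Q * ?p B * ?p P)))"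
    using X Y by (subst sum.swap) (simp add: ops_assoc[where n = n])
  also have "\<dots> = (\<Sum>B\<in>paulis n. 2 ^ n * mtrace ((X * ?p B * Y) * (?p Q * ?p B * ?p P)))"
    using X Y by (intro sum.cong refl completeness_pauli_op(1)) simp_all
  also have "\<dots> = (\<Sum>B\<in>paulis n. 2 ^ n * mtrace (?p B * (Y * ?p Q) * ?p B * (?p P * X)))"
  proof (intro sum.cong refl)
    fix B
    have "mtrace (X * (?p B * Y * (?p Q * ?p B * ?p P))) = mtrace ((?p B * Y * (?p Q * ?p B * ?p P)) * X)"
      by (rule mtrace_comm[of _ "2 ^ n"]) (use X Y in simp_all)
    then show "2 ^ n * mtrace ((X * ?p B * Y) * (?p Q * ?p B * ?p P)) =
      2 ^ n * mtrace (?p B * (Y * ?p Q) * ?p B * (?p P * X))"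
      using X Y by (simp add: ops_assoc[where n = n])
  qed
  also have "\<dots> = 2 ^ n * (2 ^ n * mtrace (Y * ?p Q) * mtrace (?p P * X))"
    unfolding sum_distrib_left[symmetric] by (subst completeness_pauli_op(2)) (use X Y in simp_all)
  also have "mtrace (Y * ?p Q) = mtrace (?p Q * Y)" by (rule mtrace_comm[of _ "2 ^ n"]) (use Y in simp_all)
  finally have "chi_of n (\<lambda>M. X * M * Y) P Q =
      (2 ^ n * 2 ^ n) * (mtrace (?p P * X) * mtrace (?p Q * Y)) / 16 ^ n"
    by (simp add: chi_of_def)
  also have "(2::complex) ^ n * 2 ^ n = 4 ^ n" by (simp flip: power_mult_distrib)
  also have "(16::complex) ^ n = 4 ^ n * 4 ^ n" by (simp flip: power_mult_distrib)
  finally show ?thesis by simp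
qed

lemma chi_of_one_sided:
  assumes X: "X \<in> operators n"
  shows "chi_of n (\<lambda>M. X * M) P Q = mtrace (pauli_op n P * X) * mtrace (pauli_op n Q) / 4 ^ n"
    and "chi_of n (\<lambda>M. M * X) P Q = mtrace (pauli_op n P) * mtrace (pauli_op n Q * X) / 4 ^ n"
proof -
  have "chi_of n (\<lambda>M. X * M) P Q = chi_of n (\<lambda>M. X * M * 1\<^sub>m (2 ^ n)) P Q"
    using X by (intro chi_of_cong) (auto simp: right_mult_one_mat[of _ "2 ^ n" "2 ^ n"])
  then show "chi_of n (\<lambda>M. X * M) P Q = mtrace (pauli_op n P * X) * mtrace (pauli_op n Q) / 4 ^ n"
    using chi_of_sandwich[OF X, of "1\<^sub>m (2 ^ n)" P Q] by simp
  have "chi_of n (\<lambda>M. M * X) P Q = chi_of n (\<lambda>M. 1\<^sub>m (2 ^ n) * M * X) P Q"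
    using X by (intro chi_of_cong) auto
  then show "chi_of n (\<lambda>M. M * X) P Q = mtrace (pauli_op n P) * mtrace (pauli_op n Q * X) / 4 ^ n"
    using chi_of_sandwich[of "1\<^sub>m (2 ^ n)" n X P Q] X by simp
qed

text \<open>The functionals \<open>chi_of\<close> are dual to the maps
  \<open>M \<mapsto> P M Q\<close>. Hence the coefficients are determined by the superoperator, and
  those of different forms of the generator can be compared.\<close>

lemma chi_of_chi_expansion:
  assumes chi: "chi_expansion n \<Phi> chi" and PQ: "P \<in> paulis n" "Q \<in> paulis n"
  shows "chi_of n \<Phi> P Q = chi (P, Q)"
proof -
  have "chi_of n \<Phi> P Q = chi_of n (\<lambda>M. op_sum n (\<lambda>u. chi u \<cdot>\<^sub>m (pauli_op n (fst u) * M * pauli_op n (snd u)))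
      (paulis n \<times> paulis n)) P Q"
    using chi by (intro chi_of_cong) (simp add: chi_expansion_def case_prod_unfold)
  also have "\<dots> = (\<Sum>u\<in>paulis n \<times> paulis n. chi_of n (\<lambda>M. chi u \<cdot>\<^sub>m (pauli_op n (fst u) * M * pauli_op n (snd u))) P Q)"
    by (rule chi_of_op_sum) simp
  also have "\<dots> = (\<Sum>u\<in>paulis n \<times> paulis n. if u = (P, Q) then chi (P, Q) else 0)"
  proof (intro sum.cong refl)
    fix u assume u: "u \<in> paulis n \<times> paulis n"
    have "chi_of n (\<lambda>M. chi u \<cdot>\<^sub>m (pauli_op n (fst u) * M * pauli_op n (snd u))) P Q =
      chi u * (mtrace (pauli_op n P * pauli_op n (fst u)) * mtrace (pauli_op n Q * pauli_op n (snd u)) / 4 ^ n)"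
      by (simp add: chi_of_linear(3) chi_of_sandwich)
    also have "\<dots> = (if u = (P, Q) then chi (P, Q) else 0)"
      using u PQ by (auto simp: mtrace_pauli_op_mult simp flip: power_mult_distrib split: if_splits)
    finally show "chi_of n (\<lambda>M. chi u \<cdot>\<^sub>m (pauli_op n (fst u) * M * pauli_op n (snd u))) P Q =
      (if u = (P, Q) then chi (P, Q) else 0)" .
  qed
  also have "\<dots> = chi (P, Q)" using PQ by simp
  finally show ?thesis .
qed

lemma chi_of_commutator:
  assumes "X \<in> operators n"
  shows "chi_of n (commutator X) P Q =
    (mtrace (pauli_op n P * X) * mtrace (pauli_op n Q) - mtrace (pauli_op n P) * mtrace (pauli_op n Q * X)) / 4 ^ n"
  unfolding commutator_def using assms
  by (simp add: chi_of_linear chi_of_one_sided diff_divide_distrib)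

lemma chi_of_anticommutator:
  assumes "X \<in> operators n"
  shows "chi_of n (anticommutator X) P Q =
    (mtrace (pauli_op n P * X) * mtrace (pauli_op n Q) + mtrace (pauli_op n P) * mtrace (pauli_op n Q * X)) / 4 ^ n"
  unfolding anticommutator_def using assms
  by (simp add: chi_of_linear chi_of_one_sided add_divide_distrib)

lemma commutator_carrier [simp]: "A \<in> operators n \<Longrightarrow> M \<in> operators n \<Longrightarrow> commutator A M \<in> operators n"
  and anticommutator_carrier [simp]: "A \<in> operators n \<Longrightarrow> M \<in> operators n \<Longrightarrow> anticommutator A M \<in> operators n"
  by (simp_all add: commutator_def anticommutator_def)

lemma hamiltonian_carrier [simp]: "hamiltonian n h A \<in> operators n"
  by (simp add: hamiltonian_def)

lemma mtrace_pauli_hamiltonian: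
  "P \<in> paulis n \<Longrightarrow> A \<subseteq> paulis n \<Longrightarrow>
    mtrace (pauli_op n P * hamiltonian n h A) = (if P \<in> A then 2 ^ n * h P else 0)"
  unfolding hamiltonian_def by (rule mtrace_pauli_op_sum)

text \<open>Commutators and anticommutators have coefficients only at pairs containing the identity,
  so nontrivial pairs see \<open>G\<close> alone. At \<open>(P, id_string)\<close> and
  \<open>(id_string, P)\<close> the anticommutators contribute equally and cancel in the difference,
  while the Hamiltonian contributes with opposite signs.\<close>

lemma chi_of_gks_expansion:
  assumes gks: "gks_expansion n \<Phi> h G" and PQ: "P \<in> paulis n" "Q \<in> paulis n"
  shows "P \<noteq> id_string \<Longrightarrow> Q \<noteq> id_string \<Longrightarrow> chi_of n \<Phi> P Q = G (P, Q)"
    and "P \<noteq> id_string \<Longrightarrow> \<i> / 2 * (chi_of n \<Phi> P id_string - chi_of n \<Phi> id_string P) = h P"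
proof -
  let ?p = "pauli_op n" and ?H = "hamiltonian n h (paulis n)"
  let ?I = "(paulis n - {id_string}) \<times> (paulis n - {id_string})"
  let ?D = "\<lambda>u M. ?p (fst u) * M * ?p (snd u) - (1 / 2) \<cdot>\<^sub>m anticommutator (?p (snd u) * ?p (fst u)) M"
  have four: "(2::complex) ^ n * 2 ^ n = 4 ^ n" by (simp flip: power_mult_distrib)
  have exp: "chi_of n \<Phi> A B = - \<i> * chi_of n (commutator ?H) A B + (\<Sum>u\<in>?I. G u * chi_of n (?D u) A B)" for A B
  proof -
    have "chi_of n \<Phi> A B = chi_of n (\<lambda>M. (- \<i>) \<cdot>\<^sub>m commutator ?H M + op_sum n (\<lambda>u. G u \<cdot>\<^sub>m ?D u M) ?I) A B"
      using gks by (intro chi_of_cong) (simp add: gks_expansion_def case_prod_unfold)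
    then show ?thesis
      by (simp add: chi_of_linear chi_of_op_sum del: times_divide_eq_left)
  qed
  have D: "chi_of n (?D u) A B = (mtrace (?p A * ?p (fst u)) * mtrace (?p B * ?p (snd u)) -
    (mtrace (?p A * (?p (snd u) * ?p (fst u))) * mtrace (?p B) + mtrace (?p A) * mtrace (?p B * (?p (snd u) * ?p (fst u)))) / 2) / 4 ^ n"
    for u A B
    by (simp add: chi_of_linear chi_of_sandwich chi_of_anticommutator[of _ n] diff_divide_distrib)
  show "chi_of n \<Phi> P Q = G (P, Q)" if ne: "P \<noteq> id_string" "Q \<noteq> id_string"
  proof -
    have "chi_of n (commutator ?H) P Q = 0"
      using ne PQ by (simp add: chi_of_commutator mtrace_pauli_op)
    moreover have "chi_of n (?D u) P Q = (if u = (P, Q) then 1 else 0)" if "u \<in> ?I" for u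
      unfolding D using that ne PQ four by (cases u) (auto simp: mtrace_pauli_op mtrace_pauli_op_mult)
    ultimately have "chi_of n \<Phi> P Q = (\<Sum>u\<in>?I. G u * (if u = (P, Q) then 1 else 0))"
      unfolding exp by simp
    also have "\<dots> = (\<Sum>u\<in>?I. if u = (P, Q) then G u else 0)" by (intro sum.cong) auto
    also have "\<dots> = G (P, Q)" using PQ ne by simp
    finally show ?thesis .
  qed
  show "\<i> / 2 * (chi_of n \<Phi> P id_string - chi_of n \<Phi> id_string P) = h P" if ne: "P \<noteq> id_string"
  proof -
    have "chi_of n (?D u) P id_string = chi_of n (?D u) id_string P" if "u \<in> ?I" for u
      unfolding D using that ne PQ by (cases u) (auto simp: mtrace_pauli_op mtrace_pauli_op_mult)
    then have s: "(\<Sum>u\<in>?I. G u * chi_of n (?D u) P id_string) = (\<Sum>u\<in>?I. G u * chi_of n (?D u) id_string P)"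
      by (intro sum.cong refl) simp
    have "chi_of n (commutator ?H) P id_string = h P" "chi_of n (commutator ?H) id_string P = - h P"
      using ne PQ four by (simp_all add: chi_of_commutator mtrace_pauli_op mtrace_pauli_hamiltonian field_simps)
    then have "chi_of n \<Phi> P id_string - chi_of n \<Phi> id_string P = - 2 * \<i> * h P"
      unfolding exp s by simp
    then show ?thesis by simp
  qed
qed

lemma hamiltonian_traceless:
  assumes "mtrace (hamiltonian n h (paulis n)) = 0"
  shows "h id_string = 0"
proof -
  have "mtrace (pauli_op n id_string * hamiltonian n h (paulis n)) = 2 ^ n * h id_string"
    by (simp add: mtrace_pauli_hamiltonian)
  moreover have "pauli_op n id_string * hamiltonian n h (paulis n) = hamiltonian n h (paulis n)"
    unfolding pauli_op_id by (rule left_mult_one_mat[OF hamiltonian_carrier])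
  ultimately show ?thesis using assms by simp
qed

text \<open>Pairing the estimates with \<open>Tr(A Q B P)\<close> on \<open>S\<close> sums the coefficients over all diagonal
  extensions: off \<open>S\<close> the trace \<open>Tr(A P' B Q')\<close> is \<open>Tr(P' Q')\<close>.\<close>

lemma local_inversion_identity:
  assumes chi: "chi_expansion n \<Phi> chi" and S: "S \<subseteq> {..<n}" and P0: "P\<^sub>0 \<in> paulis_on S" and Q0: "Q\<^sub>0 \<in> paulis_on S"
  shows "(1 / 2 ^ (3 * card S)) * (\<Sum>A\<in>paulis_on S. \<Sum>B\<in>paulis_on S.
      (mtrace (pauli_op n A * \<Phi> (pauli_op n B)) / 2 ^ n) * local_trace S A Q\<^sub>0 B P\<^sub>0) =
    (\<Sum>R\<in>paulis_on ({..<n} - S). chi (tensor_string S P\<^sub>0 R, tensor_string S Q\<^sub>0 R))"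
proof -
  let ?M = pauli_mat
  define t where "t = (\<lambda>\<sigma> \<tau> \<mu> \<nu>. mtrace (?M \<sigma> * ?M \<tau> * ?M \<mu> * ?M \<nu>))"
  let ?U = "paulis n \<times> paulis n" and ?V = "paulis_on S \<times> paulis_on S"
  define E where "E = {..<n} - S"
  have fin: "finite S" "finite E" using S by (auto simp: E_def intro: finite_subset)
  \<comment> \<open>The pairs that survive the pairing: equal to the target on \<open>S\<close>, and
    with equal components off \<open>S\<close>.\<close>
  define good where "good = (\<lambda>(P, Q). (\<forall>q\<in>S. P q = P\<^sub>0 q \<and> Q q = Q\<^sub>0 q) \<and> (\<forall>q\<in>E. P q = Q q))"
  have tr: "mtrace (pauli_op n A * (pauli_op n P * pauli_op n B * pauli_op n Q)) =
      (\<Prod>q\<in>S. t (A q) (P q) (B q) (Q q)) * (if \<forall>q\<in>E. P q = Q q then 2 ^ card E else 0)"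
    if A: "A \<in> paulis_on S" "B \<in> paulis_on S" for A B P Q
  proof -
    have "mtrace (pauli_op n A * (pauli_op n P * pauli_op n B * pauli_op n Q)) = (\<Prod>q<n. t (A q) (P q) (B q) (Q q))"
      using mtrace_pauli_op_4[of n A P B Q] by (simp add: t_def ops_assoc[where n = n])
    also have "\<dots> = (\<Prod>q\<in>S. t (A q) (P q) (B q) (Q q)) * (\<Prod>q\<in>E. t (A q) (P q) (B q) (Q q))"
      using S fin unfolding E_def by (subst prod.subset_diff[of S "{..<n}"]) (auto simp: mult.commute)
    also have "(\<Prod>q\<in>E. t (A q) (P q) (B q) (Q q)) = (\<Prod>q\<in>E. if P q = Q q then 2 else 0)"
      using A by (intro prod.cong refl) (simp add: t_def E_def supp_outside mtrace_pauli_mult)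
    also have "\<dots> = (if \<forall>q\<in>E. P q = Q q then 2 ^ card E else 0)" by (rule prod_delta[OF fin(2)])
    finally show ?thesis .
  qed
  have inner: "(\<Sum>A\<in>paulis_on S. \<Sum>B\<in>paulis_on S.
      (\<Prod>q\<in>S. t (A q) (P q) (B q) (Q q)) * (\<Prod>q\<in>S. t (A q) (Q\<^sub>0 q) (B q) (P\<^sub>0 q))) =
    (if \<forall>q\<in>S. P q = P\<^sub>0 q \<and> Q q = Q\<^sub>0 q then 16 ^ card S else 0)" for P Q
  proof -
    have "(\<Sum>A\<in>paulis_on S. \<Sum>B\<in>paulis_on S.
      (\<Prod>q\<in>S. t (A q) (P q) (B q) (Q q)) * (\<Prod>q\<in>S. t (A q) (Q\<^sub>0 q) (B q) (P\<^sub>0 q))) =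
      (\<Sum>A\<in>paulis_on S. \<Sum>B\<in>paulis_on S. \<Prod>q\<in>S. t (A q) (P q) (B q) (Q q) * t (A q) (Q\<^sub>0 q) (B q) (P\<^sub>0 q))"
      by (simp add: prod.distrib)
    also have "\<dots> = (\<Sum>A\<in>paulis_on S. \<Prod>q\<in>S. \<Sum>\<tau>\<in>UNIV. t (A q) (P q) \<tau> (Q q) * t (A q) (Q\<^sub>0 q) \<tau> (P\<^sub>0 q))"
      by (intro sum.cong refl sum_paulis_prod[OF fin(1), of "\<lambda>q \<tau>. t (A q) (P q) \<tau> (Q q) * t (A q) (Q\<^sub>0 q) \<tau> (P\<^sub>0 q)" for A])
    also have "\<dots> = (\<Prod>q\<in>S. \<Sum>\<sigma>\<in>UNIV. \<Sum>\<tau>\<in>UNIV. t \<sigma> (P q) \<tau> (Q q) * t \<sigma> (Q\<^sub>0 q) \<tau> (P\<^sub>0 q))"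
      by (rule sum_paulis_prod[OF fin(1), of "\<lambda>q \<sigma>. \<Sum>\<tau>\<in>UNIV. t \<sigma> (P q) \<tau> (Q q) * t \<sigma> (Q\<^sub>0 q) \<tau> (P\<^sub>0 q)"])
    also have "\<dots> = (\<Prod>q\<in>S. if P q = P\<^sub>0 q \<and> Q q = Q\<^sub>0 q then 16 else 0)"
      unfolding t_def local_pauli_inversion by simp
    also have "\<dots> = (if \<forall>q\<in>S. P q = P\<^sub>0 q \<and> Q q = Q\<^sub>0 q then 16 ^ card S else 0)" by (rule prod_delta[OF fin(1)])
    finally show ?thesis .
  qed
  have \<Phi>: "mtrace (pauli_op n A * \<Phi> (pauli_op n B)) =
     (\<Sum>(P, Q)\<in>?U. chi (P, Q) * mtrace (pauli_op n A * (pauli_op n P * pauli_op n B * pauli_op n Q)))" for A B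
  proof -
    have "\<Phi> (pauli_op n B) = op_sum n (\<lambda>u. chi u \<cdot>\<^sub>m (pauli_op n (fst u) * pauli_op n B * pauli_op n (snd u))) ?U"
      using chi by (simp add: chi_expansion_def case_prod_unfold)
    then show ?thesis by (simp add: mtrace_mult_op_sum case_prod_unfold)
  qed
  have "(\<Sum>A\<in>paulis_on S. \<Sum>B\<in>paulis_on S. mtrace (pauli_op n A * \<Phi> (pauli_op n B)) * local_trace S A Q\<^sub>0 B P\<^sub>0) =
    (\<Sum>A\<in>paulis_on S. \<Sum>B\<in>paulis_on S. \<Sum>(P, Q)\<in>?U. chi (P, Q) * (if \<forall>q\<in>E. P q = Q q then 2 ^ card E else 0) *
      ((\<Prod>q\<in>S. t (A q) (P q) (B q) (Q q)) * (\<Prod>q\<in>S. t (A q) (Q\<^sub>0 q) (B q) (P\<^sub>0 q))))"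
  proof (intro sum.cong refl)
    fix A B assume AB: "A \<in> paulis_on S" "B \<in> paulis_on S"
    have lt: "local_trace S A Q\<^sub>0 B P\<^sub>0 = (\<Prod>q\<in>S. t (A q) (Q\<^sub>0 q) (B q) (P\<^sub>0 q))"
      by (simp add: local_trace_def t_def)
    show "mtrace (pauli_op n A * \<Phi> (pauli_op n B)) * local_trace S A Q\<^sub>0 B P\<^sub>0 =
      (\<Sum>(P, Q)\<in>?U. chi (P, Q) * (if \<forall>q\<in>E. P q = Q q then 2 ^ card E else 0) *
      ((\<Prod>q\<in>S. t (A q) (P q) (B q) (Q q)) * (\<Prod>q\<in>S. t (A q) (Q\<^sub>0 q) (B q) (P\<^sub>0 q))))"
      unfolding \<Phi> lt sum_distrib_right
      by (intro sum.cong refl) (simp add: tr[OF AB] case_prod_unfold mult_ac)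
  qed
  also have "\<dots> = (\<Sum>(P, Q)\<in>?U. chi (P, Q) * (if \<forall>q\<in>E. P q = Q q then 2 ^ card E else 0) *
      (\<Sum>A\<in>paulis_on S. \<Sum>B\<in>paulis_on S. (\<Prod>q\<in>S. t (A q) (P q) (B q) (Q q)) * (\<Prod>q\<in>S. t (A q) (Q\<^sub>0 q) (B q) (P\<^sub>0 q))))"
  proof -
    have "(\<Sum>B\<in>X. \<Sum>C\<in>Y. \<Sum>x\<in>Z. f B C x) = (\<Sum>x\<in>Z. \<Sum>B\<in>X. \<Sum>C\<in>Y. f B C x)"
      for X Y and Z :: "(pstring \<times> pstring) set" and f :: "pstring \<Rightarrow> pstring \<Rightarrow> _ \<Rightarrow> complex"
      by (subst (2) sum.swap) (subst sum.swap, rule refl)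
    then show ?thesis by (simp add: case_prod_unfold sum_distrib_left)
  qed
  also have "\<dots> = (\<Sum>u\<in>?U. if good u then chi u * (2 ^ card E * 16 ^ card S) else 0)"
    unfolding inner by (intro sum.cong refl) (auto simp: good_def split: if_splits)
  also have "\<dots> = (\<Sum>u\<in>{u\<in>?U. good u}. chi u * (2 ^ card E * 16 ^ card S))"
    by (subst sum.inter_filter) simp_all
  also have "\<dots> = (\<Sum>R\<in>paulis_on E. chi (tensor_string S P\<^sub>0 R, tensor_string S Q\<^sub>0 R)) * (2 ^ card E * 16 ^ card S)"
    unfolding sum_distrib_right
  proof (rule sum.reindex_bij_witness[of _ "\<lambda>R. (tensor_string S P\<^sub>0 R, tensor_string S Q\<^sub>0 R)" "\<lambda>u. restrict_string E (fst u)"])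
    fix u assume u: "u \<in> {u \<in> ?U. good u}"
    then show "(tensor_string S P\<^sub>0 (restrict_string E (fst u)), tensor_string S Q\<^sub>0 (restrict_string E (fst u))) = u"
      using P0 Q0 by (cases u) (auto simp: tensor_string_def restrict_string_def good_def E_def fun_eq_iff
        intro: supp_outside[symmetric])
    then show "chi (tensor_string S P\<^sub>0 (restrict_string E (fst u)), tensor_string S Q\<^sub>0 (restrict_string E (fst u))) *
       (2 ^ card E * 16 ^ card S) = chi u * (2 ^ card E * 16 ^ card S)" by simp
    show "restrict_string E (fst u) \<in> paulis_on E"
      by (auto simp: restrict_string_def paulis_on_def supp_def)
  next
    fix R assume R: "R \<in> paulis_on E"
    then show "restrict_string E (fst (tensor_string S P\<^sub>0 R, tensor_string S Q\<^sub>0 R)) = R"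
      by (auto simp: tensor_string_def restrict_string_def E_def fun_eq_iff intro: supp_outside[symmetric])
    show "(tensor_string S P\<^sub>0 R, tensor_string S Q\<^sub>0 R) \<in> {u \<in> ?U. good u}"
      using R P0 Q0 S
      by (auto simp: tensor_string_def good_def E_def paulis_on_def supp_def subset_iff split: if_splits)
  qed
  finally have eq: "(\<Sum>A\<in>paulis_on S. \<Sum>B\<in>paulis_on S. mtrace (pauli_op n A * \<Phi> (pauli_op n B)) * local_trace S A Q\<^sub>0 B P\<^sub>0) =
    (\<Sum>R\<in>paulis_on E. chi (tensor_string S P\<^sub>0 R, tensor_string S Q\<^sub>0 R)) * (2 ^ card E * 16 ^ card S)" .
  \<comment> \<open>Rewriting the weight as \<open>2 ^ n * 2 ^ (3 * card S)\<close> separates the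
    normalisation of a transfer matrix entry from the prefactor of the inversion formula.\<close>
  have "card E + card S = n" using S fin unfolding E_def by (simp add: card_Diff_subset card_mono[of "{..<n}", simplified])
  then have "(2::complex) ^ card E * 16 ^ card S = 2 ^ n * 2 ^ (3 * card S)"
    by (auto simp: power_add power_mult simp flip: power_mult_distrib)
  then have "(\<Sum>A\<in>paulis_on S. \<Sum>B\<in>paulis_on S. mtrace (pauli_op n A * \<Phi> (pauli_op n B)) * local_trace S A Q\<^sub>0 B P\<^sub>0) =
    (\<Sum>R\<in>paulis_on E. chi (tensor_string S P\<^sub>0 R, tensor_string S Q\<^sub>0 R)) * (2 ^ n * 2 ^ (3 * card S))"
    using eq by simp
  then show ?thesis
    by (simp add: E_def sum_divide_distrib[symmetric] field_simps)
qed

section \<open>The Hilbert--Schmidt norm\<close>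

lemma hs_norm_eq:
  assumes "M \<in> operators n"
  shows "hs_norm M = sqrt (\<Sum>i<2 ^ n. \<Sum>j<2 ^ n. (cmod (M $$ (i, j)))\<^sup>2)"
    and "hs_norm M = L2_set (\<lambda>(i, j). cmod (M $$ (i, j))) ({..<(2::nat) ^ n} \<times> {..<(2::nat) ^ n})"
proof -
  have dim: "dim_row M = 2 ^ n" "dim_col M = 2 ^ n" using assms by auto
  have "mtrace (mat_adjoint M * M) = (\<Sum>i<2 ^ n. \<Sum>j<2 ^ n. mat_adjoint M $$ (i, j) * M $$ (j, i))"
    by (rule mtrace_mult) (use assms in simp_all)
  also have "\<dots> = (\<Sum>i<2 ^ n. \<Sum>j<2 ^ n. of_real ((cmod (M $$ (j, i)))\<^sup>2))"
    using dim by (intro sum.cong refl) (simp add: complex_norm_square[symmetric] mult.commute)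
  also have "\<dots> = of_real (\<Sum>i<2 ^ n. \<Sum>j<2 ^ n. (cmod (M $$ (i, j)))\<^sup>2)"
    by (subst sum.swap) simp
  finally show "hs_norm M = sqrt (\<Sum>i<2 ^ n. \<Sum>j<2 ^ n. (cmod (M $$ (i, j)))\<^sup>2)"
    by (simp add: hs_norm_def)
  then show "hs_norm M = L2_set (\<lambda>(i, j). cmod (M $$ (i, j))) ({..<(2::nat) ^ n} \<times> {..<(2::nat) ^ n})"
    by (simp add: L2_set_def sum.cartesian_product case_prod_unfold)
qed

lemmas hs_norm_eq_L2 = hs_norm_eq(2)

lemma hs_norm_nonneg: "M \<in> operators n \<Longrightarrow> 0 \<le> hs_norm M"
  by (simp add: hs_norm_eq_L2 L2_set_nonneg)

lemma hs_norm_triangle: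
  assumes "A \<in> operators n" "B \<in> operators n"
  shows "hs_norm (A + B) \<le> hs_norm A + hs_norm B"
proof -
  let ?I = "{..<(2::nat) ^ n} \<times> {..<(2::nat) ^ n}"
  have "hs_norm (A + B) = L2_set (\<lambda>(i, j). cmod ((A + B) $$ (i, j))) ?I"
    using assms by (simp add: hs_norm_eq_L2)
  also have "\<dots> \<le> L2_set (\<lambda>u. (case u of (i, j) \<Rightarrow> cmod (A $$ (i, j))) + (case u of (i, j) \<Rightarrow> cmod (B $$ (i, j)))) ?I"
    using assms by (intro L2_set_mono) (auto intro: norm_triangle_ineq)
  also have "\<dots> \<le> hs_norm A + hs_norm B"
    unfolding hs_norm_eq_L2[OF assms(1)] hs_norm_eq_L2[OF assms(2)] by (rule L2_set_triangle_ineq)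
  finally show ?thesis .
qed

lemma hs_norm_smult:
  assumes "A \<in> operators n"
  shows "hs_norm (c \<cdot>\<^sub>m A) = cmod c * hs_norm A"
proof -
  let ?I = "{..<(2::nat) ^ n} \<times> {..<(2::nat) ^ n}"
  have "hs_norm (c \<cdot>\<^sub>m A) = L2_set (\<lambda>u. cmod c * (case u of (i, j) \<Rightarrow> cmod (A $$ (i, j)))) ?I"
    using assms by (subst hs_norm_eq_L2[of _ n]) (auto intro!: L2_set_cong simp: norm_mult)
  also have "\<dots> = cmod c * hs_norm A"
    unfolding hs_norm_eq_L2[OF assms] by (simp add: L2_set_right_distrib)
  finally show ?thesis .
qed

lemma hs_norm_adjoint:
  assumes "A \<in> operators n"
  shows "hs_norm (mat_adjoint A) = hs_norm A"
proof -
  have dim: "dim_row A = 2 ^ n" "dim_col A = 2 ^ n" using assms by auto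
  have "(\<Sum>i<(2::nat) ^ n. \<Sum>j<(2::nat) ^ n. (cmod (A $$ (j, i)))\<^sup>2) = (\<Sum>i<(2::nat) ^ n. \<Sum>j<(2::nat) ^ n. (cmod (A $$ (i, j)))\<^sup>2)"
    by (rule sum.swap)
  then show ?thesis
    using assms dim by (simp add: hs_norm_eq(1)[of _ n])
qed

lemma mtrace_cauchy_schwarz:
  assumes "A \<in> operators n" "B \<in> operators n"
  shows "cmod (mtrace (A * B)) \<le> hs_norm A * hs_norm B"
proof -
  let ?I = "{..<(2::nat) ^ n} \<times> {..<(2::nat) ^ n}"
  let ?f = "\<lambda>(i, j). cmod (mat_adjoint A $$ (i, j))" and ?g = "\<lambda>(i, j). cmod (B $$ (i, j))"
  have dim: "dim_row A = 2 ^ n" "dim_col A = 2 ^ n" using assms by auto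
  have "mtrace (A * B) = (\<Sum>(i, j)\<in>?I. A $$ (j, i) * B $$ (i, j))"
    unfolding mtrace_mult[OF assms] by (subst sum.swap) (simp add: sum.cartesian_product)
  also have "cmod \<dots> \<le> (\<Sum>u\<in>?I. \<bar>?f u\<bar> * \<bar>?g u\<bar>)"
    using dim by (intro order_trans[OF norm_sum] sum_mono) (auto simp: norm_mult)
  also have "\<dots> \<le> L2_set ?f ?I * L2_set ?g ?I" by (rule L2_set_mult_ineq)
  also have "\<dots> = hs_norm A * hs_norm B"
    using assms hs_norm_adjoint[OF assms(1)] by (simp add: hs_norm_eq_L2[of _ n])
  finally show ?thesis .
qed

lemma hs_norm_op_sum:
  assumes "\<And>x. x \<in> A \<Longrightarrow> f x \<in> operators n" "finite A"
  shows "hs_norm (op_sum n f A) \<le> (\<Sum>x\<in>A. hs_norm (f x))"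
  using assms(2,1)
proof (induction rule: finite_induct)
  case empty
  then show ?case by (simp add: hs_norm_eq(1)[of _ n] op_sum_index)
next
  case (insert x A)
  have "op_sum n f (insert x A) = f x + op_sum n f A"
    using insert by (intro ops_eqI[of _ n]) (auto simp: op_sum_index)
  then show ?case using hs_norm_triangle[of "f x" n "op_sum n f A"] insert by force
qed

lemma hs_norm_pauli_op: "P \<in> paulis n \<Longrightarrow> hs_norm (pauli_op n P) = sqrt (2 ^ n)"
  by (simp add: hs_norm_def mtrace_pauli_op_mult)

lemma matrix_unit_carrier [simp]: "matrix_unit n i j \<in> operators n"
  by (simp add: matrix_unit_def)

lemma mtrace_mult_matrix_unit:
  assumes "A \<in> operators n" "i < 2 ^ n" "j < 2 ^ n"
  shows "mtrace (A * matrix_unit n i j) = A $$ (j, i)"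
proof -
  have "mtrace (A * matrix_unit n i j) = (\<Sum>a<2 ^ n. \<Sum>b<2 ^ n. if b = i then if a = j then A $$ (j, i) else 0 else 0)"
    unfolding mtrace_mult[OF assms(1) matrix_unit_carrier]
    by (intro sum.cong refl) (auto simp: matrix_unit_def)
  then show ?thesis using assms by simp
qed

lemma superop_adjoint_carrier [simp]: "superop_adjoint n \<Phi> X \<in> operators n"
  by (simp add: superop_adjoint_def)

text \<open>\<open>superop_norm\<close> is a supremum of reals and bounds nothing before its set is
  known to be bounded. Cauchy--Schwarz in each entry supplies the bound \<open>K\<close>, the
  Hilbert--Schmidt norm of \<Phi> over the matrix units; the sharp inequality then follows by
  normalising \<open>X\<close>.\<close>

lemma hs_norm_superop_adjoint:
  assumes \<Phi>: "\<And>M. M \<in> operators n \<Longrightarrow> \<Phi> M \<in> operators n" and X: "X \<in> operators n"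
  shows "hs_norm (superop_adjoint n \<Phi> X) \<le> superop_norm n (superop_adjoint n \<Phi>) * hs_norm X"
    and "0 \<le> superop_norm n (superop_adjoint n \<Phi>)"
proof -
  let ?I = "{..<(2::nat) ^ n} \<times> {..<(2::nat) ^ n}" and ?U = "{M \<in> operators n. hs_norm M \<le> 1}"
  let ?ad = "superop_adjoint n \<Phi>"
  define K where "K = L2_set (\<lambda>(i, j). hs_norm (\<Phi> (matrix_unit n i j))) ?I"
  have bound: "hs_norm (?ad Y) \<le> K * hs_norm Y" if Y: "Y \<in> operators n" for Y
  proof -
    have "hs_norm (?ad Y) = L2_set (\<lambda>(i, j). cmod (?ad Y $$ (i, j))) ?I" by (simp add: hs_norm_eq_L2[of _ n])
    also have "\<dots> \<le> L2_set (\<lambda>u. (case u of (i, j) \<Rightarrow> hs_norm (\<Phi> (matrix_unit n i j))) * hs_norm Y) ?I"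
    proof (rule L2_set_mono)
      fix u assume u: "u \<in> ?I"
      obtain i j where ij: "u = (i, j)" by (cases u)
      have "cmod (mtrace (mat_adjoint (\<Phi> (matrix_unit n i j)) * Y)) \<le>
        hs_norm (mat_adjoint (\<Phi> (matrix_unit n i j))) * hs_norm Y"
        by (rule mtrace_cauchy_schwarz) (use \<Phi> Y in simp_all)
      then show "(case u of (i, j) \<Rightarrow> cmod (?ad Y $$ (i, j))) \<le>
        (case u of (i, j) \<Rightarrow> hs_norm (\<Phi> (matrix_unit n i j))) * hs_norm Y"
        using u ij hs_norm_adjoint[OF \<Phi>, of "matrix_unit n i j"] by (simp add: superop_adjoint_def)
    qed (auto split: prod.splits)
    also have "\<dots> = K * hs_norm Y"
      using hs_norm_nonneg[OF Y] by (simp add: K_def L2_set_left_distrib)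
    finally show ?thesis .
  qed
  have K0: "0 \<le> K" by (simp add: K_def L2_set_nonneg)
  have bdd: "bdd_above ((\<lambda>M. hs_norm (?ad M)) ` ?U)"
  proof (rule bdd_aboveI2)
    fix M assume "M \<in> ?U"
    then show "hs_norm (?ad M) \<le> K"
      using bound[of M] mult_left_mono[OF _ K0, of "hs_norm M" 1] by simp
  qed
  have zero: "0\<^sub>m (2 ^ n) (2 ^ n) \<in> ?U" by (simp add: hs_norm_eq(1)[of _ n])
  have "0 \<le> hs_norm (?ad (0\<^sub>m (2 ^ n) (2 ^ n)))" by (rule hs_norm_nonneg[of _ n]) simp
  also have "\<dots> \<le> superop_norm n ?ad" unfolding superop_norm_def by (rule cSUP_upper[OF zero bdd])
  finally show "0 \<le> superop_norm n ?ad" .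
  show "hs_norm (?ad X) \<le> superop_norm n ?ad * hs_norm X"
  proof (cases "hs_norm X = 0")
    case True
    then show ?thesis using bound[OF X] by simp
  next
    case False
    then have pos: "hs_norm X > 0" using hs_norm_nonneg[OF X] by simp
    define Y where "Y = complex_of_real (1 / hs_norm X) \<cdot>\<^sub>m X"
    have Y: "Y \<in> operators n" using X by (simp add: Y_def)
    have "hs_norm Y = 1" unfolding Y_def hs_norm_smult[OF X] using pos by (simp add: norm_divide)
    then have "hs_norm (?ad Y) \<le> superop_norm n ?ad"
      unfolding superop_norm_def using Y by (intro cSUP_upper[OF _ bdd]) simp
    moreover have "?ad Y = complex_of_real (1 / hs_norm X) \<cdot>\<^sub>m ?ad X"
      using X \<Phi> by (intro ops_eqI[of _ n]) (simp_all add: superop_adjoint_def Y_def ops_distrib[where n = n] mtrace_linear[where n = n])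
    then have "hs_norm (?ad Y) = cmod (complex_of_real (1 / hs_norm X)) * hs_norm (?ad X)"
      by (simp only: hs_norm_smult[OF superop_adjoint_carrier])
    then have "hs_norm (?ad Y) = hs_norm (?ad X) / hs_norm X" using pos by (simp add: norm_divide)
    ultimately show ?thesis using pos by (simp add: divide_le_eq)
  qed
qed

section \<open>Local terms in the Heisenberg picture\<close>

lemma dissipator_carrier [simp]: "L \<in> operators n \<Longrightarrow> M \<in> operators n \<Longrightarrow> dissipator L M \<in> operators n"
  by (simp add: dissipator_def)

context
  fixes n k :: nat and g :: lindblad_data
  assumes g: "k_local_lindblad n k g"
begin

abbreviation (input) "ham_of \<equiv> \<lambda>e. hamiltonian n (ham_coeff g) {P. supp P = e}"
abbreviation (input) "Lind \<equiv> lindbladian n k g"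
abbreviation (input) "jump \<equiv> \<lambda>e a. jumps g e ! a"

section \<open>Locality of the terms and of the coefficients\<close>

lemma edges_finite: "finite (edges n k)"
  by (rule finite_subset[of _ "Pow {..<n}"]) (auto simp: edges_def)

lemma edge_subset: "e \<in> edges n k \<Longrightarrow> e \<subseteq> {..<n}"
  by (simp add: edges_def)

lemma edge_paulis:
  assumes "e \<in> edges n k"
  shows "{P. supp P = e} \<subseteq> paulis n" "{P. supp P = e} \<subseteq> paulis_on e"
  using edge_subset[OF assms] by (auto simp: paulis_on_def)

lemma ham_of_local: "e \<in> edges n k \<Longrightarrow> local_op n e (ham_of e)"
  unfolding hamiltonian_def by (intro local_op_pauli_sum edge_paulis)

lemma jump_local: "e \<in> edges n k \<Longrightarrow> a < length (jumps g e) \<Longrightarrow> local_op n e (jump e a)"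
  using g edge_subset supported_on_iff_local_op by (auto simp: k_local_lindblad_def)

lemma jump_carrier: "e \<in> edges n k \<Longrightarrow> a < length (jumps g e) \<Longrightarrow> jump e a \<in> operators n"
  using jump_local by (simp add: local_op_def)

lemma local_term_carrier [simp]:
  "e \<in> edges n k \<Longrightarrow> M \<in> operators n \<Longrightarrow> local_term n g e M \<in> operators n"
  by (simp add: local_term_def)

lemma Lind_carrier [simp]: "Lind M \<in> operators n"
  by (simp add: lindbladian_def)

text \<open>A term on \<open>e\<close> is a sum of maps \<open>M \<mapsto> X M Y\<close> with
  \<open>X\<close> and \<open>Y\<close> local on \<open>e\<close>, and its coefficient is a product
  of Pauli coefficients of \<open>X\<close> and \<open>Y\<close>. Since \<open>e\<close> has at most
  \<open>k\<close> qubits, \<open>P\<close> or \<open>Q\<close> leaves \<open>e\<close>. Thus the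
  threshold support misses no large coefficient although it contains only local pairs.\<close>

lemma chi_of_nonlocal:
  assumes PQ: "P \<in> paulis n" "Q \<in> paulis n" and "k < card (supp P \<union> supp Q)"
  shows "chi_of n Lind P Q = 0"
proof -
  have "chi_of n (local_term n g e) P Q = 0" if e: "e \<in> edges n k" for e
  proof -
    have "\<not> (supp P \<union> supp Q \<subseteq> e)"
    proof
      assume "supp P \<union> supp Q \<subseteq> e"
      then have "card (supp P \<union> supp Q) \<le> card e"
        using e finite_subset[of e "{..<n}"] by (intro card_mono) (auto simp: edges_def)
      then show False using assms e by (simp add: edges_def)
    qed
    then consider "\<not> supp P \<subseteq> e" | "\<not> supp Q \<subseteq> e" by auto
    then have 0: "mtrace (pauli_op n P * X) * mtrace (pauli_op n Q * Y) = 0"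
      if "local_op n e X" "local_op n e Y" for X Y
      using that PQ by cases (auto simp: local_op_def)
    \<comment> \<open>One-sided multiplications are sandwiches with the identity, which is local on
      every \<open>e\<close>; so \<open>0\<close> applies to them too.\<close>
    have one: "mtrace (pauli_op n R) = mtrace (pauli_op n R * 1\<^sub>m (2 ^ n))" for R by simp
    have com: "chi_of n (commutator X) P Q = 0" "chi_of n (anticommutator X) P Q = 0" if "local_op n e X" for X
      unfolding chi_of_commutator[OF local_op_carrier[OF that]] chi_of_anticommutator[OF local_op_carrier[OF that]]
        one[of P] one[of Q] 0[OF that local_op_one] 0[OF local_op_one that] by simp_all
    have diss: "chi_of n (dissipator (jump e a)) P Q = 0" if a: "a < length (jumps g e)" for a
    proof -
      note J = jump_local[OF e a] jump_carrier[OF e a]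
      have "local_op n e (mat_adjoint (jump e a) * jump e a)"
        by (intro local_op_mult local_op_adjoint J edge_subset[OF e])
      then have "chi_of n (anticommutator (mat_adjoint (jump e a) * jump e a)) P Q = 0" by (rule com)
      moreover have "chi_of n (\<lambda>M. jump e a * M * mat_adjoint (jump e a)) P Q = 0"
        using J 0[OF J(1) local_op_adjoint[OF J(1)]] by (simp add: chi_of_sandwich)
      ultimately show ?thesis
        unfolding dissipator_def using J by (subst chi_of_linear(2); simp add: chi_of_linear(3))
    qed
    have "chi_of n (local_term n g e) P Q = - \<i> * chi_of n (commutator (ham_of e)) P Q +
      (\<Sum>a<length (jumps g e). chi_of n (dissipator (jump e a)) P Q)"
    proof -
      have "chi_of n (\<lambda>M. op_sum n (\<lambda>a. dissipator (jump e a) M) {..<length (jumps g e)}) P Q =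
        (\<Sum>a<length (jumps g e). chi_of n (dissipator (jump e a)) P Q)"
        by (rule chi_of_op_sum) (use jump_carrier[OF e] in simp)
      then show ?thesis unfolding local_term_def
        by (subst chi_of_linear(1); simp add: chi_of_linear(3))
    qed
    then show ?thesis using com(1)[OF ham_of_local[OF e]] diss by simp
  qed
  then show ?thesis
    unfolding lindbladian_def by (subst chi_of_op_sum) simp_all
qed

definition heis_diss :: "complex mat \<Rightarrow> complex mat \<Rightarrow> complex mat" where
  "heis_diss L Z = mat_adjoint L * Z * L - (1 / 2) \<cdot>\<^sub>m anticommutator (mat_adjoint L * L) Z"

text \<open>The dual of \<open>local_term\<close> for the bilinear pairing \<open>Tr(Z Y)\<close>,
  not for the Hilbert--Schmidt inner product; hence the missing conjugation compared with
  \<open>superop_adjoint\<close>.\<close>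

definition heis :: "nat set \<Rightarrow> complex mat \<Rightarrow> complex mat" where
  "heis e Z = \<i> \<cdot>\<^sub>m commutator (ham_of e) Z + op_sum n (\<lambda>a. heis_diss (jump e a) Z) {..<length (jumps g e)}"

lemma heis_diss_carrier [simp]: "L \<in> operators n \<Longrightarrow> Z \<in> operators n \<Longrightarrow> heis_diss L Z \<in> operators n"
  by (simp add: heis_diss_def)

lemma heis_carrier [simp]: "e \<in> edges n k \<Longrightarrow> Z \<in> operators n \<Longrightarrow> heis e Z \<in> operators n"
  by (simp add: heis_def)

lemma mtrace_cyclic3:
  assumes "A \<in> operators n" "B \<in> operators n" "C \<in> operators n"
  shows "mtrace (A * (B * C)) = mtrace (C * A * B)"
  using mtrace_comm[of "A * B" "2 ^ n" C] assms by (simp add: ops_assoc[where n = n])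

lemma mtrace_heis_diss:
  assumes "L \<in> operators n" "Z \<in> operators n" "Y \<in> operators n"
  shows "mtrace (Z * dissipator L Y) = mtrace (heis_diss L Z * Y)"
proof -
  have L: "mat_adjoint L * L \<in> operators n" using assms by simp
  have 1: "mtrace (Z * (L * Y * mat_adjoint L)) = mtrace (mat_adjoint L * Z * L * Y)"
    using mtrace_comm[of "Z * L * Y" "2 ^ n" "mat_adjoint L"] assms by (simp add: ops_assoc[where n = n])
  have 2: "mtrace (Z * (Y * (mat_adjoint L * L))) = mtrace (mat_adjoint L * L * Z * Y)"
    by (rule mtrace_cyclic3) (use assms in simp_all)
  show ?thesis
    unfolding dissipator_def heis_diss_def anticommutator_def using assms 1 2
    by (simp add: ops_distrib[where n = n] mtrace_linear[where n = n] ops_assoc[where n = n])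
qed

lemma mtrace_heis:
  assumes e: "e \<in> edges n k" and "Z \<in> operators n" "Y \<in> operators n"
  shows "mtrace (Z * local_term n g e Y) = mtrace (heis e Z * Y)"
proof -
  let ?H = "ham_of e"
  have H: "?H \<in> operators n" by simp
  have "mtrace (Z * ((- \<i>) \<cdot>\<^sub>m commutator ?H Y)) = mtrace (\<i> \<cdot>\<^sub>m commutator ?H Z * Y)"
    unfolding commutator_def using assms mtrace_cyclic3[of Z Y ?H]
    by (simp add: ops_distrib[where n = n] mtrace_linear[where n = n] ops_assoc[where n = n] algebra_simps)
  moreover have "mtrace (Z * op_sum n (\<lambda>a. dissipator (jump e a) Y) {..<length (jumps g e)}) =
     mtrace (op_sum n (\<lambda>a. heis_diss (jump e a) Z) {..<length (jumps g e)} * Y)"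
  proof -
    let ?A = "{..<length (jumps g e)}"
    have J: "jump e a \<in> operators n" if "a \<in> ?A" for a using jump_carrier[OF e] that by simp
    have "mtrace (Z * op_sum n (\<lambda>a. dissipator (jump e a) Y) ?A) = (\<Sum>a\<in>?A. mtrace (Z * dissipator (jump e a) Y))"
      using assms J by (subst mult_op_sum; simp?) (subst mtrace_op_sum[where n = n]; simp)
    also have "\<dots> = (\<Sum>a\<in>?A. mtrace (heis_diss (jump e a) Z * Y))"
      using assms J by (intro sum.cong refl mtrace_heis_diss)
    also have "\<dots> = mtrace (op_sum n (\<lambda>a. heis_diss (jump e a) Z) ?A * Y)"
      using assms J by (subst op_sum_mult; simp?) (subst mtrace_op_sum[where n = n]; simp)
    finally show ?thesis .
  qed
  ultimately show ?thesis
    unfolding local_term_def heis_def using assms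
    by (simp add: ops_distrib[where n = n] mtrace_linear[where n = n])
qed

text \<open>The two dualities differ only by matrix adjoints, which preserve the Hilbert--Schmidt
  norm. So the norms that enter the interaction strength also control \<open>heis\<close>.\<close>

lemma superop_adjoint_local_term:
  assumes e: "e \<in> edges n k" and X: "X \<in> operators n"
  shows "superop_adjoint n (local_term n g e) X = mat_adjoint (heis e (mat_adjoint X))"
proof (rule ops_eqI[of _ n])
  fix i j :: nat assume ij: "i < 2 ^ n" "j < 2 ^ n"
  let ?F = "local_term n g e (matrix_unit n i j)"
  have F: "?F \<in> operators n" using e by simp
  have "mtrace (mat_adjoint ?F * X) = mtrace (mat_adjoint (mat_adjoint X * ?F))"
    using X F by (simp add: mat_adjoint_mult[where n = n] mat_adjoint_linear[where n = n])
  also have "\<dots> = cnj (mtrace (mat_adjoint X * ?F))"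
    by (rule mtrace_adjoint[of _ n]) (use X F in simp)
  also have "mtrace (mat_adjoint X * ?F) = heis e (mat_adjoint X) $$ (j, i)"
    using X e ij by (simp add: mtrace_heis mtrace_mult_matrix_unit)
  also have "cnj \<dots> = mat_adjoint (heis e (mat_adjoint X)) $$ (i, j)"
  proof -
    have "heis e (mat_adjoint X) \<in> operators n" using e X by simp
    then show ?thesis using ij by (subst mat_adjoint_index) auto
  qed
  finally show "superop_adjoint n (local_term n g e) X $$ (i, j) = mat_adjoint (heis e (mat_adjoint X)) $$ (i, j)"
    using ij by (simp add: superop_adjoint_def)
qed (use e X in simp_all)

abbreviation (input) "edge_norm \<equiv> \<lambda>e. superop_norm n (superop_adjoint n (local_term n g e))"

lemma hs_norm_heis:
  assumes e: "e \<in> edges n k" and Z: "Z \<in> operators n"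
  shows "hs_norm (heis e Z) \<le> edge_norm e * hs_norm Z" "0 \<le> edge_norm e"
proof -
  have "hs_norm (superop_adjoint n (local_term n g e) (mat_adjoint Z)) \<le> edge_norm e * hs_norm (mat_adjoint Z)"
    by (rule hs_norm_superop_adjoint) (use e Z in simp_all)
  then show "hs_norm (heis e Z) \<le> edge_norm e * hs_norm Z"
    using e Z by (simp add: superop_adjoint_local_term mat_adjoint_linear[where n = n] hs_norm_adjoint[of _ n])
  show "0 \<le> edge_norm e"
    by (rule hs_norm_superop_adjoint(2)[of n _ Z]) (use e Z in simp_all)
qed

lemma heis_local:
  assumes e: "e \<in> edges n k" and Z: "local_op n S Z" and S: "S \<subseteq> {..<n}"
  shows "local_op n (S \<union> e) (heis e Z)"
proof -
  have T: "S \<union> e \<subseteq> {..<n}" using S edge_subset[OF e] by simp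
  have Z': "local_op n (S \<union> e) Z" using Z by (rule local_op_mono) simp
  have H: "local_op n (S \<union> e) (ham_of e)" using ham_of_local[OF e] by (rule local_op_mono) simp
  have "local_op n (S \<union> e) (heis_diss (jump e a) Z)" if "a < length (jumps g e)" for a
  proof -
    have J: "local_op n (S \<union> e) (jump e a)" using jump_local[OF e that] by (rule local_op_mono) simp
    show ?thesis unfolding heis_diss_def anticommutator_def
      by (intro local_op_linear local_op_mult local_op_adjoint J Z' T)
  qed
  then show ?thesis
    unfolding heis_def commutator_def
    by (intro local_op_linear local_op_mult local_op_op_sum H Z' T) auto
qed

text \<open>\<open>Z\<close> commutes with the Hamiltonian part and with all jumps, so the jump term
  \<open>mat_adjoint L * Z * L\<close> equals \<open>mat_adjoint L * L * Z\<close> and is cancelled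
  by the anticommutator. In the Schroedinger picture the commutator of \<open>L\<close> with its
  adjoint, times \<open>Z\<close>, would remain; this is why supports are followed in the Heisenberg
  picture.\<close>

lemma heis_disjoint:
  assumes e: "e \<in> edges n k" and Z: "local_op n S Z" and S: "S \<subseteq> {..<n}" and "e \<inter> S = {}"
  shows "heis e Z = 0\<^sub>m (2 ^ n) (2 ^ n)"
proof -
  have com: "X * Z = Z * X" if "local_op n e X" for X
    using that edge_subset[OF e] Z S assms(4) by (rule local_op_commute)
  have Zc: "Z \<in> operators n" using Z by (rule local_op_carrier)
  have H: "commutator (ham_of e) Z = 0\<^sub>m (2 ^ n) (2 ^ n)"
    using com[OF ham_of_local[OF e]] Zc by (simp add: commutator_def minus_r_inv_mat[of _ "2 ^ n" "2 ^ n"])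
  have D: "heis_diss (jump e a) Z = 0\<^sub>m (2 ^ n) (2 ^ n)" if a: "a < length (jumps g e)" for a
  proof -
    let ?L = "jump e a"
    have L: "local_op n e ?L" using e a by (rule jump_local)
    then have Lc: "?L \<in> operators n" by (rule local_op_carrier)
    have LL: "local_op n e (mat_adjoint ?L * ?L)"
      by (intro local_op_mult local_op_adjoint L edge_subset e)
    have "mat_adjoint ?L * Z * ?L = mat_adjoint ?L * ?L * Z"
      using com[OF L] Lc Zc by (simp add: ops_assoc[where n = n])
    moreover have "Z * (mat_adjoint ?L * ?L) = mat_adjoint ?L * ?L * Z" using com[OF LL] by simp
    ultimately have eq: "mat_adjoint ?L * Z * ?L = mat_adjoint ?L * ?L * Z"
      "Z * (mat_adjoint ?L * ?L) = mat_adjoint ?L * ?L * Z" by auto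
    show ?thesis
    proof -
      have "C - (1 / 2) \<cdot>\<^sub>m (C + C) = 0\<^sub>m (2 ^ n) (2 ^ n)" if "C \<in> operators n" for C :: "complex mat"
        using that by (intro ops_eqI[of _ n]) auto
      from this[of "mat_adjoint ?L * ?L * Z"] show ?thesis
        using Lc Zc eq by (simp add: heis_diss_def anticommutator_def)
    qed
  qed
  show ?thesis
    unfolding heis_def H
    by (intro ops_eqI[of _ n]) (simp_all add: op_sum_index D)
qed

lemma smult_add_op_sum:
  assumes "M \<in> operators n" "\<And>x. x \<in> A \<Longrightarrow> f x \<in> operators n"
  shows "commutator M (op_sum n f A) = op_sum n (\<lambda>x. commutator M (f x)) A"
    "anticommutator M (op_sum n f A) = op_sum n (\<lambda>x. anticommutator M (f x)) A"
proof -
  have c: "M * f x \<in> operators n" "f x * M \<in> operators n" if "x \<in> A" for x using assms that by auto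
  have d: "dim_row (M * f x) = 2 ^ n" "dim_col (M * f x) = 2 ^ n" "dim_row (f x * M) = 2 ^ n" "dim_col (f x * M) = 2 ^ n"
    if "x \<in> A" for x using c[OF that] by auto
  show "commutator M (op_sum n f A) = op_sum n (\<lambda>x. commutator M (f x)) A"
    unfolding commutator_def using assms d
    by (intro ops_eqI[of _ n]) (simp_all add: mult_op_sum op_sum_mult op_sum_index sum_subtractf del: index_mult_mat)
  show "anticommutator M (op_sum n f A) = op_sum n (\<lambda>x. anticommutator M (f x)) A"
    unfolding anticommutator_def using assms d
    by (intro ops_eqI[of _ n]) (simp_all add: mult_op_sum op_sum_mult op_sum_index sum.distrib del: index_mult_mat)
qed

lemma heis_op_sum:
  assumes e: "e \<in> edges n k" and f: "\<And>x. x \<in> A \<Longrightarrow> f x \<in> operators n"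
  shows "heis e (op_sum n f A) = op_sum n (\<lambda>x. heis e (f x)) A"
proof (rule ops_eqI[of _ n])
  fix i j :: nat assume ij: "i < 2 ^ n" "j < 2 ^ n"
  have d: "dim_row X = 2 ^ n" "dim_col X = 2 ^ n" if "X \<in> operators n" for X :: "complex mat" using that by auto
  have D: "heis_diss L (op_sum n f A) $$ (i, j) = (\<Sum>x\<in>A. heis_diss L (f x) $$ (i, j))" if L: "L \<in> operators n" for L
  proof -
    have "mat_adjoint L * op_sum n f A * L = op_sum n (\<lambda>x. mat_adjoint L * f x * L) A"
      using L f by (simp add: mult_op_sum op_sum_mult)
    moreover have "heis_diss L (f x) $$ (i, j) = (mat_adjoint L * f x * L) $$ (i, j) - 1 / 2 * anticommutator (mat_adjoint L * L) (f x) $$ (i, j)"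
      if "x \<in> A" for x
      unfolding heis_diss_def using L f[OF that] ij d[of "anticommutator (mat_adjoint L * L) (f x)"]
      by (subst index_minus_mat) (simp_all del: index_mult_mat)
    ultimately show ?thesis
      using L f ij by (simp add: heis_diss_def smult_add_op_sum op_sum_index sum_subtractf sum_divide_distrib del: index_mult_mat)
  qed
  have J: "jump e a \<in> operators n" if "a < length (jumps g e)" for a using e that by (rule jump_carrier)
  have "heis e (op_sum n f A) $$ (i, j) = \<i> * (\<Sum>x\<in>A. commutator (ham_of e) (f x) $$ (i, j)) +
    (\<Sum>a<length (jumps g e). \<Sum>x\<in>A. heis_diss (jump e a) (f x) $$ (i, j))"
    unfolding heis_def using f ij by (simp add: smult_add_op_sum op_sum_index D J)
  also have "\<dots> = (\<Sum>x\<in>A. \<i> * commutator (ham_of e) (f x) $$ (i, j) + (\<Sum>a<length (jumps g e). heis_diss (jump e a) (f x) $$ (i, j)))"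
    by (subst sum.swap) (simp add: sum.distrib sum_distrib_left)
  also have "\<dots> = (\<Sum>x\<in>A. heis e (f x) $$ (i, j))"
  proof (intro sum.cong refl)
    fix x assume "x \<in> A"
    then have "f x \<in> operators n" by (rule f)
    then show "\<i> * commutator (ham_of e) (f x) $$ (i, j) + (\<Sum>a<length (jumps g e). heis_diss (jump e a) (f x) $$ (i, j)) =
      heis e (f x) $$ (i, j)"
      using ij d[of "commutator (ham_of e) (f x)"] by (simp add: heis_def op_sum_index)
  qed
  finally show "heis e (op_sum n f A) $$ (i, j) = op_sum n (\<lambda>x. heis e (f x)) A $$ (i, j)"
    using ij by (simp add: op_sum_index)
qed (use e in simp_all)

section \<open>Powers of the generator\<close>

definition heis_all :: "complex mat \<Rightarrow> complex mat" where
  "heis_all Z = op_sum n (\<lambda>e. heis e Z) (edges n k)"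

lemma heis_all_carrier [simp]: "heis_all Z \<in> operators n"
  by (simp add: heis_all_def)

lemma heis_pow_carrier [simp]: "Z \<in> operators n \<Longrightarrow> (heis_all ^^ m) Z \<in> operators n"
  by (induction m) simp_all

lemma Lind_pow_carrier [simp]: "M \<in> operators n \<Longrightarrow> (Lind ^^ m) M \<in> operators n"
  by (induction m) simp_all

lemma heis_all_op_sum:
  assumes "\<And>x. x \<in> A \<Longrightarrow> f x \<in> operators n"
  shows "heis_all (op_sum n f A) = op_sum n (\<lambda>x. heis_all (f x)) A"
proof (rule ops_eqI[of _ n])
  fix i j :: nat assume ij: "i < 2 ^ n" "j < 2 ^ n"
  have "heis_all (op_sum n f A) $$ (i, j) = (\<Sum>e\<in>edges n k. \<Sum>x\<in>A. heis e (f x) $$ (i, j))"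
    using assms ij by (simp add: heis_all_def op_sum_index heis_op_sum)
  also have "\<dots> = (\<Sum>x\<in>A. \<Sum>e\<in>edges n k. heis e (f x) $$ (i, j))" by (rule sum.swap)
  finally show "heis_all (op_sum n f A) $$ (i, j) = op_sum n (\<lambda>x. heis_all (f x)) A $$ (i, j)"
    using ij by (simp add: heis_all_def op_sum_index)
qed simp_all

lemma heis_pow_op_sum:
  assumes "\<And>x. x \<in> A \<Longrightarrow> f x \<in> operators n"
  shows "(heis_all ^^ m) (op_sum n f A) = op_sum n (\<lambda>x. (heis_all ^^ m) (f x)) A"
proof (induction m)
  case (Suc m)
  then show ?case using assms by (simp add: heis_all_op_sum)
qed simp

lemma mtrace_heis_all:
  assumes "Z \<in> operators n" "Y \<in> operators n"
  shows "mtrace (Z * Lind Y) = mtrace (heis_all Z * Y)"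
  unfolding lindbladian_def heis_all_def using assms
  by (simp add: mult_op_sum op_sum_mult mtrace_op_sum[where n = n] mtrace_heis)

lemma mtrace_heis_pow:
  assumes "Z \<in> operators n" "Y \<in> operators n"
  shows "mtrace (Z * (Lind ^^ m) Y) = mtrace ((heis_all ^^ m) Z * Y)"
  using assms
proof (induction m arbitrary: Z)
  case (Suc m)
  have "mtrace (Z * (Lind ^^ Suc m) Y) = mtrace (heis_all Z * (Lind ^^ m) Y)"
    using Suc.prems by (simp add: mtrace_heis_all)
  also have "\<dots> = mtrace ((heis_all ^^ m) (heis_all Z) * Y)" by (rule Suc.IH) (use Suc.prems in simp_all)
  finally show ?case by (simp add: funpow_Suc_right del: funpow.simps)
qed simp

text \<open>Trace preservation is dual to annihilating the identity, and the identity is local on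
  the empty set, which no edge meets.\<close>

lemma mtrace_Lind: "M \<in> operators n \<Longrightarrow> mtrace (Lind M) = 0"
proof -
  assume M: "M \<in> operators n"
  have "heis_all (1\<^sub>m (2 ^ n)) = 0\<^sub>m (2 ^ n) (2 ^ n)"
    by (intro ops_eqI[of _ n]) (simp_all add: heis_all_def op_sum_index heis_disjoint[OF _ local_op_one[of _ "{}"]])
  then have "mtrace (1\<^sub>m (2 ^ n) * Lind M) = mtrace (0\<^sub>m (2 ^ n) (2 ^ n) * M)"
    using M mtrace_heis_all[of "1\<^sub>m (2 ^ n)" M] by simp
  moreover have "1\<^sub>m (2 ^ n) * Lind M = Lind M" by (rule left_mult_one_mat) (rule Lind_carrier)
  moreover have "0\<^sub>m (2 ^ n) (2 ^ n) * M = 0\<^sub>m (2 ^ n) (2 ^ n)" using M by simp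
  ultimately show ?thesis by (simp add: mtrace_def)
qed

text \<open>Every edge meeting \<open>S\<close> is counted at some qubit of \<open>S\<close>, and
  the weights at one qubit add up to at most \<alpha>.\<close>

lemma sum_edge_norm:
  assumes "interaction_strength n k g \<le> \<alpha>" "S \<subseteq> {..<n}"
  shows "(\<Sum>e\<in>{e \<in> edges n k. e \<inter> S \<noteq> {}}. edge_norm e) \<le> real (card S) * \<alpha>"
proof -
  have nn: "0 \<le> edge_norm e" if "e \<in> edges n k" for e
    using hs_norm_heis(2)[OF that, of "1\<^sub>m (2 ^ n)"] by simp
  have fS: "finite S" using assms(2) by (rule finite_subset) simp
  have u: "(\<Sum>e \<in> {e \<in> edges n k. u \<in> e}. edge_norm e) \<le> \<alpha>" if "u \<in> S" for u
  proof -
    have "(\<Sum>e \<in> {e \<in> edges n k. u \<in> e}. edge_norm e) \<le> interaction_strength n k g"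
      unfolding interaction_strength_def using that assms(2) by (intro Max_ge) auto
    then show ?thesis using assms(1) by simp
  qed
  have "(\<Sum>e\<in>{e \<in> edges n k. e \<inter> S \<noteq> {}}. edge_norm e) \<le> (\<Sum>e\<in>(\<Union>u\<in>S. {e \<in> edges n k. u \<in> e}). edge_norm e)"
    using fS edges_finite nn by (intro sum_mono2) auto
  also have "\<dots> \<le> (\<Sum>u\<in>S. \<Sum>e\<in>{e \<in> edges n k. u \<in> e}. edge_norm e)"
    using fS edges_finite nn
  proof (induction S rule: finite_induct)
    case (insert x S)
    have "(\<Sum>e\<in>(\<Union>u\<in>insert x S. {e \<in> edges n k. u \<in> e}). edge_norm e) \<le>
      (\<Sum>e\<in>{e \<in> edges n k. x \<in> e}. edge_norm e) + (\<Sum>e\<in>(\<Union>u\<in>S. {e \<in> edges n k. u \<in> e}). edge_norm e)"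
      using insert.hyps insert.prems
      by (simp only: UN_insert, subst sum_Un) (auto intro!: sum_nonneg)
    then show ?case using insert by simp
  qed simp
  also have "\<dots> \<le> real (card S) * \<alpha>" using u by (rule sum_bounded_above)
  finally show ?thesis .
qed

text \<open>Only edges meeting \<open>S\<close> act, with total weight at most
  \<open>s * \<alpha>\<close>, and each result is local on at most \<open>s + k\<close> qubits; the
  remaining powers see \<open>s + k\<close> in the place of \<open>s\<close>. A bound
  \<open>s\<close> replaces \<open>card S\<close> because the sets \<open>S \<union> e\<close>
  differ in size.\<close>

lemma hs_norm_heis_pow:
  assumes \<alpha>: "interaction_strength n k g \<le> \<alpha>" "0 \<le> \<alpha>"
    and Z: "local_op n S Z" "S \<subseteq> {..<n}" "card S \<le> s"
  shows "hs_norm ((heis_all ^^ m) Z) \<le> (\<Prod>j<m. \<alpha> * (real s + real j * real k)) * hs_norm Z"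
  using Z
proof (induction m arbitrary: S Z s)
  case (Suc m)
  let ?E = "{e \<in> edges n k. e \<inter> S \<noteq> {}}"
  define c where "c = (\<Prod>j<m. \<alpha> * (real (s + k) + real j * real k))"
  have c0: "0 \<le> c" unfolding c_def using \<alpha> by (intro prod_nonneg) auto
  have Zc: "Z \<in> operators n" using Suc.prems by (simp add: local_op_def)
  have fE: "finite ?E" using edges_finite by simp
  have "heis_all Z = op_sum n (\<lambda>e. heis e Z) ?E"
  proof (rule ops_eqI[of _ n])
    fix i j :: nat assume ij: "i < 2 ^ n" "j < 2 ^ n"
    show "heis_all Z $$ (i, j) = op_sum n (\<lambda>e. heis e Z) ?E $$ (i, j)"
      unfolding heis_all_def op_sum_index[OF ij] using Suc.prems ij edges_finite
      by (intro sum.mono_neutral_right) (auto simp: heis_disjoint)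
  qed simp_all
  then have "(heis_all ^^ Suc m) Z = op_sum n (\<lambda>e. (heis_all ^^ m) (heis e Z)) ?E"
    unfolding funpow_Suc_right comp_apply using Zc by (simp only:) (rule heis_pow_op_sum, simp)
  then have "hs_norm ((heis_all ^^ Suc m) Z) \<le> (\<Sum>e\<in>?E. hs_norm ((heis_all ^^ m) (heis e Z)))"
    using Zc fE by (simp only:) (rule hs_norm_op_sum, auto)
  also have "\<dots> \<le> (\<Sum>e\<in>?E. c * (edge_norm e * hs_norm Z))"
  proof (rule sum_mono)
    fix e assume e: "e \<in> ?E"
    have "card (S \<union> e) \<le> card S + card e" by (rule card_Un_le)
    also have "\<dots> \<le> s + k" using e Suc.prems by (auto simp: edges_def)
    finally have "hs_norm ((heis_all ^^ m) (heis e Z)) \<le> c * hs_norm (heis e Z)"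
      unfolding c_def using e Suc.prems edge_subset by (intro Suc.IH[of "S \<union> e"] heis_local) auto
    also have "\<dots> \<le> c * (edge_norm e * hs_norm Z)"
      using e Zc c0 by (intro mult_left_mono hs_norm_heis) auto
    finally show "hs_norm ((heis_all ^^ m) (heis e Z)) \<le> c * (edge_norm e * hs_norm Z)" .
  qed
  also have "\<dots> = (\<Sum>e\<in>?E. edge_norm e) * (c * hs_norm Z)"
    unfolding sum_distrib_right by (intro sum.cong refl) (simp add: mult_ac)
  also have "\<dots> \<le> (real (card S) * \<alpha>) * (c * hs_norm Z)"
    using c0 hs_norm_nonneg[OF Zc] \<alpha> Suc.prems by (intro mult_right_mono sum_edge_norm mult_nonneg_nonneg) auto
  also have "\<dots> \<le> (real s * \<alpha>) * (c * hs_norm Z)"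
    using c0 hs_norm_nonneg[OF Zc] \<alpha> Suc.prems by (intro mult_right_mono mult_nonneg_nonneg) auto
  also have "\<dots> = (\<Prod>j<Suc m. \<alpha> * (real s + real j * real k)) * hs_norm Z"
    unfolding prod.lessThan_Suc_shift c_def by (simp add: algebra_simps)
  finally show ?case .
qed simp

text \<open>For \<open>s = k\<close> the factors are \<alpha> k, 2 \<alpha> k, ..., m \<alpha> k.
  The norms \<open>sqrt (2 ^ n)\<close> of the two Pauli operators cancel the normalisation
  \<open>2 ^ n\<close>, so that \<open>n\<close> disappears.\<close>

lemma ptm_power_bound:
  assumes \<alpha>: "interaction_strength n k g \<le> \<alpha>" "0 \<le> \<alpha>"
    and P: "P \<in> paulis n" "card (supp P) \<le> k" and Q: "Q \<in> paulis n"
  shows "cmod (mtrace (pauli_op n P * (Lind ^^ m) (pauli_op n Q))) / 2 ^ n \<le> (\<alpha> * real k) ^ m * fact m"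
proof -
  have S: "supp P \<subseteq> {..<n}" using P by (simp add: paulis_on_def)
  have "(\<Prod>j<m. \<alpha> * (real k + real j * real k)) = (\<alpha> * real k) ^ m * fact m"
    by (induction m) (simp_all add: algebra_simps)
  then have b: "hs_norm ((heis_all ^^ m) (pauli_op n P)) \<le> (\<alpha> * real k) ^ m * fact m * sqrt (2 ^ n)"
    using hs_norm_heis_pow[OF \<alpha> local_op_pauli[OF P(1) order_refl] S P(2), of m] P by (simp add: hs_norm_pauli_op)
  have "cmod (mtrace (pauli_op n P * (Lind ^^ m) (pauli_op n Q))) = cmod (mtrace ((heis_all ^^ m) (pauli_op n P) * pauli_op n Q))"
    by (simp add: mtrace_heis_pow)
  also have "\<dots> \<le> hs_norm ((heis_all ^^ m) (pauli_op n P)) * hs_norm (pauli_op n Q)"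
    by (rule mtrace_cauchy_schwarz[of _ n]) simp_all
  also have "\<dots> \<le> (\<alpha> * real k) ^ m * fact m * sqrt (2 ^ n) * sqrt (2 ^ n)"
    using b Q by (simp add: hs_norm_pauli_op mult_right_mono)
  also have "\<dots> = (\<alpha> * real k) ^ m * fact m * 2 ^ n" by (simp add: mult.assoc)
  finally show ?thesis by (simp add: divide_le_eq)
qed

end

section \<open>Linear superoperators and the flow\<close>

text \<open>Duality is meant for the bilinear pairing \<open>Tr(X Y)\<close>. Having a dual forces a map to be linear and
  bounded, which saves proving both separately.\<close>

definition dual_maps :: "nat \<Rightarrow> superop \<Rightarrow> superop \<Rightarrow> bool" where
  "dual_maps n \<Phi> \<Psi> \<longleftrightarrow> (\<forall>Z\<in>operators n. \<Phi> Z \<in> operators n \<and> \<Psi> Z \<in> operators n) \<and>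
     (\<forall>Z\<in>operators n. \<forall>Y\<in>operators n. mtrace (Z * \<Phi> Y) = mtrace (\<Psi> Z * Y))"

lemma dual_carrier:
  assumes "dual_maps n \<Phi> \<Psi>" "M \<in> operators n"
  shows "\<Phi> M \<in> operators n" "\<Psi> M \<in> operators n" "(\<Phi> ^^ j) M \<in> operators n"
proof -
  show "\<Phi> M \<in> operators n" "\<Psi> M \<in> operators n" using assms by (auto simp: dual_maps_def)
  show "(\<Phi> ^^ j) M \<in> operators n" using assms by (induction j) (auto simp: dual_maps_def)
qed

lemma dual_entry:
  assumes "dual_maps n \<Phi> \<Psi>" "Y \<in> operators n" "i < 2 ^ n" "j < 2 ^ n"
  shows "\<Phi> Y $$ (i, j) = mtrace (\<Psi> (matrix_unit n j i) * Y)"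
proof -
  have "mtrace (matrix_unit n j i * \<Phi> Y) = mtrace (\<Phi> Y * matrix_unit n j i)"
    by (rule mtrace_comm[of _ "2 ^ n"]) (use assms dual_carrier in auto)
  also have "\<dots> = \<Phi> Y $$ (i, j)"
    by (rule mtrace_mult_matrix_unit) (use assms dual_carrier in auto)
  finally show ?thesis using assms by (simp add: dual_maps_def)
qed

lemma dual_linear:
  assumes d: "dual_maps n \<Phi> \<Psi>" and M: "M \<in> operators n" "N \<in> operators n"
  shows "\<Phi> (M + c \<cdot>\<^sub>m N) = \<Phi> M + c \<cdot>\<^sub>m \<Phi> N"
proof (rule ops_eqI[of _ n])
  fix i j :: nat assume ij: "i < 2 ^ n" "j < 2 ^ n"
  have c: "\<Phi> M \<in> operators n" "\<Phi> N \<in> operators n" "\<Psi> (matrix_unit n j i) \<in> operators n"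
    using dual_carrier[OF d] M by auto
  show "\<Phi> (M + c \<cdot>\<^sub>m N) $$ (i, j) = (\<Phi> M + c \<cdot>\<^sub>m \<Phi> N) $$ (i, j)"
    using ij c M by (simp add: dual_entry[OF d] ops_distrib[where n = n] mtrace_linear[where n = n])
qed (use dual_carrier[OF d] M in auto)

lemma dual_pow_linear:
  assumes d: "dual_maps n \<Phi> \<Psi>" and M: "M \<in> operators n" "N \<in> operators n"
  shows "(\<Phi> ^^ j) (M + c \<cdot>\<^sub>m N) = (\<Phi> ^^ j) M + c \<cdot>\<^sub>m (\<Phi> ^^ j) N"
  by (induction j) (use M dual_carrier[OF d] dual_linear[OF d] in auto)

lemma dual_op_sum:
  assumes d: "dual_maps n \<Phi> \<Psi>" and f: "\<And>x. x \<in> A \<Longrightarrow> f x \<in> operators n"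
  shows "\<Phi> (op_sum n (\<lambda>x. c x \<cdot>\<^sub>m f x) A) = op_sum n (\<lambda>x. c x \<cdot>\<^sub>m \<Phi> (f x)) A"
proof (rule ops_eqI[of _ n])
  fix i j :: nat assume ij: "i < 2 ^ n" "j < 2 ^ n"
  have "\<Phi> (op_sum n (\<lambda>x. c x \<cdot>\<^sub>m f x) A) $$ (i, j) = (\<Sum>x\<in>A. c x * mtrace (\<Psi> (matrix_unit n j i) * f x))"
    unfolding dual_entry[OF d op_sum_carrier ij]
    by (rule mtrace_mult_op_sum) (use f dual_carrier[OF d] in auto)
  also have "\<dots> = (\<Sum>x\<in>A. (c x \<cdot>\<^sub>m \<Phi> (f x)) $$ (i, j))"
  proof (intro sum.cong refl)
    fix x assume x: "x \<in> A"
    then have "\<Phi> (f x) \<in> operators n" using f dual_carrier[OF d] by auto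
    then show "c x * mtrace (\<Psi> (matrix_unit n j i) * f x) = (c x \<cdot>\<^sub>m \<Phi> (f x)) $$ (i, j)"
      using ij by (simp add: dual_entry[OF d f[OF x]])
  qed
  finally show "\<Phi> (op_sum n (\<lambda>x. c x \<cdot>\<^sub>m f x) A) $$ (i, j) = op_sum n (\<lambda>x. c x \<cdot>\<^sub>m \<Phi> (f x)) A $$ (i, j)"
    using ij by (simp add: op_sum_index)
qed (use dual_carrier[OF d] in simp_all)

lemma dual_bounded:
  assumes d: "dual_maps n \<Phi> \<Psi>"
  shows "\<exists>B\<ge>0. \<forall>M\<in>operators n. hs_norm (\<Phi> M) \<le> B * hs_norm M"
proof -
  let ?I = "{..<(2::nat) ^ n} \<times> {..<(2::nat) ^ n}"
  define B where "B = L2_set (\<lambda>(i, j). hs_norm (\<Psi> (matrix_unit n j i))) ?I"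
  have "hs_norm (\<Phi> M) \<le> B * hs_norm M" if M: "M \<in> operators n" for M
  proof -
    have "hs_norm (\<Phi> M) \<le> L2_set (\<lambda>u. (case u of (i, j) \<Rightarrow> hs_norm (\<Psi> (matrix_unit n j i))) * hs_norm M) ?I"
      unfolding hs_norm_eq_L2[OF dual_carrier(1)[OF d M]]
    proof (rule L2_set_mono)
      fix u assume u: "u \<in> ?I"
      obtain i j where ij: "u = (i, j)" by (cases u)
      have "cmod (mtrace (\<Psi> (matrix_unit n j i) * M)) \<le> hs_norm (\<Psi> (matrix_unit n j i)) * hs_norm M"
        by (rule mtrace_cauchy_schwarz[of _ n]) (use dual_carrier[OF d] M in simp_all)
      then show "(case u of (i, j) \<Rightarrow> cmod (\<Phi> M $$ (i, j))) \<le>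
        (case u of (i, j) \<Rightarrow> hs_norm (\<Psi> (matrix_unit n j i))) * hs_norm M"
        using u ij by (simp add: dual_entry[OF d M])
    qed (auto split: prod.splits)
    then show ?thesis using hs_norm_nonneg[OF M] by (simp add: B_def L2_set_left_distrib)
  qed
  moreover have "0 \<le> B" by (simp add: B_def L2_set_nonneg)
  ultimately show ?thesis by blast
qed

lemma dual_sandwich:
  assumes "X \<in> operators n" "Y \<in> operators n"
  shows "dual_maps n (\<lambda>M. X * M * Y) (\<lambda>Z. Y * Z * X)"
  unfolding dual_maps_def
proof (intro conjI ballI)
  fix Z M assume "Z \<in> operators n" "M \<in> operators n"
  then show "mtrace (Z * (X * M * Y)) = mtrace (Y * Z * X * M)"
    using assms mtrace_comm[of "Z * X * M" "2 ^ n" Y] by (simp add: ops_assoc[where n = n])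
qed (use assms in simp_all)

lemma dual_combination:
  assumes d: "dual_maps n \<Phi> \<Psi>" "dual_maps n \<Phi>' \<Psi>'"
  shows "dual_maps n (\<lambda>M. \<Phi> M + c \<cdot>\<^sub>m \<Phi>' M) (\<lambda>M. \<Psi> M + c \<cdot>\<^sub>m \<Psi>' M)"
  using assms unfolding dual_maps_def
  by (auto simp: ops_distrib[where n = n] mtrace_linear[where n = n])

lemma entry_le_hs_norm:
  assumes "A \<in> operators n" "i < 2 ^ n" "j < 2 ^ n"
  shows "cmod (A $$ (i, j)) \<le> hs_norm A"
  unfolding hs_norm_eq_L2[OF assms(1)]
  using member_le_L2_set[of "{..<(2::nat) ^ n} \<times> {..<(2::nat) ^ n}" "(i, j)" "\<lambda>(i, j). cmod (A $$ (i, j))"] assms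
  by simp

lemma hs_norm_pow:
  assumes "dual_maps n \<Phi> \<Psi>" "0 \<le> B" "\<And>M. M \<in> operators n \<Longrightarrow> hs_norm (\<Phi> M) \<le> B * hs_norm M" "M \<in> operators n"
  shows "hs_norm ((\<Phi> ^^ j) M) \<le> B ^ j * hs_norm M"
proof (induction j)
  case (Suc j)
  have "hs_norm (\<Phi> ((\<Phi> ^^ j) M)) \<le> B * hs_norm ((\<Phi> ^^ j) M)"
    using assms dual_carrier(3) by blast
  also have "\<dots> \<le> B * (B ^ j * hs_norm M)" using Suc assms by (intro mult_left_mono)
  finally show ?case by (simp add: mult.assoc)
qed simp

lemma lindblad_flow_carrier [simp]: "lindblad_flow n \<Phi> t M \<in> operators n"
  by (simp add: lindblad_flow_def)

text \<open>The flow is defined by \<open>suminf\<close>, which says nothing before summability is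
  known; the exponential series of \<open>\<bar>t\<bar> * B\<close> dominates every entry.\<close>

lemma flow_entry_sums:
  assumes d: "dual_maps n \<Phi> \<Psi>" and M: "M \<in> operators n" and ij: "i < 2 ^ n" "j < 2 ^ n"
  shows "(\<lambda>m. of_real (t ^ m / fact m) * ((\<Phi> ^^ m) M $$ (i, j))) sums (lindblad_flow n \<Phi> t M $$ (i, j))"
proof -
  obtain B where B: "0 \<le> B" "\<And>M. M \<in> operators n \<Longrightarrow> hs_norm (\<Phi> M) \<le> B * hs_norm M"
    using dual_bounded[OF d] by blast
  have "summable (\<lambda>m. (\<bar>t\<bar> * B) ^ m / fact m * hs_norm M)"
    using summable_exp[of "\<bar>t\<bar> * B"] by (intro summable_mult2) (simp add: field_simps)
  moreover have "norm (of_real (t ^ m / fact m) * ((\<Phi> ^^ m) M $$ (i, j))) \<le> (\<bar>t\<bar> * B) ^ m / fact m * hs_norm M" for m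
  proof -
    have "cmod ((\<Phi> ^^ m) M $$ (i, j)) \<le> hs_norm ((\<Phi> ^^ m) M)"
      using dual_carrier(3)[OF d M] ij by (rule entry_le_hs_norm)
    also have "\<dots> \<le> B ^ m * hs_norm M" by (rule hs_norm_pow[OF d B M])
    finally have "\<bar>t ^ m / fact m\<bar> * cmod ((\<Phi> ^^ m) M $$ (i, j)) \<le> \<bar>t ^ m / fact m\<bar> * (B ^ m * hs_norm M)"
      by (rule mult_left_mono) simp
    then show ?thesis by (simp only: norm_mult norm_of_real) (simp add: power_abs power_mult_distrib)
  qed
  ultimately have "summable (\<lambda>m. of_real (t ^ m / fact m) * ((\<Phi> ^^ m) M $$ (i, j)))"
    by (rule summable_comparison_test'[where N = 0])
  then show ?thesis using ij by (simp add: lindblad_flow_def summable_sums)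
qed

lemma flow_sums:
  assumes d: "dual_maps n \<Phi> \<Psi>" and M: "M \<in> operators n" and Z: "Z \<in> operators n"
  shows "(\<lambda>m. of_real (t ^ m / fact m) * mtrace (Z * (\<Phi> ^^ m) M)) sums mtrace (Z * lindblad_flow n \<Phi> t M)"
proof -
  have "(\<lambda>m. \<Sum>i<2 ^ n. \<Sum>j<2 ^ n. Z $$ (i, j) * (of_real (t ^ m / fact m) * ((\<Phi> ^^ m) M $$ (j, i))))
    sums (\<Sum>i<2 ^ n. \<Sum>j<2 ^ n. Z $$ (i, j) * lindblad_flow n \<Phi> t M $$ (j, i))"
    by (intro sums_sum sums_mult flow_entry_sums[OF d M]) simp_all
  then show ?thesis
    unfolding mtrace_mult[OF Z lindblad_flow_carrier] mtrace_mult[OF Z dual_carrier(3)[OF d M]]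
    by (simp add: sum_distrib_left mult_ac)
qed

lemma flow_op_sum:
  assumes d: "dual_maps n \<Phi> \<Psi>" and f: "\<And>x. x \<in> A \<Longrightarrow> f x \<in> operators n" and Z: "Z \<in> operators n"
  shows "mtrace (Z * lindblad_flow n \<Phi> t (op_sum n (\<lambda>x. c x \<cdot>\<^sub>m f x) A)) =
    (\<Sum>x\<in>A. c x * mtrace (Z * lindblad_flow n \<Phi> t (f x)))"
proof -
  have pow: "(\<Phi> ^^ m) (op_sum n (\<lambda>x. c x \<cdot>\<^sub>m f x) A) = op_sum n (\<lambda>x. c x \<cdot>\<^sub>m (\<Phi> ^^ m) (f x)) A" for m
  proof (induction m)
    case (Suc m)
    have "\<Phi> (op_sum n (\<lambda>x. c x \<cdot>\<^sub>m (\<Phi> ^^ m) (f x)) A) = op_sum n (\<lambda>x. c x \<cdot>\<^sub>m \<Phi> ((\<Phi> ^^ m) (f x))) A"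
      by (rule dual_op_sum[OF d]) (use f dual_carrier(3)[OF d] in blast)
    then show ?case using Suc by simp
  qed simp
  have tr: "mtrace (Z * (\<Phi> ^^ m) (op_sum n (\<lambda>x. c x \<cdot>\<^sub>m f x) A)) = (\<Sum>x\<in>A. c x * mtrace (Z * (\<Phi> ^^ m) (f x)))" for m
    unfolding pow by (rule mtrace_mult_op_sum) (use f Z dual_carrier(3)[OF d] in blast)+
  have "(\<lambda>m. \<Sum>x\<in>A. c x * (of_real (t ^ m / fact m) * mtrace (Z * (\<Phi> ^^ m) (f x)))) sums
    (\<Sum>x\<in>A. c x * mtrace (Z * lindblad_flow n \<Phi> t (f x)))"
    by (intro sums_sum sums_mult flow_sums[OF d]) (use f Z in auto)
  moreover have "(\<lambda>m. of_real (t ^ m / fact m) * mtrace (Z * (\<Phi> ^^ m) (op_sum n (\<lambda>x. c x \<cdot>\<^sub>m f x) A))) sums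
    mtrace (Z * lindblad_flow n \<Phi> t (op_sum n (\<lambda>x. c x \<cdot>\<^sub>m f x) A))"
    by (rule flow_sums[OF d op_sum_carrier Z])
  ultimately show ?thesis
    unfolding tr by (simp add: sum_distrib_left mult_ac sums_unique2)
qed

section \<open>Positivity of the flow\<close>

text \<open>Testing against matrices \<open>X\<close> instead of vectors makes invariance under \<open>M \<mapsto> Y M Y\<^sup>*\<close>
  immediate.\<close>

definition psd :: "nat \<Rightarrow> complex mat \<Rightarrow> bool" where
  "psd n M \<longleftrightarrow> M \<in> operators n \<and> (\<forall>X\<in>operators n. 0 \<le> Re (mtrace (mat_adjoint X * M * X)))"

lemma psd_conjugate:
  assumes "psd n M" "Y \<in> operators n"
  shows "psd n (Y * M * mat_adjoint Y)"
  unfolding psd_def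
proof (intro conjI ballI)
  have M: "M \<in> operators n" using assms by (simp add: psd_def)
  then show "Y * M * mat_adjoint Y \<in> operators n" using assms by simp
  fix X :: "complex mat" assume X: "X \<in> operators n"
  have "mat_adjoint X * (Y * M * mat_adjoint Y) * X = mat_adjoint (mat_adjoint Y * X) * M * (mat_adjoint Y * X)"
    using assms(2) M X by (simp add: ops_assoc[where n = n] mat_adjoint_mult[where n = n] mat_adjoint_linear[where n = n])
  moreover have "0 \<le> Re (mtrace (mat_adjoint (mat_adjoint Y * X) * M * (mat_adjoint Y * X)))"
    using assms X unfolding psd_def by (meson mat_adjoint_carrier ops_mult)
  ultimately show "0 \<le> Re (mtrace (mat_adjoint X * (Y * M * mat_adjoint Y) * X))" by simp
qed

lemma psd_add_smult:
  assumes "psd n M" "psd n N" "0 \<le> c"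
  shows "psd n (M + complex_of_real c \<cdot>\<^sub>m N)"
  using assms unfolding psd_def
  by (auto simp: ops_distrib[where n = n] mtrace_linear[where n = n])

lemma psd_op_sum:
  assumes "\<And>x. x \<in> A \<Longrightarrow> psd n (f x)"
  shows "psd n (op_sum n f A)"
  unfolding psd_def
proof (intro conjI ballI)
  fix X :: "complex mat" assume X: "X \<in> operators n"
  have f: "f x \<in> operators n" if "x \<in> A" for x using assms[OF that] by (simp add: psd_def)
  have "mtrace (mat_adjoint X * op_sum n f A * X) = (\<Sum>x\<in>A. mtrace (mat_adjoint X * f x * X))"
    using X f by (simp add: mult_op_sum op_sum_mult mtrace_op_sum[where n = n])
  then show "0 \<le> Re (mtrace (mat_adjoint X * op_sum n f A * X))"
    using assms X by (auto simp: psd_def intro!: sum_nonneg)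
qed simp

lemma psd_limit:
  assumes "\<And>m. psd n (f m)" "M \<in> operators n"
    and lim: "\<And>i j. i < 2 ^ n \<Longrightarrow> j < 2 ^ n \<Longrightarrow> (\<lambda>m. f m $$ (i, j)) \<longlonglongrightarrow> M $$ (i, j)"
  shows "psd n M"
  unfolding psd_def
proof (intro conjI ballI assms(2))
  fix X :: "complex mat" assume X: "X \<in> operators n"
  have tr: "mtrace (mat_adjoint X * N * X) = (\<Sum>i<2 ^ n. \<Sum>j<2 ^ n. (X * mat_adjoint X) $$ (i, j) * N $$ (j, i))"
    if N: "N \<in> operators n" for N
  proof -
    have "mtrace (mat_adjoint X * N * X) = mtrace ((X * mat_adjoint X) * N)"
      using mtrace_comm[of "mat_adjoint X * N" "2 ^ n" X] X N by (simp add: ops_assoc[where n = n])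
    then show ?thesis using X N by (simp add: mtrace_mult[of _ "2 ^ n"] del: index_mult_mat)
  qed
  have "(\<lambda>m. Re (mtrace (mat_adjoint X * f m * X))) \<longlonglongrightarrow> Re (mtrace (mat_adjoint X * M * X))"
    unfolding tr[OF assms(2)]
    using assms(1) by (simp only: tr psd_def) (intro tendsto_intros lim; simp)
  moreover have "0 \<le> Re (mtrace (mat_adjoint X * f m * X))" for m
    using assms(1) X by (simp add: psd_def)
  ultimately show "0 \<le> Re (mtrace (mat_adjoint X * M * X))"
    by (intro LIMSEQ_le_const) auto
qed

text \<open>Pascal's rule, in the form that absorbs one further Euler step
  \<open>x j + d * x (Suc j)\<close> into the binomial expansion of the others.\<close>

lemma binomial_recurrence:
  fixes x :: "nat \<Rightarrow> complex"
  shows "(\<Sum>j\<le>m. of_nat (m choose j) * d ^ j * (x j + d * x (Suc j))) = (\<Sum>j\<le>Suc m. of_nat (Suc m choose j) * d ^ j * x j)"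
proof -
  have "(\<Sum>j\<le>Suc m. of_nat (Suc m choose j) * d ^ j * x j) =
    x 0 + (\<Sum>j\<le>m. of_nat (Suc m choose Suc j) * d ^ Suc j * x (Suc j))"
    by (subst sum.atMost_Suc_shift) simp
  also have "\<dots> = (x 0 + (\<Sum>j\<le>m. of_nat (m choose Suc j) * d ^ Suc j * x (Suc j))) + (\<Sum>j\<le>m. of_nat (m choose j) * d ^ Suc j * x (Suc j))"
    by (simp add: distrib_right sum.distrib)
  also have "x 0 + (\<Sum>j\<le>m. of_nat (m choose Suc j) * d ^ Suc j * x (Suc j)) = (\<Sum>j\<le>Suc m. of_nat (m choose j) * d ^ j * x j)"
    by (subst sum.atMost_Suc_shift) simp
  also have "\<dots> = (\<Sum>j\<le>m. of_nat (m choose j) * d ^ j * x j)" by simp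
  finally show ?thesis by (simp add: distrib_left sum.distrib mult_ac)
qed

lemma euler_step_power:
  assumes d: "dual_maps n \<Phi> \<Psi>" and M: "M \<in> operators n" and ij: "i < 2 ^ n" "j < 2 ^ n"
  shows "((\<lambda>M. M + c \<cdot>\<^sub>m \<Phi> M) ^^ m) M $$ (i, j) = (\<Sum>l\<le>m. of_nat (m choose l) * c ^ l * ((\<Phi> ^^ l) M $$ (i, j)))"
  using M
proof (induction m arbitrary: M)
  case (Suc m)
  have M': "M + c \<cdot>\<^sub>m \<Phi> M \<in> operators n" using Suc.prems dual_carrier(1)[OF d] by simp
  have "((\<lambda>M. M + c \<cdot>\<^sub>m \<Phi> M) ^^ Suc m) M $$ (i, j) =
     (\<Sum>l\<le>m. of_nat (m choose l) * c ^ l * ((\<Phi> ^^ l) (M + c \<cdot>\<^sub>m \<Phi> M) $$ (i, j)))"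
    by (simp only: funpow_Suc_right comp_apply Suc.IH[OF M'])
  also have "\<dots> = (\<Sum>l\<le>m. of_nat (m choose l) * c ^ l * ((\<Phi> ^^ l) M $$ (i, j) + c * ((\<Phi> ^^ Suc l) M $$ (i, j))))"
  proof (intro sum.cong refl)
    fix l
    have "(\<Phi> ^^ l) (M + c \<cdot>\<^sub>m \<Phi> M) = (\<Phi> ^^ l) M + c \<cdot>\<^sub>m (\<Phi> ^^ Suc l) M"
      using dual_pow_linear[OF d Suc.prems dual_carrier(1)[OF d Suc.prems]] by (simp add: funpow_swap1)
    moreover have "(\<Phi> ^^ l) M \<in> operators n" "(\<Phi> ^^ Suc l) M \<in> operators n"
      using dual_carrier(3)[OF d Suc.prems] by blast+
    ultimately have "(\<Phi> ^^ l) (M + c \<cdot>\<^sub>m \<Phi> M) $$ (i, j) = (\<Phi> ^^ l) M $$ (i, j) + c * ((\<Phi> ^^ Suc l) M $$ (i, j))"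
      using ij by (simp del: funpow.simps)
    then show "of_nat (m choose l) * c ^ l * ((\<Phi> ^^ l) (M + c \<cdot>\<^sub>m \<Phi> M) $$ (i, j)) =
       of_nat (m choose l) * c ^ l * ((\<Phi> ^^ l) M $$ (i, j) + c * ((\<Phi> ^^ Suc l) M $$ (i, j)))" by (simp only:)
  qed
  also have "\<dots> = (\<Sum>l\<le>Suc m. of_nat (Suc m choose l) * c ^ l * ((\<Phi> ^^ l) M $$ (i, j)))"
    by (rule binomial_recurrence)
  finally show ?case .
qed simp

lemma binomial_limit:
  "(\<lambda>m. real (Suc m choose l) * (t / real (Suc m)) ^ l) \<longlonglongrightarrow> t ^ l / fact l"
proof -
  have eq: "real (Suc m choose l) * (t / real (Suc m)) ^ l =
    (\<Prod>i = 0..<l. (real (Suc m) - real i) / real (Suc m)) * (t ^ l / fact l)" for m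
    by (simp add: binomial_gbinomial gbinomial_prod_rev prod_dividef power_divide)
  have "(\<lambda>m. (\<Prod>i = 0..<l. (real (Suc m) - real i) / real (Suc m)) * (t ^ l / fact l)) \<longlonglongrightarrow>
      (\<Prod>i = 0..<l. 1) * (t ^ l / fact l)"
    by (intro tendsto_mult tendsto_prod tendsto_const) real_asymp
  then show ?thesis unfolding eq by simp
qed

text \<open>Binomial expansion of the steps: the \<open>l\<close>-th term tends to the
  \<open>l\<close>-th term of the exponential series and is dominated by
  \<open>(t * K) ^ l / fact l * hs_norm M\<close>, so Tannery's theorem exchanges limit and sum. The
  perturbation by \<open>\<Phi>'\<close> carries an additional step size and vanishes
  termwise.\<close>

lemma euler_limit:
  assumes d: "dual_maps n \<Phi> \<Psi>" "dual_maps n \<Phi>' \<Psi>'" and M: "M \<in> operators n" and t: "0 \<le> t"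
    and ij: "i < 2 ^ n" "j < 2 ^ n"
  defines "c \<equiv> \<lambda>m. complex_of_real (t / real (Suc m))"
  shows "(\<lambda>m. ((\<lambda>M. M + c m \<cdot>\<^sub>m (\<Phi> M + c m \<cdot>\<^sub>m \<Phi>' M)) ^^ Suc m) M $$ (i, j)) \<longlonglongrightarrow> lindblad_flow n \<Phi> t M $$ (i, j)"
proof -
  let ?X = "\<lambda>m M. \<Phi> M + c m \<cdot>\<^sub>m \<Phi>' M"
  have X: "dual_maps n (?X m) (\<lambda>M. \<Psi> M + c m \<cdot>\<^sub>m \<Psi>' M)" for m by (rule dual_combination[OF d])
  have c0: "c \<longlonglongrightarrow> 0"
  proof -
    have "(\<lambda>m. t / real (Suc m)) \<longlonglongrightarrow> 0" by real_asymp
    from tendsto_of_real[OF this, where 'a = complex] show ?thesis by (simp add: c_def)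
  qed
  obtain B B' where B: "0 \<le> B" "\<And>M. M \<in> operators n \<Longrightarrow> hs_norm (\<Phi> M) \<le> B * hs_norm M"
      and B': "0 \<le> B'" "\<And>M. M \<in> operators n \<Longrightarrow> hs_norm (\<Phi>' M) \<le> B' * hs_norm M"
    using dual_bounded[OF d(1)] dual_bounded[OF d(2)] by blast
  \<comment> \<open>All step sizes are at most \<open>t\<close>, so this bounds the perturbed
    generators uniformly in \<open>m\<close>, as domination requires.\<close>
  define K where "K = B + t * B'"
  have K0: "0 \<le> K" using B B' t by (simp add: K_def)
  have K: "hs_norm (?X m N) \<le> K * hs_norm N" if N: "N \<in> operators n" for m N
  proof -
    have "cmod (c m) = t / real (Suc m)" unfolding c_def norm_of_real using t by simp
    also have "\<dots> \<le> t" using t by (simp add: divide_le_eq mult_le_cancel_left1 algebra_simps)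
    finally have "cmod (c m) \<le> t" .
    have "hs_norm (?X m N) \<le> hs_norm (\<Phi> N) + cmod (c m) * hs_norm (\<Phi>' N)"
      using hs_norm_triangle[of "\<Phi> N" n "c m \<cdot>\<^sub>m \<Phi>' N"] dual_carrier(1)[OF d(1) N] dual_carrier(1)[OF d(2) N]
      by (simp add: hs_norm_smult[where n = n])
    also have "\<dots> \<le> B * hs_norm N + t * (B' * hs_norm N)"
      using B B' N \<open>cmod (c m) \<le> t\<close> hs_norm_nonneg[OF dual_carrier(1)[OF d(2) N]] t by (intro add_mono mult_mono) auto
    finally show ?thesis by (simp add: K_def algebra_simps)
  qed
  have entry: "(\<lambda>m. (?X m ^^ l) M $$ (a, b)) \<longlonglongrightarrow> (\<Phi> ^^ l) M $$ (a, b)" if "a < 2 ^ n" "b < 2 ^ n" for l a b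
    using that
  proof (induction l arbitrary: a b)
    case (Suc l)
    let ?N = "\<lambda>m. (?X m ^^ l) M"
    have N: "?N m \<in> operators n" for m by (rule dual_carrier(3)[OF X M])
    have lim: "(\<lambda>m. \<Theta> (?N m) $$ (a, b)) \<longlonglongrightarrow> \<Theta> ((\<Phi> ^^ l) M) $$ (a, b)" if "dual_maps n \<Theta> \<Theta>'" for \<Theta> \<Theta>'
    proof -
      have e: "\<Theta> A $$ (a, b) = (\<Sum>i<2 ^ n. \<Sum>j<2 ^ n. \<Theta>' (matrix_unit n b a) $$ (i, j) * A $$ (j, i))"
        if A: "A \<in> operators n" for A
        unfolding dual_entry[OF \<open>dual_maps n \<Theta> \<Theta>'\<close> A Suc.prems]
        by (rule mtrace_mult) (use dual_carrier(2)[OF \<open>dual_maps n \<Theta> \<Theta>'\<close>] A in simp_all)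
      show ?thesis unfolding e[OF N] e[OF dual_carrier(3)[OF d(1) M]]
        by (intro tendsto_intros Suc.IH) simp_all
    qed
    have "(\<lambda>m. \<Phi> (?N m) $$ (a, b) + c m * \<Phi>' (?N m) $$ (a, b)) \<longlonglongrightarrow>
      \<Phi> ((\<Phi> ^^ l) M) $$ (a, b) + 0 * \<Phi>' ((\<Phi> ^^ l) M) $$ (a, b)"
      by (intro tendsto_intros lim[OF d(1)] lim[OF d(2)] c0)
    moreover have "(?X m ^^ Suc l) M $$ (a, b) = \<Phi> (?N m) $$ (a, b) + c m * \<Phi>' (?N m) $$ (a, b)" for m
      unfolding funpow.simps comp_apply
      using dual_carrier(1)[OF d(1) N[of m]] dual_carrier(1)[OF d(2) N[of m]] Suc.prems
      by (subst index_add_mat) auto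
    ultimately show ?case by simp
  qed simp
  define a where "a = (\<lambda>l m. of_nat (Suc m choose l) * c m ^ l * ((?X m ^^ l) M $$ (i, j)))"
  have step: "((\<lambda>M. M + c m \<cdot>\<^sub>m ?X m M) ^^ Suc m) M $$ (i, j) = (\<Sum>l. a l m)" for m
  proof -
    have "(\<Sum>l. a l m) = (\<Sum>l\<le>Suc m. a l m)"
      by (intro suminf_finite) (auto simp: a_def)
    then show ?thesis unfolding euler_step_power[OF X M ij] a_def by simp
  qed
  have coef: "complex_of_real (real (Suc m choose l) * (t / real (Suc m)) ^ l) = of_nat (Suc m choose l) * c m ^ l" for l m
    by (simp only: c_def of_real_mult of_real_power of_real_of_nat_eq)
  have lim: "(\<lambda>m. a l m) \<longlonglongrightarrow> of_real (t ^ l / fact l) * ((\<Phi> ^^ l) M $$ (i, j))" for l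
    unfolding a_def coef[symmetric] by (intro tendsto_mult tendsto_of_real binomial_limit entry ij)
  have bound: "norm (a l m) \<le> (t * K) ^ l / fact l * hs_norm M" for l m
  proof -
    have "real (Suc m choose l) * fact l \<le> real (Suc m) ^ l"
      using binomial_fact_pow[of "Suc m" l] by (metis of_nat_fact of_nat_le_iff of_nat_mult of_nat_power)
    then have "real (Suc m choose l) \<le> real (Suc m) ^ l / fact l" by (simp add: field_simps)
    then have "real (Suc m choose l) * (t / real (Suc m)) ^ l \<le> real (Suc m) ^ l / fact l * (t / real (Suc m)) ^ l"
      using t by (intro mult_right_mono) auto
    also have "\<dots> = t ^ l / fact l" by (simp add: power_divide)
    finally have 1: "real (Suc m choose l) * (t / real (Suc m)) ^ l \<le> t ^ l / fact l" .
    have "cmod ((?X m ^^ l) M $$ (i, j)) \<le> hs_norm ((?X m ^^ l) M)"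
      by (rule entry_le_hs_norm[OF dual_carrier(3)[OF X M] ij])
    also have "\<dots> \<le> K ^ l * hs_norm M" by (rule hs_norm_pow[OF X K0 K M])
    finally have 2: "cmod ((?X m ^^ l) M $$ (i, j)) \<le> K ^ l * hs_norm M" .
    have "norm (a l m) = \<bar>real (Suc m choose l) * (t / real (Suc m)) ^ l\<bar> * cmod ((?X m ^^ l) M $$ (i, j))"
      unfolding a_def coef[symmetric] norm_mult norm_of_real ..
    also have "\<dots> \<le> t ^ l / fact l * (K ^ l * hs_norm M)"
      using 1 2 t by (intro mult_mono) auto
    finally show ?thesis by (simp add: power_mult_distrib)
  qed
  have "summable (\<lambda>l. (t * K) ^ l / fact l * hs_norm M)"
    using summable_exp[of "t * K"] by (intro summable_mult2) (simp add: field_simps)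
  then have "(\<lambda>m. \<Sum>l. a l m) \<longlonglongrightarrow> (\<Sum>l. of_real (t ^ l / fact l) * ((\<Phi> ^^ l) M $$ (i, j)))"
    by (intro tannerys_theorem[THEN conjunct2, THEN conjunct2, of a _ sequentially "\<lambda>l. (t * K) ^ l / fact l * hs_norm M"]
        lim always_eventually) (use bound in auto)
  then show ?thesis unfolding step using ij by (simp add: lindblad_flow_def)
qed

text \<open>Here \<open>\<Phi>'\<close> is any correction of second order that makes each Euler step
  preserve positivity; it leaves no trace in the limit.\<close>

lemma flow_psd:
  assumes d: "dual_maps n \<Phi> \<Psi>" "dual_maps n \<Phi>' \<Psi>'" and M: "psd n M" and t: "0 \<le> t"
    and pos: "\<And>c N. 0 \<le> c \<Longrightarrow> psd n N \<Longrightarrow>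
      psd n (N + complex_of_real c \<cdot>\<^sub>m (\<Phi> N + complex_of_real c \<cdot>\<^sub>m \<Phi>' N))"
  shows "psd n (lindblad_flow n \<Phi> t M)"
proof (rule psd_limit)
  let ?c = "\<lambda>m. complex_of_real (t / real (Suc m))"
  show "psd n (((\<lambda>M. M + ?c m \<cdot>\<^sub>m (\<Phi> M + ?c m \<cdot>\<^sub>m \<Phi>' M)) ^^ Suc m) M)" for m
  proof -
    have "psd n (((\<lambda>M. M + ?c m \<cdot>\<^sub>m (\<Phi> M + ?c m \<cdot>\<^sub>m \<Phi>' M)) ^^ l) M)" for l
    proof (induction l)
      case (Suc l)
      have "0 \<le> t / real (Suc m)" using t by simp
      from pos[OF this Suc] show ?case by (simp only: funpow.simps comp_apply)
    qed (use M in simp)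
    then show ?thesis .
  qed
  show "(\<lambda>m. ((\<lambda>M. M + ?c m \<cdot>\<^sub>m (\<Phi> M + ?c m \<cdot>\<^sub>m \<Phi>' M)) ^^ Suc m) M $$ (i, j)) \<longlonglongrightarrow>
      lindblad_flow n \<Phi> t M $$ (i, j)" if "i < 2 ^ n" "j < 2 ^ n" for i j
    using d M t that by (intro euler_limit) (auto simp: psd_def)
qed simp

section \<open>The flow of a local generator\<close>

context
  fixes n k :: nat and g :: lindblad_data
  assumes g: "k_local_lindblad n k g"
begin

lemma Lind_dual: "dual_maps n (lindbladian n k g) (heis_all n k g)"
  unfolding dual_maps_def
  using mtrace_heis_all[OF g] Lind_carrier[OF g] heis_all_carrier[OF g] by blast

text \<open>Only the full Hamiltonian is assumed to be Hermitian. As Pauli operators are Hermitian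
  and independent, its coefficients are real, and then the part on each single edge is Hermitian as
  well.\<close>

lemma ham_coeff_real:
  assumes P: "P \<in> paulis n"
  shows "cnj (ham_coeff g P) = ham_coeff g P"
proof -
  let ?H = "hamiltonian n (ham_coeff g) (paulis n)"
  have H: "mat_adjoint ?H = ?H" using g by (simp add: k_local_lindblad_def Let_def)
  have "cnj (mtrace (pauli_op n P * ?H)) = mtrace (mat_adjoint (pauli_op n P * ?H))"
    by (rule mtrace_adjoint[symmetric, of _ n]) simp
  also have "\<dots> = mtrace (?H * pauli_op n P)" by (simp add: mat_adjoint_mult[where n = n] H)
  also have "\<dots> = mtrace (pauli_op n P * ?H)" by (rule mtrace_comm[of _ "2 ^ n"]) simp_all
  finally show ?thesis using P by (simp add: mtrace_pauli_hamiltonian)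
qed

lemma ham_of_hermitian:
  assumes "e \<in> edges n k"
  shows "mat_adjoint (hamiltonian n (ham_coeff g) {P. supp P = e}) = hamiltonian n (ham_coeff g) {P. supp P = e}"
proof -
  have "mat_adjoint (hamiltonian n (ham_coeff g) {P. supp P = e}) =
    op_sum n (\<lambda>P. mat_adjoint (ham_coeff g P \<cdot>\<^sub>m pauli_op n P)) {P. supp P = e}"
    unfolding hamiltonian_def by (rule mat_adjoint_op_sum) simp
  also have "\<dots> = hamiltonian n (ham_coeff g) {P. supp P = e}"
    unfolding hamiltonian_def
  proof (rule op_sum_cong)
    fix P assume "P \<in> {P. supp P = e}"
    then have "P \<in> paulis n" using edge_paulis(1)[OF g assms] by blast
    then show "mat_adjoint (ham_coeff g P \<cdot>\<^sub>m pauli_op n P) = ham_coeff g P \<cdot>\<^sub>m pauli_op n P"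
      by (simp add: mat_adjoint_linear[where n = n] ham_coeff_real)
  qed
  finally show ?thesis .
qed

text \<open>For an effective Hamiltonian \<open>K\<close> and step size \<open>c\<close> the map \<open>M + c \<L>(M) + c\<^sup>2 K M K\<^sup>*\<close> equals
  \<open>(1 + c K) M (1 + c K)\<^sup>* + c \<Sum> L M L\<^sup>*\<close>.\<close>

definition drift_of :: "nat set \<Rightarrow> complex mat" where
  "drift_of e = (- \<i>) \<cdot>\<^sub>m hamiltonian n (ham_coeff g) {P. supp P = e}
     + (- 1 / 2) \<cdot>\<^sub>m op_sum n (\<lambda>a. mat_adjoint (jumps g e ! a) * (jumps g e ! a)) {..<length (jumps g e)}"

definition drift :: "complex mat" where
  "drift = op_sum n drift_of (edges n k)"

definition jump_part :: "nat set \<Rightarrow> complex mat \<Rightarrow> complex mat" where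
  "jump_part e M = op_sum n (\<lambda>a. (jumps g e ! a) * M * mat_adjoint (jumps g e ! a)) {..<length (jumps g e)}"

lemma drift_carrier [simp]: "drift_of e \<in> operators n" "drift \<in> operators n"
  by (simp_all add: drift_of_def drift_def)

lemma local_term_drift:
  assumes e: "e \<in> edges n k" and M: "M \<in> operators n"
  shows "local_term n g e M = drift_of e * M + M * mat_adjoint (drift_of e) + jump_part e M"
proof -
  let ?H = "hamiltonian n (ham_coeff g) {P. supp P = e}" and ?A = "{..<length (jumps g e)}" and ?J = "\<lambda>a. jumps g e ! a"
  let ?S = "op_sum n (\<lambda>a. mat_adjoint (?J a) * ?J a) ?A"
  have J: "?J a \<in> operators n" if "a \<in> ?A" for a using jump_carrier[OF g e] that by simp
  have JJ: "mat_adjoint (mat_adjoint (?J a) * ?J a) = mat_adjoint (?J a) * ?J a" if "a \<in> ?A" for a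
    using J[OF that] by (simp add: mat_adjoint_mult[where n = n] mat_adjoint_linear[where n = n])
  have S: "mat_adjoint ?S = ?S"
    by (subst mat_adjoint_op_sum) (use J JJ in \<open>auto intro!: op_sum_cong\<close>)
  have adj: "mat_adjoint (drift_of e) = \<i> \<cdot>\<^sub>m ?H + (- 1 / 2) \<cdot>\<^sub>m ?S"
    unfolding drift_of_def using ham_of_hermitian[OF e] S by (simp add: mat_adjoint_linear[where n = n])
  have SM: "?S * M = op_sum n (\<lambda>a. mat_adjoint (?J a) * ?J a * M) ?A"
    "M * ?S = op_sum n (\<lambda>a. M * (mat_adjoint (?J a) * ?J a)) ?A"
    by (rule op_sum_mult mult_op_sum; use J M in simp)+
  show ?thesis
  proof (rule ops_eqI[of _ n])
    fix i j :: nat assume ij: "i < 2 ^ n" "j < 2 ^ n"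
    have d: "dim_row X = 2 ^ n" "dim_col X = 2 ^ n" if "X \<in> operators n" for X :: "complex mat" using that by auto
    have diss: "dissipator (?J a) M $$ (i, j) = (?J a * M * mat_adjoint (?J a)) $$ (i, j) -
       1 / 2 * ((mat_adjoint (?J a) * ?J a * M) $$ (i, j) + (M * (mat_adjoint (?J a) * ?J a)) $$ (i, j))" if a: "a \<in> ?A" for a
    proof -
      have "mat_adjoint (?J a) * ?J a * M \<in> operators n" "M * (mat_adjoint (?J a) * ?J a) \<in> operators n"
        "?J a * M * mat_adjoint (?J a) \<in> operators n" using J[OF a] M by simp_all
      note dd = d[OF this(1)] d[OF this(2)] d[OF this(3)]
      show ?thesis
        unfolding dissipator_def anticommutator_def using ij dd by (simp del: index_mult_mat)
    qed
    have HM: "?H * M \<in> operators n" "M * ?H \<in> operators n" using M by simp_all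
    note dH = d[OF HM(1)] d[OF HM(2)]
    have "local_term n g e M $$ (i, j) = - \<i> * ((?H * M) $$ (i, j) - (M * ?H) $$ (i, j)) + (\<Sum>a\<in>?A. dissipator (?J a) M $$ (i, j))"
      unfolding local_term_def commutator_def using ij dH by (simp add: op_sum_index del: index_mult_mat)
    also have "(\<Sum>a\<in>?A. dissipator (?J a) M $$ (i, j)) = jump_part e M $$ (i, j) - 1 / 2 * ((?S * M) $$ (i, j) + (M * ?S) $$ (i, j))"
      unfolding SM jump_part_def op_sum_index[OF ij]
      by (subst sum.cong[OF refl diss]) (simp_all add: sum_subtractf sum.distrib sum_divide_distrib[symmetric])
    finally have L: "local_term n g e M $$ (i, j) = - \<i> * ((?H * M) $$ (i, j) - (M * ?H) $$ (i, j)) +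
      (jump_part e M $$ (i, j) - 1 / 2 * ((?S * M) $$ (i, j) + (M * ?S) $$ (i, j)))" .
    have "drift_of e * M = (- \<i>) \<cdot>\<^sub>m (?H * M) + (- 1 / 2) \<cdot>\<^sub>m (?S * M)"
      unfolding drift_of_def using M by (simp add: ops_distrib[where n = n])
    moreover have "M * mat_adjoint (drift_of e) = \<i> \<cdot>\<^sub>m (M * ?H) + (- 1 / 2) \<cdot>\<^sub>m (M * ?S)"
      unfolding adj using M by (simp add: ops_distrib[where n = n])
    moreover have SMc: "?S * M \<in> operators n" "M * ?S \<in> operators n" using M by simp_all
    note dS = d[OF SMc(1)] d[OF SMc(2)]
    have "jump_part e M \<in> operators n" by (simp add: jump_part_def)
    note dJ = d[OF this]
    ultimately show "local_term n g e M $$ (i, j) = (drift_of e * M + M * mat_adjoint (drift_of e) + jump_part e M) $$ (i, j)"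
      unfolding L using ij dH dS dJ by (simp add: algebra_simps del: index_mult_mat)
  qed (use e M g in \<open>simp_all add: jump_part_def local_term_carrier\<close>)
qed

lemma Lind_drift:
  assumes M: "M \<in> operators n"
  shows "lindbladian n k g M = drift * M + M * mat_adjoint drift + op_sum n (\<lambda>e. jump_part e M) (edges n k)"
proof -
  have adj: "mat_adjoint drift = op_sum n (\<lambda>e. mat_adjoint (drift_of e)) (edges n k)"
    unfolding drift_def by (rule mat_adjoint_op_sum) simp
  have "drift * M = op_sum n (\<lambda>e. drift_of e * M) (edges n k)"
    unfolding drift_def by (rule op_sum_mult) (use M in simp_all)
  moreover have "M * mat_adjoint drift = op_sum n (\<lambda>e. M * mat_adjoint (drift_of e)) (edges n k)"
    unfolding adj by (rule mult_op_sum) (use M in simp_all)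
  moreover have "lindbladian n k g M = op_sum n (\<lambda>e. drift_of e * M + M * mat_adjoint (drift_of e) + jump_part e M) (edges n k)"
    unfolding lindbladian_def using M by (intro op_sum_cong local_term_drift)
  moreover have "op_sum n (\<lambda>e. drift_of e * M + M * mat_adjoint (drift_of e) + jump_part e M) (edges n k) =
    op_sum n (\<lambda>e. drift_of e * M) (edges n k) + op_sum n (\<lambda>e. M * mat_adjoint (drift_of e)) (edges n k) +
    op_sum n (\<lambda>e. jump_part e M) (edges n k)"
  proof (rule ops_eqI[of _ n])
    fix i j :: nat assume ij: "i < 2 ^ n" "j < 2 ^ n"
    have d: "dim_row X = 2 ^ n" "dim_col X = 2 ^ n" if "X \<in> operators n" for X :: "complex mat" using that by auto
    have c: "drift_of e * M \<in> operators n" "M * mat_adjoint (drift_of e) \<in> operators n" "jump_part e M \<in> operators n" for e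
      using M by (simp_all add: jump_part_def)
    note dd = d[OF c(1)] d[OF c(2)] d[OF c(3)]
    show "op_sum n (\<lambda>e. drift_of e * M + M * mat_adjoint (drift_of e) + jump_part e M) (edges n k) $$ (i, j) =
      (op_sum n (\<lambda>e. drift_of e * M) (edges n k) + op_sum n (\<lambda>e. M * mat_adjoint (drift_of e)) (edges n k) +
       op_sum n (\<lambda>e. jump_part e M) (edges n k)) $$ (i, j)"
      using ij dd by (simp add: op_sum_index sum.distrib del: index_mult_mat)
  qed simp_all
  ultimately show ?thesis by simp
qed

lemma Lind_euler_psd:
  assumes c: "0 \<le> c" and N: "psd n N"
  shows "psd n (N + complex_of_real c \<cdot>\<^sub>m (lindbladian n k g N + complex_of_real c \<cdot>\<^sub>m (drift * N * mat_adjoint drift)))"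
proof -
  let ?c = "complex_of_real c" and ?K = "drift" and ?R = "op_sum n (\<lambda>e. jump_part e N) (edges n k)"
  have Nc: "N \<in> operators n" using N by (simp add: psd_def)
  define Y where "Y = 1\<^sub>m (2 ^ n) + ?c \<cdot>\<^sub>m ?K"
  have Yc: "Y \<in> operators n" by (simp add: Y_def)
  have "psd n (jump_part e N)" if "e \<in> edges n k" for e
    unfolding jump_part_def using jump_carrier[OF g that] N by (intro psd_op_sum psd_conjugate) auto
  then have R: "psd n ?R" by (intro psd_op_sum)
  have "psd n (Y * N * mat_adjoint Y + ?c \<cdot>\<^sub>m ?R)"
    by (intro psd_add_smult psd_conjugate N Yc R c)
  also have "Y * N * mat_adjoint Y + ?c \<cdot>\<^sub>m ?R =
     N + ?c \<cdot>\<^sub>m (lindbladian n k g N + ?c \<cdot>\<^sub>m (?K * N * mat_adjoint ?K))"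
  proof (rule ops_eqI[of _ n])
    fix i j :: nat assume ij: "i < 2 ^ n" "j < 2 ^ n"
    have d: "dim_row X = 2 ^ n" "dim_col X = 2 ^ n" if "X \<in> operators n" for X :: "complex mat" using that by auto
    have adj: "mat_adjoint Y = 1\<^sub>m (2 ^ n) + ?c \<cdot>\<^sub>m mat_adjoint ?K"
      unfolding Y_def by (simp add: mat_adjoint_linear[where n = n])
    have KN: "?K * N \<in> operators n" "N * mat_adjoint ?K \<in> operators n" "?K * N * mat_adjoint ?K \<in> operators n"
      using Nc by simp_all
    have YN: "Y * N = N + ?c \<cdot>\<^sub>m (?K * N)"
      unfolding Y_def using Nc by (simp add: ops_distrib[where n = n])
    have "Y * N * mat_adjoint Y = (N + ?c \<cdot>\<^sub>m (?K * N)) * (1\<^sub>m (2 ^ n)) + (N + ?c \<cdot>\<^sub>m (?K * N)) * (?c \<cdot>\<^sub>m mat_adjoint ?K)"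
      unfolding YN adj using Nc KN by (intro ops_distrib(1)[where n = n]) simp_all
    also have "\<dots> = (N + ?c \<cdot>\<^sub>m (?K * N)) + ?c \<cdot>\<^sub>m (N * mat_adjoint ?K + ?c \<cdot>\<^sub>m (?K * N * mat_adjoint ?K))"
      using Nc KN by (simp add: ops_distrib[where n = n] right_mult_one_mat[of _ "2 ^ n" "2 ^ n"])
    finally have eq: "Y * N * mat_adjoint Y =
      (N + ?c \<cdot>\<^sub>m (?K * N)) + ?c \<cdot>\<^sub>m (N * mat_adjoint ?K + ?c \<cdot>\<^sub>m (?K * N * mat_adjoint ?K))" .
    note dd = d[OF Nc] d[OF KN(1)] d[OF KN(2)] d[OF KN(3)]
    show "(Y * N * mat_adjoint Y + ?c \<cdot>\<^sub>m ?R) $$ (i, j) =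
       (N + ?c \<cdot>\<^sub>m (lindbladian n k g N + ?c \<cdot>\<^sub>m (?K * N * mat_adjoint ?K))) $$ (i, j)"
      unfolding eq Lind_drift[OF Nc] using ij dd by (simp add: algebra_simps del: index_mult_mat)
  qed (use Nc Yc Lind_carrier[OF g] in simp_all)
  finally show ?thesis .
qed

lemma Lind_flow_psd:
  assumes "psd n M" "0 \<le> t"
  shows "psd n (lindblad_flow n (lindbladian n k g) t M)"
  using Lind_dual dual_sandwich[of drift n "mat_adjoint drift"] assms Lind_euler_psd
  by (rule flow_psd) simp_all

lemma mtrace_Lind_flow:
  assumes M: "M \<in> operators n"
  shows "mtrace (lindblad_flow n (lindbladian n k g) t M) = mtrace M"
proof -
  let ?L = "lindbladian n k g" and ?I = "1\<^sub>m (2 ^ n) :: complex mat"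
  have "(\<lambda>m. of_real (t ^ m / fact m) * mtrace (?I * (?L ^^ m) M)) sums mtrace (?I * lindblad_flow n ?L t M)"
    by (rule flow_sums[OF Lind_dual M]) simp
  moreover have "?I * X = X" if "X \<in> operators n" for X using that by (rule left_mult_one_mat)
  ultimately have s: "(\<lambda>m. of_real (t ^ m / fact m) * mtrace ((?L ^^ m) M)) sums mtrace (lindblad_flow n ?L t M)"
    using dual_carrier(3)[OF Lind_dual M] by simp
  have "mtrace ((?L ^^ m) M) = 0" if "m \<noteq> 0" for m
    using that mtrace_Lind[OF g dual_carrier(3)[OF Lind_dual M]] by (cases m) auto
  then have "(\<lambda>m. of_real (t ^ m / fact m) * mtrace ((?L ^^ m) M)) = (\<lambda>m. if m = 0 then mtrace M else 0)"
    by auto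
  then show ?thesis using s sums_single[of 0 "\<lambda>_. mtrace M"] by (simp add: sums_unique2)
qed

end

section \<open>Expectation of one sample\<close>

abbreviation (input) basis_choices :: "nat \<Rightarrow> (nat \<Rightarrow> pauli) set" where
  "basis_choices n \<equiv> PiE_dflt {..<n} PI (\<lambda>_. {PX, PY, PZ})"

abbreviation (input) sign_choices :: "nat \<Rightarrow> (nat \<Rightarrow> bool) set" where
  "sign_choices n \<equiv> PiE_dflt {..<n} False (\<lambda>_. UNIV)"

lemma sum_PiE_dflt_prod:
  fixes f :: "'a \<Rightarrow> 'b \<Rightarrow> complex"
  assumes "finite A" "\<And>x. x \<in> A \<Longrightarrow> finite (B x)"
  shows "(\<Sum>h\<in>PiE_dflt A d B. \<Prod>x\<in>A. f x (h x)) = (\<Prod>x\<in>A. \<Sum>y\<in>B x. f x y)"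
proof -
  have inj: "inj_on (\<lambda>h x. if x \<in> A then h x else d) (PiE A B)"
  proof (rule inj_onI)
    fix g h assume gh: "g \<in> PiE A B" "h \<in> PiE A B" "(\<lambda>x. if x \<in> A then g x else d) = (\<lambda>x. if x \<in> A then h x else d)"
    show "g = h"
    proof
      fix x show "g x = h x"
        using fun_cong[OF gh(3), of x] PiE_arb[OF gh(1), of x] PiE_arb[OF gh(2), of x] by (cases "x \<in> A") auto
    qed
  qed
  have "(\<Sum>h\<in>PiE_dflt A d B. \<Prod>x\<in>A. f x (h x)) = (\<Sum>g\<in>PiE A B. \<Prod>x\<in>A. f x (g x))"
    unfolding dflt_image_PiE[symmetric] sum.reindex[OF inj] by (intro sum.cong refl) simp
  then show ?thesis using prod_sum_PiE[of A B f] assms by simp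
qed

lemma finite_choices [simp]: "finite (basis_choices n)" "finite (sign_choices n)"
  by (intro finite_PiE_dflt; simp)+

lemma card_choices: "card (basis_choices n) = 3 ^ n" "card (sign_choices n) = 2 ^ n"
  by (simp add: card_PiE_dflt numeral_3_eq_3) (simp add: card_PiE_dflt UNIV_bool numeral_2_eq_2)

lemma choices_nonempty [simp]: "basis_choices n \<noteq> {}" "sign_choices n \<noteq> {}"
  by auto

lemma random_bases_uniform: "random_bases n = pmf_of_set (basis_choices n)"
  unfolding random_bases_def by (rule Pi_pmf_of_set) auto

lemma random_signs_uniform: "random_signs n = pmf_of_set (sign_choices n)"
  unfolding random_signs_def by (rule Pi_pmf_of_set) auto

section \<open>Projectors and the Born rule\<close>

lemma eigenprojector_carrier [simp]: "eigenprojector \<sigma> s \<in> carrier_mat 2 2"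
  by (auto simp: eigenprojector_def)

lemma eigenprojector_entries:
  assumes "i < 2" "j < 2"
  shows "eigenprojector \<sigma> s $$ (i, j) = (pauli_mat PI $$ (i, j) + of_real (sign_of s) * pauli_mat \<sigma> $$ (i, j)) / 2"
  using assms by (simp add: eigenprojector_def carrier_matD[OF pauli_mat_carrier])

lemma eigenprojector_projection:
  assumes "\<sigma> \<noteq> PI"
  shows "mat_adjoint (eigenprojector \<sigma> s) = eigenprojector \<sigma> s"
    and "eigenprojector \<sigma> s * eigenprojector \<sigma> s = eigenprojector \<sigma> s"
proof -
  have d: "dim_row (eigenprojector \<sigma> s) = 2" "dim_col (eigenprojector \<sigma> s) = 2"
    by (rule carrier_matD[OF eigenprojector_carrier])+
  show "mat_adjoint (eigenprojector \<sigma> s) = eigenprojector \<sigma> s"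
    using d by (intro eq_matI) (auto simp: less_2_iff eigenprojector_entries pauli_mat_entries)
  show "eigenprojector \<sigma> s * eigenprojector \<sigma> s = eigenprojector \<sigma> s"
  proof (rule eq_matI)
    fix i j assume "i < dim_row (eigenprojector \<sigma> s)" "j < dim_col (eigenprojector \<sigma> s)"
    then have ij: "i < 2" "j < 2" using d by auto
    show "(eigenprojector \<sigma> s * eigenprojector \<sigma> s) $$ (i, j) = eigenprojector \<sigma> s $$ (i, j)"
      unfolding mult_2_entry[OF eigenprojector_carrier eigenprojector_carrier ij]
      using ij assms unfolding less_2_iff
      by (cases \<sigma>; cases s) (auto simp: eigenprojector_entries pauli_mat_entries sign_of_def)
  qed (simp_all add: d)
qed

lemma product_projector_carrier [simp]: "product_projector n \<beta> s \<in> operators n"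
  by (simp add: product_projector_def)

lemma product_projector_projection:
  assumes "\<beta> \<in> basis_choices n"
  shows "mat_adjoint (product_projector n \<beta> s) = product_projector n \<beta> s"
    and "product_projector n \<beta> s * product_projector n \<beta> s = product_projector n \<beta> s"
proof -
  have ne: "\<beta> q \<noteq> PI" if "q < n" for q using assms that by (auto simp: PiE_dflt_def)
  show "mat_adjoint (product_projector n \<beta> s) = product_projector n \<beta> s"
    unfolding product_projector_def using ne
    by (subst mat_adjoint_tensor_op) (auto intro!: tensor_op_cong simp: eigenprojector_projection)
  show "product_projector n \<beta> s * product_projector n \<beta> s = product_projector n \<beta> s"
    unfolding product_projector_def using ne
    by (subst tensor_op_mult) (auto intro!: tensor_op_cong simp: eigenprojector_projection)
qed

lemma psd_product_projector:
  assumes \<beta>: "\<beta> \<in> basis_choices n"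
  shows "psd n (product_projector n \<beta> s)"
proof -
  let ?E = "product_projector n \<beta> s"
  have "psd n (1\<^sub>m (2 ^ n))"
    unfolding psd_def
  proof (intro conjI ballI)
    fix X :: "complex mat" assume X: "X \<in> operators n"
    have d: "dim_row X = 2 ^ n" "dim_col X = 2 ^ n" using X by auto
    have "mat_adjoint X * 1\<^sub>m (2 ^ n) * X = mat_adjoint X * X" using X d by simp
    then have "mtrace (mat_adjoint X * 1\<^sub>m (2 ^ n) * X) = (\<Sum>i<2 ^ n. \<Sum>j<2 ^ n. mat_adjoint X $$ (i, j) * X $$ (j, i))"
      using X by (simp add: mtrace_mult[of _ "2 ^ n"])
    also have "\<dots> = (\<Sum>i<2 ^ n. \<Sum>j<2 ^ n. of_real ((cmod (X $$ (j, i)))\<^sup>2))"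
      using d by (intro sum.cong refl) (simp add: complex_norm_square[symmetric] mult.commute)
    finally show "0 \<le> Re (mtrace (mat_adjoint X * 1\<^sub>m (2 ^ n) * X))"
      by (simp add: sum_nonneg)
  qed simp
  then have "psd n (?E * 1\<^sub>m (2 ^ n) * mat_adjoint ?E)" by (rule psd_conjugate) simp
  moreover have "?E * 1\<^sub>m (2 ^ n) = ?E" by (rule right_mult_one_mat) (rule product_projector_carrier)
  ultimately show ?thesis using product_projector_projection[OF \<beta>, of s] by simp
qed

text \<open>For a projection \<open>E\<close>, \<open>Tr(E \<rho>)\<close> is the trace of \<rho>
  conjugated by \<open>E\<close>, which is the form in which \<open>psd\<close> tests
  positivity.\<close>

lemma born_nonneg:
  assumes \<beta>: "\<beta> \<in> basis_choices n" and \<rho>: "psd n \<rho>"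
  shows "0 \<le> Re (mtrace (product_projector n \<beta> s * \<rho>))"
proof -
  let ?E = "product_projector n \<beta> s"
  have r: "\<rho> \<in> operators n" using \<rho> by (simp add: psd_def)
  have "mtrace (mat_adjoint ?E * \<rho> * ?E) = mtrace (?E * ?E * \<rho>)"
    using mtrace_comm[of "?E * \<rho>" "2 ^ n" ?E] r product_projector_projection(1)[OF \<beta>, of s]
    by (simp add: ops_assoc[where n = n])
  then show ?thesis
    using \<rho> product_projector_projection(2)[OF \<beta>, of s] by (simp add: psd_def) (metis product_projector_carrier)
qed

text \<open>The factor of the overlap estimator at one qubit, continued by 1 off the support, so
  that products run over all qubits and combine with those of the projectors.\<close>

definition weight :: "pstring \<Rightarrow> nat \<Rightarrow> pauli \<Rightarrow> bool \<Rightarrow> real" where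
  "weight P q \<sigma> s = (if P q = PI then 1 else if \<sigma> = P q then 3 * sign_of s else 0)"

lemma supp_prod_weight:
  assumes "P \<in> paulis n"
  shows "(\<Prod>q\<in>supp P. if \<beta> q = P q then 3 * sign_of (s q) else 0) = (\<Prod>q<n. weight P q (\<beta> q) (s q))"
  by (rule prod.mono_neutral_cong_left) (use assms in \<open>auto simp: weight_def paulis_on_def supp_def\<close>)

text \<open>Qubit by qubit: off the support the two projectors of each of the three bases add up to
  the identity, on it only the matching basis contributes, namely 3 times the difference of its
  projectors. Either way the factor is 3.\<close>

lemma average_projector:
  assumes P: "P \<in> paulis n"
  shows "op_sum n (\<lambda>(\<beta>, s). complex_of_real (\<Prod>q<n. weight P q (\<beta> q) (s q)) \<cdot>\<^sub>m product_projector n \<beta> s)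
     (basis_choices n \<times> sign_choices n) = 3 ^ n \<cdot>\<^sub>m pauli_op n P"
proof (rule ops_eqI[of _ n])
  fix a b :: nat assume ab: "a < 2 ^ n" "b < 2 ^ n"
  let ?B = "\<lambda>c q. c div 2 ^ q mod (2::nat)"
  let ?e = "\<lambda>q \<sigma> s. complex_of_real (weight P q \<sigma> s) * eigenprojector \<sigma> s $$ (?B a q, ?B b q)"
  have single: "(\<Sum>\<sigma>\<in>{PX, PY, PZ}. \<Sum>s\<in>UNIV. ?e q \<sigma> s) = 3 * pauli_mat (P q) $$ (?B a q, ?B b q)" for q
  proof -
    define i j where "i = ?B a q" and "j = ?B b q"
    have ij: "i < 2" "j < 2" by (simp_all add: i_def j_def)
    have "(\<Sum>s\<in>UNIV. complex_of_real (weight P q \<sigma> s) * eigenprojector \<sigma> s $$ (i, j)) =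
      (if P q = PI then pauli_mat PI $$ (i, j) else if \<sigma> = P q then 3 * pauli_mat (P q) $$ (i, j) else 0)" for \<sigma>
      using ij by (simp add: UNIV_bool eigenprojector_entries weight_def sign_of_def field_simps)
    then show ?thesis unfolding i_def[symmetric] j_def[symmetric] by (cases "P q") simp_all
  qed
  have "(\<Sum>(\<beta>, s)\<in>basis_choices n \<times> sign_choices n.
       complex_of_real (\<Prod>q<n. weight P q (\<beta> q) (s q)) * product_projector n \<beta> s $$ (a, b)) =
     (\<Sum>\<beta>\<in>basis_choices n. \<Sum>s\<in>sign_choices n. \<Prod>q<n. ?e q (\<beta> q) (s q))"
    unfolding sum.cartesian_product[symmetric] product_projector_def tensor_op_index[OF ab]
    by (simp add: prod.distrib)
  also have "\<dots> = (\<Sum>\<beta>\<in>basis_choices n. \<Prod>q<n. \<Sum>s\<in>UNIV. ?e q (\<beta> q) s)"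
    by (intro sum.cong refl sum_PiE_dflt_prod[of "{..<n}" "\<lambda>_. UNIV" "\<lambda>q s. ?e q (\<beta> q) s" False for \<beta>]) simp_all
  also have "\<dots> = (\<Prod>q<n. \<Sum>\<sigma>\<in>{PX, PY, PZ}. \<Sum>s\<in>UNIV. ?e q \<sigma> s)"
    by (rule sum_PiE_dflt_prod[of "{..<n}" "\<lambda>_. {PX, PY, PZ}" "\<lambda>q \<sigma>. \<Sum>s\<in>UNIV. ?e q \<sigma> s" PI]) simp_all
  also have "\<dots> = 3 ^ n * pauli_op n P $$ (a, b)"
    unfolding single by (simp add: prod.distrib pauli_op_def tensor_op_index[OF ab])
  finally show "op_sum n (\<lambda>(\<beta>, s). complex_of_real (\<Prod>q<n. weight P q (\<beta> q) (s q)) \<cdot>\<^sub>m product_projector n \<beta> s)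
     (basis_choices n \<times> sign_choices n) $$ (a, b) = (3 ^ n \<cdot>\<^sub>m pauli_op n P) $$ (a, b)"
  proof -
    assume *: "(\<Sum>(\<beta>, s)\<in>basis_choices n \<times> sign_choices n.
       complex_of_real (\<Prod>q<n. weight P q (\<beta> q) (s q)) * product_projector n \<beta> s $$ (a, b)) = 3 ^ n * pauli_op n P $$ (a, b)"
    have "dim_row (product_projector n \<beta> s) = 2 ^ n" "dim_col (product_projector n \<beta> s) = 2 ^ n" for \<beta> s
      by (simp_all add: product_projector_def)
    then show ?thesis using * ab by (simp add: op_sum_index case_prod_unfold)
  qed
qed simp_all

lemma sum_product_projector:
  assumes \<beta>: "\<beta> \<in> basis_choices n"
  shows "op_sum n (\<lambda>s. product_projector n \<beta> s) (sign_choices n) = 1\<^sub>m (2 ^ n)"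
proof (rule ops_eqI[of _ n])
  fix a b :: nat assume ab: "a < 2 ^ n" "b < 2 ^ n"
  let ?B = "\<lambda>c q. c div 2 ^ q mod (2::nat)"
  have "(\<Sum>s\<in>sign_choices n. product_projector n \<beta> s $$ (a, b)) =
     (\<Sum>s\<in>sign_choices n. \<Prod>q<n. eigenprojector (\<beta> q) (s q) $$ (?B a q, ?B b q))"
    unfolding product_projector_def tensor_op_index[OF ab] ..
  also have "\<dots> = (\<Prod>q<n. \<Sum>s\<in>UNIV. eigenprojector (\<beta> q) s $$ (?B a q, ?B b q))"
    by (rule sum_PiE_dflt_prod[of "{..<n}" "\<lambda>_. UNIV" "\<lambda>q s. eigenprojector (\<beta> q) s $$ (?B a q, ?B b q)" False]) simp_all
  also have "\<dots> = (\<Prod>q<n. pauli_mat (id_string q) $$ (?B a q, ?B b q))"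
    by (intro prod.cong refl) (simp add: UNIV_bool eigenprojector_entries sign_of_def id_string_def field_simps)
  also have "\<dots> = pauli_op n id_string $$ (a, b)" by (simp add: pauli_op_def tensor_op_index[OF ab])
  finally show "op_sum n (\<lambda>s. product_projector n \<beta> s) (sign_choices n) $$ (a, b) = 1\<^sub>m (2 ^ n) $$ (a, b)"
    using ab by (simp add: op_sum_index pauli_op_id)
qed simp_all

lemma mtrace_product_projector:
  assumes "\<beta> \<in> basis_choices n"
  shows "mtrace (product_projector n \<beta> s) = 1"
proof -
  have "mtrace (eigenprojector (\<beta> q) (s q)) = 1" if "q < n" for q
    unfolding mtrace_2[OF eigenprojector_carrier] using assms that
    by (auto simp: PiE_dflt_def eigenprojector_entries pauli_mat_entries simp flip: add_divide_distrib)
  then show ?thesis by (simp add: product_projector_def mtrace_tensor_op)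
qed

lemma sign_choices_iff: "r \<in> sign_choices n \<longleftrightarrow> (\<forall>q\<ge>n. \<not> r q)"
  by (auto simp: PiE_dflt_def)

text \<open>\<open>embed_pmf\<close> has the prescribed weights only if they are nonnegative and add
  up to 1. This is where positivity and unit trace of the evolved state enter.\<close>

lemma pmf_measure_outcome:
  assumes \<gamma>: "\<gamma> \<in> basis_choices n" and \<rho>: "psd n \<rho>" "mtrace \<rho> = 1"
  shows "pmf (measure_outcome n \<gamma> \<rho>) r =
    (if r \<in> sign_choices n then Re (mtrace (product_projector n \<gamma> r * \<rho>)) else 0)"
    and "set_pmf (measure_outcome n \<gamma> \<rho>) \<subseteq> sign_choices n"
proof -
  let ?f = "\<lambda>r. if \<forall>q\<ge>n. \<not> r q then Re (mtrace (product_projector n \<gamma> r * \<rho>)) else 0"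
  have r: "\<rho> \<in> operators n" using \<rho> by (simp add: psd_def)
  have nonneg: "0 \<le> ?f r" for r using born_nonneg[OF \<gamma> \<rho>(1)] by simp
  have "(\<Sum>r\<in>sign_choices n. mtrace (product_projector n \<gamma> r * \<rho>)) = mtrace (op_sum n (\<lambda>r. product_projector n \<gamma> r) (sign_choices n) * \<rho>)"
    using r by (simp add: op_sum_mult mtrace_op_sum[where n = n])
  also have "\<dots> = 1"
    unfolding sum_product_projector[OF \<gamma>] using \<rho>(2) left_mult_one_mat[OF r] by simp
  finally have "(\<Sum>r\<in>sign_choices n. Re (mtrace (product_projector n \<gamma> r * \<rho>))) = 1"
    by (metis Re_sum one_complex.sel(1))
  then have sum1: "(\<Sum>r\<in>sign_choices n. ?f r) = 1"
    by (simp add: sign_choices_iff[symmetric])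
  have "(\<integral>\<^sup>+ r. ennreal (?f r) \<partial>count_space UNIV) = (\<Sum>r\<in>sign_choices n. ennreal (?f r))"
    by (intro nn_integral_count_space') (auto simp: sign_choices_iff)
  also have "\<dots> = ennreal (\<Sum>r\<in>sign_choices n. ?f r)" using nonneg by (intro sum_ennreal)
  finally have prob: "(\<integral>\<^sup>+ r. ennreal (?f r) \<partial>count_space UNIV) = 1" using sum1 by simp
  show "pmf (measure_outcome n \<gamma> \<rho>) r =
    (if r \<in> sign_choices n then Re (mtrace (product_projector n \<gamma> r * \<rho>)) else 0)"
    unfolding measure_outcome_def pmf_embed_pmf[OF nonneg prob] sign_choices_iff ..
  show "set_pmf (measure_outcome n \<gamma> \<rho>) \<subseteq> sign_choices n"
    unfolding measure_outcome_def set_embed_pmf[OF nonneg prob] by (auto simp: sign_choices_iff)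
qed

lemma overlap_estimator_bound:
  assumes "card (supp P) \<le> k" "card (supp Q) \<le> k"
  shows "\<bar>overlap_estimator P Q x\<bar> \<le> 9 ^ k"
proof -
  obtain \<beta> s \<gamma> r where x: "x = (\<beta>, s, \<gamma>, r)" by (metis prod_cases4)
  have b: "\<bar>\<Prod>q\<in>supp R. if \<delta> q = R q then 3 * sign_of (u q) else 0\<bar> \<le> 3 ^ k" if "card (supp R) \<le> k" for R \<delta> u
  proof -
    have "\<bar>\<Prod>q\<in>supp R. if \<delta> q = R q then 3 * sign_of (u q) else 0\<bar> \<le> (\<Prod>q\<in>supp R. 3)"
      unfolding abs_prod by (intro prod_mono) (auto simp: sign_of_def)
    also have "\<dots> = 3 ^ card (supp R)" by simp
    also have "\<dots> \<le> 3 ^ k" using that by (intro power_increasing) auto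
    finally show ?thesis .
  qed
  have "\<bar>overlap_estimator P Q x\<bar> \<le> 3 ^ k * 3 ^ k"
    unfolding overlap_estimator_def x prod.case abs_mult using assms by (intro mult_mono b) auto
  then show ?thesis by (simp flip: power_mult_distrib)
qed

lemma expectation_component:
  fixes f :: "'a \<Rightarrow> real"
  assumes "finite I"
  shows "measure_pmf.expectation (Pi_pmf I d p) (\<lambda>D. f (D j)) = (if j \<in> I then measure_pmf.expectation (p j) f else f d)"
proof -
  have "measure_pmf.expectation (Pi_pmf I d p) (\<lambda>D. f (D j)) = measure_pmf.expectation (map_pmf (\<lambda>D. D j) (Pi_pmf I d p)) f"
    by simp
  also have "map_pmf (\<lambda>D. D j) (Pi_pmf I d p) = (if j \<in> I then p j else return_pmf d)"
    by (rule Pi_pmf_component[OF assms])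
  finally show ?thesis by simp
qed

text \<open>The estimator of one sample is bounded, so that Hoeffding's inequality applies to plain means: neither
  several batches nor rounds of refinement are needed.\<close>

definition simple_plan :: "real \<Rightarrow> nat \<Rightarrow> nat \<Rightarrow> plan" where
  "simple_plan T d M = \<lparr>fit_degree = d, fit_cells = 1, fit_rounds = 0, fit_times = cheb_nodes T d,
     batches = 1, batch_size = M\<rparr>"

lemma median_of_means_single:
  "median_of_means (simple_plan T d M) D P Q i = (\<Sum>j<M. overlap_estimator P Q (D (i, 0, j))) / real M"
  by (simp add: median_of_means_def simple_plan_def median_def mean_def interv_sum_list_conv_sum_set_nat atLeast0LessThan)

context
  fixes n k :: nat and g :: lindblad_data
  assumes g: "k_local_lindblad n k g"
begin

abbreviation (input) "overlap \<equiv> \<lambda>P Q t. Re (mtrace (pauli_op n P * lindblad_flow n (lindbladian n k g) t (pauli_op n Q))) / 2 ^ n"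

text \<open>The Born weight is linear in the prepared and in the measured projector, so
  \<open>average_projector\<close> applies to both. The two factors \<open>3 ^ n\<close> cancel the
  probabilities of the bases, and the uniform preparation signs leave the normalisation
  \<open>2 ^ n\<close>.\<close>

lemma expectation_sample:
  assumes PQ: "P \<in> paulis n" "Q \<in> paulis n" and t: "0 \<le> t"
  shows "measure_pmf.expectation (sample_pmf n (lindbladian n k g) t) (overlap_estimator P Q) = overlap P Q t"
proof -
  let ?F = "lindblad_flow n (lindbladian n k g) t" and ?E = "product_projector n"
  let ?w = "\<lambda>P \<beta> s. \<Prod>q<n. weight P q (\<beta> q) (s q)"
  let ?Bs = "basis_choices n" and ?Ss = "sign_choices n"
  have \<rho>: "psd n (?F (?E \<beta> s))" "mtrace (?F (?E \<beta> s)) = 1" if "\<beta> \<in> ?Bs" for \<beta> s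
    using Lind_flow_psd[OF g psd_product_projector[OF that] t] mtrace_Lind_flow[OF g product_projector_carrier]
      mtrace_product_projector[OF that] by simp_all
  have fin: "finite (set_pmf (measure_outcome n \<gamma> (?F (?E \<beta> s))))" if "\<beta> \<in> ?Bs" "\<gamma> \<in> ?Bs" for \<beta> s \<gamma>
    using pmf_measure_outcome(2)[OF that(2) \<rho>[OF that(1)]] by (rule finite_subset) simp
  have outcome: "measure_pmf.expectation (measure_outcome n \<gamma> (?F (?E \<beta> s)) \<bind> (\<lambda>r. return_pmf (\<beta>, s, \<gamma>, r))) (overlap_estimator P Q) =
      (\<Sum>r\<in>?Ss. ?w Q \<beta> s * ?w P \<gamma> r * Re (mtrace (?E \<gamma> r * ?F (?E \<beta> s))))"
    if b: "\<beta> \<in> ?Bs" "\<gamma> \<in> ?Bs" for \<beta> s \<gamma>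
    by (subst pmf_expectation_bind[of ?Ss])
       (use pmf_measure_outcome[OF b(2) \<rho>[OF b(1)]] in
        \<open>auto simp: overlap_estimator_def supp_prod_weight[OF PQ(1)] supp_prod_weight[OF PQ(2)] mult_ac intro!: sum.cong\<close>)
  have "measure_pmf.expectation (sample_pmf n (lindbladian n k g) t) (overlap_estimator P Q) =
    (\<Sum>\<beta>\<in>?Bs. \<Sum>s\<in>?Ss. \<Sum>\<gamma>\<in>?Bs. \<Sum>r\<in>?Ss. ?w Q \<beta> s * ?w P \<gamma> r * Re (mtrace (?E \<gamma> r * ?F (?E \<beta> s))) / (3 ^ n * 2 ^ n * 3 ^ n))"
  proof -
    have fin3: "finite (set_pmf (random_bases n \<bind> (\<lambda>\<gamma>. measure_outcome n \<gamma> (?F (?E \<beta> s)) \<bind> (\<lambda>r. return_pmf (\<beta>, s, \<gamma>, r)))))"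
      if "\<beta> \<in> ?Bs" for \<beta> s
      using fin[OF that] by (auto simp: random_bases_uniform)
    have e3: "measure_pmf.expectation (random_bases n \<bind> (\<lambda>\<gamma>. measure_outcome n \<gamma> (?F (?E \<beta> s)) \<bind> (\<lambda>r. return_pmf (\<beta>, s, \<gamma>, r)))) (overlap_estimator P Q) =
       (\<Sum>\<gamma>\<in>?Bs. (\<Sum>r\<in>?Ss. ?w Q \<beta> s * ?w P \<gamma> r * Re (mtrace (?E \<gamma> r * ?F (?E \<beta> s)))) / 3 ^ n)"
      if "\<beta> \<in> ?Bs" for \<beta> s
      unfolding random_bases_uniform
      by (subst pmf_expectation_bind_pmf_of_set)
         (use fin[OF that] outcome[OF that] in \<open>auto simp: card_choices divide_inverse mult.commute intro!: sum.cong\<close>)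
    have fin2: "finite (set_pmf (random_signs n \<bind> (\<lambda>s. random_bases n \<bind> (\<lambda>\<gamma>. measure_outcome n \<gamma> (?F (?E \<beta> s)) \<bind> (\<lambda>r. return_pmf (\<beta>, s, \<gamma>, r))))))"
      if "\<beta> \<in> ?Bs" for \<beta>
      using fin3[OF that] by (auto simp: random_signs_uniform)
    have e2: "measure_pmf.expectation (random_signs n \<bind> (\<lambda>s. random_bases n \<bind> (\<lambda>\<gamma>. measure_outcome n \<gamma> (?F (?E \<beta> s)) \<bind> (\<lambda>r. return_pmf (\<beta>, s, \<gamma>, r))))) (overlap_estimator P Q) =
       (\<Sum>s\<in>?Ss. (\<Sum>\<gamma>\<in>?Bs. (\<Sum>r\<in>?Ss. ?w Q \<beta> s * ?w P \<gamma> r * Re (mtrace (?E \<gamma> r * ?F (?E \<beta> s)))) / 3 ^ n) / 2 ^ n)"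
      if "\<beta> \<in> ?Bs" for \<beta>
      unfolding random_signs_uniform
      by (subst pmf_expectation_bind_pmf_of_set)
         (use fin3[OF that] e3[OF that] in \<open>auto simp: card_choices divide_inverse mult.commute intro!: sum.cong\<close>)
    have "measure_pmf.expectation (sample_pmf n (lindbladian n k g) t) (overlap_estimator P Q) =
       (\<Sum>\<beta>\<in>?Bs. (\<Sum>s\<in>?Ss. (\<Sum>\<gamma>\<in>?Bs. (\<Sum>r\<in>?Ss. ?w Q \<beta> s * ?w P \<gamma> r * Re (mtrace (?E \<gamma> r * ?F (?E \<beta> s)))) / 3 ^ n) / 2 ^ n) / 3 ^ n)"
      unfolding sample_pmf_def random_bases_uniform[of n]
      unfolding random_bases_uniform[symmetric]
      by (subst (1) random_bases_uniform, subst pmf_expectation_bind_pmf_of_set)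
         (use fin2 e2 in \<open>auto simp: card_choices divide_inverse mult.commute intro!: sum.cong\<close>)
    then show ?thesis by (simp add: sum_divide_distrib mult_ac)
  qed
  also have "\<dots> = Re (\<Sum>\<beta>\<in>?Bs. \<Sum>s\<in>?Ss. \<Sum>\<gamma>\<in>?Bs. \<Sum>r\<in>?Ss.
      complex_of_real (?w Q \<beta> s) * (complex_of_real (?w P \<gamma> r) * mtrace (?E \<gamma> r * ?F (?E \<beta> s)))) / (3 ^ n * 2 ^ n * 3 ^ n)"
    by (simp add: sum_divide_distrib mult_ac del: of_real_prod)
  also have "(\<Sum>\<beta>\<in>?Bs. \<Sum>s\<in>?Ss. \<Sum>\<gamma>\<in>?Bs. \<Sum>r\<in>?Ss.
      complex_of_real (?w Q \<beta> s) * (complex_of_real (?w P \<gamma> r) * mtrace (?E \<gamma> r * ?F (?E \<beta> s)))) =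
      3 ^ n * (3 ^ n * mtrace (pauli_op n P * ?F (pauli_op n Q)))"
  proof -
    have inner: "(\<Sum>\<gamma>\<in>?Bs. \<Sum>r\<in>?Ss. complex_of_real (?w P \<gamma> r) * mtrace (?E \<gamma> r * Z)) = 3 ^ n * mtrace (pauli_op n P * Z)"
      if Z: "Z \<in> operators n" for Z
    proof -
      have "(\<Sum>\<gamma>\<in>?Bs. \<Sum>r\<in>?Ss. complex_of_real (?w P \<gamma> r) * mtrace (?E \<gamma> r * Z)) =
        (\<Sum>u\<in>?Bs \<times> ?Ss. complex_of_real (?w P (fst u) (snd u)) * mtrace (Z * ?E (fst u) (snd u)))"
        using Z mtrace_comm[OF Z, of "?E \<gamma> r" for \<gamma> r] by (simp add: sum.cartesian_product case_prod_unfold)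
      also have "\<dots> = mtrace (Z * op_sum n (\<lambda>u. complex_of_real (?w P (fst u) (snd u)) \<cdot>\<^sub>m ?E (fst u) (snd u)) (?Bs \<times> ?Ss))"
        by (rule mtrace_mult_op_sum[symmetric]) (use Z in simp_all)
      also have "\<dots> = mtrace (Z * (3 ^ n \<cdot>\<^sub>m pauli_op n P))"
        using average_projector[OF PQ(1)] by (simp only: case_prod_unfold)
      also have "\<dots> = 3 ^ n * mtrace (pauli_op n P * Z)"
        using Z mtrace_comm[OF Z, of "pauli_op n P"] by (simp add: ops_distrib[where n = n] mtrace_linear[where n = n])
      finally show ?thesis .
    qed
    have "(\<Sum>\<beta>\<in>?Bs. \<Sum>s\<in>?Ss. \<Sum>\<gamma>\<in>?Bs. \<Sum>r\<in>?Ss.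
      complex_of_real (?w Q \<beta> s) * (complex_of_real (?w P \<gamma> r) * mtrace (?E \<gamma> r * ?F (?E \<beta> s)))) =
      (\<Sum>\<beta>\<in>?Bs. \<Sum>s\<in>?Ss. complex_of_real (?w Q \<beta> s) * (3 ^ n * mtrace (pauli_op n P * ?F (?E \<beta> s))))"
      unfolding sum_distrib_left[symmetric] by (subst inner) (simp_all only: lindblad_flow_carrier)
    also have "\<dots> = 3 ^ n * (\<Sum>u\<in>?Bs \<times> ?Ss. complex_of_real (?w Q (fst u) (snd u)) * mtrace (pauli_op n P * ?F (?E (fst u) (snd u))))"
      unfolding sum_distrib_left sum.cartesian_product by (intro sum.cong refl) (simp only: case_prod_unfold mult_ac)
    also have "\<dots> = 3 ^ n * mtrace (pauli_op n P * ?F (op_sum n (\<lambda>u. complex_of_real (?w Q (fst u) (snd u)) \<cdot>\<^sub>m ?E (fst u) (snd u)) (?Bs \<times> ?Ss)))"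
      by (subst flow_op_sum[OF Lind_dual[OF g]]) simp_all
    also have "op_sum n (\<lambda>u. complex_of_real (?w Q (fst u) (snd u)) \<cdot>\<^sub>m ?E (fst u) (snd u)) (?Bs \<times> ?Ss) = 3 ^ n \<cdot>\<^sub>m pauli_op n Q"
      using average_projector[OF PQ(2)] by (simp only: case_prod_unfold)
    \<comment> \<open>Homogeneity of the flow is obtained from its linearity on operator sums, here
      with a single summand.\<close>
    also have "3 ^ n \<cdot>\<^sub>m pauli_op n Q = op_sum n (\<lambda>u. 3 ^ n \<cdot>\<^sub>m pauli_op n Q) {()}"
      by (intro ops_eqI[of _ n]) (simp_all add: op_sum_index)
    also have "mtrace (pauli_op n P * ?F \<dots>) = 3 ^ n * mtrace (pauli_op n P * ?F (pauli_op n Q))"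
      by (subst flow_op_sum[OF Lind_dual[OF g]]) simp_all
    finally show ?thesis .
  qed
  also have "Re (3 ^ n * (3 ^ n * mtrace (pauli_op n P * ?F (pauli_op n Q)))) / (3 ^ n * 2 ^ n * 3 ^ n) =
    Re (mtrace (pauli_op n P * ?F (pauli_op n Q))) / 2 ^ n"
  proof -
    have "(3::complex) ^ n = complex_of_real (3 ^ n)" by simp
    then show ?thesis by (simp only: times_complex.sel Re_complex_of_real Im_complex_of_real) simp
  qed
  finally show ?thesis .
qed

text \<open>Hoeffding's inequality for \<open>M\<close> independent variables in an interval of
  length \<open>2 * 9 ^ k\<close>, whose square is \<open>4 * 81 ^ k\<close>.\<close>

lemma overlap_deviation:
  assumes PQ: "P \<in> paulis n" "Q \<in> paulis n" "card (supp P) \<le> k" "card (supp Q) \<le> k"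
    and T: "0 \<le> T" and i: "i \<le> d" and M: "0 < M" and \<eta>: "0 \<le> \<eta>"
  shows "measure_pmf.prob (data_pmf n (lindbladian n k g) (simple_plan T d M))
      {D. \<eta> \<le> \<bar>median_of_means (simple_plan T d M) D P Q i - overlap P Q (cheb_nodes T d ! i)\<bar>}
    \<le> 2 * exp (- (real M * \<eta>\<^sup>2 / (2 * 81 ^ k)))"
proof -
  let ?\<pi> = "simple_plan T d M" and ?t = "cheb_nodes T d ! i"
  let ?I = "{..<Suc d} \<times> {..<1::nat} \<times> {..<M}"
  let ?J = "(\<lambda>j. (i, 0::nat, j)) ` {..<M}"
  let ?p = "\<lambda>(i, c, j). sample_pmf n (lindbladian n k g) (cheb_nodes T d ! i)"
  let ?X = "\<lambda>u (D::data). overlap_estimator P Q (D u)"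
  have data: "data_pmf n (lindbladian n k g) ?\<pi> = Pi_pmf ?I undefined ?p"
    by (simp add: data_pmf_def simple_plan_def)
  define DM where "DM = measure_pmf (Pi_pmf ?I undefined ?p)"
  interpret D: prob_space DM unfolding DM_def by (rule measure_pmf.prob_space_axioms)
  have "cheb_nodes T d ! i \<in> set (cheb_nodes T d)" using i by (intro nth_mem) simp
  then have t: "0 \<le> ?t" using cheb_nodes_bounds[OF T, of d] by auto
  have J: "?J \<subseteq> ?I" using i by auto
  have "D.indep_vars (\<lambda>_. count_space UNIV) (\<lambda>u f. f u) ?I"
    unfolding DM_def by (rule indep_vars_Pi_pmf) simp
  then have "D.indep_vars (\<lambda>_. count_space UNIV) (\<lambda>u f. f u) ?J" using J by (rule D.indep_vars_subset)
  then have "D.indep_vars (\<lambda>_. borel) (\<lambda>u f. overlap_estimator P Q (f u)) ?J"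
    by (rule D.indep_vars_compose2) simp
  then interpret H: indep_interval_bounded_random_variables DM ?J ?X "\<lambda>_. - (9 ^ k)" "\<lambda>_. 9 ^ k"
    using overlap_estimator_bound[OF PQ(3,4)]
    by unfold_locales (auto simp: abs_le_iff minus_le_iff)
  define \<mu> where "\<mu> = (\<Sum>u\<in>?J. D.expectation (?X u))"
  interpret H: Hoeffding_ineq DM ?J ?X "\<lambda>_. - (9 ^ k)" "\<lambda>_. 9 ^ k" \<mu>
    by unfold_locales (simp add: \<mu>_def)
  have inj: "inj_on (\<lambda>j. (i, 0::nat, j)) {..<M}" by (auto simp: inj_on_def)
  have E: "D.expectation (?X u) = overlap P Q ?t" if u: "u \<in> ?J" for u
  proof -
    have "D.expectation (?X u) = measure_pmf.expectation (?p u) (overlap_estimator P Q)"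
      unfolding DM_def using u J by (subst expectation_component) auto
    also have "?p u = sample_pmf n (lindbladian n k g) ?t" using u by auto
    finally show ?thesis using expectation_sample[OF PQ(1,2) t] by simp
  qed
  have mu: "\<mu> = real M * overlap P Q ?t"
    unfolding \<mu>_def by (subst sum.cong[OF refl E]) (simp_all add: card_image[OF inj])
  have nine: "(9 ^ k - - (9 ^ k :: real))\<^sup>2 = 4 * 81 ^ k"
    by (simp add: power2_eq_square algebra_simps flip: power_mult_distrib)
  have S: "(\<Sum>u\<in>?J. (9 ^ k - - (9 ^ k :: real))\<^sup>2) = real M * (4 * 81 ^ k)"
    unfolding nine by (simp add: card_image[OF inj])
  have "D.prob {D\<in>space DM. \<bar>(\<Sum>u\<in>?J. ?X u D) - \<mu>\<bar> \<ge> real M * \<eta>}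
      \<le> 2 * exp (-2 * (real M * \<eta>)\<^sup>2 / (\<Sum>u\<in>?J. (9 ^ k - - (9 ^ k :: real))\<^sup>2))"
    by (rule H.Hoeffding_ineq_abs_ge) (use M \<eta> in \<open>simp_all only: S, simp_all\<close>)
  also have "-2 * (real M * \<eta>)\<^sup>2 / (\<Sum>u\<in>?J. (9 ^ k - - (9 ^ k :: real))\<^sup>2) = - (real M * \<eta>\<^sup>2 / (2 * 81 ^ k))"
    unfolding S using M by (simp add: power2_eq_square field_simps)
  also have "{D\<in>space DM. \<bar>(\<Sum>u\<in>?J. ?X u D) - \<mu>\<bar> \<ge> real M * \<eta>} =
     {D. \<eta> \<le> \<bar>median_of_means ?\<pi> D P Q i - overlap P Q ?t\<bar>}"
  proof -
    have "(\<bar>(\<Sum>u\<in>?J. ?X u D) - \<mu>\<bar> \<ge> real M * \<eta>) = (\<eta> \<le> \<bar>median_of_means ?\<pi> D P Q i - overlap P Q ?t\<bar>)" for D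
    proof -
      have "(\<Sum>u\<in>?J. ?X u D) = (\<Sum>j<M. overlap_estimator P Q (D (i, 0, j)))"
        by (subst sum.reindex[OF inj]) simp
      then have "(\<Sum>u\<in>?J. ?X u D) - \<mu> = real M * (median_of_means ?\<pi> D P Q i - overlap P Q ?t)"
        unfolding median_of_means_single mu using M by (simp add: right_diff_distrib)
      then have "\<bar>(\<Sum>u\<in>?J. ?X u D) - \<mu>\<bar> = real M * \<bar>median_of_means ?\<pi> D P Q i - overlap P Q ?t\<bar>"
        by (simp only: abs_mult abs_of_nat)
      then show ?thesis using M by simp
    qed
    then show ?thesis by (simp add: DM_def)
  qed
  finally show ?thesis unfolding data DM_def .
qed

text \<open>In the form of \<open>Lind_drift\<close> the two drift terms are exchanged by taking
  adjoints, while each jump term keeps its shape.\<close>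

lemma adjoint_Lind:
  assumes M: "M \<in> operators n"
  shows "mat_adjoint (lindbladian n k g M) = lindbladian n k g (mat_adjoint M)"
proof -
  let ?K = "drift n k g" and ?J = "\<lambda>M. op_sum n (\<lambda>e. jump_part n g e M) (edges n k)"
  have jp: "mat_adjoint (jump_part n g e M) = jump_part n g e (mat_adjoint M)" if e: "e \<in> edges n k" for e
  proof -
    have J: "jumps g e ! a \<in> operators n" if "a \<in> {..<length (jumps g e)}" for a
      using jump_carrier[OF g e] that by simp
    have "mat_adjoint (jump_part n g e M) = op_sum n (\<lambda>a. mat_adjoint (jumps g e ! a * M * mat_adjoint (jumps g e ! a))) {..<length (jumps g e)}"
      unfolding jump_part_def[OF g] by (rule mat_adjoint_op_sum) (use J M in simp)
    also have "\<dots> = jump_part n g e (mat_adjoint M)"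
      unfolding jump_part_def[OF g]
    proof (rule op_sum_cong)
      fix a assume "a \<in> {..<length (jumps g e)}"
      then have "jumps g e ! a \<in> operators n" by (rule J)
      then show "mat_adjoint (jumps g e ! a * M * mat_adjoint (jumps g e ! a)) = jumps g e ! a * mat_adjoint M * mat_adjoint (jumps g e ! a)"
        using M by (simp add: mat_adjoint_mult[where n = n] mat_adjoint_linear[where n = n] ops_assoc[where n = n])
    qed
    finally show ?thesis .
  qed
  have jc: "jump_part n g e M \<in> operators n" for e M by (simp add: jump_part_def[OF g])
  have "mat_adjoint (?J M) = ?J (mat_adjoint M)"
    by (subst mat_adjoint_op_sum) (use jc jp in \<open>auto intro!: op_sum_cong\<close>)
  then have "mat_adjoint (?K * M + M * mat_adjoint ?K + ?J M) = mat_adjoint M * mat_adjoint ?K + ?K * mat_adjoint M + ?J (mat_adjoint M)"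
    using M drift_carrier(2)[OF g]
    by (simp add: mat_adjoint_mult[where n = n] mat_adjoint_linear[where n = n])
  also have "mat_adjoint M * mat_adjoint ?K + ?K * mat_adjoint M = ?K * mat_adjoint M + mat_adjoint M * mat_adjoint ?K"
    by (rule comm_add_mat[of _ "2 ^ n" "2 ^ n"]) (use M drift_carrier(2)[OF g] in simp_all)
  finally show ?thesis
    using Lind_drift[OF g M] Lind_drift[OF g, of "mat_adjoint M"] M by simp
qed

text \<open>The estimates are real and approximate the real parts of the entries; preservation of
  Hermiticity makes these the entries themselves.\<close>

lemma ptm_real:
  "mtrace (pauli_op n P * lindbladian n k g (pauli_op n Q)) = of_real (Re (mtrace (pauli_op n P * lindbladian n k g (pauli_op n Q))))"
proof -
  let ?L = "lindbladian n k g (pauli_op n Q)"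
  have L: "?L \<in> operators n" by (rule Lind_carrier[OF g])
  have "cnj (mtrace (pauli_op n P * ?L)) = mtrace (mat_adjoint (pauli_op n P * ?L))"
    by (rule mtrace_adjoint[symmetric, of _ n]) (use L in simp)
  also have "\<dots> = mtrace (?L * pauli_op n P)"
    using L by (simp add: mat_adjoint_mult[where n = n] adjoint_Lind)
  also have "\<dots> = mtrace (pauli_op n P * ?L)" by (rule mtrace_comm[of _ "2 ^ n"]) (use L in simp_all)
  finally show ?thesis by (simp add: complex_eq_iff)
qed

text \<open>The factorial in \<open>ptm_power_bound\<close> cancels that of the exponential series,
  so up to time \<open>1 / (4 * \<alpha> * k)\<close> the \<open>m\<close>-th Taylor term is at most
  \<open>(1 / 4) ^ m\<close>; the terms beyond \<open>d\<close> add up to a third of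
  \<open>(1 / 4) ^ d\<close>. From degree 1 on, the derivative at 0 is exact.\<close>

lemma taylor_polynomial:
  assumes \<alpha>: "interaction_strength n k g \<le> \<alpha>" "0 < \<alpha>" and k: "1 \<le> k"
    and PQ: "P \<in> paulis n" "Q \<in> paulis n" "card (supp P) \<le> k" and d: "1 \<le> d"
  obtains q where "degree q \<le> d" "poly (pderiv q) 0 = Re (mtrace (pauli_op n P * lindbladian n k g (pauli_op n Q))) / 2 ^ n"
    "\<And>t. 0 \<le> t \<Longrightarrow> t \<le> 1 / (4 * \<alpha> * real k) \<Longrightarrow> \<bar>overlap P Q t - poly q t\<bar> \<le> (1 / 4) ^ d"
proof -
  let ?L = "lindbladian n k g"
  define c where "c = (\<lambda>m. Re (mtrace (pauli_op n P * (?L ^^ m) (pauli_op n Q))) / 2 ^ n)"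
  define q where "q = (\<Sum>m\<le>d. monom (c m / fact m) m)"
  have q: "poly q t = (\<Sum>m\<le>d. c m / fact m * t ^ m)" for t by (simp add: q_def poly_sum poly_monom)
  have "degree q \<le> d" unfolding q_def by (intro degree_sum_le) (auto intro: order_trans[OF degree_monom_le])
  moreover have "poly (pderiv q) 0 = c 1"
  proof -
    have "poly (pderiv q) 0 = coeff (pderiv q) 0" by (simp add: poly_0_coeff_0)
    also have "\<dots> = coeff q 1" by (simp add: coeff_pderiv)
    also have "\<dots> = (\<Sum>m\<le>d. if m = 1 then c m / fact m else 0)" by (simp add: q_def coeff_sum)
    also have "\<dots> = c 1" using d by simp
    finally show ?thesis .
  qed
  moreover have "\<bar>overlap P Q t - poly q t\<bar> \<le> (1 / 4) ^ d" if t: "0 \<le> t" "t \<le> 1 / (4 * \<alpha> * real k)" for t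
  proof -
    have ak: "0 < \<alpha> * real k" using \<alpha> k by simp
    have "t * (\<alpha> * real k) \<le> 1 / (4 * \<alpha> * real k) * (\<alpha> * real k)" using t ak by (intro mult_right_mono) auto
    also have "\<dots> = 1 / 4" using \<alpha> k by simp
    finally have tak: "t * (\<alpha> * real k) \<le> 1 / 4" .
    have s: "(\<lambda>m. c m / fact m * t ^ m) sums overlap P Q t"
    proof -
      have "(\<lambda>m. Re (of_real (t ^ m / fact m) * mtrace (pauli_op n P * (?L ^^ m) (pauli_op n Q))) / 2 ^ n) sums overlap P Q t"
        by (intro sums_divide sums_Re flow_sums[OF Lind_dual[OF g]]) simp_all
      moreover have "Re (of_real (t ^ m / fact m) * mtrace (pauli_op n P * (?L ^^ m) (pauli_op n Q))) / 2 ^ n = c m / fact m * t ^ m" for m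
        by (simp add: c_def mult_ac del: of_real_divide of_real_power)
      ultimately show ?thesis by simp
    qed
    have b: "\<bar>c m / fact m * t ^ m\<bar> \<le> (1 / 4) ^ m" for m
    proof -
      have "\<bar>c m\<bar> \<le> cmod (mtrace (pauli_op n P * (?L ^^ m) (pauli_op n Q))) / 2 ^ n"
        unfolding c_def by (simp add: divide_right_mono abs_Re_le_cmod)
      also have "\<dots> \<le> (\<alpha> * real k) ^ m * fact m"
        by (rule ptm_power_bound[OF g]) (use \<alpha> PQ in auto)
      finally have "\<bar>c m\<bar> / fact m * t ^ m \<le> (\<alpha> * real k) ^ m * t ^ m"
        using t by (intro mult_right_mono) (auto simp: divide_le_eq)
      also have "\<dots> = (t * (\<alpha> * real k)) ^ m" by (simp add: power_mult_distrib mult.commute)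
      also have "\<dots> \<le> (1 / 4) ^ m" using tak t ak by (intro power_mono) auto
      finally show ?thesis using t by (simp add: abs_mult)
    qed
    have s': "(\<lambda>m. c (m + Suc d) / fact (m + Suc d) * t ^ (m + Suc d)) sums (overlap P Q t - poly q t)"
      using sums_split_initial_segment[OF s, of "Suc d"] unfolding q lessThan_Suc_atMost .
    have g4: "(\<lambda>m. (1 / 4) ^ (m + Suc d) :: real) sums ((1 / 4) ^ Suc d * (1 / (1 - 1 / 4)))"
      using sums_mult[OF geometric_sums[of "1 / 4 :: real"], of "(1 / 4) ^ Suc d"] by (simp add: power_add mult_ac)
    have "\<bar>overlap P Q t - poly q t\<bar> \<le> (1 / 4) ^ Suc d * (1 / (1 - 1 / 4))"
    proof -
      have "\<bar>suminf (\<lambda>m. c (m + Suc d) / fact (m + Suc d) * t ^ (m + Suc d))\<bar> \<le> suminf (\<lambda>m. (1 / 4) ^ (m + Suc d))"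
        using norm_suminf_le[of "\<lambda>m. c (m + Suc d) / fact (m + Suc d) * t ^ (m + Suc d)" "\<lambda>m. (1 / 4) ^ (m + Suc d)"]
          b g4 by (simp only: real_norm_def sums_summable)
      then show ?thesis using s' g4 by (simp only: sums_unique[symmetric])
    qed
    also have "\<dots> \<le> (1 / 4) ^ d" by simp
    finally show ?thesis .
  qed
  ultimately show ?thesis using that by (simp add: c_def)
qed

lemma ptm_estimate_error:
  assumes \<alpha>: "interaction_strength n k g \<le> \<alpha>" "0 < \<alpha>" and k: "1 \<le> k"
    and PQ: "P \<in> paulis n" "Q \<in> paulis n" "card (supp P) \<le> k" and d: "1 \<le> d"
  defines "T \<equiv> 1 / (4 * \<alpha> * real k)"
  assumes good: "\<And>i. i \<le> d \<Longrightarrow> \<bar>median_of_means (simple_plan T d M) D P Q i - overlap P Q (cheb_nodes T d ! i)\<bar> \<le> \<eta>"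
  shows "\<bar>ptm_estimate T (simple_plan T d M) D P Q - Re (mtrace (pauli_op n P * lindbladian n k g (pauli_op n Q))) / 2 ^ n\<bar>
    \<le> 16 * \<alpha> * real k * real d ^ 3 * (\<eta> + (1 / 4) ^ d)"
proof -
  have T: "0 < T" using \<alpha> k by (simp add: T_def)
  obtain q where q: "degree q \<le> d" "poly (pderiv q) 0 = Re (mtrace (pauli_op n P * lindbladian n k g (pauli_op n Q))) / 2 ^ n"
    "\<And>t. 0 \<le> t \<Longrightarrow> t \<le> T \<Longrightarrow> \<bar>overlap P Q t - poly q t\<bar> \<le> (1 / 4) ^ d"
    unfolding T_def using taylor_polynomial[OF \<alpha> k PQ d] by blast
  have "\<bar>median_of_means (simple_plan T d M) D P Q i - poly q (cheb_nodes T d ! i)\<bar> \<le> \<eta> + (1 / 4) ^ d" if i: "i \<le> d" for i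
  proof -
    have "cheb_nodes T d ! i \<in> set (cheb_nodes T d)" using i by (intro nth_mem) simp
    then have "cheb_nodes T d ! i \<in> {0..T}" using cheb_nodes_bounds[of T d] T by auto
    then show ?thesis using q(3)[of "cheb_nodes T d ! i"] good[OF i] by auto
  qed
  then have "\<bar>poly (pderiv (robust_fit d T 1 0 (cheb_nodes T d) (median_of_means (simple_plan T d M) D P Q))) 0 - poly (pderiv q) 0\<bar>
    \<le> 4 / T * real d ^ 3 * (\<eta> + (1 / 4) ^ d)"
    by (intro fit_derivative_error T q(1))
  moreover have "ptm_estimate T (simple_plan T d M) D P Q =
     poly (pderiv (robust_fit d T 1 0 (cheb_nodes T d) (median_of_means (simple_plan T d M) D P Q))) 0"
    unfolding ptm_estimate_def by (simp add: simple_plan_def)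
  moreover have "4 / T = 16 * \<alpha> * real k" using \<alpha> k by (simp add: T_def)
  ultimately show ?thesis unfolding q(2) by simp
qed

text \<open>All pairs share the same samples, so their deviations are dependent; a union bound over
  pairs and nodes makes this harmless.\<close>

lemma ptm_estimates_prob:
  assumes \<alpha>: "interaction_strength n k g \<le> \<alpha>" "0 < \<alpha>" and k: "1 \<le> k"
    and W: "finite W" "\<And>P Q. (P, Q) \<in> W \<Longrightarrow> P \<in> paulis n \<and> Q \<in> paulis n \<and> card (supp P) \<le> k \<and> card (supp Q) \<le> k"
    and d: "1 \<le> d" and M: "0 < M" and \<eta>: "0 \<le> \<eta>"
  defines "T \<equiv> 1 / (4 * \<alpha> * real k)"
  shows "1 - real (card W) * (real d + 1) * (2 * exp (- (real M * \<eta>\<^sup>2 / (2 * 81 ^ k)))) \<le>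
    measure_pmf.prob (data_pmf n (lindbladian n k g) (simple_plan T d M))
      {D. \<forall>(P, Q)\<in>W. \<bar>ptm_estimate T (simple_plan T d M) D P Q -
         Re (mtrace (pauli_op n P * lindbladian n k g (pauli_op n Q))) / 2 ^ n\<bar> \<le> 16 * \<alpha> * real k * real d ^ 3 * (\<eta> + (1 / 4) ^ d)}"
    (is "_ \<le> measure_pmf.prob ?p ?G")
proof -
  have T: "0 \<le> T" using \<alpha> by (simp add: T_def)
  let ?bad = "\<lambda>(P, Q) i. {D. \<eta> \<le> \<bar>median_of_means (simple_plan T d M) D P Q i - overlap P Q (cheb_nodes T d ! i)\<bar>}"
  let ?e = "2 * exp (- (real M * \<eta>\<^sup>2 / (2 * 81 ^ k)))"
  let ?U = "\<Union>u\<in>W \<times> {..d}. ?bad (fst u) (snd u)"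
  have "measure_pmf.prob ?p ?U \<le> (\<Sum>u\<in>W \<times> {..d}. measure_pmf.prob ?p (?bad (fst u) (snd u)))"
    using W(1) by (intro measure_pmf.finite_measure_subadditive_finite) auto
  also have "\<dots> \<le> (\<Sum>u\<in>W \<times> {..d}. ?e)"
  proof (rule sum_mono)
    fix u assume "u \<in> W \<times> {..d}"
    then obtain P Q i where u: "u = ((P, Q), i)" "(P, Q) \<in> W" "i \<le> d" by auto
    have "measure_pmf.prob ?p {D. \<eta> \<le> \<bar>median_of_means (simple_plan T d M) D P Q i - overlap P Q (cheb_nodes T d ! i)\<bar>} \<le> ?e"
      by (rule overlap_deviation) (use W(2)[OF u(2)] u(3) T M \<eta> in auto)
    then show "measure_pmf.prob ?p (?bad (fst u) (snd u)) \<le> ?e" by (simp add: u(1))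
  qed
  also have "\<dots> = real (card W) * (real d + 1) * ?e" by (simp add: card_cartesian_product algebra_simps)
  finally have U: "measure_pmf.prob ?p ?U \<le> real (card W) * (real d + 1) * ?e" .
  have "- ?U \<subseteq> ?G"
  proof
    fix D assume D: "D \<in> - ?U"
    have "\<bar>ptm_estimate T (simple_plan T d M) D P Q - Re (mtrace (pauli_op n P * lindbladian n k g (pauli_op n Q))) / 2 ^ n\<bar>
      \<le> 16 * \<alpha> * real k * real d ^ 3 * (\<eta> + (1 / 4) ^ d)" if PQ: "(P, Q) \<in> W" for P Q
      unfolding T_def
    proof (rule ptm_estimate_error[OF \<alpha> k _ _ _ d])
      fix i assume i: "i \<le> d"
      have "D \<notin> ?bad (P, Q) i" using D PQ i by auto
      then show "\<bar>median_of_means (simple_plan (1 / (4 * \<alpha> * real k)) d M) D P Q i -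
         overlap P Q (cheb_nodes (1 / (4 * \<alpha> * real k)) d ! i)\<bar> \<le> \<eta>" by (simp add: T_def)
    qed (use W(2)[OF PQ] in auto)
    then show "D \<in> ?G" by auto
  qed
  then have "measure_pmf.prob ?p (- ?U) \<le> measure_pmf.prob ?p ?G" by (intro measure_pmf.finite_measure_mono) auto
  moreover have "measure_pmf.prob ?p (- ?U) = 1 - measure_pmf.prob ?p ?U"
    using measure_pmf.prob_compl[of ?U ?p] by (simp add: Compl_eq_Diff_UNIV)
  ultimately show ?thesis using U by simp
qed

end

section \<open>Decay of the diagonal extensions\<close>

text \<open>Both sides depend only on the multiset of values. The free \<open>h\<close> covers
  counting as well as truncated summation.\<close>

lemma sum_rearrangement:
  assumes "finite A"
  shows "(\<Sum>x\<in>A. h (f x)) = (\<Sum>j<length (decreasing_rearrangement f A). h (decreasing_rearrangement f A ! j) :: real)"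
proof -
  let ?xs = "decreasing_rearrangement f A"
  have "(\<Sum>x\<in>A. h (f x)) = sum_mset (image_mset h (mset ?xs))"
    by (simp add: decreasing_rearrangement_def sum_unfold_sum_mset multiset.map_comp comp_def)
  also have "\<dots> = sum_list (map h ?xs)" by (simp flip: sum_mset_sum_list)
  also have "\<dots> = (\<Sum>j<length ?xs. h (?xs ! j))"
    by (simp add: sum_list_sum_nth atLeast0LessThan)
  finally show ?thesis .
qed

text \<open>Comparison with the integral of \<open>x powr (- p)\<close>, in a telescoping form given
  by the mean value theorem.\<close>

lemma powr_tail_step:
  assumes "1 < p" "1 \<le> (j::nat)"
  shows "real (Suc j) powr (- p) \<le> (real j powr (1 - p) - real (Suc j) powr (1 - p)) / (p - 1)"
proof -
  have "\<exists>z. real j < z \<and> z < real (Suc j) \<and>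
    real (Suc j) powr (1 - p) - real j powr (1 - p) = (real (Suc j) - real j) * ((1 - p) * z powr (- p))"
  proof (rule MVT2)
    fix x assume "real j \<le> x" "x \<le> real (Suc j)"
    then show "((\<lambda>x. x powr (1 - p)) has_real_derivative (1 - p) * x powr (- p)) (at x)"
      using assms by (auto intro!: derivative_eq_intros)
  qed simp
  then obtain z where z: "real j < z" "z < real (Suc j)"
    "real (Suc j) powr (1 - p) - real j powr (1 - p) = (1 - p) * z powr (- p)" by auto
  have "real (Suc j) powr (- p) \<le> z powr (- p)"
    using z assms by (intro powr_mono2') auto
  also have "\<dots> = (real j powr (1 - p) - real (Suc j) powr (1 - p)) / (p - 1)"
    using z(3) assms by (simp add: field_simps)
  finally show ?thesis .
qed

lemma powr_tail_sum:
  assumes "1 < p" "1 \<le> (b::nat)" "b \<le> m"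
  shows "(\<Sum>j\<in>{b..<m}. real (Suc j) powr (- p)) \<le> real b powr (1 - p) / (p - 1)"
proof -
  have "(\<Sum>j\<in>{b..<m}. real (Suc j) powr (- p)) \<le> (real b powr (1 - p) - real m powr (1 - p)) / (p - 1)"
    using assms(3)
  proof (induction m rule: dec_induct)
    case (step m)
    then show ?case using powr_tail_step[of p m] assms by (simp add: diff_divide_distrib)
  qed simp
  also have "\<dots> \<le> real b powr (1 - p) / (p - 1)" using assms by (simp add: divide_right_mono)
  finally show ?thesis .
qed

text \<open>The list entry of index \<open>b\<close> is already below \<tau>, so only the
  \<open>b\<close> entries before it can exceed \<tau>. Among the values up to \<tau>, those at the
  first \<open>b\<close> positions are bounded by \<tau> and all later ones by the decay.\<close>

lemma decay_split:
  assumes A: "finite A" and nonneg: "\<And>x. x \<in> A \<Longrightarrow> 0 \<le> f x"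
    and decay: "\<And>j. j < length (decreasing_rearrangement f A) \<Longrightarrow>
      decreasing_rearrangement f A ! j \<le> C * real (j + 1) powr (- p)"
    and C: "0 < C" and p: "1 < p" and b: "1 \<le> (b::nat)" and \<tau>: "C * real (b + 1) powr (- p) < \<tau>"
  shows "card {x \<in> A. \<tau> < f x} \<le> b"
    and "(\<Sum>x\<in>{x \<in> A. f x \<le> \<tau>}. f x) \<le> real b * \<tau> + C * (real b powr (1 - p) / (p - 1))"
proof -
  let ?xs = "decreasing_rearrangement f A"
  have "0 \<le> C * real (b + 1) powr (- p)" using C by simp
  then have tau0: "0 \<le> \<tau>" using \<tau> by linarith
  have small: "?xs ! j < \<tau>" if "j < length ?xs" "b \<le> j" for j
  proof -
    have "C * real (j + 1) powr (- p) \<le> C * real (b + 1) powr (- p)"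
      using that C p by (intro mult_left_mono powr_mono2') auto
    then show ?thesis using decay[OF that(1)] \<tau> by simp
  qed
  have "real (card {x \<in> A. \<tau> < f x}) = (\<Sum>x\<in>A. if \<tau> < f x then 1 else 0)"
    using A by (simp add: sum.If_cases Int_def)
  also have "\<dots> = (\<Sum>j<length ?xs. if \<tau> < ?xs ! j then 1 else 0)"
    by (rule sum_rearrangement[OF A, of "\<lambda>v. if \<tau> < v then 1 else 0"])
  also have "\<dots> \<le> (\<Sum>j<length ?xs. if j < b then 1 else 0)"
    using small by (intro sum_mono) (force simp: not_less)
  also have "\<dots> \<le> (\<Sum>j\<in>{..<b}. 1)"
    by (simp add: sum.If_cases Int_def) (metis (no_types, lifting) card_lessThan card_mono finite_lessThan lessThan_iff mem_Collect_eq subsetI)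
  finally show "card {x \<in> A. \<tau> < f x} \<le> b" by simp
  have "(\<Sum>x\<in>{x \<in> A. f x \<le> \<tau>}. f x) = (\<Sum>x\<in>A. if f x \<le> \<tau> then f x else 0)"
    using A by (simp add: sum.inter_filter)
  also have "\<dots> = (\<Sum>j<length ?xs. if ?xs ! j \<le> \<tau> then ?xs ! j else 0)"
    by (rule sum_rearrangement[OF A, of "\<lambda>v. if v \<le> \<tau> then v else 0"])
  also have "\<dots> \<le> (\<Sum>j<length ?xs. (if j < b then \<tau> else 0) + (if b \<le> j then C * real (Suc j) powr (- p) else 0))"
  proof (rule sum_mono)
    fix j assume "j \<in> {..<length ?xs}"
    then have j: "j < length ?xs" by simp
    show "(if ?xs ! j \<le> \<tau> then ?xs ! j else 0) \<le>
       (if j < b then \<tau> else 0) + (if b \<le> j then C * real (Suc j) powr (- p) else 0)"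
    proof (cases "j < b")
      case True
      then show ?thesis using tau0 by simp
    next
      case False
      have "0 \<le> C * real (Suc j) powr (- p)" using C by simp
      then show ?thesis using False decay[OF j] by simp
    qed
  qed
  \<comment> \<open>The list may be shorter than \<open>b\<close>; the maximum keeps the interval in
    the form that \<open>powr_tail_sum\<close> accepts.\<close>
  also have "\<dots> \<le> real b * \<tau> + (\<Sum>j\<in>{b..<max b (length ?xs)}. C * real (Suc j) powr (- p))"
    unfolding sum.distrib
  proof (rule add_mono)
    have "(\<Sum>j<length ?xs. if j < b then \<tau> else 0) = (\<Sum>j\<in>{j \<in> {..<length ?xs}. j < b}. \<tau>)"
      by (subst sum.inter_filter) simp_all
    also have "\<dots> \<le> (\<Sum>j\<in>{..<b}. \<tau>)" using tau0 by (intro sum_mono2) auto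
    finally show "(\<Sum>j<length ?xs. if j < b then \<tau> else 0) \<le> real b * \<tau>" by simp
    have "(\<Sum>j<length ?xs. if b \<le> j then C * real (Suc j) powr (- p) else 0) =
       (\<Sum>j\<in>{j \<in> {..<length ?xs}. b \<le> j}. C * real (Suc j) powr (- p))"
      by (subst sum.inter_filter) simp_all
    also have "\<dots> \<le> (\<Sum>j\<in>{b..<max b (length ?xs)}. C * real (Suc j) powr (- p))"
      using C by (intro sum_mono2) auto
    finally show "(\<Sum>j<length ?xs. if b \<le> j then C * real (Suc j) powr (- p) else 0) \<le> \<dots>" .
  qed
  also have "\<dots> \<le> real b * \<tau> + C * (real b powr (1 - p) / (p - 1))"
    unfolding sum_distrib_left[symmetric] using C powr_tail_sum[OF p b, of "max b (length ?xs)"]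
    by (intro add_left_mono mult_left_mono) auto
  finally show "(\<Sum>x\<in>{x \<in> A. f x \<le> \<tau>}. f x) \<le> real b * \<tau> + C * (real b powr (1 - p) / (p - 1))" .
qed

section \<open>Error of the reconstruction\<close>

text \<open>Entries at most double with every product of 2 by 2 matrices. The sharp bound is 2, but
  it would change only constants depending on \<open>k\<close>.\<close>

lemma cmod_pauli_trace: "cmod (mtrace (pauli_mat \<sigma> * pauli_mat \<tau> * pauli_mat \<mu> * pauli_mat \<nu>)) \<le> 16"
proof -
  have prod: "cmod ((A * B) $$ (i, j)) \<le> 2 * x * y"
    if A: "A \<in> carrier_mat 2 2" "\<And>i j. i < 2 \<Longrightarrow> j < 2 \<Longrightarrow> cmod (A $$ (i, j)) \<le> x"
      and B: "B \<in> carrier_mat 2 2" "\<And>i j. i < 2 \<Longrightarrow> j < 2 \<Longrightarrow> cmod (B $$ (i, j)) \<le> y" and ij: "i < 2" "j < 2"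
      and x: "0 \<le> x"
    for A B :: "complex mat" and x y i j
  proof -
    have "cmod ((A * B) $$ (i, j)) \<le> cmod (A $$ (i, 0)) * cmod (B $$ (0, j)) + cmod (A $$ (i, Suc 0)) * cmod (B $$ (Suc 0, j))"
      unfolding mult_2_entry[OF A(1) B(1) ij] by (rule order_trans[OF norm_triangle_ineq]) (simp add: norm_mult)
    also have "\<dots> \<le> x * y + x * y"
      using A(2) B(2) ij x by (intro add_mono mult_mono) auto
    finally show ?thesis by simp
  qed
  have e: "cmod (pauli_mat \<sigma> $$ (i, j)) \<le> 1" if "i < 2" "j < 2" for \<sigma> i j
    using that unfolding less_2_iff by (elim disjE) (auto simp: pauli_mat_entries)
  let ?A = "pauli_mat \<sigma> * pauli_mat \<tau>" and ?M = pauli_mat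
  have c1: "?A \<in> carrier_mat 2 2" by (rule mult_carrier_mat[of _ 2 2]) simp_all
  then have c2: "?A * ?M \<mu> \<in> carrier_mat 2 2" by (rule mult_carrier_mat) simp
  then have c3: "?A * ?M \<mu> * ?M \<nu> \<in> carrier_mat 2 2" by (rule mult_carrier_mat) simp
  have e1: "cmod (?A $$ (i, j)) \<le> 2" if "i < 2" "j < 2" for i j
    using prod[OF pauli_mat_carrier e pauli_mat_carrier e that, of \<sigma> \<tau>] by simp
  have e2: "cmod ((?A * ?M \<mu>) $$ (i, j)) \<le> 4" if "i < 2" "j < 2" for i j
    using prod[OF c1 e1 pauli_mat_carrier e that, of \<mu>] by simp
  have e3: "cmod ((?A * ?M \<mu> * ?M \<nu>) $$ (i, j)) \<le> 8" if "i < 2" "j < 2" for i j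
    using prod[OF c2 e2 pauli_mat_carrier e that, of \<nu>] by simp
  have "cmod (mtrace (?A * ?M \<mu> * ?M \<nu>)) \<le> 8 + 8"
    unfolding mtrace_2[OF c3] by (rule order_trans[OF norm_triangle_ineq]) (intro add_mono e3; simp)
  then show ?thesis by simp
qed

text \<open>With \<open>s\<close> qubits there are \<open>16 ^ s\<close> summands with traces up to
  \<open>16 ^ s\<close>, divided by \<open>8 ^ s\<close>; hence the factor 32 per qubit.\<close>

lemma local_inversion_error:
  assumes S: "finite (pair_supp u)" "card (pair_supp u) \<le> k" and \<theta>: "0 \<le> \<theta>"
    and err: "\<And>A B. A \<in> paulis_on (pair_supp u) \<Longrightarrow> B \<in> paulis_on (pair_supp u) \<Longrightarrow>
      cmod (of_real (Lhat A B) - L A B) \<le> \<theta>"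
  shows "cmod (local_inversion Lhat u - (1 / 2 ^ (3 * card (pair_supp u))) * (\<Sum>A\<in>paulis_on (pair_supp u).
     \<Sum>B\<in>paulis_on (pair_supp u). L A B * local_trace (pair_supp u) A (snd u) B (fst u))) \<le> 32 ^ k * \<theta>"
proof -
  let ?S = "pair_supp u" and ?P = "paulis_on (pair_supp u)"
  have lt: "cmod (local_trace ?S A (snd u) B (fst u)) \<le> 16 ^ card ?S" for A B
    unfolding local_trace_def prod_norm[symmetric]
    by (rule order_trans[OF prod_mono[of _ _ "\<lambda>_. 16"]]) (auto intro: cmod_pauli_trace)
  let ?lt = "\<lambda>A B. local_trace ?S A (snd u) B (fst u)"
  have diff: "local_inversion Lhat u - (1 / 2 ^ (3 * card ?S)) * (\<Sum>A\<in>?P. \<Sum>B\<in>?P. L A B * ?lt A B) =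
    (\<Sum>A\<in>?P. \<Sum>B\<in>?P. (of_real (Lhat A B) - L A B) * ?lt A B) / 2 ^ (3 * card ?S)"
    by (simp add: local_inversion_def Let_def left_diff_distrib sum_subtractf diff_divide_distrib)
  have "cmod (\<Sum>A\<in>?P. \<Sum>B\<in>?P. (of_real (Lhat A B) - L A B) * ?lt A B) \<le> (\<Sum>A\<in>?P. \<Sum>B\<in>?P. \<theta> * 16 ^ card ?S)"
    using err lt \<theta> by (intro order_trans[OF norm_sum] sum_mono order_trans[OF norm_sum] sum_mono)
      (auto simp: norm_mult intro!: mult_mono)
  also have "\<dots> = (16 ^ card ?S * 16 ^ card ?S) * \<theta>"
    using S(1) by (simp add: card_paulis_on mult_ac flip: power_mult_distrib)
  also have "(16::real) ^ card ?S * 16 ^ card ?S = 32 ^ card ?S * 2 ^ (3 * card ?S)"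
    by (simp add: power_mult flip: power_mult_distrib)
  finally have "cmod (\<Sum>A\<in>?P. \<Sum>B\<in>?P. (of_real (Lhat A B) - L A B) * ?lt A B) / 2 ^ (3 * card ?S) \<le> 32 ^ card ?S * \<theta>"
    by (simp add: divide_le_eq mult_ac)
  also have "\<dots> \<le> 32 ^ k * \<theta>" using S \<theta> by (intro mult_right_mono power_increasing) auto
  finally show ?thesis unfolding diff by (simp add: norm_divide norm_power)
qed

context
  fixes n k :: nat and g :: lindblad_data and chi :: "pstring \<times> pstring \<Rightarrow> complex"
    and C p \<tau> :: real and b :: nat and \<Omega> :: "(pstring \<times> pstring) set"
  assumes g: "k_local_lindblad n k g"
    and chi: "chi_expansion n (lindbladian n k g) chi"
    and decay: "diagonal_extension_decay n chi C p"
    and C: "0 < C" and p: "1 < p" and b: "1 \<le> b" and \<tau>: "C * real (b + 1) powr (- p) < \<tau>"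
    and \<Omega>: "\<Omega> = threshold_support n k chi \<tau>"
begin

abbreviation (input) "ext u R \<equiv> (tensor_string (pair_supp u) (fst u) R, tensor_string (pair_supp u) (snd u) R)"
abbreviation (input) "exts u \<equiv> paulis_on ({..<n} - pair_supp u) - {id_string}"

lemma tau_pos: "0 < \<tau>"
proof -
  have "0 \<le> C * real (b + 1) powr (- p)" using C by simp
  then show ?thesis using \<tau> by linarith
qed

lemma support_facts:
  assumes "u \<in> \<Omega>"
  shows "fst u \<in> paulis n" "snd u \<in> paulis n" "pair_supp u \<subseteq> {..<n}" "finite (pair_supp u)"
    "1 \<le> card (pair_supp u)" "card (pair_supp u) \<le> k" "pair_supp u \<noteq> {}"
    "fst u \<in> paulis_on (pair_supp u)" "snd u \<in> paulis_on (pair_supp u)"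
proof -
  show PQ: "fst u \<in> paulis n" "snd u \<in> paulis n"
    using assms \<Omega> by (auto simp: threshold_support_def local_pairs_nontriv_def local_pairs_def)
  then show sub: "pair_supp u \<subseteq> {..<n}" by (auto simp: pair_supp_def paulis_on_def)
  then show fin: "finite (pair_supp u)" by (rule finite_subset) simp
  show "card (pair_supp u) \<le> k"
    using assms \<Omega> by (auto simp: threshold_support_def local_pairs_nontriv_def local_pairs_def)
  show ne: "pair_supp u \<noteq> {}"
  proof
    assume "pair_supp u = {}"
    then have "fst u = id_string" "snd u = id_string"
      by (auto simp: pair_supp_def supp_def id_string_def)
    then show False using assms \<Omega> by (cases u) (auto simp: threshold_support_def local_pairs_nontriv_def)
  qed
  then show "1 \<le> card (pair_supp u)" using fin by (simp add: Suc_le_eq card_gt_0_iff)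
  show "fst u \<in> paulis_on (pair_supp u)" "snd u \<in> paulis_on (pair_supp u)"
    by (auto simp: paulis_on_def pair_supp_def)
qed

lemma chi_zero_nonlocal:
  assumes "P \<in> paulis n" "Q \<in> paulis n" "k < card (pair_supp (P, Q))"
  shows "chi (P, Q) = 0"
  using chi_of_nonlocal[OF g assms(1,2)] chi_of_chi_expansion[OF chi assms(1,2)] assms(3)
  by (simp add: pair_supp_def)

text \<open>Beyond \<open>k\<close> qubits the coefficient is 0, hence below the positive threshold:
  exceeding the threshold implies locality.\<close>

lemma mem_support_iff:
  assumes "P \<in> paulis n" "Q \<in> paulis n" "(P, Q) \<noteq> (id_string, id_string)"
  shows "(P, Q) \<in> \<Omega> \<longleftrightarrow> \<tau> < cmod (chi (P, Q))"
  using assms chi_zero_nonlocal[OF assms(1,2)] tau_pos \<Omega>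
  by (auto simp: threshold_support_def local_pairs_nontriv_def local_pairs_def not_le)

lemma ext_supp:
  assumes "u \<in> \<Omega>" "R \<in> exts u"
  shows "pair_supp (ext u R) = pair_supp u \<union> supp R" "supp R \<noteq> {}" "supp R \<inter> pair_supp u = {}"
    "fst (ext u R) \<in> paulis n" "snd (ext u R) \<in> paulis n" "ext u R \<noteq> (id_string, id_string)"
proof -
  show dis: "supp R \<inter> pair_supp u = {}" using assms by (auto simp: paulis_on_def)
  show ne: "supp R \<noteq> {}" using assms by (auto simp: supp_def id_string_def)
  show eq: "pair_supp (ext u R) = pair_supp u \<union> supp R"
    using dis by (auto simp: pair_supp_def supp_def tensor_string_def split: if_splits)
  have "supp R \<subseteq> {..<n}" using assms by (auto simp: paulis_on_def)
  then have "pair_supp (ext u R) \<subseteq> {..<n}" using eq support_facts(3)[OF assms(1)] by simp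
  then show "fst (ext u R) \<in> paulis n" "snd (ext u R) \<in> paulis n" by (auto simp: paulis_on_def pair_supp_def)
  show "ext u R \<noteq> (id_string, id_string)"
  proof
    assume "ext u R = (id_string, id_string)"
    then have "pair_supp (ext u R) = pair_supp (id_string, id_string)" by simp
    also have "\<dots> = {}" by (simp add: pair_supp_def supp_def id_string_def)
    finally show False using eq ne by simp
  qed
qed

lemma inj_ext: "u \<in> \<Omega> \<Longrightarrow> inj_on (ext u) (exts u)"
proof (rule inj_onI)
  fix R R' assume u: "u \<in> \<Omega>" and R: "R \<in> exts u" "R' \<in> exts u" "ext u R = ext u R'"
  show "R = R'"
  proof (rule paulis_on_eqI)
    show "R \<in> paulis_on ({..<n} - pair_supp u)" "R' \<in> paulis_on ({..<n} - pair_supp u)" using R by auto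
    fix q assume "q \<in> {..<n} - pair_supp u"
    then show "R q = R' q" using R(3) by (auto simp: tensor_string_def dest: fun_cong[of _ _ q])
  qed
qed

text \<open>Matches two descriptions of diagonal extensions: the restriction test performed by the
  algorithm, and tensoring with a nontrivial string, over which the decay is assumed.\<close>

lemma extensions_in_support:
  assumes u: "u \<in> \<Omega>"
  shows "{v \<in> \<Omega>. extends u v} = ext u ` {R \<in> exts u. \<tau> < cmod (chi (ext u R))}"
proof (intro equalityI subsetI)
  fix v assume "v \<in> ext u ` {R \<in> exts u. \<tau> < cmod (chi (ext u R))}"
  then obtain R where R: "v = ext u R" "R \<in> exts u" "\<tau> < cmod (chi (ext u R))" by auto
  note e = ext_supp[OF u R(2)]
  have "v \<in> \<Omega>" using R mem_support_iff[of "fst v" "snd v"] e by simp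
  moreover have "extends u v"
    unfolding extends_def R(1) e(1)
  proof (intro conjI ballI)
    show "pair_supp u \<subset> pair_supp u \<union> supp R" using e by auto
    show "u = (restrict_string (pair_supp u) (fst (ext u R)), restrict_string (pair_supp u) (snd (ext u R)))"
      using support_facts(8,9)[OF u]
      by (cases u) (auto simp: restrict_string_def tensor_string_def fun_eq_iff supp_outside)
    fix q assume "q \<in> pair_supp u \<union> supp R - pair_supp u"
    then show "fst (ext u R) q = snd (ext u R) q" by (simp add: tensor_string_def)
  qed
  ultimately show "v \<in> {v \<in> \<Omega>. extends u v}" by simp
next
  fix v assume "v \<in> {v \<in> \<Omega>. extends u v}"
  then have v: "v \<in> \<Omega>" "extends u v" by auto
  define R where "R = restrict_string ({..<n} - pair_supp u) (fst v)"
  have uv: "u = (restrict_string (pair_supp u) (fst v), restrict_string (pair_supp u) (snd v))"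
    using v(2) unfolding extends_def by blast
  have sub: "pair_supp u \<subset> pair_supp v" using v(2) by (simp add: extends_def)
  have eq: "fst v q = snd v q" if "q \<notin> pair_supp u" for q
  proof (cases "q \<in> pair_supp v")
    case True
    then show ?thesis using v(2) that by (simp add: extends_def)
  next
    case False
    then show ?thesis by (simp add: pair_supp_def supp_def)
  qed
  have out: "fst v q = PI" if "\<not> q < n" for q using support_facts(1)[OF v(1)] that supp_outside[of "fst v" "{..<n}" q] by simp
  have in_u: "fst u q = fst v q" "snd u q = snd v q" if "q \<in> pair_supp u" for q
    using uv that by (metis fst_conv restrict_string_def, metis snd_conv restrict_string_def)
  have v_eq: "v = ext u R"
  proof (rule prod_eqI)
    show "fst v = fst (ext u R)"
      by (rule ext) (auto simp: tensor_string_def R_def restrict_string_def in_u out)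
    show "snd v = snd (ext u R)"
      by (rule ext) (auto simp: tensor_string_def R_def restrict_string_def in_u out eq[symmetric])
  qed
  have "R \<noteq> id_string"
  proof
    assume "R = id_string"
    then have "pair_supp v \<subseteq> pair_supp u"
      unfolding v_eq by (auto simp: pair_supp_def supp_def tensor_string_def id_string_def split: if_splits)
    then show False using sub by auto
  qed
  moreover have "R \<in> paulis_on ({..<n} - pair_supp u)"
    by (auto simp: R_def paulis_on_def supp_def restrict_string_def split: if_splits)
  ultimately have R: "R \<in> exts u" by simp
  have "\<tau> < cmod (chi (ext u R))" using v(1) \<Omega> v_eq by (simp add: threshold_support_def)
  then show "v \<in> ext u ` {R \<in> exts u. \<tau> < cmod (chi (ext u R))}" using R v_eq by blast
qed

definition tail :: real where
  "tail = real b * \<tau> + C * (real b powr (1 - p) / (p - 1))"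

lemma extension_decay:
  assumes u: "u \<in> \<Omega>"
  shows "card {v \<in> \<Omega>. extends u v} \<le> b"
    and "(\<Sum>R\<in>{R \<in> exts u. cmod (chi (ext u R)) \<le> \<tau>}. cmod (chi (ext u R))) \<le> tail"
proof -
  have fin: "finite (exts u)" by simp
  have d: "decreasing_rearrangement (\<lambda>R. cmod (chi (ext u R))) (exts u) ! j \<le> C * real (j + 1) powr (- p)"
    if "j < length (decreasing_rearrangement (\<lambda>R. cmod (chi (ext u R))) (exts u))" for j
    using decay that support_facts[OF u] unfolding diagonal_extension_decay_def Let_def by blast
  note split = decay_split[of "exts u" "\<lambda>R. cmod (chi (ext u R))", OF fin _ d C p b \<tau>]
  show "card {v \<in> \<Omega>. extends u v} \<le> b"
    unfolding extensions_in_support[OF u]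
    using card_image_le[of "{R \<in> exts u. \<tau> < cmod (chi (ext u R))}" "ext u"] fin split(1) by simp
  show "(\<Sum>R\<in>{R \<in> exts u. cmod (chi (ext u R)) \<le> \<tau>}. cmod (chi (ext u R))) \<le> tail"
    unfolding tail_def using split(2) by simp
qed

lemma tail_nonneg: "0 \<le> tail"
  using tau_pos C p by (simp add: tail_def)

text \<open>Comparing the recursion of the registers with the exact inversion identity, the error at
  \<open>u\<close> consists of the noise of the inversion, the extensions below the threshold, and
  the errors at the extensions in \<Omega>. The last are handled by
  \<open>error_propagation\<close>. Outside \<Omega> the estimate is 0 and the error at most \<tau>,
  hence the maximum.\<close>

lemma reconstruction_error:
  assumes \<omega>: "distinct \<omega>" "set \<omega> = \<Omega>" and \<theta>: "0 \<le> \<theta>"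
    and ptm: "\<And>u A B. u \<in> \<Omega> \<Longrightarrow> A \<in> paulis_on (pair_supp u) \<Longrightarrow> B \<in> paulis_on (pair_supp u) \<Longrightarrow>
      \<bar>Lhat A B - Re (mtrace (pauli_op n A * lindbladian n k g (pauli_op n B))) / 2 ^ n\<bar> \<le> \<theta>"
    and PQ: "P \<in> paulis n" "Q \<in> paulis n" "(P, Q) \<noteq> (id_string, id_string)"
  shows "cmod (chi_reg (postprocess k \<omega> Lhat) (P, Q) - chi (P, Q)) \<le>
    max \<tau> ((32 ^ k * \<theta> + tail) * geometric_factor k b)"
proof (cases "(P, Q) \<in> \<Omega>")
  case False
  then have "chi_reg (postprocess k \<omega> Lhat) (P, Q) = 0"
    using support_facts by (intro postprocess_registers(1)[where \<Omega> = \<Omega>] \<omega>) auto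
  moreover have "cmod (chi (P, Q)) \<le> \<tau>" using False mem_support_iff[OF PQ] by simp
  ultimately show ?thesis by simp
next
  case True
  let ?r = "chi_reg (postprocess k \<omega> Lhat)"
  define err where "err = (\<lambda>u. cmod (?r u - chi u))"
  let ?a = "32 ^ k * \<theta> + tail"
  have a: "0 \<le> ?a" using \<theta> tail_nonneg by simp
  have step: "err u \<le> ?a + (\<Sum>v\<in>{v \<in> \<Omega>. extends u v}. err v)" if u: "u \<in> \<Omega>" for u
  proof -
    note s = support_facts[OF u]
    let ?S = "pair_supp u"
    define x where "x = (\<Sum>R\<in>paulis_on ({..<n} - ?S). chi (ext u R))"
    have "cmod (local_inversion Lhat u - (1 / 2 ^ (3 * card ?S)) * (\<Sum>A\<in>paulis_on ?S. \<Sum>B\<in>paulis_on ?S.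
      (mtrace (pauli_op n A * lindbladian n k g (pauli_op n B)) / 2 ^ n) * local_trace ?S A (snd u) B (fst u))) \<le> 32 ^ k * \<theta>"
    proof (rule local_inversion_error[OF s(4,6) \<theta>])
      fix A B assume AB: "A \<in> paulis_on ?S" "B \<in> paulis_on ?S"
      have "complex_of_real (Lhat A B) - mtrace (pauli_op n A * lindbladian n k g (pauli_op n B)) / 2 ^ n =
        complex_of_real (Lhat A B - Re (mtrace (pauli_op n A * lindbladian n k g (pauli_op n B))) / 2 ^ n)"
        by (subst ptm_real[OF g]) simp
      then show "cmod (complex_of_real (Lhat A B) - mtrace (pauli_op n A * lindbladian n k g (pauli_op n B)) / 2 ^ n) \<le> \<theta>"
        using ptm[OF u AB] by (simp only: norm_of_real)
    qed
    then have noise: "cmod (local_inversion Lhat u - x) \<le> 32 ^ k * \<theta>"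
      unfolding local_inversion_identity[OF chi s(3,8,9)] x_def .
    let ?big = "{R \<in> exts u. \<tau> < cmod (chi (ext u R))}" and ?small = "{R \<in> exts u. cmod (chi (ext u R)) \<le> \<tau>}"
    have fin: "finite (exts u)" by simp
    have id: "ext u id_string = u"
      using s(8,9) by (cases u) (auto simp: tensor_string_def id_string_def fun_eq_iff supp_outside)
    have "x = chi (ext u id_string) + (\<Sum>R\<in>exts u. chi (ext u R))"
      unfolding x_def by (rule sum.remove) simp_all
    also have "(\<Sum>R\<in>exts u. chi (ext u R)) = (\<Sum>R\<in>?big. chi (ext u R)) + (\<Sum>R\<in>?small. chi (ext u R))"
    proof -
      have "exts u = ?big \<union> ?small" by auto
      then have "(\<Sum>R\<in>exts u. chi (ext u R)) = (\<Sum>R\<in>?big \<union> ?small. chi (ext u R))" by (rule arg_cong)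
      also have "\<dots> = (\<Sum>R\<in>?big. chi (ext u R)) + (\<Sum>R\<in>?small. chi (ext u R))"
        using fin by (intro sum.union_disjoint) auto
      finally show ?thesis .
    qed
    also have "(\<Sum>R\<in>?big. chi (ext u R)) = (\<Sum>v\<in>{v \<in> \<Omega>. extends u v}. chi v)"
      unfolding extensions_in_support[OF u]
      by (subst sum.reindex[OF inj_on_subset[OF inj_ext[OF u]]]) auto
    finally have x: "x = chi u + ((\<Sum>v\<in>{v \<in> \<Omega>. extends u v}. chi v) + (\<Sum>R\<in>?small. chi (ext u R)))"
      unfolding id .
    have "?r u = local_inversion Lhat u - (\<Sum>v\<in>{v \<in> \<Omega>. extends u v}. ?r v)"
      using support_facts u by (intro postprocess_registers(2) \<omega>) auto
    then have "?r u - chi u = (local_inversion Lhat u - x) + (\<Sum>R\<in>?small. chi (ext u R)) - (\<Sum>v\<in>{v \<in> \<Omega>. extends u v}. ?r v - chi v)"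
      unfolding x sum_subtractf by simp
    then have "err u \<le> cmod (local_inversion Lhat u - x) + cmod (\<Sum>R\<in>?small. chi (ext u R)) + cmod (\<Sum>v\<in>{v \<in> \<Omega>. extends u v}. ?r v - chi v)"
      unfolding err_def
      by (simp only:) (rule order_trans[OF norm_triangle_ineq4], intro add_mono norm_triangle_ineq order_refl)
    also have "\<dots> \<le> 32 ^ k * \<theta> + tail + (\<Sum>v\<in>{v \<in> \<Omega>. extends u v}. err v)"
      unfolding err_def
      by (intro add_mono noise norm_sum order_trans[OF norm_sum extension_decay(2)[OF u]])
    finally show ?thesis .
  qed
  have "err (P, Q) \<le> ?a * (\<Sum>l\<le>k - card (pair_supp (P, Q)). real b ^ l)"
  proof (rule error_propagation[OF step _ _ _ a True, where rank = "\<lambda>u. card (pair_supp u)"])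
    show "{v \<in> \<Omega>. extends u v} \<subseteq> \<Omega> \<and> card {v \<in> \<Omega>. extends u v} \<le> b" if "u \<in> \<Omega>" for u
      using extension_decay(1)[OF that] by auto
    show "card (pair_supp u) < card (pair_supp v)" if "u \<in> \<Omega>" "v \<in> {v \<in> \<Omega>. extends u v}" for u v
      using that support_facts(4)[of v] by (intro extends_card) auto
    show "card (pair_supp u) \<le> k" if "u \<in> \<Omega>" for u using support_facts(6)[OF that] .
  qed
  also have "\<dots> \<le> ?a * geometric_factor k b"
    unfolding geometric_factor_def using a by (intro mult_left_mono sum_mono2) auto
  finally show ?thesis by (simp add: err_def)
qed

end

section \<open>Choice of the parameters\<close>

text \<open>Up to constants, the inverse of the accuracy required of a transfer matrix entry before
  its error is multiplied by \<open>geometric_factor k b\<close>.\<close>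

definition precision :: "nat \<Rightarrow> nat \<Rightarrow> real \<Rightarrow> real" where
  "precision k b \<epsilon> = geometric_factor k b * inv_accuracy \<epsilon>"

text \<open>The factor \<open>32\<^sup>k\<close> comes from the inversion on at most \<open>k\<close> qubits, \<open>16 \<alpha> k = 4 / T\<close> from
  differentiating the fit at \<open>0\<close>; \<open>1\<close> is added to stay away from \<open>0\<close>.\<close>

definition amplification :: "nat \<Rightarrow> real \<Rightarrow> real" where
  "amplification k \<alpha> = 1 + 32 ^ k * (16 * \<alpha> * real k)"

text \<open>Chosen such that the bound \<open>27 * exp (- d / 3)\<close> of
  \<open>cube_geometric_decay\<close> for \<open>d ^ 3 * (1 / 4) ^ d\<close>, times the
  amplification, is at most half of \<open>1 / precision k b \<epsilon>\<close>: hence the factors 3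
  and 54 = 2 * 27. The final 1 makes the degree positive.\<close>

definition fit_deg :: "nat \<Rightarrow> real \<Rightarrow> nat \<Rightarrow> real \<Rightarrow> nat" where
  "fit_deg k \<alpha> b \<epsilon> = nat \<lceil>3 * (ln (54 * amplification k \<alpha>) + ln (precision k b \<epsilon>))\<rceil> + 1"

text \<open>Takes the other half of the error budget \<open>1 / precision k b \<epsilon>\<close>,
  after amplification and the factor \<open>d ^ 3\<close> lost in differentiating the fit.\<close>

definition stat_error :: "nat \<Rightarrow> real \<Rightarrow> nat \<Rightarrow> real \<Rightarrow> real" where
  "stat_error k \<alpha> b \<epsilon> = 1 / (2 * precision k b \<epsilon> * amplification k \<alpha> * real (fit_deg k \<alpha> b \<epsilon>) ^ 3)"

text \<open>At least the logarithm of \<open>2 * N * 16 ^ k * (d + 1) / \<delta>\<close>: the pairs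
  read by the inversions, times the nodes, times the 2 of the two-sided Hoeffding bound, over the
  failure probability.\<close>

definition log_failure :: "nat \<Rightarrow> real \<Rightarrow> nat \<Rightarrow> real \<Rightarrow> nat \<Rightarrow> real \<Rightarrow> real" where
  "log_failure k \<alpha> b \<epsilon> N \<delta> = log_factor N \<delta> + ln (2 * 16 ^ k * (real (fit_deg k \<alpha> b \<epsilon>) + 1))"

definition repetitions :: "nat \<Rightarrow> real \<Rightarrow> nat \<Rightarrow> real \<Rightarrow> nat \<Rightarrow> real \<Rightarrow> nat" where
  "repetitions k \<alpha> b \<epsilon> N \<delta> = nat \<lceil>2 * 81 ^ k / (stat_error k \<alpha> b \<epsilon>)\<^sup>2 * log_failure k \<alpha> b \<epsilon> N \<delta>\<rceil>"

definition plan_of :: "nat \<Rightarrow> real \<Rightarrow> nat \<Rightarrow> real \<Rightarrow> nat \<Rightarrow> real \<Rightarrow> plan" where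
  "plan_of k \<alpha> b \<epsilon> N \<delta> = simple_plan (1 / (4 * \<alpha> * real k)) (fit_deg k \<alpha> b \<epsilon>) (repetitions k \<alpha> b \<epsilon> N \<delta>)"

section \<open>Accuracy and failure probability\<close>

lemma geometric_factor_bounds:
  assumes "1 \<le> b"
  shows "1 \<le> geometric_factor k b" "real b ^ k \<le> geometric_factor k b"
    "geometric_factor k b \<le> (real k + 1) * real b ^ k"
proof -
  have "real b ^ l \<le> geometric_factor k b" if "l \<le> k" for l
    unfolding geometric_factor_def using that by (intro member_le_sum) auto
  from this[of 0] this[of k] show "1 \<le> geometric_factor k b" "real b ^ k \<le> geometric_factor k b" by simp_all
  have "geometric_factor k b \<le> (\<Sum>l\<le>k. real b ^ k)"
    unfolding geometric_factor_def using assms by (intro sum_mono power_increasing) auto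
  then show "geometric_factor k b \<le> (real k + 1) * real b ^ k" by (simp add: algebra_simps)
qed

lemma inv_accuracy_bounds:
  assumes "0 < \<epsilon>"
  shows "1 \<le> inv_accuracy \<epsilon>" "1 / \<epsilon> \<le> inv_accuracy \<epsilon>" "1 / inv_accuracy \<epsilon> \<le> \<epsilon>"
proof -
  show 1: "1 \<le> inv_accuracy \<epsilon>" and 2: "1 / \<epsilon> \<le> inv_accuracy \<epsilon>" by (simp_all add: inv_accuracy_def)
  show "1 / inv_accuracy \<epsilon> \<le> \<epsilon>" using 1 2 assms by (simp add: field_simps)
qed

lemma precision_ge_1: "1 \<le> b \<Longrightarrow> 0 < \<epsilon> \<Longrightarrow> 1 \<le> precision k b \<epsilon>"
  using geometric_factor_bounds(1)[of b k] inv_accuracy_bounds(1)[of \<epsilon>]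
    mult_mono[of 1 "geometric_factor k b" 1 "inv_accuracy \<epsilon>"]
  by (simp add: precision_def)

lemma amplification_ge_1: "0 < \<alpha> \<Longrightarrow> 1 \<le> amplification k \<alpha>"
  by (simp add: amplification_def)

lemma fit_deg_ge_1: "1 \<le> fit_deg k \<alpha> b \<epsilon>"
  by (simp add: fit_deg_def)

lemma fit_deg_lower: "3 * (ln (54 * amplification k \<alpha>) + ln (precision k b \<epsilon>)) \<le> real (fit_deg k \<alpha> b \<epsilon>)"
  unfolding fit_deg_def by linarith

text \<open>Bernoulli gives \<open>d \<le> 3 * (4 / 3) ^ d\<close>. Its cube costs a factor 64/27
  per degree, which against 1/4 leaves 16/27, less than \<open>exp (- 1 / 3)\<close>.\<close>

lemma cube_geometric_decay: "real d ^ 3 * (1 / 4) ^ d \<le> 27 * exp (- real d / 3)"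
proof -
  have "1 + real d * (1 / 3) \<le> (1 + 1 / 3) ^ d" by (rule Bernoulli_inequality) simp
  then have "real d \<le> 3 * (4 / 3) ^ d" by simp
  then have "real d ^ 3 \<le> (3 * (4 / 3) ^ d) ^ 3" by (intro power_mono) auto
  also have "\<dots> = 27 * (64 / 27) ^ d"
    by (simp add: power_mult_distrib power_mult[symmetric] mult.commute[of d 3]) (simp add: power_mult power_divide)
  finally have "real d ^ 3 * (1 / 4) ^ d \<le> 27 * (64 / 27) ^ d * (1 / 4) ^ d" by (intro mult_right_mono) auto
  also have "\<dots> = 27 * (16 / 27) ^ d" by (simp add: mult.assoc flip: power_mult_distrib)
  also have "\<dots> \<le> 27 * exp (- (1 / 3)) ^ d"
    using exp_ge_add_one_self[of "- (1 / 3)"] by (intro mult_left_mono power_mono) auto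
  also have "exp (- (1 / 3)) ^ d = exp (- real d / 3)" by (simp flip: exp_of_nat_mult)
  finally show ?thesis .
qed

lemma truncation_error:
  assumes "0 < \<alpha>" "1 \<le> b" "0 < \<epsilon>"
  shows "amplification k \<alpha> * (real (fit_deg k \<alpha> b \<epsilon>) ^ 3 * (1 / 4) ^ fit_deg k \<alpha> b \<epsilon>) \<le> 1 / (2 * precision k b \<epsilon>)"
proof -
  let ?a = "amplification k \<alpha>" and ?A = "precision k b \<epsilon>" and ?d = "fit_deg k \<alpha> b \<epsilon>"
  have a: "1 \<le> ?a" and A: "1 \<le> ?A" using assms amplification_ge_1 precision_ge_1 by auto
  have "- real ?d / 3 \<le> - (ln (54 * ?a) + ln ?A)" using fit_deg_lower[of k \<alpha> b \<epsilon>] by simp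
  then have "exp (- real ?d / 3) \<le> exp (- (ln (54 * ?a) + ln ?A))" by simp
  also have "\<dots> = 1 / (54 * ?a * ?A)" unfolding exp_minus exp_add using a A by (simp add: inverse_eq_divide)
  finally have "27 * exp (- real ?d / 3) \<le> 27 * (1 / (54 * ?a * ?A))" by simp
  then have "real ?d ^ 3 * (1 / 4) ^ ?d \<le> 27 * (1 / (54 * ?a * ?A))"
    using cube_geometric_decay[of ?d] by linarith
  then have "?a * (real ?d ^ 3 * (1 / 4) ^ ?d) \<le> ?a * (27 * (1 / (54 * ?a * ?A)))"
    using a by (intro mult_left_mono) auto
  also have "\<dots> = 1 / (2 * ?A)" using a A by (simp add: field_simps)
  finally show ?thesis .
qed

text \<open>Statistical and truncation error each contribute at most
  \<open>1 / (2 * precision k b \<epsilon>)\<close>; multiplying by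
  \<open>geometric_factor k b\<close> leaves \<open>1 / inv_accuracy \<epsilon>\<close>.\<close>

lemma noise_bound:
  fixes k :: nat
  assumes "0 < \<alpha>" "1 \<le> b" "0 < \<epsilon>"
  defines "d \<equiv> fit_deg k \<alpha> b \<epsilon>"
  shows "32 ^ k * (16 * \<alpha> * real k * real d ^ 3 * (stat_error k \<alpha> b \<epsilon> + (1 / 4) ^ d)) * geometric_factor k b \<le> \<epsilon>"
    (is "?l \<le> _")
proof -
  let ?a = "amplification k \<alpha>" and ?A = "precision k b \<epsilon>" and ?s = "stat_error k \<alpha> b \<epsilon>" and ?g = "geometric_factor k b"
  have a: "1 \<le> ?a" and A: "1 \<le> ?A" and g: "1 \<le> ?g" and d: "1 \<le> d"
    using assms amplification_ge_1 precision_ge_1 geometric_factor_bounds fit_deg_ge_1 by (auto simp: d_def)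
  have s: "0 \<le> ?s" "?a * (real d ^ 3 * ?s) = 1 / (2 * ?A)"
    using a A d by (auto simp: stat_error_def d_def[symmetric])
  have "?l = (32 ^ k * (16 * \<alpha> * real k)) * (real d ^ 3 * (?s + (1 / 4) ^ d)) * ?g" by (simp add: mult_ac)
  also have "\<dots> \<le> ?a * (real d ^ 3 * (?s + (1 / 4) ^ d)) * ?g"
    using s g by (intro mult_right_mono) (auto simp: amplification_def)
  also have "\<dots> = (?a * (real d ^ 3 * ?s) + ?a * (real d ^ 3 * (1 / 4) ^ d)) * ?g" by (simp add: algebra_simps)
  also have "\<dots> \<le> (1 / (2 * ?A) + 1 / (2 * ?A)) * ?g"
    using truncation_error[OF assms(1-3), of k] s g by (intro mult_right_mono add_mono) (auto simp: d_def)
  also have "\<dots> = 1 / inv_accuracy \<epsilon>" using g A inv_accuracy_bounds(1)[OF assms(3)] by (simp add: precision_def field_simps)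
  also have "\<dots> \<le> \<epsilon>" by (rule inv_accuracy_bounds(3)[OF assms(3)])
  finally show ?thesis .
qed

lemma log_factor_ge: "1 \<le> log_factor N \<delta>" "ln (real N / \<delta>) \<le> log_factor N \<delta>"
  by (simp_all add: log_factor_def)

lemma ln_union_nonneg: "0 \<le> ln (2 * 16 ^ k * (real d + 1))"
proof -
  have "1 * 1 \<le> (2 * 16 ^ k) * (real d + 1)" by (intro mult_mono) (auto intro: order_trans[OF one_le_power[of "16::real" k]])
  then show ?thesis by simp
qed

lemma repetitions_facts:
  assumes "0 < \<alpha>" "1 \<le> b" "0 < \<epsilon>"
  shows "0 < repetitions k \<alpha> b \<epsilon> N \<delta>"
    "log_failure k \<alpha> b \<epsilon> N \<delta> \<le> real (repetitions k \<alpha> b \<epsilon> N \<delta>) * (stat_error k \<alpha> b \<epsilon>)\<^sup>2 / (2 * 81 ^ k)"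
    "1 \<le> log_failure k \<alpha> b \<epsilon> N \<delta>" "0 < stat_error k \<alpha> b \<epsilon>"
proof -
  let ?s = "stat_error k \<alpha> b \<epsilon>" and ?l = "log_failure k \<alpha> b \<epsilon> N \<delta>"
  show s: "0 < ?s"
    using amplification_ge_1[OF assms(1), of k] precision_ge_1[OF assms(2,3), of k] fit_deg_ge_1[of k \<alpha> b \<epsilon>]
    by (simp add: stat_error_def)
  show l: "1 \<le> ?l" unfolding log_failure_def using log_factor_ge(1)[of N \<delta>] ln_union_nonneg[of k "fit_deg k \<alpha> b \<epsilon>"] by linarith
  let ?x = "2 * 81 ^ k / ?s\<^sup>2 * ?l"
  have x: "0 < ?x" using s l by simp
  then show "0 < repetitions k \<alpha> b \<epsilon> N \<delta>" by (simp add: repetitions_def)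
  have "?x \<le> real (repetitions k \<alpha> b \<epsilon> N \<delta>)" unfolding repetitions_def by linarith
  then show "?l \<le> real (repetitions k \<alpha> b \<epsilon> N \<delta>) * ?s\<^sup>2 / (2 * 81 ^ k)"
    using s by (simp add: field_simps)
qed

lemma failure_bound:
  assumes "0 < \<alpha>" "1 \<le> b" "0 < \<epsilon>" "0 < \<delta>" "1 \<le> N" and w: "w \<le> N * 16 ^ k"
  shows "real w * (real (fit_deg k \<alpha> b \<epsilon>) + 1) *
     (2 * exp (- (real (repetitions k \<alpha> b \<epsilon> N \<delta>) * (stat_error k \<alpha> b \<epsilon>)\<^sup>2 / (2 * 81 ^ k)))) \<le> \<delta>"
proof -
  let ?d = "real (fit_deg k \<alpha> b \<epsilon>) + 1" and ?l = "log_failure k \<alpha> b \<epsilon> N \<delta>"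
  have pos: "0 < 2 * 16 ^ k * ?d" by (intro mult_pos_pos) auto
  have "exp (- (real (repetitions k \<alpha> b \<epsilon> N \<delta>) * (stat_error k \<alpha> b \<epsilon>)\<^sup>2 / (2 * 81 ^ k))) \<le> exp (- ?l)"
    using repetitions_facts(2)[OF assms(1-3), of k N \<delta>] by simp
  also have "\<dots> \<le> exp (- (ln (real N / \<delta>) + ln (2 * 16 ^ k * ?d)))"
    unfolding log_failure_def using log_factor_ge(2)[of N \<delta>] by simp
  also have "\<dots> = \<delta> / real N / (2 * 16 ^ k * ?d)"
    unfolding exp_minus exp_add using assms pos by (simp add: inverse_eq_divide)
  finally have e: "exp (- (real (repetitions k \<alpha> b \<epsilon> N \<delta>) * (stat_error k \<alpha> b \<epsilon>)\<^sup>2 / (2 * 81 ^ k))) \<le> \<delta> / real N / (2 * 16 ^ k * ?d)" .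
  have "real w \<le> real (N * 16 ^ k)" using w by (simp only: of_nat_le_iff)
  then have "real w * ?d * (2 * exp (- (real (repetitions k \<alpha> b \<epsilon> N \<delta>) * (stat_error k \<alpha> b \<epsilon>)\<^sup>2 / (2 * 81 ^ k)))) \<le>
    real (N * 16 ^ k) * ?d * (2 * (\<delta> / real N / (2 * 16 ^ k * ?d)))"
    using e by (intro mult_mono) auto
  also have "\<dots> = \<delta>"
  proof -
    have "real (N * 16 ^ k) * D * (2 * (\<delta> / real N / (2 * 16 ^ k * D))) = \<delta>" if "0 < D" for D
      using that assms by (simp add: field_simps)
    from this[of ?d] show ?thesis by (simp add: add_nonneg_pos)
  qed
  finally show ?thesis .
qed

section \<open>Number of samples\<close>

definition deg_const :: "nat \<Rightarrow> real \<Rightarrow> real" where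
  "deg_const k \<alpha> = 3 * ln (54 * amplification k \<alpha>) + 5"

lemma deg_const_ge: "0 < \<alpha> \<Longrightarrow> 5 \<le> deg_const k \<alpha>"
  using amplification_ge_1[of \<alpha> k] by (simp add: deg_const_def)

lemma fit_deg_upper:
  assumes "0 < \<alpha>" "1 \<le> b" "0 < \<epsilon>"
  shows "real (fit_deg k \<alpha> b \<epsilon>) \<le> deg_const k \<alpha> * (1 + ln (precision k b \<epsilon>))"
proof -
  have l: "0 \<le> ln (54 * amplification k \<alpha>)" "0 \<le> ln (precision k b \<epsilon>)"
    using amplification_ge_1[OF assms(1), of k] precision_ge_1[OF assms(2,3), of k] by auto
  have "real (fit_deg k \<alpha> b \<epsilon>) \<le> 3 * (ln (54 * amplification k \<alpha>) + ln (precision k b \<epsilon>)) + 2"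
  proof -
    have "0 \<le> 3 * (ln (54 * amplification k \<alpha>) + ln (precision k b \<epsilon>))" using l by simp
    then show ?thesis unfolding fit_deg_def by linarith
  qed
  also have "\<dots> \<le> deg_const k \<alpha> * (1 + ln (precision k b \<epsilon>))"
    using l by (simp add: deg_const_def algebra_simps)
  finally show ?thesis .
qed

lemma length_bound:
  assumes "1 \<le> (d::nat)"
  shows "real (Suc d) \<le> 2 * (real d * (1 + ln (real d)))"
proof -
  have "real d * 1 \<le> real d * (1 + ln (real d))" using assms by (intro mult_left_mono) auto
  moreover have "real (Suc d) = real d + 1" "1 \<le> real d" using assms by simp_all
  ultimately show ?thesis by linarith
qed

definition count_const :: "nat \<Rightarrow> real \<Rightarrow> real" where
  "count_const k \<alpha> = 2 * (8 * 81 ^ k * (amplification k \<alpha>)\<^sup>2 * (2 + ln (2 * 16 ^ k)) + 1)"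

text \<open>The eighth power of the degree arises as follows: six from the inverse square of
  \<open>stat_error\<close>, one from \<open>ln (d + 1)\<close> in \<open>log_failure\<close>,
  estimated by \<open>d\<close>, and one from the \<open>d + 1\<close> nodes.\<close>

lemma sample_count_deg:
  assumes "0 < \<alpha>" "1 \<le> b" "0 < \<epsilon>"
  shows "real (sample_count (plan_of k \<alpha> b \<epsilon> N \<delta>)) \<le>
    count_const k \<alpha> * ((precision k b \<epsilon>)\<^sup>2 * log_factor N \<delta>) * real (fit_deg k \<alpha> b \<epsilon>) ^ 8"
proof -
  let ?d = "real (fit_deg k \<alpha> b \<epsilon>)" and ?A = "precision k b \<epsilon>" and ?a = "amplification k \<alpha>"
  let ?lf = "log_factor N \<delta>" and ?c = "2 + ln (2 * 16 ^ k)"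
  have d: "1 \<le> ?d" using fit_deg_ge_1[of k \<alpha> b \<epsilon>] by simp
  have A: "1 \<le> ?A" and a: "1 \<le> ?a" using assms precision_ge_1 amplification_ge_1 by auto
  have lf: "1 \<le> ?lf" by (rule log_factor_ge)
  have c: "0 \<le> ln (2 * 16 ^ k :: real)" using ln_union_nonneg[of k 0] by simp
  have "log_failure k \<alpha> b \<epsilon> N \<delta> = ?lf + ln (2 * 16 ^ k) + ln (?d + 1)"
    unfolding log_failure_def using d by (subst ln_mult) auto
  also have "\<dots> \<le> ?lf * 1 + ?lf * ln (2 * 16 ^ k) + ?lf * ?d"
  proof -
    have "1 * ln (2 * 16 ^ k) \<le> ?lf * ln (2 * 16 ^ k)" using lf c by (rule mult_right_mono)
    moreover have "1 * ?d \<le> ?lf * ?d" using lf by (rule mult_right_mono) simp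
    moreover have "ln (?d + 1) \<le> ?d" using ln_add_one_self_le_self[of ?d] by (simp add: add.commute)
    ultimately show ?thesis by linarith
  qed
  also have "\<dots> \<le> ?lf * (?d * ?c)"
  proof -
    have "1 + ln (2 * 16 ^ k) + ?d \<le> ?d * ?c"
      using d c mult_right_mono[of 1 ?d "ln (2 * 16 ^ k)"] by (simp add: algebra_simps)
    then have "?lf * (1 + ln (2 * 16 ^ k) + ?d) \<le> ?lf * (?d * ?c)" using lf by (intro mult_left_mono) auto
    then show ?thesis by (simp add: algebra_simps)
  qed
  finally have l: "log_failure k \<alpha> b \<epsilon> N \<delta> \<le> ?lf * (?d * ?c)" .
  have s: "2 * 81 ^ k / (stat_error k \<alpha> b \<epsilon>)\<^sup>2 = 8 * 81 ^ k * ?a\<^sup>2 * ?A\<^sup>2 * ?d ^ 6"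
    unfolding stat_error_def by (simp add: power_divide power_mult_distrib power_mult[symmetric])
  have "0 \<le> 2 * 81 ^ k / (stat_error k \<alpha> b \<epsilon>)\<^sup>2 * log_failure k \<alpha> b \<epsilon> N \<delta>"
    using repetitions_facts(3)[OF assms, of k N \<delta>] by simp
  then have "real (repetitions k \<alpha> b \<epsilon> N \<delta>) \<le> 2 * 81 ^ k / (stat_error k \<alpha> b \<epsilon>)\<^sup>2 * log_failure k \<alpha> b \<epsilon> N \<delta> + 1"
    unfolding repetitions_def by linarith
  also have "\<dots> \<le> 8 * 81 ^ k * ?a\<^sup>2 * ?A\<^sup>2 * ?d ^ 6 * (?lf * (?d * ?c)) + 1"
    unfolding s using l by (intro add_right_mono mult_left_mono) auto
  also have "\<dots> = 8 * 81 ^ k * ?a\<^sup>2 * ?c * (?A\<^sup>2 * ?lf * ?d ^ 7) + 1"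
    by (simp add: eval_nat_numeral mult_ac)
  also have "\<dots> \<le> 8 * 81 ^ k * ?a\<^sup>2 * ?c * (?A\<^sup>2 * ?lf * ?d ^ 7) + ?A\<^sup>2 * ?lf * ?d ^ 7"
  proof -
    have "1 * 1 * 1 \<le> ?A\<^sup>2 * ?lf * ?d ^ 7" using A lf d by (intro mult_mono one_le_power) auto
    then show ?thesis by simp
  qed
  also have "\<dots> = (8 * 81 ^ k * ?a\<^sup>2 * ?c + 1) * (?A\<^sup>2 * ?lf * ?d ^ 7)" by (simp add: distrib_right)
  finally have M: "real (repetitions k \<alpha> b \<epsilon> N \<delta>) \<le> (8 * 81 ^ k * ?a\<^sup>2 * ?c + 1) * (?A\<^sup>2 * ?lf * ?d ^ 7)" .
  have "real (sample_count (plan_of k \<alpha> b \<epsilon> N \<delta>)) = (?d + 1) * real (repetitions k \<alpha> b \<epsilon> N \<delta>)"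
    by (simp add: sample_count_def plan_of_def simple_plan_def algebra_simps)
  also have "\<dots> \<le> (2 * ?d) * ((8 * 81 ^ k * ?a\<^sup>2 * ?c + 1) * (?A\<^sup>2 * ?lf * ?d ^ 7))"
    using M d by (intro mult_mono) auto
  also have "\<dots> = count_const k \<alpha> * (?A\<^sup>2 * ?lf) * ?d ^ 8"
    unfolding count_const_def by (simp add: eval_nat_numeral mult_ac)
  finally show ?thesis .
qed

lemma ln_precision_polylog:
  assumes "1 \<le> b" "0 < \<epsilon>"
  shows "1 + ln (precision k b \<epsilon>) \<le> (2 * real k + 2) * (ln (exp 1 + real b) * ln (exp 1 + 1 / \<epsilon>))"
proof -
  let ?x = "ln (exp 1 + real b)" and ?y = "ln (exp 1 + 1 / \<epsilon>)"
  have g: "1 \<le> geometric_factor k b" using geometric_factor_bounds[OF assms(1)] by simp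
  have x: "1 \<le> ?x"
  proof -
    have "ln (exp 1) \<le> ?x" by (rule ln_mono) (auto intro: add_pos_nonneg)
    then show ?thesis by simp
  qed
  have y: "1 \<le> ?y"
  proof -
    have "ln (exp 1) \<le> ?y" using assms by (intro ln_mono) (auto intro: add_pos_nonneg)
    then show ?thesis by simp
  qed
  have "ln (geometric_factor k b) \<le> ln ((real k + 1) * real b ^ k)"
    using geometric_factor_bounds[OF assms(1), of k] g by (intro ln_mono) auto
  also have "\<dots> = ln (real k + 1) + real k * ln (real b)" using assms by (simp add: ln_mult ln_realpow)
  also have "\<dots> \<le> real k + real k * ?x"
  proof (rule add_mono)
    show "ln (real k + 1) \<le> real k" using ln_add_one_self_le_self[of "real k"] by (simp add: add.commute)
    have "ln (real b) \<le> ?x" using assms by (intro ln_mono) auto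
    then show "real k * ln (real b) \<le> real k * ?x" by (intro mult_left_mono) auto
  qed
  finally have 1: "ln (geometric_factor k b) \<le> real k + real k * ?x" .
  have 2: "ln (inv_accuracy \<epsilon>) \<le> ?y"
  proof -
    have "1 \<le> exp (1::real)" by simp
    then have "inv_accuracy \<epsilon> \<le> exp 1 + 1 / \<epsilon>" using assms unfolding inv_accuracy_def by (auto simp: max_def intro: add_increasing2)
    then show ?thesis using inv_accuracy_bounds(1)[OF assms(2)] by (intro ln_mono) auto
  qed
  have "ln (precision k b \<epsilon>) = ln (geometric_factor k b) + ln (inv_accuracy \<epsilon>)"
    unfolding precision_def using g inv_accuracy_bounds(1)[OF assms(2)] by (simp add: ln_mult)
  then have "1 + ln (precision k b \<epsilon>) \<le> 1 + real k + real k * ?x + ?y" using 1 2 by simp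
  also have "\<dots> \<le> (2 * real k + 2) * (?x * ?y)"
  proof -
    have xy: "1 \<le> ?x * ?y" "?x \<le> ?x * ?y" "?y \<le> ?x * ?y"
      using x y mult_mono[of 1 ?x 1 ?y] mult_left_mono[of 1 ?y ?x] mult_right_mono[of 1 ?x ?y] by auto
    have "real k * 1 \<le> real k * (?x * ?y)" "real k * ?x \<le> real k * (?x * ?y)"
      using xy by (intro mult_left_mono; simp)+
    then show ?thesis using xy by (simp add: algebra_simps)
  qed
  finally show ?thesis .
qed

text \<open>The degree is at most a constant times a product of logarithms, so its eighth power is a
  \<open>polylog\<close> of exponent 8; the logarithm in \<open>N\<close> is inserted as a factor
  that is at least 1.\<close>

lemma sample_count_bound:
  assumes "0 < \<alpha>" "1 \<le> b" "0 < \<epsilon>"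
  shows "real (sample_count (plan_of k \<alpha> b \<epsilon> N \<delta>)) \<le>
    count_const k \<alpha> * (deg_const k \<alpha> * (2 * real k + 2)) ^ 8 *
      ((geometric_factor k b)\<^sup>2 * (inv_accuracy \<epsilon>)\<^sup>2 * log_factor N \<delta>) * polylog 8 b \<epsilon> N"
proof -
  let ?d = "real (fit_deg k \<alpha> b \<epsilon>)" and ?B = "(precision k b \<epsilon>)\<^sup>2 * log_factor N \<delta>"
  let ?x = "ln (exp 1 + real b)" and ?y = "ln (exp 1 + 1 / \<epsilon>)" and ?z = "ln (exp 1 + real N)"
  let ?D = "deg_const k \<alpha> * (2 * real k + 2)"
  have D: "0 \<le> deg_const k \<alpha>" using deg_const_ge[OF assms(1), of k] by simp
  have z: "1 \<le> ?z"
  proof -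
    have "ln (exp 1) \<le> ?z" by (rule ln_mono) (auto intro: add_pos_nonneg)
    then show ?thesis by simp
  qed
  have "0 \<le> ln (precision k b \<epsilon>)" using precision_ge_1[OF assms(2,3), of k] by simp
  then have "0 \<le> (2 * real k + 2) * (?x * ?y)" using ln_precision_polylog[OF assms(2,3), of k] by linarith
  then have xy: "0 \<le> ?x * ?y" by (simp add: zero_le_mult_iff)
  have "?d \<le> deg_const k \<alpha> * ((2 * real k + 2) * (?x * ?y))"
    using fit_deg_upper[OF assms, of k] mult_left_mono[OF ln_precision_polylog[OF assms(2,3), of k] D] by linarith
  also have "\<dots> \<le> ?D * (?x * ?y * ?z)"
  proof -
    have "?x * ?y * 1 \<le> ?x * ?y * ?z" using z xy by (rule mult_left_mono)
    moreover have "0 \<le> ?D" using D by simp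
    ultimately have "?D * (?x * ?y * 1) \<le> ?D * (?x * ?y * ?z)" by (rule mult_left_mono)
    moreover have "?D * (?x * ?y * 1) = deg_const k \<alpha> * ((2 * real k + 2) * (?x * ?y))" by (simp add: mult.assoc)
    ultimately show ?thesis by (simp only:)
  qed
  finally have "?d ^ 8 \<le> (?D * (?x * ?y * ?z)) ^ 8" by (intro power_mono) auto
  then have d8: "?d ^ 8 \<le> ?D ^ 8 * polylog 8 b \<epsilon> N" by (simp add: polylog_def power_mult_distrib)
  have c: "0 \<le> count_const k \<alpha>"
    using ln_union_nonneg[of k 0] by (simp add: count_const_def)
  have B: "0 \<le> ?B" using log_factor_ge(1)[of N \<delta>] by simp
  have "real (sample_count (plan_of k \<alpha> b \<epsilon> N \<delta>)) \<le> count_const k \<alpha> * ?B * ?d ^ 8"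
    by (rule sample_count_deg[OF assms])
  also have "\<dots> \<le> count_const k \<alpha> * ?B * (?D ^ 8 * polylog 8 b \<epsilon> N)"
    using d8 c B by (intro mult_left_mono) auto
  finally show ?thesis by (simp add: precision_def power_mult_distrib mult_ac)
qed

section \<open>Size of the branching number and of the threshold\<close>

lemma branching_bounds:
  fixes C p \<epsilon> :: real and k :: nat
  assumes "0 < \<epsilon>"
  defines "b \<equiv> branching k C p \<epsilon>"
  shows "1 \<le> b" "(4 * C / \<epsilon>) powr (1 / p) \<le> real b"
    "(2 * (real k + 1) * C_bar C p / \<epsilon>) powr (1 / (p - real k - 1)) \<le> real b"
    "real b \<le> 2 + (4 * C / \<epsilon>) powr (1 / p) + (2 * (real k + 1) * C_bar C p / \<epsilon>) powr (1 / (p - real k - 1))"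
proof -
  let ?x = "(4 * C / \<epsilon>) powr (1 / p)" and ?y = "(2 * (real k + 1) * C_bar C p / \<epsilon>) powr (1 / (p - real k - 1))"
  have b: "b = nat \<lceil>max 1 (max ?x ?y)\<rceil>" by (simp add: b_def branching_def)
  have nn: "0 \<le> ?x" "0 \<le> ?y" by simp_all
  have le: "max 1 (max ?x ?y) \<le> real b" unfolding b by linarith
  then have "1 \<le> real b" by simp
  then show "1 \<le> b" by simp
  show "?x \<le> real b" "?y \<le> real b" using le by simp_all
  have "0 \<le> max 1 (max ?x ?y)" by simp
  then have "real b \<le> max 1 (max ?x ?y) + 1" unfolding b by linarith
  then show "real b \<le> 2 + ?x + ?y" using nn by linarith
qed

lemma C_bar_pos: "0 < C \<Longrightarrow> 1 < p \<Longrightarrow> 0 < C_bar C p"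
  by (simp add: C_bar_def add_pos_nonneg)

lemma powr_root_le: "0 < (q::real) \<Longrightarrow> 0 \<le> x \<Longrightarrow> x powr (1 / q) \<le> y \<Longrightarrow> x \<le> y powr q"
  using powr_mono2[of q "x powr (1 / q)" y] by (simp add: powr_powr)

text \<open>The second entry of the maximum in \<open>branching\<close> gives
  \<open>4 * C / \<epsilon> \<le> b powr p\<close>, hence the bound on \<tau>. In the tail,
  \<open>b * \<tau>\<close> is at most \<open>2 * C * b powr (1 - p)\<close>; together with the
  summed decay this is the origin of \<open>C_bar\<close>. As \<open>geometric_factor k b\<close> is
  at most \<open>(k + 1) * b ^ k\<close>, the exponent becomes \<open>- (p - k - 1)\<close>, and the
  third entry of the maximum applies.\<close>

lemma threshold_le:
  assumes C: "0 < C" and p: "real k + 1 < p" and \<epsilon>: "0 < \<epsilon>"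
    and \<tau>: "\<tau> \<le> 2 * C * real (branching k C p \<epsilon> + 1) powr (- p)"
  shows "\<tau> \<le> \<epsilon> / 2"
    and "(real (branching k C p \<epsilon>) * \<tau> + C * (real (branching k C p \<epsilon>) powr (1 - p) / (p - 1))) *
      geometric_factor k (branching k C p \<epsilon>) \<le> \<epsilon> / 2"
proof -
  define b where "b = branching k C p \<epsilon>"
  note bb = branching_bounds[OF \<epsilon>, where k = k and C = C and p = p, folded b_def]
  have b1: "1 \<le> real b" using bb(1) by simp
  have p1: "1 < p" "0 < p" "0 < p - real k - 1" using p by auto
  have mono: "real (b + 1) powr (- p) \<le> real b powr (- p)" using b1 p1 by (intro powr_mono2') auto
  have \<tau>b: "\<tau> \<le> 2 * C * real b powr (- p)"
    using \<tau>[folded b_def] C mult_left_mono[OF mono, of "2 * C"] by linarith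
  have "4 * C / \<epsilon> \<le> real b powr p" using bb(2) C \<epsilon> p1 by (intro powr_root_le) auto
  then have "2 * C * real b powr (- p) \<le> \<epsilon> / 2"
    using b1 \<epsilon> by (simp add: powr_minus field_simps)
  then show "\<tau> \<le> \<epsilon> / 2" using \<tau>b by linarith
  have pw: "real b * real b powr (- p) = real b powr (1 - p)"
    using b1 by (simp add: powr_diff powr_minus divide_inverse)
  have "real b * \<tau> \<le> real b * (2 * C * real b powr (- p))" using \<tau>b by (intro mult_left_mono) auto
  also have "\<dots> = 2 * C * real b powr (1 - p)" using pw by (simp add: mult_ac)
  finally have "real b * \<tau> + C * (real b powr (1 - p) / (p - 1)) \<le> C_bar C p * real b powr (1 - p)"
    by (simp add: C_bar_def algebra_simps)
  then have "(real b * \<tau> + C * (real b powr (1 - p) / (p - 1))) * geometric_factor k b \<le>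
    (C_bar C p * real b powr (1 - p)) * ((real k + 1) * real b ^ k)"
    using geometric_factor_bounds[OF bb(1), of k] C_bar_pos[OF C p1(1)] by (intro mult_mono) auto
  also have "\<dots> = (real k + 1) * C_bar C p * real b powr (- (p - real k - 1))"
  proof -
    have "real b powr (1 - p) * real b ^ k = real b powr (1 - p) * real b powr real k"
      using b1 by (simp add: powr_realpow)
    also have "\<dots> = real b powr (- (p - real k - 1))" by (simp add: algebra_simps flip: powr_add)
    finally show ?thesis by (simp add: mult_ac)
  qed
  also have "\<dots> \<le> \<epsilon> / 2"
  proof -
    have "2 * (real k + 1) * C_bar C p / \<epsilon> \<le> real b powr (p - real k - 1)"
      using bb(3) C_bar_pos[OF C p1(1)] \<epsilon> p1 by (intro powr_root_le) auto
    moreover have "0 < real b powr (p - real k - 1)" using b1 by simp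
    ultimately show ?thesis using \<epsilon> unfolding powr_minus by (simp add: field_simps)
  qed
  finally show "(real (branching k C p \<epsilon>) * \<tau> + C * (real (branching k C p \<epsilon>) powr (1 - p) / (p - 1))) *
      geometric_factor k (branching k C p \<epsilon>) \<le> \<epsilon> / 2" by (simp add: b_def)
qed

text \<open>\<open>geometric_factor k b\<close> is of order \<open>b ^ k\<close>, and
  \<open>b\<close> is of order \<open>inv_accuracy \<epsilon> powr s\<close>. The upper bound uses
  \<open>1 / p \<le> s\<close>, so that the last entry of the maximum dominates; the lower bound
  comes from that entry for \<open>\<epsilon> \<le> 1\<close>, and from
  \<open>inv_accuracy \<epsilon> = 1\<close> otherwise.\<close>

lemma bounds_comparable:
  assumes C: "0 < C" and p: "real k + 1 < p"
  shows "\<exists>K>0. \<forall>\<epsilon>>0. \<forall>N \<delta>.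
    (geometric_factor k (branching k C p \<epsilon>))\<^sup>2 * (inv_accuracy \<epsilon>)\<^sup>2 * log_factor N \<delta> \<le>
      K * (inv_accuracy \<epsilon> powr (2 + 2 * real k / (p - real k - 1)) * log_factor N \<delta>) \<and>
    inv_accuracy \<epsilon> powr (2 + 2 * real k / (p - real k - 1)) * log_factor N \<delta> \<le>
      K * ((geometric_factor k (branching k C p \<epsilon>))\<^sup>2 * (inv_accuracy \<epsilon>)\<^sup>2 * log_factor N \<delta>)"
proof -
  define s where "s = 1 / (p - real k - 1)"
  define Y where "Y = 2 * (real k + 1) * C_bar C p"
  define B where "B = 2 + (4 * C) powr (1 / p) + Y powr s"
  define L where "L = max 1 (1 / Y powr s)"
  have p1: "1 < p" "0 < p" "0 < p - real k - 1" using p by auto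
  have s: "0 < s" "1 / p \<le> s" using p1 by (auto simp: s_def field_simps)
  have Y: "0 < Y" using C_bar_pos[OF C p1(1)] by (simp add: Y_def)
  have B: "0 < B" by (simp add: B_def add_pos_nonneg)
  have L: "1 \<le> L" by (simp add: L_def)
  define K where "K = max (((real k + 1) * B ^ k)\<^sup>2) ((L ^ k)\<^sup>2)"
  have K: "0 < K" using L by (simp add: K_def less_max_iff_disj)
  show ?thesis
  proof (intro exI[of _ K] conjI K allI impI)
    fix \<epsilon> :: real and N and \<delta> :: real
    assume \<epsilon>: "0 < \<epsilon>"
    define b where "b = branching k C p \<epsilon>"
    define i where "i = inv_accuracy \<epsilon>"
    define l where "l = log_factor N \<delta>"
    note bb = branching_bounds[OF \<epsilon>, where k = k and C = C and p = p, folded b_def]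
    have i: "1 \<le> i" "1 / \<epsilon> \<le> i" using inv_accuracy_bounds[OF \<epsilon>] by (auto simp: i_def)
    have l: "0 \<le> l" using log_factor_ge(1)[of N \<delta>] by (simp add: l_def)
    have ige: "1 \<le> i powr s" using i s by (simp add: ge_one_powr_ge_zero)
    have up: "real b \<le> B * i powr s"
    proof -
      have "(4 * C / \<epsilon>) powr (1 / p) \<le> (4 * C * i) powr (1 / p)"
        using C i \<epsilon> p1 mult_left_mono[OF i(2), of "4 * C"] by (intro powr_mono2) auto
      also have "\<dots> = (4 * C) powr (1 / p) * i powr (1 / p)" using C i by (simp add: powr_mult)
      also have "\<dots> \<le> (4 * C) powr (1 / p) * i powr s" using i s by (intro mult_left_mono powr_mono) auto
      finally have 1: "(4 * C / \<epsilon>) powr (1 / p) \<le> (4 * C) powr (1 / p) * i powr s" .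
      have "(Y / \<epsilon>) powr s \<le> (Y * i) powr s"
        using Y i \<epsilon> s mult_left_mono[OF i(2), of Y] by (intro powr_mono2) auto
      also have "\<dots> = Y powr s * i powr s" using Y i by (simp add: powr_mult)
      finally have 2: "(Y / \<epsilon>) powr s \<le> Y powr s * i powr s" .
      have "real b \<le> 2 * 1 + (4 * C / \<epsilon>) powr (1 / p) + (Y / \<epsilon>) powr s"
        using bb(4) by (simp add: Y_def s_def)
      also have "\<dots> \<le> 2 * i powr s + (4 * C) powr (1 / p) * i powr s + Y powr s * i powr s"
        using 1 2 ige by (intro add_mono) auto
      finally show ?thesis by (simp add: B_def algebra_simps)
    qed
    have low: "i powr s \<le> L * real b"
    proof (cases "\<epsilon> \<le> 1")
      case True
      then have ie: "i = 1 / \<epsilon>" using \<epsilon> by (simp add: i_def inv_accuracy_def max_def field_simps)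
      have "Y powr s * i powr s = (Y / \<epsilon>) powr s" using Y \<epsilon> by (simp add: ie powr_mult powr_divide)
      also have "\<dots> \<le> real b" using bb(3) by (simp add: Y_def s_def)
      finally have "i powr s \<le> (1 / Y powr s) * real b" using Y by (simp add: field_simps)
      also have "\<dots> \<le> L * real b" by (intro mult_right_mono) (auto simp: L_def)
      finally show ?thesis .
    next
      case False
      then have "1 / \<epsilon> \<le> 1" by simp
      then have "i = 1" unfolding i_def inv_accuracy_def by (simp only: max_absorb1)
      moreover have "1 * 1 \<le> L * real b" using L bb(1) by (intro mult_mono) auto
      ultimately show ?thesis by simp
    qed
    have pw: "i powr (2 + 2 * real k / (p - real k - 1)) = i\<^sup>2 * ((i powr s) ^ k)\<^sup>2"
    proof -
      have "2 + 2 * real k / (p - real k - 1) = real 2 + (s * real k + s * real k)" by (simp add: s_def)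
      then have "i powr (2 + 2 * real k / (p - real k - 1)) = i powr real 2 * (i powr (s * real k) * i powr (s * real k))"
        by (simp only: powr_add)
      also have "i powr real 2 = i\<^sup>2" using i by (intro powr_realpow) auto
      also have "i powr (s * real k) = (i powr s) ^ k" using i by (simp add: powr_powr[symmetric] powr_realpow)
      finally show ?thesis by (simp add: power2_eq_square)
    qed
    have "geometric_factor k b \<le> (real k + 1) * real b ^ k" by (rule geometric_factor_bounds[OF bb(1)])
    also have "\<dots> \<le> (real k + 1) * (B * i powr s) ^ k" using up by (intro mult_left_mono power_mono) auto
    also have "\<dots> = (real k + 1) * B ^ k * (i powr s) ^ k" by (simp add: power_mult_distrib)
    finally have "(geometric_factor k b)\<^sup>2 \<le> ((real k + 1) * B ^ k * (i powr s) ^ k)\<^sup>2"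
      using geometric_factor_bounds(1)[OF bb(1), of k] by (intro power_mono) auto
    also have "\<dots> = ((real k + 1) * B ^ k)\<^sup>2 * ((i powr s) ^ k)\<^sup>2" by (simp add: power_mult_distrib)
    also have "\<dots> \<le> K * ((i powr s) ^ k)\<^sup>2" by (intro mult_right_mono) (auto simp: K_def)
    finally have "(geometric_factor k b)\<^sup>2 * (i\<^sup>2 * l) \<le> K * ((i powr s) ^ k)\<^sup>2 * (i\<^sup>2 * l)"
      using l by (intro mult_right_mono) auto
    then show "(geometric_factor k (branching k C p \<epsilon>))\<^sup>2 * (inv_accuracy \<epsilon>)\<^sup>2 * log_factor N \<delta> \<le>
      K * (inv_accuracy \<epsilon> powr (2 + 2 * real k / (p - real k - 1)) * log_factor N \<delta>)"
      unfolding b_def[symmetric] i_def[symmetric] l_def[symmetric] pw by (simp only: mult_ac)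
    have "(i powr s) ^ k \<le> (L * real b) ^ k" using low by (intro power_mono) auto
    also have "\<dots> = L ^ k * real b ^ k" by (simp add: power_mult_distrib)
    also have "\<dots> \<le> L ^ k * geometric_factor k b"
      using L geometric_factor_bounds(2)[OF bb(1), of k] by (intro mult_left_mono) auto
    finally have "((i powr s) ^ k)\<^sup>2 \<le> (L ^ k * geometric_factor k b)\<^sup>2" by (intro power_mono) auto
    also have "\<dots> = (L ^ k)\<^sup>2 * (geometric_factor k b)\<^sup>2" by (simp only: power_mult_distrib)
    also have "\<dots> \<le> K * (geometric_factor k b)\<^sup>2" by (intro mult_right_mono) (auto simp: K_def)
    finally have "((i powr s) ^ k)\<^sup>2 * (i\<^sup>2 * l) \<le> K * (geometric_factor k b)\<^sup>2 * (i\<^sup>2 * l)"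
      using l by (intro mult_right_mono) auto
    then show "inv_accuracy \<epsilon> powr (2 + 2 * real k / (p - real k - 1)) * log_factor N \<delta> \<le>
      K * ((geometric_factor k (branching k C p \<epsilon>))\<^sup>2 * (inv_accuracy \<epsilon>)\<^sup>2 * log_factor N \<delta>)"
      unfolding b_def[symmetric] i_def[symmetric] l_def[symmetric] pw by (simp only: mult_ac)
  qed
qed

section \<open>Correctness of the algorithm\<close>

text \<open>The noise contributes \<epsilon> and the discarded extensions \<epsilon> / 2, so every
  coefficient is known up to 3/2 \<epsilon>. Forming \<open>h\<close> takes half of a difference of
  two coefficients, which does not increase this bound.\<close>

lemma postprocess_correct:
  fixes k :: nat and Lhat
  assumes g: "k_local_lindblad n k g" and chi: "chi_expansion n (lindbladian n k g) chi"
    and G: "gks_expansion n (lindbladian n k g) (ham_coeff g) G"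
    and decay: "diagonal_extension_decay n chi C p" and C: "0 < C" and p: "real k + 1 < p"
    and \<alpha>: "0 < \<alpha>" and \<epsilon>: "0 < \<epsilon>"
  defines "b \<equiv> branching k C p \<epsilon>"
  assumes \<tau>: "C * real (b + 1) powr (- p) < \<tau>" "\<tau> \<le> 2 * C * real (b + 1) powr (- p)"
    and \<omega>: "distinct \<omega>" "set \<omega> = threshold_support n k chi \<tau>"
  defines "d \<equiv> fit_deg k \<alpha> b \<epsilon>"
  defines "r \<equiv> postprocess k \<omega> Lhat"
  assumes ptm: "\<And>u A B. u \<in> set \<omega> \<Longrightarrow> A \<in> paulis_on (pair_supp u) \<Longrightarrow> B \<in> paulis_on (pair_supp u) \<Longrightarrow>
      \<bar>Lhat A B - Re (mtrace (pauli_op n A * lindbladian n k g (pauli_op n B))) / 2 ^ n\<bar> \<le>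
        16 * \<alpha> * real k * real d ^ 3 * (stat_error k \<alpha> b \<epsilon> + (1 / 4) ^ d)"
  shows "\<forall>P \<in> paulis n - {id_string}. \<forall>Q \<in> paulis n - {id_string}. cmod (G_reg r (P, Q) - G (P, Q)) \<le> 2 * \<epsilon>"
    and "\<forall>P \<in> paulis n. cmod (h_reg r P - ham_coeff g P) \<le> 2 * \<epsilon>"
proof -
  let ?\<theta> = "16 * \<alpha> * real k * real d ^ 3 * (stat_error k \<alpha> b \<epsilon> + (1 / 4) ^ d)"
  have b1: "1 \<le> b" unfolding b_def by (rule branching_bounds(1)[OF \<epsilon>])
  have p1: "1 < p" using p by simp
  note ctx = g chi decay C p1 b1 \<tau>(1)
  have \<theta>: "0 \<le> ?\<theta>"
    using \<alpha> repetitions_facts(4)[OF \<alpha> b1 \<epsilon>, of k] by (intro mult_nonneg_nonneg add_nonneg_nonneg) auto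
  have err: "cmod (chi_reg r (P, Q) - chi (P, Q)) \<le> 3 / 2 * \<epsilon>"
    if PQ: "P \<in> paulis n" "Q \<in> paulis n" "(P, Q) \<noteq> (id_string, id_string)" for P Q
  proof -
    have "cmod (chi_reg r (P, Q) - chi (P, Q)) \<le>
      max \<tau> ((32 ^ k * ?\<theta> + tail C p \<tau> b) * geometric_factor k b)"
      unfolding r_def
      by (rule reconstruction_error[OF ctx \<omega>(2) \<omega>(1) refl \<theta> _ PQ]) (use ptm in blast)
    also have "\<dots> \<le> 3 / 2 * \<epsilon>"
    proof (rule max.boundedI)
      show "\<tau> \<le> 3 / 2 * \<epsilon>" using threshold_le(1)[OF C p \<epsilon> \<tau>(2)[unfolded b_def]] \<epsilon> by simp
      have "32 ^ k * ?\<theta> * geometric_factor k b \<le> \<epsilon>"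
        unfolding d_def by (rule noise_bound[OF \<alpha> b1 \<epsilon>])
      moreover have "tail C p \<tau> b * geometric_factor k b \<le> \<epsilon> / 2"
        unfolding tail_def[OF ctx refl] unfolding b_def by (rule threshold_le(2)[OF C p \<epsilon> \<tau>(2)[unfolded b_def]])
      ultimately show "(32 ^ k * ?\<theta> + tail C p \<tau> b) * geometric_factor k b \<le> 3 / 2 * \<epsilon>"
        unfolding distrib_right by linarith
    qed
    finally show ?thesis .
  qed
  note facts = support_facts[OF ctx refl, folded \<omega>(2)]
  note regs = postprocess_registers[where \<Omega> = "set \<omega>" and k = k and \<omega> = \<omega> and Lhat = Lhat, folded r_def, OF _ _ \<omega>(1) refl]
  have fin: "finite (pair_supp u)" "1 \<le> card (pair_supp u) \<and> card (pair_supp u) \<le> k" if "u \<in> set \<omega>" for u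
    using facts[OF that] by auto
  show "\<forall>P \<in> paulis n - {id_string}. \<forall>Q \<in> paulis n - {id_string}. cmod (G_reg r (P, Q) - G (P, Q)) \<le> 2 * \<epsilon>"
  proof (intro ballI)
    fix P Q assume PQ: "P \<in> paulis n - {id_string}" "Q \<in> paulis n - {id_string}"
    have "G_reg r (P, Q) = chi_reg r (P, Q)" using PQ by (intro regs(3) fin) auto
    moreover have "G (P, Q) = chi (P, Q)"
      using PQ chi_of_gks_expansion(1)[OF G] chi_of_chi_expansion[OF chi] by (metis DiffD1 DiffD2 singletonI)
    ultimately show "cmod (G_reg r (P, Q) - G (P, Q)) \<le> 2 * \<epsilon>" using err[of P Q] PQ \<epsilon> by auto
  qed
  show "\<forall>P \<in> paulis n. cmod (h_reg r P - ham_coeff g P) \<le> 2 * \<epsilon>"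
  proof
    fix P assume P: "P \<in> paulis n"
    have h: "h_reg r P = \<i> / 2 * (chi_reg r (P, id_string) - chi_reg r (id_string, P))"
      by (intro regs(4) fin) auto
    show "cmod (h_reg r P - ham_coeff g P) \<le> 2 * \<epsilon>"
    \<comment> \<open>The bound \<open>err\<close> does not cover the pair of two identities. At
      \<open>P = id_string\<close> the register is half of a difference of equal terms, and the true
      coefficient vanishes because the Hamiltonian is traceless.\<close>
    proof (cases "P = id_string")
      case True
      have "mtrace (hamiltonian n (ham_coeff g) (paulis n)) = 0"
        using g unfolding k_local_lindblad_def Let_def by blast
      then have "ham_coeff g id_string = 0" by (rule hamiltonian_traceless)
      then show ?thesis using h True \<epsilon> by simp
    next
      case False
      have "ham_coeff g P = \<i> / 2 * (chi (P, id_string) - chi (id_string, P))"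
        using chi_of_gks_expansion(2)[OF G P id_string_paulis False]
          chi_of_chi_expansion[OF chi P id_string_paulis] chi_of_chi_expansion[OF chi id_string_paulis P] by simp
      then have eq: "h_reg r P - ham_coeff g P =
        \<i> / 2 * ((chi_reg r (P, id_string) - chi (P, id_string)) - (chi_reg r (id_string, P) - chi (id_string, P)))"
        unfolding h by (simp add: algebra_simps)
      have "cmod (h_reg r P - ham_coeff g P) =
        1 / 2 * cmod ((chi_reg r (P, id_string) - chi (P, id_string)) - (chi_reg r (id_string, P) - chi (id_string, P)))"
        unfolding eq norm_mult norm_divide by simp
      also have "\<dots> \<le> 1 / 2 * (3 / 2 * \<epsilon> + 3 / 2 * \<epsilon>)"
        using False P by (intro mult_left_mono order_trans[OF norm_triangle_ineq4] add_mono err) auto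
      finally show ?thesis using \<epsilon> by simp
    qed
  qed
qed

text \<open>Postprocessing is correct on the event that all entries in \<open>?W\<close> are
  accurate. These are the entries read by the inversions, at most \<open>4 ^ k * 4 ^ k\<close> for
  each supplied pair, so the event fails with probability at most \<delta>.\<close>

lemma algorithm_success:
  fixes k :: nat and \<tau> :: real
  assumes g: "k_local_lindblad n k g" and strength: "interaction_strength n k g \<le> \<alpha>"
    and chi: "chi_expansion n (lindbladian n k g) chi"
    and G: "gks_expansion n (lindbladian n k g) (ham_coeff g) G"
    and decay: "diagonal_extension_decay n chi C p" and C: "0 < C" and p: "real k + 1 < p"
    and \<alpha>: "0 < \<alpha>" and \<epsilon>: "0 < \<epsilon>" and \<delta>: "0 < \<delta>"
  defines "b \<equiv> branching k C p \<epsilon>" and "N \<equiv> card (threshold_support n k chi \<tau>)"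
    and "T \<equiv> 1 / (4 * \<alpha> * real k)"
  assumes \<tau>: "C * real (b + 1) powr (- p) < \<tau>" "\<tau> \<le> 2 * C * real (b + 1) powr (- p)"
    and \<omega>: "distinct \<omega>" "set \<omega> = threshold_support n k chi \<tau>"
  shows "1 - \<delta> \<le> measure_pmf.prob (supplied_support_algorithm n k (lindbladian n k g) T (plan_of k \<alpha> b \<epsilon> N \<delta>) \<omega>)
     {r. (\<forall>P \<in> paulis n - {id_string}. \<forall>Q \<in> paulis n - {id_string}. cmod (G_reg r (P, Q) - G (P, Q)) \<le> 2 * \<epsilon>) \<and>
         (\<forall>P \<in> paulis n. cmod (h_reg r P - ham_coeff g P) \<le> 2 * \<epsilon>)}"
    (is "_ \<le> measure_pmf.prob _ ?R")
proof -
  let ?d = "fit_deg k \<alpha> b \<epsilon>" and ?s = "stat_error k \<alpha> b \<epsilon>" and ?M = "repetitions k \<alpha> b \<epsilon> N \<delta>"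
  let ?\<pi> = "plan_of k \<alpha> b \<epsilon> N \<delta>" and ?L = "lindbladian n k g"
  let ?W = "\<Union>u\<in>set \<omega>. paulis_on (pair_supp u) \<times> paulis_on (pair_supp u)"
  let ?good = "{D. \<forall>(P, Q)\<in>?W. \<bar>ptm_estimate T ?\<pi> D P Q - Re (mtrace (pauli_op n P * ?L (pauli_op n Q))) / 2 ^ n\<bar> \<le>
      16 * \<alpha> * real k * real ?d ^ 3 * (?s + (1 / 4) ^ ?d)}"
  have b1: "1 \<le> b" unfolding b_def by (rule branching_bounds(1)[OF \<epsilon>])
  have p1: "1 < p" using p by simp
  note facts = support_facts[OF g chi decay C p1 b1 \<tau>(1) refl, folded \<omega>(2)]
  have "?good \<subseteq> (\<lambda>D. postprocess k \<omega> (ptm_estimate T ?\<pi> D)) -` ?R"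
  proof
    fix D assume D: "D \<in> ?good"
    have "\<bar>ptm_estimate T ?\<pi> D A B - Re (mtrace (pauli_op n A * ?L (pauli_op n B))) / 2 ^ n\<bar> \<le>
        16 * \<alpha> * real k * real ?d ^ 3 * (?s + (1 / 4) ^ ?d)"
      if "u \<in> set \<omega>" "A \<in> paulis_on (pair_supp u)" "B \<in> paulis_on (pair_supp u)" for u A B
      using D that by blast
    from postprocess_correct[OF g chi G decay C p \<alpha> \<epsilon> \<tau>[unfolded b_def] \<omega>, folded b_def, OF this]
    show "D \<in> (\<lambda>D. postprocess k \<omega> (ptm_estimate T ?\<pi> D)) -` ?R" by simp
  qed
  then have mono: "measure_pmf.prob (data_pmf n ?L ?\<pi>) ?good \<le>
      measure_pmf.prob (supplied_support_algorithm n k ?L T ?\<pi> \<omega>) ?R"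
    unfolding supplied_support_algorithm_def measure_map_pmf by (intro measure_pmf.finite_measure_mono) auto
  show ?thesis
  \<comment> \<open>Without supplied pairs nothing is read and every outcome is good. Otherwise some
    support is nonempty, which yields \<open>1 \<le> k\<close>; for \<open>k = 0\<close> the time
    \<open>T\<close> would be the default value of \<open>1 / 0\<close>.\<close>
  proof (cases "N = 0")
    case True
    then have "set \<omega> = {}" using \<omega> by (metis List.finite_set N_def card_0_eq)
    then have "?good = UNIV" by simp
    then have "measure_pmf.prob (data_pmf n ?L ?\<pi>) ?good = 1" by simp
    then show ?thesis using mono \<delta> by linarith
  next
    case False
    then obtain u where "u \<in> set \<omega>" using \<omega> by (metis N_def card.empty ex_in_conv)
    then have k: "1 \<le> k" using facts(5,6)[of u] by simp
    have W: "finite ?W" using facts(4) by auto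
    have "card ?W \<le> (\<Sum>u\<in>set \<omega>. card (paulis_on (pair_supp u) \<times> paulis_on (pair_supp u)))"
      by (rule card_UN_le) simp
    also have "\<dots> \<le> (\<Sum>u\<in>set \<omega>. 16 ^ k)"
    proof (rule sum_mono)
      fix u assume u: "u \<in> set \<omega>"
      have "card (paulis_on (pair_supp u) \<times> paulis_on (pair_supp u)) = 16 ^ card (pair_supp u)"
        using facts(4)[OF u] by (simp add: card_cartesian_product card_paulis_on flip: power_mult_distrib)
      also have "\<dots> \<le> 16 ^ k" using facts(6)[OF u] by (intro power_increasing) auto
      finally show "card (paulis_on (pair_supp u) \<times> paulis_on (pair_supp u)) \<le> 16 ^ k" .
    qed
    also have "\<dots> = N * 16 ^ k" using \<omega>(2) by (simp add: N_def)
    finally have cW: "card ?W \<le> N * 16 ^ k" .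
    have "1 - real (card ?W) * (real ?d + 1) * (2 * exp (- (real ?M * ?s\<^sup>2 / (2 * 81 ^ k)))) \<le>
      measure_pmf.prob (data_pmf n ?L ?\<pi>) ?good"
      unfolding plan_of_def T_def
    proof (rule ptm_estimates_prob[OF g strength \<alpha> k W])
      fix P Q assume "(P, Q) \<in> ?W"
      then obtain u where u: "u \<in> set \<omega>" "P \<in> paulis_on (pair_supp u)" "Q \<in> paulis_on (pair_supp u)" by auto
      note f = facts(3,4,6)[OF u(1)]
      have "supp P \<subseteq> pair_supp u" "supp Q \<subseteq> pair_supp u" using u by (auto simp: paulis_on_def)
      then show "P \<in> paulis n \<and> Q \<in> paulis n \<and> card (supp P) \<le> k \<and> card (supp Q) \<le> k"
        using f order_trans[OF card_mono[OF f(2)] f(3)] unfolding paulis_on_def by auto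
    qed (use fit_deg_ge_1[of k \<alpha> b \<epsilon>] repetitions_facts(1)[OF \<alpha> b1 \<epsilon>, where k = k and N = N and \<delta> = \<delta>]
        repetitions_facts(4)[OF \<alpha> b1 \<epsilon>, where k = k] in auto)
    moreover have "real (card ?W) * (real ?d + 1) * (2 * exp (- (real ?M * ?s\<^sup>2 / (2 * 81 ^ k)))) \<le> \<delta>"
      by (rule failure_bound) (use \<alpha> b1 \<epsilon> \<delta> False cW in auto)
    ultimately show ?thesis using mono by linarith
  qed
qed

text \<open>The order of the quantifiers encodes the dependence of the constants: the error constant
  is absolute, the time constant depends on \<open>k\<close>, and only \<open>K'\<close> depends on
  \<open>C\<close> and \<open>p\<close>. The sampling plan may use \<open>k\<close> and \<alpha>,
  but of the instance it sees only \<open>b\<close>, \<epsilon>, \<open>N\<close> and \<delta>, so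
  it cannot depend on \<open>n\<close> or on the generator.\<close>

theorem corollary3p10:
  shows "\<exists>K_err>0::real. \<forall>k::nat. \<exists>K_time>0::real. \<forall>\<alpha>>0::real.
    \<exists>K>0::real. \<exists>c::nat. \<exists>plan :: nat \<Rightarrow> real \<Rightarrow> nat \<Rightarrow> real \<Rightarrow> plan.
    \<forall>C>0::real. \<forall>p>real k + 1. \<exists>K'>0::real.
    \<forall>(n::nat) (g::lindblad_data) (chi :: pstring \<times> pstring \<Rightarrow> complex)
      (G :: pstring \<times> pstring \<Rightarrow> complex) (\<epsilon>::real) (\<delta>::real) (\<tau>::real)
      (\<omega> :: (pstring \<times> pstring) list).
      k_local_lindblad n k g \<longrightarrow>
      interaction_strength n k g \<le> \<alpha> \<longrightarrow>
      chi_expansion n (lindbladian n k g) chi \<longrightarrow>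
      gks_expansion n (lindbladian n k g) (ham_coeff g) G \<longrightarrow>
      diagonal_extension_decay n chi C p \<longrightarrow>
      0 < \<epsilon> \<longrightarrow> 0 < \<delta> \<longrightarrow> \<delta> < 1 \<longrightarrow>
      C * real (branching k C p \<epsilon> + 1) powr (- p) < \<tau> \<longrightarrow>
      \<tau> \<le> 2 * C * real (branching k C p \<epsilon> + 1) powr (- p) \<longrightarrow>
      distinct \<omega> \<longrightarrow> set \<omega> = threshold_support n k chi \<tau> \<longrightarrow>
      (let b = branching k C p \<epsilon>;
           N = card (threshold_support n k chi \<tau>);
           T = 1 / (4 * \<alpha> * real k);
           \<pi> = plan b \<epsilon> N \<delta>;
           alg = supplied_support_algorithm n k (lindbladian n k g) T \<pi> \<omega>;
           bound1 = (geometric_factor k b)\<^sup>2 * (inv_accuracy \<epsilon>)\<^sup>2 * log_factor N \<delta>;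
           bound2 = inv_accuracy \<epsilon> powr (2 + 2 * real k / (p - real k - 1)) * log_factor N \<delta>
       in set (fit_times \<pi>) \<subseteq> {0..T} \<and>
          1 \<le> fit_degree \<pi> \<and>
          real (fit_degree \<pi>) \<le> K * (1 + ln (geometric_factor k b * inv_accuracy \<epsilon>)) \<and>
          real (length (fit_times \<pi>)) \<le> K * (real (fit_degree \<pi>) * (1 + ln (real (fit_degree \<pi>)))) \<and>
          measure_pmf.prob alg
            {r. (\<forall>P \<in> paulis n - {id_string}. \<forall>Q \<in> paulis n - {id_string}.
                    cmod (G_reg r (P, Q) - G (P, Q)) \<le> K_err * \<epsilon>) \<and>
                (\<forall>P \<in> paulis n. cmod (h_reg r P - ham_coeff g P) \<le> K_err * \<epsilon>)} \<ge> 1 - \<delta> \<and>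
          real (sample_count \<pi>) \<le> K * bound1 * polylog c b \<epsilon> N \<and>
          bound1 \<le> K' * bound2 \<and> bound2 \<le> K' * bound1 \<and>
          real (sample_count \<pi>) \<le> K' * bound2 * polylog c b \<epsilon> N \<and>
          (\<forall>r \<in> set_pmf alg. real (steps r) \<le> K_time * real N))"
\<comment> \<open>The error constant 2 is that of \<open>postprocess_correct\<close>.\<close>
proof (rule exI[of _ 2], rule conjI, simp, rule allI, goal_cases)
  case (1 k)
  have time_pos: "0 < real (k * (1 + visit_cost k) + 7)" by (simp only: of_nat_0_less_iff)
  show ?case
  proof (rule exI[of _ "real (k * (1 + visit_cost k) + 7)"], rule conjI, rule time_pos, intro allI impI, goal_cases)
    case (1 \<alpha>)
    then have \<alpha>: "0 < \<alpha>" by simp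
    define A where "A = count_const k \<alpha> * (deg_const k \<alpha> * (2 * real k + 2)) ^ 8"
    \<comment> \<open>One constant has to dominate the coefficient \<open>A\<close> of the sample
      bound, the coefficient of the degree bound, and the 2 of \<open>length_bound\<close>.\<close>
    define K where "K = A + deg_const k \<alpha> + 2"
    have dc: "5 \<le> deg_const k \<alpha>" by (rule deg_const_ge[OF \<alpha>])
    have "0 \<le> count_const k \<alpha>" using ln_union_nonneg[of k 0] by (simp add: count_const_def)
    then have A: "0 \<le> A" using dc by (simp add: A_def)
    have K: "0 < K" "A \<le> K" "deg_const k \<alpha> \<le> K" "2 \<le> K" using A dc by (auto simp: K_def)
    show ?case
    proof (rule exI[of _ K], rule conjI, rule K(1), rule exI[of _ "8::nat"], rule exI[of _ "plan_of k \<alpha>"], intro allI impI, goal_cases)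
      case (1 C p)
      then have C: "0 < C" and p: "real k + 1 < p" by simp_all
      obtain B where B: "0 < B" "\<And>\<epsilon> N \<delta>. 0 < \<epsilon> \<Longrightarrow>
          (geometric_factor k (branching k C p \<epsilon>))\<^sup>2 * (inv_accuracy \<epsilon>)\<^sup>2 * log_factor N \<delta> \<le>
            B * (inv_accuracy \<epsilon> powr (2 + 2 * real k / (p - real k - 1)) * log_factor N \<delta>)"
        "\<And>\<epsilon> N \<delta>. 0 < \<epsilon> \<Longrightarrow> inv_accuracy \<epsilon> powr (2 + 2 * real k / (p - real k - 1)) * log_factor N \<delta> \<le>
            B * ((geometric_factor k (branching k C p \<epsilon>))\<^sup>2 * (inv_accuracy \<epsilon>)\<^sup>2 * log_factor N \<delta>)"
        using bounds_comparable[OF C p] by blast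
      \<comment> \<open>It has to dominate \<open>B\<close>, for comparing the two bounds, and
        \<open>K * B\<close>, for the sample count in terms of the second bound.\<close>
      define K' where "K' = (1 + K) * B"
      have "0 < K * B" using K(1) B(1) by (rule mult_pos_pos)
      moreover have "K' = B + K * B" by (simp add: K'_def distrib_right)
      ultimately have K': "0 < K'" "B \<le> K'" "K * B \<le> K'" using B(1) by linarith+
      show ?case
      proof (rule exI[of _ K'], rule conjI, rule K'(1), intro allI impI, goal_cases)
        case (1 n g chi G \<epsilon> \<delta> \<tau> \<omega>)
        define b where "b = branching k C p \<epsilon>"
        define N where "N = card (threshold_support n k chi \<tau>)"
        let ?T = "1 / (4 * \<alpha> * real k)" and ?\<pi> = "plan_of k \<alpha> b \<epsilon> N \<delta>"
        let ?alg = "supplied_support_algorithm n k (lindbladian n k g) ?T ?\<pi> \<omega>"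
        let ?b1 = "(geometric_factor k b)\<^sup>2 * (inv_accuracy \<epsilon>)\<^sup>2 * log_factor N \<delta>"
        let ?b2 = "inv_accuracy \<epsilon> powr (2 + 2 * real k / (p - real k - 1)) * log_factor N \<delta>"
        have \<epsilon>: "0 < \<epsilon>" using 1 by simp
        have b1: "1 \<le> b" unfolding b_def by (rule branching_bounds(1)[OF \<epsilon>])
        have \<pi>: "fit_times ?\<pi> = cheb_nodes ?T (fit_deg k \<alpha> b \<epsilon>)" "fit_degree ?\<pi> = fit_deg k \<alpha> b \<epsilon>"
          by (simp_all add: plan_of_def simple_plan_def)
        have "set (fit_times ?\<pi>) \<subseteq> {0..?T}" unfolding \<pi> using \<alpha> by (intro cheb_nodes_bounds) simp
        moreover have "1 \<le> fit_degree ?\<pi>" unfolding \<pi> by (rule fit_deg_ge_1)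
        moreover have "real (fit_degree ?\<pi>) \<le> K * (1 + ln (geometric_factor k b * inv_accuracy \<epsilon>))"
        proof -
          have "0 \<le> ln (precision k b \<epsilon>)" using precision_ge_1[OF b1 \<epsilon>, of k] by simp
          then have "deg_const k \<alpha> * (1 + ln (precision k b \<epsilon>)) \<le> K * (1 + ln (precision k b \<epsilon>))"
            using K(3) by (intro mult_right_mono) auto
          then show ?thesis
            using fit_deg_upper[OF \<alpha> b1 \<epsilon>, of k] unfolding \<pi> precision_def by linarith
        qed
        moreover have "real (length (fit_times ?\<pi>)) \<le> K * (real (fit_degree ?\<pi>) * (1 + ln (real (fit_degree ?\<pi>))))"
        proof -
          have "0 \<le> real (fit_degree ?\<pi>) * (1 + ln (real (fit_degree ?\<pi>)))"
            unfolding \<pi> using fit_deg_ge_1[of k \<alpha> b \<epsilon>] by (intro mult_nonneg_nonneg add_nonneg_nonneg) auto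
          then have "2 * (real (fit_degree ?\<pi>) * (1 + ln (real (fit_degree ?\<pi>)))) \<le>
              K * (real (fit_degree ?\<pi>) * (1 + ln (real (fit_degree ?\<pi>))))"
            using K(4) by (intro mult_right_mono) auto
          moreover have "real (length (fit_times ?\<pi>)) \<le> 2 * (real (fit_degree ?\<pi>) * (1 + ln (real (fit_degree ?\<pi>))))"
            unfolding \<pi> length_cheb_nodes by (rule length_bound[OF fit_deg_ge_1])
          ultimately show ?thesis by linarith
        qed
        moreover have "1 - \<delta> \<le> measure_pmf.prob ?alg
          {r. (\<forall>P \<in> paulis n - {id_string}. \<forall>Q \<in> paulis n - {id_string}. cmod (G_reg r (P, Q) - G (P, Q)) \<le> 2 * \<epsilon>) \<and>
              (\<forall>P \<in> paulis n. cmod (h_reg r P - ham_coeff g P) \<le> 2 * \<epsilon>)}"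
          unfolding b_def N_def by (rule algorithm_success) (use 1 C p \<alpha> in auto)
        moreover have count: "real (sample_count ?\<pi>) \<le> K * ?b1 * polylog 8 b \<epsilon> N"
          and "?b1 \<le> K' * ?b2" "?b2 \<le> K' * ?b1"
          and "real (sample_count ?\<pi>) \<le> K' * ?b2 * polylog 8 b \<epsilon> N"
        proof -
          have nn: "0 \<le> ?b1" "0 \<le> ?b2" "0 \<le> polylog 8 b \<epsilon> N"
            using log_factor_ge(1)[of N \<delta>] by (auto simp: polylog_def)
          have "A * ?b1 * polylog 8 b \<epsilon> N \<le> K * ?b1 * polylog 8 b \<epsilon> N"
            using K(2) nn by (intro mult_right_mono) auto
          then show count: "real (sample_count ?\<pi>) \<le> K * ?b1 * polylog 8 b \<epsilon> N"
            using sample_count_bound[OF \<alpha> b1 \<epsilon>, of k N \<delta>] unfolding A_def by linarith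
          have 12: "?b1 \<le> B * ?b2" "?b2 \<le> B * ?b1" using B(2,3)[OF \<epsilon>] unfolding b_def by blast+
          have "B * ?b2 \<le> K' * ?b2" "B * ?b1 \<le> K' * ?b1" using K'(2) nn by (intro mult_right_mono; simp)+
          then show "?b1 \<le> K' * ?b2" "?b2 \<le> K' * ?b1" using 12 by linarith+
          have "K * ?b1 \<le> K * (B * ?b2)" using 12(1) K(1) by (intro mult_left_mono) auto
          also have "\<dots> = (K * B) * ?b2" by (rule mult.assoc[symmetric])
          also have "\<dots> \<le> K' * ?b2" using K'(3) nn by (intro mult_right_mono) auto
          finally have "K * ?b1 * polylog 8 b \<epsilon> N \<le> K' * ?b2 * polylog 8 b \<epsilon> N"
            using nn(3) by (rule mult_right_mono)
          then show "real (sample_count ?\<pi>) \<le> K' * ?b2 * polylog 8 b \<epsilon> N" using count by linarith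
        qed
        moreover have "\<forall>r \<in> set_pmf ?alg. real (steps r) \<le> real (k * (1 + visit_cost k) + 7) * real N"
        proof
          fix r assume "r \<in> set_pmf ?alg"
          then obtain D where r: "r = postprocess k \<omega> (ptm_estimate ?T ?\<pi> D)"
            by (auto simp: supplied_support_algorithm_def)
          have "finite (pair_supp u)" if "u \<in> set \<omega>" for u
          proof -
            have "pair_supp u \<subseteq> {..<n}" using that 1
              by (auto simp: threshold_support_def local_pairs_nontriv_def local_pairs_def pair_supp_def paulis_on_def)
            then show ?thesis by (rule finite_subset) simp
          qed
          then have "steps r \<le> (k * (1 + visit_cost k) + 7) * length \<omega>" unfolding r by (rule steps_postprocess)
          also have "length \<omega> = N" unfolding N_def using 1 by (metis distinct_card)
          finally show "real (steps r) \<le> real (k * (1 + visit_cost k) + 7) * real N"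
            by (simp only: of_nat_mult[symmetric] of_nat_le_iff)
        qed
        ultimately show ?case
          unfolding Let_def b_def[symmetric] N_def[symmetric] by (intro conjI)
      qed
    qed
  qed
qed

end
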